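(* Assume $0<\rho<1$ and $0<\eta<\|u(0)\|$. Then the scheme described in the context, with the choices of initialization $\tilde u_0$, iteration tolerances $\varepsilon_n$ and recompression tolerances $\delta_n$ given there, achieves a global error bounded by $$\sup_{1\le n\le N}\|\tilde u_n-u(nh)\|\le\left(\eta+\kappa_J h^{J+1}+\kappa_{2J}h^{2J}T\right)\exp\left(8\Lambda_JC_V\frac{1+\rho}{(1-\rho)^3}T\right).$$ Moreover, if $\rho\le 1/2$, the ranks of the scheme are bounded by $$\operatorname{rank}(\tilde u_n)\le\frac{16}{\rho^3}\left(\frac{1+\rho}{1-\rho}\right)^2\Big(1+J\operatorname{rank}(V)\max\{r_1,r_2,\dots,r_n\}\Big)\qquad\text{for all }1\le n\le N,$$ and the intermediate ranks in the $n$-th subinterval (that is, the ranks of all components of the iterates $\mathbf u^k$ and $\mathbf\Phi\mathbf u^k$, $0\le k\le K$, produced in that subinterval) are at most twice this bound.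
   Context: Setting. $\Omega=\Omega_1\times\Omega_2$ with $\Omega_i\subseteq\mathbb R^{d_i}$; $\|\cdot\|$ is the norm of the complex space $L^2(\Omega)$; $\Delta=\Delta_1\otimes I+I\otimes\Delta_2$ is the Laplacian on $\Omega$, with $\Delta_i$ a self-adjoint realization of the Laplacian on $L^2(\Omega_i)$, so that $e^{it\Delta}=e^{it\Delta_1}\otimes e^{it\Delta_2}$ is a unitary group. $\mathcal W(s,t)=L^\infty(s,t;L^2(\Omega))$ with its natural norm. $V:\Omega\to\mathbb R$ is a time-independent potential acting by multiplication, $V\ne0$, with $C_V=\|V\|_{L^2(\Omega)\to L^2(\Omega)}<\infty$ and finite rank as a function: $\operatorname{rank}(V)\in\mathbb N$ is the minimal number of terms in a representation $V=\sum_\ell V_1^{(\ell)}\otimes V_2^{(\ell)}$ with $V_i^{(\ell)}\in L^2(\Omega_i)$. $u\in C([0,T];L^2(\Omega))$ is the solution of $i\partial_tu=-\Delta u+Vu$ with initial data $u(0)$, i.e. $u(t)=e^{it\Delta}u(0)-i\int_0^te^{i(t-s)\Delta}Vu(s)\,ds$. The interval $[0,T]$ is divided into $N=T/h\in\mathbb N$ subintervals $[(n-1)h,nh]$. Quadrature. $J\in\mathbb N$; $0<t_1<\dots<t_J<h$ are the Gauss–Legendre nodes on $[0,h]$; $\ell_m(t)=\prod_{j\ne m}\frac{t-t_j}{t_m-t_j}$; $\Lambda_J=\frac1h\int_0^h\sum_{m=1}^J|\ell_m(s)|\,ds$; $\rho=h\Lambda_JC_V$. Singular values. Each $v\in L^2(\Omega)$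 has a singular value decomposition $v=\sum_{k\ge1}\sigma_k\,v_k^{(1)}\otimes v_k^{(2)}$ with $\sigma_1\ge\sigma_2\ge\dots\ge0$ and $(v_k^{(i)})_k$ orthonormal in $L^2(\Omega_i)$; $\operatorname{rank}(v)$ is the number of nonzero singular values and $\sigma_{\max}(v)=\sigma_1$. Soft thresholding: $\mathcal S_\alpha v=\sum_k\max\{\sigma_k-\alpha,0\}v_k^{(1)}\otimes v_k^{(2)}$. Hard thresholding: $\mathcal H_\alpha v=\sum_{k:\sigma_k>\alpha}\sigma_kv_k^{(1)}\otimes v_k^{(2)}$. Recompression: $\mathcal R_\delta v=\sum_{k\le r_\delta}\sigma_kv_k^{(1)}\otimes v_k^{(2)}$ with $r_\delta=\min\{r\in\mathbb N_0:\sum_{k>r}\sigma_k^2\le\delta^2\}$. $\boldsymbol{\mathcal S}_\alpha$ acts componentwise on $L^2(\Omega)^J$, and $\|\mathbf w\|_J=\max_{1\le j\le J}\|w_j\|$. Scheme (Gauss–Legendre–Picard iteration with constant decrease of the threshold, in untwisted variables). In the $n$-th subinterval, with time measured from its left endpoint and initial value $u_0:=\tilde u_{n-1}$, put for $\mathbf w\in L^2(\Omega)^J$ and $t\in[0,h]$ $$\Phi\mathbf w(t)=e^{it\Delta}u_0-i\int_0^t\sum_{m=1}^Je^{i(t-t_m)\Delta}Vw_m\,\ell_m(s)\,ds,\qquad(\mathbf\Phi\mathbf w)_j=\Phi\mathbf w(t_j).$$ Set $\mathbf u^0=\mathbf 0$, $\mathbf u^{k+1}=\boldsymbol{\mathcal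 S}_{\theta^k\sigma_{\max}(u_0)}(\mathbf\Phi\mathbf u^k)$ with $\theta=\sqrt\rho$, and let $K$ be the first index $k\ge0$ with $\|\mathbf\Phi\mathbf u^k-\mathbf u^k\|_J\le\varepsilon_n$. Then $\tilde u_n=\mathcal R_{\delta_n}\big(\Phi\mathbf u^K(h)\big)$. Constants. $\kappa_J$ and $\kappa_{2J}$ are finite numbers satisfying $$\kappa_J\ge\frac{J!}{\sqrt{2J+1}\,(2J)!}\big\|\partial_t^J(e^{-it\Delta}Vu)\big\|_{\mathcal W(0,T)},\qquad\kappa_{2J}\ge\frac{(J!)^4}{(2J+1)!\,(2J)!^2}\max_{1\le n\le N}\big\|(\partial_t-i\Delta+iV)^{2J+1}u^\diamond_{(n)}\big\|_{\mathcal W((n-1)h,nh)},$$ where $u^\diamond_{(n)}$ is the exact collocation solution on $[(n-1)h,nh]$ with exact initial value $u((n-1)h)$: in local time $t\in[0,h]$ it satisfies $u^\diamond_{(n)}(t)=e^{it\Delta}u((n-1)h)-i\int_0^t\sum_{m=1}^Je^{i(t-t_m)\Delta}Vu^\diamond_{(n)}(t_m)\ell_m(s)\,ds$. It is assumed that these functions are regular enough for these quantities to be well defined and finite: $t\mapsto e^{-it\Delta}Vu(t)$ is of class $C^J$ into $L^2(\Omega)$, and the successive functions $w_0=u^\diamond_{(n)}$, $w_{m+1}=(\partial_t-i\Delta+iV)w_m$, satisfy $w_m\in C^1\cap C(\,\cdot\,;D(\Delta))$ for $0\le m\le2J$ and $w_{2J+1}$ is continuous into $L^2(\Omega)$. Parameters.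 $\eta$ is the target accuracy. For $1\le n\le N$, $$\alpha_n=\max\{\alpha>0:\ \|u(t)-\mathcal S_\alpha u(t)\|\le\eta\ \ \forall t\in[(n-1)h,nh]\},\qquad r_n=\frac{\eta^2}{\alpha_n^2}=\frac{\|u-\mathcal S_{\alpha_n}u\|^2_{\mathcal W((n-1)h,nh)}}{\alpha_n^2}.$$ For $0\le n\le N$, $\xi_n=\big(\eta+\kappa_Jh^{J+1}+n\kappa_{2J}h^{2J+1}\big)\exp\big(8\rho n\frac{1+\rho}{(1-\rho)^3}\big)$. For $1\le n\le N$, $\varepsilon_n=4\xi_{n-1}\frac{1+\rho}{(1-\rho)^2}$ and $\delta_n=\frac{\rho\varepsilon_n}{1-\rho}$. Initialization: $\tilde u_0=\mathcal H_{\alpha_0}u(0)$ with $\alpha_0=\max\{\alpha>0:\|u(0)-\mathcal S_\alpha u(0)\|\le\eta\}$. *)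

theory Defs
  imports
    "HOL-Analysis.Analysis"
    "HOL-Probability.Essential_Supremum"
    "HOL-Computational_Algebra.Polynomial"
begin

definition square_integrable :: "('a::euclidean_space \<Rightarrow> complex) \<Rightarrow> bool" where
  "square_integrable f \<longleftrightarrow>
     f \<in> borel_measurable lebesgue \<and> integrable lebesgue (\<lambda>x. (cmod (f x))\<^sup>2)"

lemma square_integrable_zero: "square_integrable (\<lambda>x. 0)"
  by (simp add: square_integrable_def)

lemma square_integrable_scale:
  "square_integrable f \<Longrightarrow> square_integrable (\<lambda>x. c * f x)"
  by (auto simp: square_integrable_def norm_mult power_mult_distrib)

lemma square_integrable_add:
  assumes "square_integrable f" "square_integrable g"
  shows "square_integrable (\<lambda>x. f x + g x)"
proof -
  have [measurable]: "f \<in> borel_measurable lebesgue" "g \<in> borel_measurable lebesgue"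
    using assms by (auto simp: square_integrable_def)
  have "integrable lebesgue (\<lambda>x. 2 * (cmod (f x))\<^sup>2 + 2 * (cmod (g x))\<^sup>2)"
    using assms by (auto simp: square_integrable_def)
  then have "integrable lebesgue (\<lambda>x. (cmod (f x + g x))\<^sup>2)"
  proof (rule Bochner_Integration.integrable_bound)
    show "AE x in lebesgue. norm ((cmod (f x + g x))\<^sup>2)
            \<le> norm (2 * (cmod (f x))\<^sup>2 + 2 * (cmod (g x))\<^sup>2)"
    proof (rule AE_I2)
      fix x
      have "(cmod (f x + g x))\<^sup>2 \<le> (cmod (f x) + cmod (g x))\<^sup>2"
        by (intro power_mono norm_triangle_ineq) auto
      also have "\<dots> \<le> 2 * (cmod (f x))\<^sup>2 + 2 * (cmod (g x))\<^sup>2"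
        using sum_squares_bound[of "cmod (f x)" "cmod (g x)"] by (simp add: power2_sum)
      finally show "norm ((cmod (f x + g x))\<^sup>2)
            \<le> norm (2 * (cmod (f x))\<^sup>2 + 2 * (cmod (g x))\<^sup>2)" by simp
    qed
  qed measurable
  then show ?thesis by (simp add: square_integrable_def)
qed

lemma borel_measurable_cnj:
  "f \<in> borel_measurable M \<Longrightarrow> (\<lambda>x. cnj (f x)) \<in> borel_measurable M"
  by (rule borel_measurable_continuous_on[where f = cnj]) (auto intro: continuous_intros)

lemma square_integrable_mult:
  assumes "square_integrable f" "square_integrable g"
  shows "integrable lebesgue (\<lambda>x. cnj (f x) * g x)"
proof -
  have [measurable]: "f \<in> borel_measurable lebesgue" "g \<in> borel_measurable lebesgue"
    using assms by (auto simp: square_integrable_def)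
  have "integrable lebesgue (\<lambda>x. (cmod (f x))\<^sup>2 + (cmod (g x))\<^sup>2)"
    using assms by (auto simp: square_integrable_def)
  then show ?thesis
  proof (rule Bochner_Integration.integrable_bound)
    show "AE x in lebesgue. norm (cnj (f x) * g x) \<le> norm ((cmod (f x))\<^sup>2 + (cmod (g x))\<^sup>2)"
    proof (rule AE_I2)
      fix x
      have "0 \<le> (cmod (f x))\<^sup>2 + (cmod (g x))\<^sup>2 - 2 * (cmod (f x) * cmod (g x))"
        using sum_squares_bound[of "cmod (f x)" "cmod (g x)"] by (simp add: algebra_simps)
      moreover have "0 \<le> cmod (f x) * cmod (g x)" by simp
      ultimately show "norm (cnj (f x) * g x) \<le> norm ((cmod (f x))\<^sup>2 + (cmod (g x))\<^sup>2)"
        unfolding norm_mult real_norm_def by (simp del: norm_ge_zero)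
    qed
  qed (auto intro!: borel_measurable_times borel_measurable_cnj)
qed

quotient_type (overloaded) 'a L2 = "'a::euclidean_space \<Rightarrow> complex" /
  partial: "\<lambda>f g. square_integrable f \<and> square_integrable g \<and> (AE x in lebesgue. f x = g x)"
proof (rule part_equivpI)
  show "\<exists>f. square_integrable f \<and> square_integrable f \<and> (AE x in lebesgue. f x = f x)"
    using square_integrable_zero by auto
  show "symp (\<lambda>f g. square_integrable f \<and> square_integrable g \<and> (AE x in lebesgue. f x = g x))"
    by (auto intro!: sympI simp: eq_commute)
  show "transp (\<lambda>f g. square_integrable f \<and> square_integrable g \<and> (AE x in lebesgue. f x = g x))"
    by (auto intro!: transpI)
qed

lift_definition scaleC :: "complex \<Rightarrow> 'a::euclidean_space L2 \<Rightarrow> 'a L2" (infixr "*\<^sub>C" 75)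
  is "\<lambda>c f x. c * f x"
  by (auto intro: square_integrable_scale)

lift_definition cinner :: "'a::euclidean_space L2 \<Rightarrow> 'a L2 \<Rightarrow> complex"
  is "\<lambda>f g. \<integral>x. cnj (f x) * g x \<partial>lebesgue"
proof -
  fix f f' g g' :: "'a \<Rightarrow> complex"
  assume f: "square_integrable f \<and> square_integrable f' \<and> (AE x in lebesgue. f x = f' x)"
    and g: "square_integrable g \<and> square_integrable g' \<and> (AE x in lebesgue. g x = g' x)"
  then have [measurable]: "f \<in> borel_measurable lebesgue" "f' \<in> borel_measurable lebesgue"
    "g \<in> borel_measurable lebesgue" "g' \<in> borel_measurable lebesgue"
    by (auto simp: square_integrable_def)
  have "AE x in lebesgue. cnj (f x) * g x = cnj (f' x) * g' x"
    using f g by auto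
  then show "(\<integral>x. cnj (f x) * g x \<partial>lebesgue) = (\<integral>x. cnj (f' x) * g' x \<partial>lebesgue)"
    by (intro integral_cong_AE borel_measurable_times borel_measurable_cnj) auto
qed

instantiation L2 :: (euclidean_space) real_inner
begin

lift_definition zero_L2 :: "'a L2" is "\<lambda>x. 0"
  by (simp add: square_integrable_zero)

lift_definition plus_L2 :: "'a L2 \<Rightarrow> 'a L2 \<Rightarrow> 'a L2" is "\<lambda>f g x. f x + g x"
  by (auto intro: square_integrable_add)

lift_definition uminus_L2 :: "'a L2 \<Rightarrow> 'a L2" is "\<lambda>f x. - f x"
  by (auto simp: square_integrable_def)

definition minus_L2 :: "'a L2 \<Rightarrow> 'a L2 \<Rightarrow> 'a L2" where
  "minus_L2 f g = f + (- g)"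

definition scaleR_L2 :: "real \<Rightarrow> 'a L2 \<Rightarrow> 'a L2" where
  "scaleR_L2 r f = complex_of_real r *\<^sub>C f"

definition inner_L2 :: "'a L2 \<Rightarrow> 'a L2 \<Rightarrow> real" where
  "inner_L2 f g = Re (cinner f g)"

definition norm_L2 :: "'a L2 \<Rightarrow> real" where
  "norm_L2 f = sqrt (inner f f)"

definition sgn_L2 :: "'a L2 \<Rightarrow> 'a L2" where
  "sgn_L2 f = inverse (norm f) *\<^sub>R f"

definition dist_L2 :: "'a L2 \<Rightarrow> 'a L2 \<Rightarrow> real" where
  "dist_L2 f g = norm (f - g)"

definition uniformity_L2 :: "('a L2 \<times> 'a L2) filter" where
  "uniformity_L2 = (INF e\<in>{0<..}. principal {(x, y). dist x y < e})"

definition open_L2 :: "'a L2 set \<Rightarrow> bool" where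
  "open_L2 S \<longleftrightarrow> (\<forall>x\<in>S. \<forall>\<^sub>F (x', y) in uniformity. x' = x \<longrightarrow> y \<in> S)"

instance
proof
  fix f g k :: "'a L2" and r s :: real
  show "f + g + k = f + (g + k)"
    by transfer (auto intro!: square_integrable_add simp: add.assoc)
  show "f + g = g + f"
    by transfer (auto intro!: square_integrable_add simp: add.commute)
  show "0 + f = f"
    by transfer auto
  show "- f + f = 0"
    by transfer (auto simp: square_integrable_zero)
  show "f - g = f + - g"
    by (simp add: minus_L2_def)
  show "r *\<^sub>R (f + g) = r *\<^sub>R f + r *\<^sub>R g"
    unfolding scaleR_L2_def
    by transfer (auto intro!: square_integrable_add square_integrable_scale simp: ring_distribs)
  show "(r + s) *\<^sub>R f = r *\<^sub>R f + s *\<^sub>R f"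
    unfolding scaleR_L2_def
    by transfer (auto intro!: square_integrable_add square_integrable_scale simp: ring_distribs)
  show "r *\<^sub>R s *\<^sub>R f = (r * s) *\<^sub>R f"
    unfolding scaleR_L2_def
    by transfer (auto intro!: square_integrable_scale simp: mult.assoc)
  show "1 *\<^sub>R f = f"
    unfolding scaleR_L2_def by transfer auto
  show "dist f g = norm (f - g)"
    by (rule dist_L2_def)
  show "sgn f = inverse (norm f) *\<^sub>R f"
    by (rule sgn_L2_def)
  show "(uniformity :: ('a L2 \<times> 'a L2) filter)
          = (INF e\<in>{0<..}. principal {(x, y). dist x y < e})"
    by (rule uniformity_L2_def)
  show "norm f = sqrt (inner f f)"
    by (rule norm_L2_def)
  have "cinner g f = cnj (cinner f g)"
    by transfer (simp add: mult.commute flip: Bochner_Integration.integral_cnj)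
  then show "inner f g = inner g f"
    by (simp add: inner_L2_def)
  have "cinner (f + g) k = cinner f k + cinner g k"
    by transfer (auto simp: ring_distribs square_integrable_mult)
  then show "inner (f + g) k = inner f k + inner g k"
    by (simp add: inner_L2_def)
  have "cinner (r *\<^sub>R f) g = of_real r * cinner f g"
    unfolding scaleR_L2_def by transfer (auto simp: mult.assoc)
  then show "inner (r *\<^sub>R f) g = r * inner f g"
    by (simp add: inner_L2_def)
  have "Re (\<integral>x. cnj (\<phi> x) * \<phi> x \<partial>lebesgue) = (\<integral>x. (cmod (\<phi> x))\<^sup>2 \<partial>lebesgue)"
    if "square_integrable \<phi>" for \<phi> :: "'a \<Rightarrow> complex"
  proof -
    have "(\<lambda>x. cnj (\<phi> x) * \<phi> x) = (\<lambda>x. complex_of_real ((cmod (\<phi> x))\<^sup>2))"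
      by (rule ext) (metis complex_norm_square mult.commute)
    then show ?thesis by (simp only: integral_complex_of_real Re_complex_of_real)
  qed
  note sq = this
  show "0 \<le> inner f f"
    unfolding inner_L2_def by transfer (simp add: sq)
  show "inner f f = 0 \<longleftrightarrow> f = 0"
    unfolding inner_L2_def
  proof transfer
    fix \<phi> :: "'a \<Rightarrow> complex"
    assume "square_integrable \<phi> \<and> square_integrable \<phi> \<and> (AE x in lebesgue. \<phi> x = \<phi> x)"
    then have \<phi>: "square_integrable \<phi>" by simp
    then have "integrable lebesgue (\<lambda>x. (cmod (\<phi> x))\<^sup>2)"
      by (simp add: square_integrable_def)
    then have "(\<integral>x. (cmod (\<phi> x))\<^sup>2 \<partial>lebesgue) = 0 \<longleftrightarrow> (AE x in lebesgue. (cmod (\<phi> x))\<^sup>2 = 0)"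
      by (intro integral_nonneg_eq_0_iff_AE) auto
    with \<phi> show "Re (\<integral>x. cnj (\<phi> x) * \<phi> x \<partial>lebesgue) = 0 \<longleftrightarrow>
        square_integrable \<phi> \<and> square_integrable (\<lambda>x::'a. 0) \<and> (AE x in lebesgue. \<phi> x = 0)"
      by (simp add: sq square_integrable_zero)
  qed
qed (rule open_L2_def)

end

text \<open>
  Functions on \<open>\<Omega>\<close> are extended by zero, so that the space over \<open>\<Omega>\<close> is a closed subspace of
  the space over the ambient Euclidean space.
\<close>

lift_definition vanishes_outside :: "'a::euclidean_space set \<Rightarrow> 'a L2 \<Rightarrow> bool"
  is "\<lambda>\<Omega> f. AE x in lebesgue. x \<notin> \<Omega> \<longrightarrow> f x = 0"
proof -
  fix \<Omega> :: "'a set" and f g :: "'a \<Rightarrow> complex"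
  assume "square_integrable f \<and> square_integrable g \<and> (AE x in lebesgue. f x = g x)"
  then have ae: "AE x in lebesgue. f x = g x" by blast
  then have "AE x in lebesgue. (x \<notin> \<Omega> \<longrightarrow> f x = 0) = (x \<notin> \<Omega> \<longrightarrow> g x = 0)"
    by eventually_elim auto
  then show "(AE x in lebesgue. x \<notin> \<Omega> \<longrightarrow> f x = 0) = (AE x in lebesgue. x \<notin> \<Omega> \<longrightarrow> g x = 0)"
    by (rule eventually_subst)
qed

definition L2_on :: "'a::euclidean_space set \<Rightarrow> 'a L2 set" where
  "L2_on \<Omega> = {f. vanishes_outside \<Omega> f}"

lemma null_set_Times_UNIV:
  assumes "N \<in> null_sets (lborel :: 'a::euclidean_space measure)"
  shows "N \<times> (UNIV :: 'b::euclidean_space set) \<in> null_sets lborel"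
    and "(UNIV :: 'b set) \<times> N \<in> null_sets lborel"
proof -
  have "N \<times> (UNIV :: 'b set) \<in> null_sets (lborel \<Otimes>\<^sub>M lborel)"
    "(UNIV :: 'b set) \<times> N \<in> null_sets (lborel \<Otimes>\<^sub>M lborel)"
    using assms by (auto simp: null_sets_def lborel.emeasure_pair_measure_Times intro!: pair_measureI)
  then show "N \<times> (UNIV :: 'b set) \<in> null_sets lborel" "(UNIV :: 'b set) \<times> N \<in> null_sets lborel"
    by (simp_all only: lborel_prod)
qed

lemma Times_UNIV_lebesgue:
  assumes "A \<in> sets (lebesgue :: 'a::euclidean_space measure)"
  shows "A \<times> (UNIV :: 'b::euclidean_space set) \<in> sets lebesgue"
    and "(UNIV :: 'b set) \<times> A \<in> sets lebesgue"
proof -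
  from assms obtain S N N'
    where A: "A = S \<union> N" "N \<subseteq> N'" "N' \<in> null_sets lborel" "S \<in> sets lborel"
    by (rule sets_completionE)
  have "S \<times> (UNIV :: 'b set) \<in> sets (lborel \<Otimes>\<^sub>M lborel)"
    "(UNIV :: 'b set) \<times> S \<in> sets (lborel \<Otimes>\<^sub>M lborel)"
    using A(4) by (auto intro!: pair_measureI)
  then have S: "S \<times> (UNIV :: 'b set) \<in> sets lborel" "(UNIV :: 'b set) \<times> S \<in> sets lborel"
    by (simp_all only: lborel_prod)
  show "A \<times> (UNIV :: 'b set) \<in> sets lebesgue"
    by (rule sets_completionI[OF _ _ null_set_Times_UNIV(1)[OF A(3)] S(1), of _ "N \<times> UNIV"])
      (use A(1,2) in auto)
  show "(UNIV :: 'b set) \<times> A \<in> sets lebesgue"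
    by (rule sets_completionI[OF _ _ null_set_Times_UNIV(2)[OF A(3)] S(2), of _ "UNIV \<times> N"])
      (use A(1,2) in auto)
qed

lemma fst_measurable_lebesgue:
  "fst \<in> measurable (lebesgue :: ('a::euclidean_space \<times> 'b::euclidean_space) measure) lebesgue"
  by (rule measurableI) (auto simp: vimage_fst intro: Times_UNIV_lebesgue)

lemma snd_measurable_lebesgue:
  "snd \<in> measurable (lebesgue :: ('a::euclidean_space \<times> 'b::euclidean_space) measure) lebesgue"
  by (rule measurableI) (auto simp: vimage_snd intro: Times_UNIV_lebesgue)

lemma AE_lebesgue_fst:
  assumes "AE x in (lebesgue :: 'a::euclidean_space measure). P x"
  shows "AE z in (lebesgue :: ('a \<times> 'b::euclidean_space) measure). P (fst z)"
proof -
  from assms have "AE x in (lborel :: 'a measure). P x"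
    by (simp add: AE_completion_iff)
  then obtain N where N: "{x \<in> space lborel. \<not> P x} \<subseteq> N" "N \<in> null_sets (lborel :: 'a measure)"
    unfolding eventually_ae_filter by blast
  have "AE z in (lborel :: ('a \<times> 'b) measure). P (fst z)"
    by (rule AE_I'[OF null_set_Times_UNIV(1)[OF N(2)]]) (use N(1) in auto)
  then show ?thesis by (simp add: AE_completion_iff)
qed

lemma AE_lebesgue_snd:
  assumes "AE y in (lebesgue :: 'b::euclidean_space measure). P y"
  shows "AE z in (lebesgue :: ('a::euclidean_space \<times> 'b) measure). P (snd z)"
proof -
  from assms have "AE x in (lborel :: 'b measure). P x"
    by (simp add: AE_completion_iff)
  then obtain N where N: "{x \<in> space lborel. \<not> P x} \<subseteq> N" "N \<in> null_sets (lborel :: 'b measure)"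
    unfolding eventually_ae_filter by blast
  have "AE z in (lborel :: ('a \<times> 'b) measure). P (snd z)"
    by (rule AE_I'[OF null_set_Times_UNIV(2)[OF N(2)]]) (use N(1) in auto)
  then show ?thesis by (simp add: AE_completion_iff)
qed

lift_definition tensor :: "'a::euclidean_space L2 \<Rightarrow> 'b::euclidean_space L2 \<Rightarrow> ('a \<times> 'b) L2"
    (infixr "\<otimes>" 70)
  is "\<lambda>f g (x, y). f x * g y"
proof -
  have sq: "square_integrable (\<lambda>(x, y). f x * g y)"
    if "square_integrable f" "square_integrable g"
    for f :: "'a \<Rightarrow> complex" and g :: "'b \<Rightarrow> complex"
  proof -
    have mf: "f \<in> borel_measurable lebesgue" and mg: "g \<in> borel_measurable lebesgue"
      using that by (auto simp: square_integrable_def)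
    have meas: "(\<lambda>z. f (fst z) * g (snd z)) \<in> borel_measurable lebesgue"
      using measurable_compose[OF fst_measurable_lebesgue mf]
        measurable_compose[OF snd_measurable_lebesgue mg]
      by (rule borel_measurable_times)
    obtain F where F: "F \<in> borel_measurable lborel" "AE x in lborel. (cmod (f x))\<^sup>2 = F x"
      using completion_ex_borel_measurable_real[of "\<lambda>x. (cmod (f x))\<^sup>2" lborel] mf by auto
    obtain G where G: "G \<in> borel_measurable lborel" "AE y in lborel. (cmod (g y))\<^sup>2 = G y"
      using completion_ex_borel_measurable_real[of "\<lambda>y. (cmod (g y))\<^sup>2" lborel] mg by auto
    have "integrable lebesgue F"
      using that(1) F mf measurable_completion[OF F(1)]
      by (subst integrable_cong_AE[of _ _ "\<lambda>x. (cmod (f x))\<^sup>2"])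
        (auto simp: square_integrable_def AE_completion_iff eq_commute)
    then have iF: "integrable lborel F" using F(1) integrable_completion by blast
    have "integrable lebesgue G"
      using that(2) G mg measurable_completion[OF G(1)]
      by (subst integrable_cong_AE[of _ _ "\<lambda>x. (cmod (g x))\<^sup>2"])
        (auto simp: square_integrable_def AE_completion_iff eq_commute)
    then have iG: "integrable lborel G" using G(1) integrable_completion by blast
    have [measurable]: "F \<in> borel_measurable borel" "G \<in> borel_measurable borel"
      using F(1) G(1) by auto
    have "integrable (lborel \<Otimes>\<^sub>M lborel) (\<lambda>z. F (fst z) * G (snd z))"
    proof (rule lborel_pair.Fubini_integrable)
      show "integrable lborel (\<lambda>x. \<integral>y. norm (F (fst (x, y)) * G (snd (x, y))) \<partial>lborel)"
        using iF by (simp add: abs_mult)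
      show "AE x in lborel. integrable lborel (\<lambda>y. F (fst (x, y)) * G (snd (x, y)))"
        using iG by simp
    qed measurable
    then have iFG: "integrable lborel (\<lambda>z. F (fst z) * G (snd z))"
      by (simp only: lborel_prod)
    then have iFG': "integrable lebesgue (\<lambda>z. F (fst z) * G (snd z))"
      by (subst integrable_completion) (auto intro: borel_measurable_integrable)
    have "AE z in lebesgue. (cmod (f (fst z)))\<^sup>2 = F (fst z)"
      by (rule AE_lebesgue_fst) (use F(2) in \<open>simp add: AE_completion_iff\<close>)
    moreover have "AE z in lebesgue. (cmod (g (snd z)))\<^sup>2 = G (snd z)"
      by (rule AE_lebesgue_snd) (use G(2) in \<open>simp add: AE_completion_iff\<close>)
    ultimately have "AE z in lebesgue.
        F (fst z) * G (snd z) = (cmod (f (fst z) * g (snd z)))\<^sup>2"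
      by eventually_elim (simp add: norm_mult power_mult_distrib)
    then have "integrable lebesgue (\<lambda>z. (cmod (f (fst z) * g (snd z)))\<^sup>2)"
      using iFG' meas borel_measurable_integrable[OF iFG']
      by (subst (asm) integrable_cong_AE) auto
    with meas show ?thesis
      by (simp add: square_integrable_def case_prod_beta')
  qed
  fix f f' :: "'a \<Rightarrow> complex" and g g' :: "'b \<Rightarrow> complex"
  assume f: "square_integrable f \<and> square_integrable f' \<and> (AE x in lebesgue. f x = f' x)"
    and g: "square_integrable g \<and> square_integrable g' \<and> (AE y in lebesgue. g y = g' y)"
  have "AE z in lebesgue. f (fst z) = f' (fst z)" "AE z in lebesgue. g (snd z) = g' (snd z)"
    using f g by (auto intro: AE_lebesgue_fst AE_lebesgue_snd)
  then have "AE z in lebesgue. (\<lambda>(x, y). f x * g y) z = (\<lambda>(x, y). f' x * g' y) z"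
    by eventually_elim (auto simp: case_prod_beta')
  with f g sq show "square_integrable (\<lambda>(x, y). f x * g y) \<and>
      square_integrable (\<lambda>(x, y). f' x * g' y) \<and>
      (AE z in lebesgue. (\<lambda>(x, y). f x * g y) z = (\<lambda>(x, y). f' x * g' y) z)"
    by auto
qed

definition orthonormal_seq :: "(nat \<Rightarrow> 'a::euclidean_space L2) \<Rightarrow> bool" where
  "orthonormal_seq e \<longleftrightarrow> (\<forall>i j. cinner (e i) (e j) = (if i = j then 1 else 0))"

definition is_svd :: "('a::euclidean_space \<times> 'b::euclidean_space) L2 \<Rightarrow>
    (nat \<Rightarrow> real) \<Rightarrow> (nat \<Rightarrow> 'a L2) \<Rightarrow> (nat \<Rightarrow> 'b L2) \<Rightarrow> bool" where
  "is_svd v \<sigma> a b \<longleftrightarrow> (\<forall>k. 0 \<le> \<sigma> k) \<and> decseq \<sigma> \<and> orthonormal_seq a \<and> orthonormal_seq b \<and>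
     (\<lambda>k. \<sigma> k *\<^sub>R (a k \<otimes> b k)) sums v"

text \<open>
  Singular values are indexed from \<open>0\<close>. The singular vectors belonging to nonzero singular
  values of an element of \<open>L2_on (\<Omega>\<^sub>1 \<times> \<Omega>\<^sub>2)\<close> lie in \<open>L2_on \<Omega>\<^sub>1\<close> and \<open>L2_on \<Omega>\<^sub>2\<close>; the others do
  not enter the operations below. The singular values, and hence these operations, do not
  depend on the decomposition that is selected.
\<close>

definition svd :: "('a::euclidean_space \<times> 'b::euclidean_space) L2 \<Rightarrow>
    (nat \<Rightarrow> real) \<times> (nat \<Rightarrow> 'a L2) \<times> (nat \<Rightarrow> 'b L2)" where
  "svd v = (SOME (\<sigma>, a, b). is_svd v \<sigma> a b)"

definition sing_val :: "('a::euclidean_space \<times> 'b::euclidean_space) L2 \<Rightarrow> nat \<Rightarrow> real" where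
  "sing_val v = fst (svd v)"

definition sing_term :: "('a::euclidean_space \<times> 'b::euclidean_space) L2 \<Rightarrow> nat \<Rightarrow> ('a \<times> 'b) L2" where
  "sing_term v k = fst (snd (svd v)) k \<otimes> snd (snd (svd v)) k"

definition sigma_max :: "('a::euclidean_space \<times> 'b::euclidean_space) L2 \<Rightarrow> real" where
  "sigma_max v = sing_val v 0"

definition rank_L2 :: "('a::euclidean_space \<times> 'b::euclidean_space) L2 \<Rightarrow> enat" where
  "rank_L2 v = (if finite {k. sing_val v k \<noteq> 0} then enat (card {k. sing_val v k \<noteq> 0}) else \<infinity>)"

definition soft_threshold ::
    "real \<Rightarrow> ('a::euclidean_space \<times> 'b::euclidean_space) L2 \<Rightarrow> ('a \<times> 'b) L2" where
  "soft_threshold \<alpha> v = (\<Sum>k. max (sing_val v k - \<alpha>) 0 *\<^sub>R sing_term v k)"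

definition hard_threshold ::
    "real \<Rightarrow> ('a::euclidean_space \<times> 'b::euclidean_space) L2 \<Rightarrow> ('a \<times> 'b) L2" where
  "hard_threshold \<alpha> v = (\<Sum>k. (if sing_val v k > \<alpha> then sing_val v k else 0) *\<^sub>R sing_term v k)"

definition recompress ::
    "real \<Rightarrow> ('a::euclidean_space \<times> 'b::euclidean_space) L2 \<Rightarrow> ('a \<times> 'b) L2" where
  "recompress \<delta> v =
     (\<Sum>k < (LEAST r. (\<Sum>k. (sing_val v (k + r))\<^sup>2) \<le> \<delta>\<^sup>2). sing_val v k *\<^sub>R sing_term v k)"

definition largest_threshold ::
    "real \<Rightarrow> (real \<Rightarrow> ('a::euclidean_space \<times> 'b::euclidean_space) L2) \<Rightarrow> real set \<Rightarrow> real" where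
  "largest_threshold \<eta> u I =
     (GREATEST \<alpha>. 0 < \<alpha> \<and> (\<forall>t\<in>I. norm (u t - soft_threshold \<alpha> (u t)) \<le> \<eta>))"

text \<open>Only the values of the potential on \<open>\<Omega>\<close> matter for the action on \<open>L2_on \<Omega>\<close>.\<close>

definition mult_op :: "('a::euclidean_space \<Rightarrow> real) \<Rightarrow> 'a L2 \<Rightarrow> 'a L2" where
  "mult_op V f = abs_L2 (\<lambda>x. complex_of_real (V x) * rep_L2 f x)"

definition bounded_potential :: "'a::euclidean_space set \<Rightarrow> ('a \<Rightarrow> real) \<Rightarrow> bool" where
  "bounded_potential \<Omega> V \<longleftrightarrow>
     (\<forall>f\<in>L2_on \<Omega>. square_integrable (\<lambda>x. complex_of_real (V x) * rep_L2 f x)) \<and>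
     (\<exists>C. \<forall>f\<in>L2_on \<Omega>. norm (mult_op V f) \<le> C * norm f)"

definition op_norm_on :: "'a::euclidean_space L2 set \<Rightarrow> ('a L2 \<Rightarrow> 'a L2) \<Rightarrow> real" where
  "op_norm_on S A = (SUP f\<in>S - {0}. norm (A f) / norm f)"

definition separable_repr :: "'a::euclidean_space set \<Rightarrow> 'b::euclidean_space set \<Rightarrow>
    ('a \<times> 'b \<Rightarrow> real) \<Rightarrow> nat \<Rightarrow> bool" where
  "separable_repr \<Omega>\<^sub>1 \<Omega>\<^sub>2 V r \<longleftrightarrow>
     (\<exists>V\<^sub>1 V\<^sub>2. (\<forall>l<r. V\<^sub>1 l \<in> L2_on \<Omega>\<^sub>1 \<and> V\<^sub>2 l \<in> L2_on \<Omega>\<^sub>2) \<and>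
        (AE z in lebesgue. z \<in> \<Omega>\<^sub>1 \<times> \<Omega>\<^sub>2 \<longrightarrow>
           complex_of_real (V z) = rep_L2 (\<Sum>l<r. V\<^sub>1 l \<otimes> V\<^sub>2 l) z))"

definition potential_rank :: "'a::euclidean_space set \<Rightarrow> 'b::euclidean_space set \<Rightarrow>
    ('a \<times> 'b \<Rightarrow> real) \<Rightarrow> nat" where
  "potential_rank \<Omega>\<^sub>1 \<Omega>\<^sub>2 V = (LEAST r. separable_repr \<Omega>\<^sub>1 \<Omega>\<^sub>2 V r)"

definition dir_deriv ::
    "'a::euclidean_space \<Rightarrow> ('a \<Rightarrow> complex) \<Rightarrow> 'a \<Rightarrow> complex" where
  "dir_deriv b \<phi> x = frechet_derivative \<phi> (at x) b"

definition smooth :: "('a::euclidean_space \<Rightarrow> complex) \<Rightarrow> bool" where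
  "smooth \<phi> \<longleftrightarrow>
     (\<forall>bs. set bs \<subseteq> Basis \<longrightarrow> (\<forall>x. foldr dir_deriv bs \<phi> differentiable (at x)))"

definition test_function :: "'a::euclidean_space set \<Rightarrow> ('a \<Rightarrow> complex) \<Rightarrow> bool" where
  "test_function \<Omega> \<phi> \<longleftrightarrow>
     smooth \<phi> \<and> compact (closure {x. \<phi> x \<noteq> 0}) \<and> closure {x. \<phi> x \<noteq> 0} \<subseteq> \<Omega>"

definition laplace :: "('a::euclidean_space \<Rightarrow> complex) \<Rightarrow> 'a \<Rightarrow> complex" where
  "laplace \<phi> x = (\<Sum>b\<in>Basis. dir_deriv b (dir_deriv b \<phi>) x)"

text \<open>
  Unbounded operators on a closed subspace \<open>S\<close> are represented by their graphs. A relation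
  that coincides with its adjoint and has dense domain is automatically the graph of a closed
  linear operator.
\<close>

definition adjoint_graph :: "'a::euclidean_space L2 set \<Rightarrow> 'a L2 rel \<Rightarrow> 'a L2 rel" where
  "adjoint_graph S A =
     {(g, g'). g \<in> S \<and> g' \<in> S \<and> (\<forall>(f, f')\<in>A. cinner g f' = cinner g' f)}"

definition self_adjoint_on :: "'a::euclidean_space L2 set \<Rightarrow> 'a L2 rel \<Rightarrow> bool" where
  "self_adjoint_on S A \<longleftrightarrow>
     A \<subseteq> S \<times> S \<and> S \<subseteq> closure (Domain A) \<and> adjoint_graph S A = A"

definition laplacian_realization :: "'a::euclidean_space set \<Rightarrow> 'a L2 rel \<Rightarrow> bool" where
  "laplacian_realization \<Omega> A \<longleftrightarrow> self_adjoint_on (L2_on \<Omega>) A \<and>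
     (\<forall>\<phi>. test_function (interior \<Omega>) \<phi> \<longrightarrow> (abs_L2 \<phi>, abs_L2 (laplace \<phi>)) \<in> A)"

text \<open>
  The self-adjoint operator \<open>A \<otimes> I + I \<otimes> B\<close>, that is, the closure of its restriction to the
  algebraic tensor product of the two domains.
\<close>

definition tensor_sum :: "'a::euclidean_space L2 rel \<Rightarrow> 'b::euclidean_space L2 rel \<Rightarrow>
    ('a \<times> 'b) L2 rel" where
  "tensor_sum A B = closure (span
     {(f \<otimes> g, f' \<otimes> g + f \<otimes> g') | f f' g g'. (f, f') \<in> A \<and> (g, g') \<in> B})"

definition unitary_group_on ::
    "'a::euclidean_space L2 set \<Rightarrow> (real \<Rightarrow> 'a L2 \<Rightarrow> 'a L2) \<Rightarrow> bool" where
  "unitary_group_on S U \<longleftrightarrow>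
     (\<forall>t. \<forall>f\<in>S. U t f \<in> S \<and> norm (U t f) = norm f) \<and>
     (\<forall>t. \<forall>f\<in>S. \<forall>g\<in>S. U t (f + g) = U t f + U t g) \<and>
     (\<forall>t c. \<forall>f\<in>S. U t (c *\<^sub>C f) = c *\<^sub>C U t f) \<and>
     (\<forall>f\<in>S. U 0 f = f) \<and>
     (\<forall>s t. \<forall>f\<in>S. U (s + t) f = U s (U t f)) \<and>
     (\<forall>f\<in>S. continuous_on UNIV (\<lambda>t. U t f))"

text \<open>
  \<open>U t = exp (\<i> t A)\<close> on \<open>S\<close>: by Stone's theorem, a self-adjoint \<open>A\<close> determines \<open>U\<close> on \<open>S\<close>
  uniquely through its infinitesimal generator \<open>\<i> A\<close> (including the domain of the latter).
\<close>

definition is_exp_i :: "'a::euclidean_space L2 set \<Rightarrow> 'a L2 rel \<Rightarrow>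
    (real \<Rightarrow> 'a L2 \<Rightarrow> 'a L2) \<Rightarrow> bool" where
  "is_exp_i S A U \<longleftrightarrow> unitary_group_on S U \<and>
     (\<forall>f\<in>S. \<forall>g. ((\<lambda>t. U t f) has_vector_derivative \<i> *\<^sub>C g) (at 0) \<longleftrightarrow> (f, g) \<in> A)"

definition schroedinger_solution :: "'a::euclidean_space L2 set \<Rightarrow> (real \<Rightarrow> 'a L2 \<Rightarrow> 'a L2) \<Rightarrow>
    ('a \<Rightarrow> real) \<Rightarrow> real \<Rightarrow> (real \<Rightarrow> 'a L2) \<Rightarrow> bool" where
  "schroedinger_solution S U V T u \<longleftrightarrow>
     continuous_on {0..T} u \<and>
     (\<forall>t\<in>{0..T}. u t \<in> S \<and>
        u t = U t (u 0) - \<i> *\<^sub>C integral {0..t} (\<lambda>s. U (t - s) (mult_op V (u s))))"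

definition W_norm :: "real \<Rightarrow> real \<Rightarrow> (real \<Rightarrow> 'a::euclidean_space L2) \<Rightarrow> ereal" where
  "W_norm s t f = esssup (lebesgue_on {s..t}) (\<lambda>\<tau>. ereal (norm (f \<tau>)))"

text \<open>\<open>g m\<close> is the \<open>m\<close>-th derivative of \<open>g 0\<close>, which is of class \<open>C\<^sup>M\<close> on \<open>I\<close>.\<close>

definition derivs_on :: "real set \<Rightarrow> nat \<Rightarrow> (nat \<Rightarrow> real \<Rightarrow> 'a::euclidean_space L2) \<Rightarrow> bool" where
  "derivs_on I M g \<longleftrightarrow>
     (\<forall>m<M. \<forall>t\<in>I. (g m has_vector_derivative g (Suc m) t) (at t within I)) \<and>
     continuous_on I (g M)"

text \<open>
  \<open>w (m + 1) = (\<partial>\<^sub>t - \<i> A + \<i> V) (w m)\<close>, where \<open>w m\<close> is continuously differentiable and continuous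
  with respect to the graph norm of \<open>A\<close>.
\<close>

definition schroedinger_derivs_on :: "'a::euclidean_space L2 rel \<Rightarrow> ('a \<Rightarrow> real) \<Rightarrow>
    real set \<Rightarrow> nat \<Rightarrow> (nat \<Rightarrow> real \<Rightarrow> 'a L2) \<Rightarrow> bool" where
  "schroedinger_derivs_on A V I M w \<longleftrightarrow>
     (\<forall>m<M. \<exists>w' a.
        continuous_on I w' \<and> (\<forall>t\<in>I. (w m has_vector_derivative w' t) (at t within I)) \<and>
        continuous_on I a \<and> (\<forall>t\<in>I. (w m t, a t) \<in> A) \<and>
        (\<forall>t\<in>I. w (Suc m) t = w' t - \<i> *\<^sub>C a t + \<i> *\<^sub>C mult_op V (w m t))) \<and>
     continuous_on I (w M)"

definition legendre :: "nat \<Rightarrow> real poly" where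
  "legendre n = smult (1 / (2 ^ n * fact n)) ((pderiv ^^ n) ([:-1, 0, 1:] ^ n))"

definition gauss_legendre_nodes :: "nat \<Rightarrow> real \<Rightarrow> (nat \<Rightarrow> real) \<Rightarrow> bool" where
  "gauss_legendre_nodes J h \<tau> \<longleftrightarrow> strict_mono_on {1..J} \<tau> \<and>
     (\<forall>j\<in>{1..J}. 0 < \<tau> j \<and> \<tau> j < h \<and> poly (legendre J) (2 * \<tau> j / h - 1) = 0)"

definition lagrange_basis :: "nat \<Rightarrow> (nat \<Rightarrow> real) \<Rightarrow> nat \<Rightarrow> real \<Rightarrow> real" where
  "lagrange_basis J \<tau> m t = (\<Prod>j\<in>{1..J} - {m}. (t - \<tau> j) / (\<tau> m - \<tau> j))"

definition mean_lebesgue_const :: "nat \<Rightarrow> real \<Rightarrow> (nat \<Rightarrow> real) \<Rightarrow> real" where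
  "mean_lebesgue_const J h \<tau> = 1 / h * integral {0..h} (\<lambda>s. \<Sum>m=1..J. \<bar>lagrange_basis J \<tau> m s\<bar>)"

text \<open>
  Elements of the \<open>J\<close>-fold product space are functions on \<open>nat\<close>, of which only the values on
  \<open>{1..J}\<close> matter.
\<close>

definition norm_J :: "nat \<Rightarrow> (nat \<Rightarrow> 'a::euclidean_space L2) \<Rightarrow> real" where
  "norm_J J w = Max ((\<lambda>j. norm (w j)) ` {1..J})"

definition picard_map :: "(real \<Rightarrow> 'a::euclidean_space L2 \<Rightarrow> 'a L2) \<Rightarrow> ('a \<Rightarrow> real) \<Rightarrow> nat \<Rightarrow>
    (nat \<Rightarrow> real) \<Rightarrow> 'a L2 \<Rightarrow> (nat \<Rightarrow> 'a L2) \<Rightarrow> real \<Rightarrow> 'a L2" where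
  "picard_map U V J \<tau> u0 w t = U t u0 -
     \<i> *\<^sub>C integral {0..t}
       (\<lambda>s. \<Sum>m=1..J. lagrange_basis J \<tau> m s *\<^sub>R U (t - \<tau> m) (mult_op V (w m)))"

primrec picard_iterate ::
    "(real \<Rightarrow> ('a::euclidean_space \<times> 'b::euclidean_space) L2 \<Rightarrow> ('a \<times> 'b) L2) \<Rightarrow>
     ('a \<times> 'b \<Rightarrow> real) \<Rightarrow> nat \<Rightarrow> (nat \<Rightarrow> real) \<Rightarrow> real \<Rightarrow> ('a \<times> 'b) L2 \<Rightarrow>
     nat \<Rightarrow> nat \<Rightarrow> ('a \<times> 'b) L2" where
  "picard_iterate U V J \<tau> \<theta> u0 0 = (\<lambda>j. 0)"
| "picard_iterate U V J \<tau> \<theta> u0 (Suc k) =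
     (\<lambda>j. soft_threshold (\<theta> ^ k * sigma_max u0)
        (picard_map U V J \<tau> u0 (picard_iterate U V J \<tau> \<theta> u0 k) (\<tau> j)))"

definition stopping_index ::
    "(real \<Rightarrow> ('a::euclidean_space \<times> 'b::euclidean_space) L2 \<Rightarrow> ('a \<times> 'b) L2) \<Rightarrow>
     ('a \<times> 'b \<Rightarrow> real) \<Rightarrow> nat \<Rightarrow> (nat \<Rightarrow> real) \<Rightarrow> real \<Rightarrow> real \<Rightarrow> ('a \<times> 'b) L2 \<Rightarrow> nat" where
  "stopping_index U V J \<tau> \<theta> \<epsilon> u0 =
     (LEAST k. norm_J J (\<lambda>j. picard_map U V J \<tau> u0 (picard_iterate U V J \<tau> \<theta> u0 k) (\<tau> j)
                              - picard_iterate U V J \<tau> \<theta> u0 k j) \<le> \<epsilon>)"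

primrec glp_scheme ::
    "(real \<Rightarrow> ('a::euclidean_space \<times> 'b::euclidean_space) L2 \<Rightarrow> ('a \<times> 'b) L2) \<Rightarrow>
     ('a \<times> 'b \<Rightarrow> real) \<Rightarrow> nat \<Rightarrow> real \<Rightarrow> (nat \<Rightarrow> real) \<Rightarrow> real \<Rightarrow> (nat \<Rightarrow> real) \<Rightarrow> (nat \<Rightarrow> real) \<Rightarrow>
     ('a \<times> 'b) L2 \<Rightarrow> nat \<Rightarrow> ('a \<times> 'b) L2" where
  "glp_scheme U V J h \<tau> \<theta> \<epsilon> \<delta> init 0 = init"
| "glp_scheme U V J h \<tau> \<theta> \<epsilon> \<delta> init (Suc n) =
     (let u0 = glp_scheme U V J h \<tau> \<theta> \<epsilon> \<delta> init n;
          K = stopping_index U V J \<tau> \<theta> (\<epsilon> (Suc n)) u0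
      in recompress (\<delta> (Suc n)) (picard_map U V J \<tau> u0 (picard_iterate U V J \<tau> \<theta> u0 K) h))"

end

theory Submission
  imports Defs "HOL-Library.Diagonal_Subsequence"
begin

text \<open>
  In the interaction picture \<open>v t = exp (- \<i> t \<Delta>) (u t)\<close> the equation becomes a linear ordinary
  differential equation with a bounded skew-adjoint right-hand side \<open>G t\<close>, and the Picard map is a
  contraction with factor \<open>\<rho>\<close>. Two facts control the error. The collocation flow is an isometry, and
  testing its residual, which vanishes at the Gauss nodes, with the backward solution gives the order
  \<open>2 J + 1\<close>. The stopping rule puts the last iterate within \<open>\<delta>\<^sub>n\<close> of the collocation solution that
  starts from the computed value, and recompression adds another \<open>\<delta>\<^sub>n\<close>. Hence the errors satisfy
  \<open>e\<^sub>n \<le> e\<^sub>n\<^sub>-\<^sub>1 + 2 \<delta>\<^sub>n + \<kappa>\<^sub>2\<^sub>J h\<^bsup>2J+1\<^esup>\<close>, and \<open>2 \<delta>\<^sub>n\<close> is a multiple of \<open>\<xi>\<^sub>n\<^sub>-\<^sub>1\<close>, which yields the exponential.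

  For the ranks, let \<open>\<beta>\<^sub>k\<close> be the maximum of \<open>1\<close> and the \<open>k\<close>-th threshold divided by \<open>\<alpha>\<^sub>n\<close>. Soft
  thresholding is nonexpansive and moves the exact solution by at most \<open>\<eta> \<beta>\<^sub>k\<close>, so the iterates stay
  within \<open>\<xi> / (1 - \<rho>) + \<eta> \<beta>\<^sub>k / (1 - \<theta>)\<close> of the exact solution, and the iteration stops at the latest
  when \<open>\<eta> \<beta>\<^sub>k \<le> \<xi>\<close>. Before that, the errors are comparable to the threshold, while the exact
  solution is within \<open>\<eta>\<close> of an element of rank at most \<open>r\<^sub>n\<close>; by the Eckart--Young theorem only
  \<open>O(r\<^sub>n)\<close> singular values exceed the threshold. The final value lies within \<open>\<delta>\<^sub>n / \<rho>\<close> of an element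
  of rank at most \<open>r\<^sub>n\<close>, so recompression with tolerance \<open>\<delta>\<^sub>n\<close> removes a fraction \<open>\<rho>\<^sup>2\<close> of the excess
  rank, and the rank bound reproduces itself.
\<close>

subsection \<open>The Hilbert space structure\<close>

text \<open>The operations on singular values refer to a selected decomposition, so its existence in
  infinite dimensions has to be proved before they can be used. Ranks are then carried by
  \<open>tensor_rank_le\<close>, the length of a sum of elementary tensors, which is visibly
  subadditive and respected by the propagator; Eckart--Young leads back to singular values. With
  \<theta> = sqrt \<rho> the thresholds shrink more slowly than the Picard map contracts: \<rho>
  \<beta>(k) \<le> \<theta> \<beta>(k+1), so the errors inherited from earlier thresholds sum to a
  factor 1 / (1 - \<theta>). The number 4 (1 + \<rho>) / (1 - \<rho>)^2 in the tolerance bounds the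
  residual once the iterates are within 3 \<xi> / (1 - \<rho>) of the exact solution; multiplied by
  2 \<rho> / (1 - \<rho>) it becomes the growth rate in the exponential. In the rank bound, ((1 +
  \<rho>) / (1 - \<rho>))^2 / \<rho> is, up to a constant, the squared ratio of iteration error to
  threshold, relative to r_n. The further 1 / \<rho>^2 compensates for a recompression that removes
  only the fraction \<rho>^2 of the excess rank.\<close>

lemma rep_L2: "square_integrable (rep_L2 f)"
  using Quotient3_rep_reflp[OF Quotient3_L2] by blast

lemma abs_rep_L2 [simp]: "abs_L2 (rep_L2 f) = f"
  using Quotient3_abs_rep[OF Quotient3_L2] by blast

lemma abs_L2_eq_iff:
  assumes "square_integrable f" "square_integrable g"
  shows "abs_L2 f = abs_L2 g \<longleftrightarrow> (AE x in lebesgue. f x = g x)"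
  using Quotient3_rel[OF Quotient3_L2, of f g] assms by auto

lemma rep_abs_L2: "square_integrable f \<Longrightarrow> AE x in lebesgue. rep_L2 (abs_L2 f) x = f x"
  using abs_L2_eq_iff[OF rep_L2, of f "abs_L2 f"] by simp

lemma L2_eqI: "(AE x in lebesgue. rep_L2 f x = rep_L2 g x) \<Longrightarrow> f = g"
  using abs_L2_eq_iff[OF rep_L2 rep_L2] by (metis abs_rep_L2)

lemma square_integrable_measurable [measurable_dest]:
  "square_integrable f \<Longrightarrow> f \<in> borel_measurable lebesgue"
  by (simp add: square_integrable_def)

lemma rep_L2_measurable [measurable]: "rep_L2 f \<in> borel_measurable lebesgue"
  using rep_L2 by (rule square_integrable_measurable)

lemma rep_L2_add: "AE x in lebesgue. rep_L2 (f + g) x = rep_L2 f x + rep_L2 g x"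
proof -
  have "f + g = abs_L2 (\<lambda>x. rep_L2 f x + rep_L2 g x)"
    by (simp add: plus_L2_def)
  then show ?thesis
    using rep_abs_L2[OF square_integrable_add[OF rep_L2 rep_L2]] by simp
qed

lemma rep_L2_scaleC: "AE x in lebesgue. rep_L2 (c *\<^sub>C f) x = c * rep_L2 f x"
proof -
  have "c *\<^sub>C f = abs_L2 (\<lambda>x. c * rep_L2 f x)"
    by (simp add: scaleC_def)
  then show ?thesis
    using rep_abs_L2[OF square_integrable_scale[OF rep_L2]] by simp
qed

lemma rep_L2_zero: "AE x in lebesgue. rep_L2 0 x = 0"
  unfolding zero_L2_def using rep_abs_L2[OF square_integrable_zero] by simp

lemma rep_L2_tensor:
  "AE z in lebesgue. rep_L2 (f \<otimes> g) z = rep_L2 f (fst z) * rep_L2 g (snd z)"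
proof -
  have "f \<otimes> g = abs_L2 (\<lambda>(x, y). rep_L2 f x * rep_L2 g y)"
    by (simp add: tensor_def)
  moreover have "square_integrable (\<lambda>(x, y). rep_L2 f x * rep_L2 g y)"
    using tensor.rsp rep_L2[of f] rep_L2[of g] unfolding rel_fun_def by blast
  ultimately show ?thesis
    using rep_abs_L2 by (fastforce simp: case_prod_beta')
qed

lemma cinner_rep: "cinner f g = (\<integral>x. cnj (rep_L2 f x) * rep_L2 g x \<partial>lebesgue)"
  by (simp add: cinner_def)

lemma cinner_add_left: "cinner (f + g) k = cinner f k + cinner g k"
  by transfer (auto simp: ring_distribs square_integrable_mult)

lemma cinner_add_right: "cinner k (f + g) = cinner k f + cinner k g"
  by transfer (auto simp: ring_distribs square_integrable_mult)

lemma cinner_scaleC_left: "cinner (c *\<^sub>C f) k = cnj c * cinner f k"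
  by transfer (auto simp: mult.assoc)

lemma cinner_scaleC_right: "cinner k (c *\<^sub>C f) = c * cinner k f"
  by transfer (auto simp: mult.left_commute)

lemma cinner_commute: "cinner g f = cnj (cinner f g)"
  by transfer (simp add: mult.commute flip: Bochner_Integration.integral_cnj)

lemma scaleC_add_right: "c *\<^sub>C (f + g) = c *\<^sub>C f + c *\<^sub>C g"
  by transfer (auto intro!: square_integrable_add square_integrable_scale simp: ring_distribs)

lemma scaleC_add_left: "(c + d) *\<^sub>C f = c *\<^sub>C f + d *\<^sub>C f"
  by transfer (auto intro!: square_integrable_add square_integrable_scale simp: ring_distribs)

lemma scaleC_scaleC: "c *\<^sub>C d *\<^sub>C f = (c * d) *\<^sub>C f"
  by transfer (auto intro!: square_integrable_scale simp: mult.assoc)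

lemma scaleR_scaleC: "r *\<^sub>R f = complex_of_real r *\<^sub>C f"
  by (simp add: scaleR_L2_def)

lemma scaleC_one [simp]: "1 *\<^sub>C f = f"
  by transfer auto

lemma scaleC_minus_one: "(-1) *\<^sub>C f = - f"
  using scaleR_scaleC[of "-1" f] by simp

lemma cinner_self: "cinner f f = complex_of_real ((norm f)\<^sup>2)"
proof -
  have "Im (cinner f f) = 0"
    using cinner_commute[of f f] by (metis complex.sel(2) cnj.simps(2) equation_minus_iff
      neg_equal_zero)
  moreover have "Re (cinner f f) = (norm f)\<^sup>2"
    using inner_L2_def power2_norm_eq_inner by metis
  ultimately show ?thesis by (simp add: complex_eq_iff)
qed

lemma norm_scaleC [simp]: "norm (c *\<^sub>C f) = cmod c * norm f"
proof -
  have "complex_of_real ((norm (c *\<^sub>C f))\<^sup>2) = (c * cnj c) * cinner f f"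
    by (simp only: cinner_self[symmetric] cinner_scaleC_left cinner_scaleC_right mult_ac)
  also have "\<dots> = complex_of_real ((cmod c * norm f)\<^sup>2)"
    by (simp add: complex_norm_square[symmetric] cinner_self power_mult_distrib)
  finally have "complex_of_real ((norm (c *\<^sub>C f))\<^sup>2) = complex_of_real ((cmod c * norm f)\<^sup>2)" .
  then have "(norm (c *\<^sub>C f))\<^sup>2 = (cmod c * norm f)\<^sup>2"
    using of_real_eq_iff by blast
  then show ?thesis by (simp add: power2_eq_iff_nonneg)
qed

text \<open>A unimodular factor on \<open>g\<close> makes the inner product real and nonnegative,
  which reduces the complex inequality to the one for the real inner product.\<close>

lemma cinner_cauchy_schwarz: "cmod (cinner f g) \<le> norm f * norm g"
proof (cases "cinner f g = 0")
  case False
  define z where "z = cinner f g"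
  define c where "c = cnj z / cmod z"
  have c: "cmod c = 1" using False by (simp add: c_def z_def norm_divide)
  have "c * z = complex_of_real (cmod z)"
    using False complex_norm_square[of z]
    by (simp add: c_def z_def[symmetric] field_simps power2_eq_square mult.commute)
  then have "cmod z = Re (cinner f (c *\<^sub>C g))"
    by (simp add: cinner_scaleC_right z_def[symmetric])
  also have "\<dots> \<le> norm f * norm (c *\<^sub>C g)"
    using Cauchy_Schwarz_ineq2[of f "c *\<^sub>C g"] by (simp add: inner_L2_def)
  finally show ?thesis using c by (simp add: z_def)
qed auto

lemma cinner_bilinear: "bounded_bilinear (cinner :: 'a::euclidean_space L2 \<Rightarrow> 'a L2 \<Rightarrow> complex)"
proof
  show "\<exists>K. \<forall>a b. norm (cinner a b :: complex) \<le> norm (a::'a L2) * norm b * K"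
    by (rule exI[of _ 1]) (simp add: cinner_cauchy_schwarz)
qed (simp_all add: cinner_add_left cinner_add_right cinner_scaleC_left cinner_scaleC_right
      scaleR_scaleC scaleR_conv_of_real)

lemma scaleC_bilinear: "bounded_bilinear (scaleC :: complex \<Rightarrow> 'a::euclidean_space L2 \<Rightarrow> 'a L2)"
proof
  show "\<exists>K. \<forall>a b. norm (a *\<^sub>C b :: 'a L2) \<le> norm a * norm b * K"
    by (rule exI[of _ 1]) simp
qed (simp_all add: scaleC_add_left scaleC_add_right scaleR_scaleC scaleC_scaleC
      scaleR_conv_of_real mult.commute)

lemmas cinner_zero_left [simp] = bounded_bilinear.zero_left[OF cinner_bilinear]
  and cinner_zero_right [simp] = bounded_bilinear.zero_right[OF cinner_bilinear]
  and cinner_diff_left = bounded_bilinear.diff_left[OF cinner_bilinear]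
  and cinner_diff_right = bounded_bilinear.diff_right[OF cinner_bilinear]
  and cinner_sum_left = bounded_bilinear.sum_left[OF cinner_bilinear]
  and cinner_sum_right = bounded_bilinear.sum_right[OF cinner_bilinear]
  and scaleC_zero_left [simp] = bounded_bilinear.zero_left[OF scaleC_bilinear]
  and scaleC_zero_right [simp] = bounded_bilinear.zero_right[OF scaleC_bilinear]
  and scaleC_minus_left = bounded_bilinear.minus_left[OF scaleC_bilinear]
  and scaleC_sum_right = bounded_bilinear.sum_right[OF scaleC_bilinear]

lemma cinner_scaleR_left: "cinner (r *\<^sub>R f) k = complex_of_real r * cinner f k"
  by (simp add: scaleR_scaleC cinner_scaleC_left)

lemma cinner_scaleR_right: "cinner k (r *\<^sub>R f) = complex_of_real r * cinner k f"
  by (simp add: scaleR_scaleC cinner_scaleC_right)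

lemma scaleC_scaleR: "c *\<^sub>C r *\<^sub>R f = r *\<^sub>R c *\<^sub>C f"
  by (simp add: scaleR_scaleC scaleC_scaleC mult.commute)

text \<open>This skewness is what makes the twisted generator \<open>G\<close> skew although the
  potential is symmetric, and hence the flow isometric.\<close>

lemma cinner_scaleC_i_skew: "inner (\<i> *\<^sub>C f) g = - inner f (\<i> *\<^sub>C g)"
  by (simp add: inner_L2_def cinner_scaleC_left cinner_scaleC_right)

lemma norm_abs_L2:
  assumes "square_integrable f"
  shows "(norm (abs_L2 f))\<^sup>2 = (\<integral>x. (cmod (f x))\<^sup>2 \<partial>lebesgue)"
proof -
  have "complex_of_real ((norm (abs_L2 f))\<^sup>2) = cinner (abs_L2 f) (abs_L2 f)"
    by (simp add: cinner_self)
  also have "\<dots> = (\<integral>x. cnj (f x) * f x \<partial>lebesgue)"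
    unfolding cinner_rep using rep_abs_L2[OF assms] rep_L2_measurable[of "abs_L2 f"]
      square_integrable_measurable[OF assms]
    by (intro integral_cong_AE borel_measurable_times borel_measurable_cnj) auto
  also have "\<dots> = (\<integral>x. complex_of_real ((cmod (f x))\<^sup>2) \<partial>lebesgue)"
    by (intro arg_cong[where f = "lebesgue_integral _"] ext) (metis complex_norm_square mult.commute)
  finally show ?thesis
    by (simp only: integral_complex_of_real of_real_eq_iff)
qed

lemma nn_integral_norm_L2:
  assumes "square_integrable f"
  shows "(\<integral>\<^sup>+x. ennreal ((cmod (f x))\<^sup>2) \<partial>lebesgue) = ennreal ((norm (abs_L2 f))\<^sup>2)"
  using assms by (simp add: norm_abs_L2 square_integrable_def nn_integral_eq_integral)

lemma rep_L2_diff: "AE x in lebesgue. rep_L2 (f - g) x = rep_L2 f x - rep_L2 g x"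
proof -
  have "f - g = f + (-1) *\<^sub>C g" by (simp add: scaleC_minus_one)
  moreover have "AE x in lebesgue. rep_L2 (f + (-1) *\<^sub>C g) x = rep_L2 f x - rep_L2 g x"
    using rep_L2_add[of f "(-1) *\<^sub>C g"] rep_L2_scaleC[of "-1" g] by eventually_elim simp
  ultimately show ?thesis by (simp only:)
qed

lemma square_integrable_diff:
  "square_integrable f \<Longrightarrow> square_integrable g \<Longrightarrow> square_integrable (\<lambda>x. f x - g x)"
  using square_integrable_add[of f "\<lambda>x. -1 * g x"] square_integrable_scale[of g "-1"] by simp

lemma abs_L2_diff:
  assumes "square_integrable f" "square_integrable g"
  shows "abs_L2 f - abs_L2 g = abs_L2 (\<lambda>x. f x - g x)"
proof (rule L2_eqI)
  show "AE x in lebesgue. rep_L2 (abs_L2 f - abs_L2 g) x = rep_L2 (abs_L2 (\<lambda>x. f x - g x)) x"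
    using rep_L2_diff[of "abs_L2 f" "abs_L2 g"] rep_abs_L2[OF assms(1)] rep_abs_L2[OF assms(2)]
      rep_abs_L2[OF square_integrable_diff[OF assms]]
    by eventually_elim simp
qed

lemma square_integrable_if_nn_integral:
  assumes [measurable]: "f \<in> borel_measurable lebesgue"
    and "(\<integral>\<^sup>+x. ennreal ((cmod (f x))\<^sup>2) \<partial>lebesgue) < \<infinity>"
  shows "square_integrable f"
  unfolding square_integrable_def using assms by (auto intro!: integrableI_bounded)

text \<open>Riesz--Fischer: a subsequence with summable increments converges almost everywhere, and
  Fatou's lemma turns this into convergence in norm.\<close>

instance L2 :: (euclidean_space) banach
proof
  fix X :: "nat \<Rightarrow> 'a L2"
  assume X: "Cauchy X"
  have "\<forall>n. \<exists>N. \<forall>k\<ge>N. \<forall>l\<ge>N. norm (X k - X l) < (1/2) ^ n"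
    using X unfolding Cauchy_def dist_norm by (meson zero_less_power half_gt_zero zero_less_one)
  then obtain N where N: "\<And>n k l. k \<ge> N n \<Longrightarrow> l \<ge> N n \<Longrightarrow> norm (X k - X l) < (1/2) ^ n"
    by metis
  \<comment> \<open>Summing the \<open>N i\<close> makes \<open>s\<close> monotone and keeps both
    \<open>s n\<close> and \<open>s (Suc n)\<close> above \<open>N n\<close>.\<close>
  define s where "s = (\<lambda>n. (\<Sum>i\<le>n. N i))"
  have s: "s n \<ge> N n" "s (Suc n) \<ge> N n" for n
    by (auto simp: s_def intro: member_le_sum order_trans[OF member_le_sum[of n "{..n}"]])
  define F where "F = (\<lambda>n. rep_L2 (X (s n)))"
  define d where "d = (\<lambda>n x. F (Suc n) x - F n x)"
  have F_sq: "square_integrable (F n)" for n by (simp add: F_def rep_L2)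
  have d_sq: "square_integrable (d n)" for n
    unfolding d_def by (intro square_integrable_diff F_sq)
  have [measurable]: "F n \<in> borel_measurable lebesgue" "d n \<in> borel_measurable lebesgue" for n
    using F_sq d_sq by (auto simp: square_integrable_def)
  have d_norm: "norm (abs_L2 (d n)) \<le> (1/2) ^ n" for n
    using N[OF s(2) s(1), of n] abs_L2_diff[OF F_sq F_sq, of "Suc n" n] by (simp add: d_def F_def)
  have "(\<integral>\<^sup>+x. (\<Sum>n. ennreal (2 ^ n * (cmod (d n x))\<^sup>2)) \<partial>lebesgue)
      = (\<Sum>n. ennreal (2 ^ n * (norm (abs_L2 (d n)))\<^sup>2))"
    by (subst nn_integral_suminf)
      (auto simp: ennreal_mult' nn_integral_cmult nn_integral_norm_L2[OF d_sq])
  also have "\<dots> \<le> (\<Sum>n. ennreal ((1/2) ^ n))"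
  proof (intro suminf_le ennreal_leI)
    fix n
    have "(norm (abs_L2 (d n)))\<^sup>2 \<le> ((1/2) ^ n)\<^sup>2"
      using d_norm by (intro power_mono) auto
    then show "2 ^ n * (norm (abs_L2 (d n)))\<^sup>2 \<le> (1/2) ^ n"
      by (simp add: power2_eq_square power_divide divide_simps mult_ac)
  qed auto
  also have "\<dots> < \<infinity>"
    using summable_geometric[of "1/2 :: real"]
    by (subst suminf_ennreal2) auto
  finally have "AE x in lebesgue. (\<Sum>n. ennreal (2 ^ n * (cmod (d n x))\<^sup>2)) \<noteq> \<infinity>"
    by (intro nn_integral_PInf_AE) auto
  then have "AE x in lebesgue. convergent (\<lambda>n. F n x)"
  proof eventually_elim
    case (elim x)
    then have "summable (\<lambda>n. 2 ^ n * (cmod (d n x))\<^sup>2)"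
      by (intro summable_suminf_not_top) auto
    then have "summable (\<lambda>n. (1/2) ^ n + 2 ^ n * (cmod (d n x))\<^sup>2)"
      using summable_geometric[of "1/2 :: real"] by (intro summable_add) auto
    \<comment> \<open>The majorant is Young's inequality with weight 2^n. The weight was affordable
      in the integral above because the squared norms of \<open>d n\<close> are at most
      4^-n.\<close>
    then have "summable (\<lambda>n. d n x)"
    proof (rule summable_comparison_test'[where N = 0])
      fix n
      have "0 \<le> (2 ^ n * cmod (d n x) - 1)\<^sup>2 + 2 ^ n * cmod (d n x)" by simp
      then have "2 ^ n * cmod (d n x) \<le> 1 + (2 ^ n * cmod (d n x))\<^sup>2"
        by (simp add: power2_eq_square algebra_simps)
      then show "norm (d n x) \<le> (1/2) ^ n + 2 ^ n * (cmod (d n x))\<^sup>2"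
        by (simp add: power_divide field_simps power2_eq_square)
    qed
    then have "convergent (\<lambda>n. \<Sum>k<n. d k x)" by (simp add: summable_iff_convergent)
    then have "convergent (\<lambda>n. (\<Sum>k<n. d k x) + F 0 x)"
      by (rule convergent_add[OF _ convergent_const])
    moreover have "(\<lambda>n. (\<Sum>k<n. d k x) + F 0 x) = (\<lambda>n. F n x)"
      using sum_lessThan_telescope[of "\<lambda>n. F n x"] by (simp add: d_def)
    ultimately show ?case by (simp only:)
  qed
  then have lim: "AE x in lebesgue. (\<lambda>n. F n x) \<longlonglongrightarrow> lim (\<lambda>n. F n x)"
    by (simp add: convergent_LIMSEQ_iff)
  define f where "f = (\<lambda>x. lim (\<lambda>n. F n x))"
  have [measurable]: "f \<in> borel_measurable lebesgue"
    unfolding f_def by (rule borel_measurable_lim_metric) auto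
  \<comment> \<open>The limit is compared with every late \<open>X k\<close>, not only with the
    subsequence, so that the whole sequence is seen to converge.\<close>
  have fatou: "(\<integral>\<^sup>+x. ennreal ((cmod (f x - rep_L2 (X k) x))\<^sup>2) \<partial>lebesgue) \<le> ennreal (((1/2) ^ n)\<^sup>2)"
    if k: "k \<ge> N n" for n k
  proof -
    have "(\<integral>\<^sup>+x. ennreal ((cmod (f x - rep_L2 (X k) x))\<^sup>2) \<partial>lebesgue)
        = (\<integral>\<^sup>+x. liminf (\<lambda>m. ennreal ((cmod (F m x - rep_L2 (X k) x))\<^sup>2)) \<partial>lebesgue)"
    proof (rule nn_integral_cong_AE, use lim in eventually_elim)
      case (elim x)
      then have "(\<lambda>m. ennreal ((cmod (F m x - rep_L2 (X k) x))\<^sup>2))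
          \<longlonglongrightarrow> ennreal ((cmod (f x - rep_L2 (X k) x))\<^sup>2)"
        unfolding f_def by (intro tendsto_intros)
      from lim_imp_Liminf[OF sequentially_bot this] show ?case by (rule sym)
    qed
    also have "\<dots> \<le> liminf (\<lambda>m. \<integral>\<^sup>+x. ennreal ((cmod (F m x - rep_L2 (X k) x))\<^sup>2) \<partial>lebesgue)"
      by (rule nn_integral_liminf) auto
    also have "\<dots> \<le> ennreal (((1/2) ^ n)\<^sup>2)"
    proof (rule order_trans[OF Liminf_le_Limsup[OF sequentially_bot] Limsup_bounded],
        rule eventually_sequentiallyI)
      fix m assume m: "n \<le> m"
      have "s m \<ge> s n" using m by (auto simp: s_def intro!: sum_mono2)
      then have "s m \<ge> N n" using s(1)[of n] by simp
      then have "(norm (X (s m) - X k))\<^sup>2 \<le> ((1/2) ^ n)\<^sup>2"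
        using N[of n "s m" k] k by (intro power_mono) auto
      then show "(\<integral>\<^sup>+x. ennreal ((cmod (F m x - rep_L2 (X k) x))\<^sup>2) \<partial>lebesgue) \<le> ennreal (((1/2) ^ n)\<^sup>2)"
        using nn_integral_norm_L2[OF square_integrable_diff[OF F_sq rep_L2, of m "X k"]]
          abs_L2_diff[OF F_sq rep_L2, of m "X k"]
        by (simp add: F_def ennreal_leI)
    qed
    finally show ?thesis .
  qed
  have fd_sq: "square_integrable (\<lambda>x. f x - rep_L2 (X k) x)" if "k \<ge> N n" for n k
    using fatou[OF that] by (intro square_integrable_if_nn_integral) (auto simp: order_le_less_trans)
  have "square_integrable (\<lambda>x. (f x - rep_L2 (X (N 0)) x) + rep_L2 (X (N 0)) x)"
    by (intro square_integrable_add fd_sq[of 0] rep_L2) simp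
  then have f_sq: "square_integrable f" by simp
  have "X \<longlonglongrightarrow> abs_L2 f"
  proof (rule LIMSEQ_I)
    fix e :: real assume "0 < e"
    then obtain n where n: "(1/2 :: real) ^ n < e"
      using real_arch_pow_inv[of e "1/2"] by auto
    have "norm (X k - abs_L2 f) < e" if k: "k \<ge> N n" for k
    proof -
      have "ennreal ((norm (abs_L2 f - X k))\<^sup>2) \<le> ennreal (((1/2) ^ n)\<^sup>2)"
        using fatou[OF k] nn_integral_norm_L2[OF fd_sq[OF k]] abs_L2_diff[OF f_sq rep_L2, of "X k"]
        by simp
      then have "(norm (abs_L2 f - X k))\<^sup>2 \<le> ((1/2) ^ n)\<^sup>2"
        by (subst (asm) ennreal_le_iff) auto
      then have "norm (abs_L2 f - X k) \<le> (1/2) ^ n"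
        by (rule power2_le_imp_le) simp
      with n show ?thesis by (simp add: norm_minus_commute)
    qed
    then show "\<exists>no. \<forall>k\<ge>no. norm (X k - abs_L2 f) < e" by blast
  qed
  then show "convergent X" by (auto simp: convergent_def)
qed

subsection \<open>Tensor products\<close>

lemma tensor_add_left: "(f + f') \<otimes> g = f \<otimes> g + f' \<otimes> g"
proof (rule L2_eqI)
  show "AE z in lebesgue. rep_L2 ((f + f') \<otimes> g) z = rep_L2 (f \<otimes> g + f' \<otimes> g) z"
    using rep_L2_tensor[of "f + f'" g] rep_L2_tensor[of f g] rep_L2_tensor[of f' g]
      AE_lebesgue_fst[OF rep_L2_add[of f f']] rep_L2_add[of "f \<otimes> g" "f' \<otimes> g"]
    by eventually_elim (simp add: ring_distribs)
qed

lemma tensor_add_right: "f \<otimes> (g + g') = f \<otimes> g + f \<otimes> g'"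
proof (rule L2_eqI)
  show "AE z in lebesgue. rep_L2 (f \<otimes> (g + g')) z = rep_L2 (f \<otimes> g + f \<otimes> g') z"
    using rep_L2_tensor[of f "g + g'"] rep_L2_tensor[of f g] rep_L2_tensor[of f g']
      AE_lebesgue_snd[OF rep_L2_add[of g g']] rep_L2_add[of "f \<otimes> g" "f \<otimes> g'"]
    by eventually_elim (simp add: ring_distribs)
qed

lemma tensor_scaleC_left: "(c *\<^sub>C f) \<otimes> g = c *\<^sub>C (f \<otimes> g)"
proof (rule L2_eqI)
  show "AE z in lebesgue. rep_L2 ((c *\<^sub>C f) \<otimes> g) z = rep_L2 (c *\<^sub>C (f \<otimes> g)) z"
    using rep_L2_tensor[of "c *\<^sub>C f" g] rep_L2_tensor[of f g]
      AE_lebesgue_fst[OF rep_L2_scaleC[of c f]] rep_L2_scaleC[of c "f \<otimes> g"]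
    by eventually_elim simp
qed

lemma tensor_scaleC_right: "f \<otimes> (c *\<^sub>C g) = c *\<^sub>C (f \<otimes> g)"
proof (rule L2_eqI)
  show "AE z in lebesgue. rep_L2 (f \<otimes> (c *\<^sub>C g)) z = rep_L2 (c *\<^sub>C (f \<otimes> g)) z"
    using rep_L2_tensor[of f "c *\<^sub>C g"] rep_L2_tensor[of f g]
      AE_lebesgue_snd[OF rep_L2_scaleC[of c g]] rep_L2_scaleC[of c "f \<otimes> g"]
    by eventually_elim simp
qed

text \<open>On the product space \<open>lborel\<close> is a product measure, while
  \<open>lebesgue\<close> is its completion. Fubini's theorem is therefore applied to Borel versions
  of the integrands.\<close>

lemma ex_borel_version:
  fixes f :: "'a::euclidean_space \<Rightarrow> complex"
  assumes "f \<in> borel_measurable lebesgue"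
  obtains f' where "f' \<in> borel_measurable borel" "AE x in lebesgue. f x = f' x"
proof -
  have [measurable]: "f \<in> borel_measurable lebesgue" by fact
  obtain g where g: "g \<in> borel_measurable lborel" "AE x in lborel. Re (f x) = g x"
    using completion_ex_borel_measurable_real[of "\<lambda>x. Re (f x)" lborel] by auto
  obtain k where k: "k \<in> borel_measurable lborel" "AE x in lborel. Im (f x) = k x"
    using completion_ex_borel_measurable_real[of "\<lambda>x. Im (f x)" lborel] by auto
  have "AE x in lborel. f x = Complex (g x) (k x)"
    using g(2) k(2) by eventually_elim (simp add: complex_eq_iff)
  moreover have "(\<lambda>x. Complex (g x) (k x)) \<in> borel_measurable borel"
    using g(1) k(1) by (simp add: borel_measurable_complex_iff)
  ultimately show ?thesis
    by (intro that[of "\<lambda>x. Complex (g x) (k x)"]) (auto simp: AE_completion_iff)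
qed

lemma integrable_lebesgue_borel_version:
  fixes f f' :: "'a::euclidean_space \<Rightarrow> complex"
  assumes "integrable lebesgue f" "f' \<in> borel_measurable borel" "AE x in lebesgue. f x = f' x"
  shows "integrable lborel f'" "integral\<^sup>L lebesgue f = integral\<^sup>L lborel f'"
proof -
  have m: "f' \<in> borel_measurable lebesgue"
    using assms(2) by (intro measurable_completion) simp
  have "integrable lebesgue f'"
    using assms m by (subst integrable_cong_AE[of _ _ f]) (auto simp: eq_commute)
  then show "integrable lborel f'"
    using assms(2) by (simp add: integrable_completion)
  show "integral\<^sup>L lebesgue f = integral\<^sup>L lborel f'"
    using assms m integral_completion[of f' lborel] by (subst integral_cong_AE[of _ _ f']) auto
qed

lemma lebesgue_integral_product:
  fixes F :: "'a::euclidean_space \<Rightarrow> complex" and G :: "'b::euclidean_space \<Rightarrow> complex"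
  assumes F: "integrable lebesgue F" and G: "integrable lebesgue G"
  shows "(\<integral>z. F (fst z) * G (snd z) \<partial>lebesgue) = (\<integral>x. F x \<partial>lebesgue) * (\<integral>y. G y \<partial>lebesgue)"
proof -
  obtain F' where F': "F' \<in> borel_measurable borel" "AE x in lebesgue. F x = F' x"
    using ex_borel_version[of F] F by auto
  obtain G' where G': "G' \<in> borel_measurable borel" "AE x in lebesgue. G x = G' x"
    using ex_borel_version[of G] G by auto
  note [measurable] = F'(1) G'(1)
  note iF = integrable_lebesgue_borel_version[OF F F']
  note iG = integrable_lebesgue_borel_version[OF G G']
  have *: "integrable (lborel \<Otimes>\<^sub>M lborel) (\<lambda>z. F' (fst z) * G' (snd z))"
  proof (rule lborel_pair.Fubini_integrable)
    show "integrable lborel (\<lambda>x. \<integral>y. norm (F' (fst (x, y)) * G' (snd (x, y))) \<partial>lborel)"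
      using iF by (simp add: norm_mult)
    show "AE x in lborel. integrable lborel (\<lambda>y. F' (fst (x, y)) * G' (snd (x, y)))"
      using iG by simp
  qed measurable
  have m: "(\<lambda>z. F' (fst z) * G' (snd z)) \<in> borel_measurable (borel :: ('a \<times> 'b) measure)"
    using F'(1) G'(1) by (auto simp: borel_prod[symmetric])
  have "AE z in lebesgue. F (fst z) * G (snd z) = F' (fst z) * G' (snd z)"
    using AE_lebesgue_fst[OF F'(2), where 'b = 'b] AE_lebesgue_snd[OF G'(2), where 'a = 'a]
    by eventually_elim simp
  moreover have "(\<lambda>z. F (fst z) * G (snd z)) \<in> borel_measurable lebesgue"
    using measurable_compose[OF fst_measurable_lebesgue borel_measurable_integrable[OF F]]
      measurable_compose[OF snd_measurable_lebesgue borel_measurable_integrable[OF G]]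
    by (rule borel_measurable_times)
  ultimately have "(\<integral>z. F (fst z) * G (snd z) \<partial>lebesgue) = (\<integral>z. F' (fst z) * G' (snd z) \<partial>lebesgue)"
    using measurable_completion[of "\<lambda>z. F' (fst z) * G' (snd z)" "lborel" borel] m
    by (intro integral_cong_AE) auto
  also have "\<dots> = (\<integral>z. F' (fst z) * G' (snd z) \<partial>(lborel \<Otimes>\<^sub>M lborel))"
    using m by (subst integral_completion) (auto simp: lborel_prod)
  also have "\<dots> = (\<integral>x. F' x \<partial>lborel) * (\<integral>y. G' y \<partial>lborel)"
    using lborel_pair.integral_fst'[OF *] by simp
  finally show ?thesis using iF iG by simp
qed

lemma cinner_tensor: "cinner (f \<otimes> g) (f' \<otimes> g') = cinner f f' * cinner g g'"
proof -
  have "cinner (f \<otimes> g) (f' \<otimes> g') = (\<integral>z. (cnj (rep_L2 f (fst z)) * rep_L2 f' (fst z)) *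
      (cnj (rep_L2 g (snd z)) * rep_L2 g' (snd z)) \<partial>lebesgue)"
    unfolding cinner_rep
  proof (intro integral_cong_AE)
    show "AE z in lebesgue. cnj (rep_L2 (f \<otimes> g) z) * rep_L2 (f' \<otimes> g') z =
        cnj (rep_L2 f (fst z)) * rep_L2 f' (fst z) * (cnj (rep_L2 g (snd z)) * rep_L2 g' (snd z))"
      using rep_L2_tensor[of f g] rep_L2_tensor[of f' g'] by eventually_elim simp
    have *: "(\<lambda>z. cnj (rep_L2 f (fst z)) * rep_L2 f' (fst z)) \<in> borel_measurable lebesgue"
      "(\<lambda>z. cnj (rep_L2 g (snd z)) * rep_L2 g' (snd z)) \<in> borel_measurable lebesgue"
      by (rule measurable_compose[OF fst_measurable_lebesgue]
          measurable_compose[OF snd_measurable_lebesgue],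
          intro borel_measurable_times borel_measurable_cnj rep_L2_measurable)+
    show "(\<lambda>z. cnj (rep_L2 f (fst z)) * rep_L2 f' (fst z) *
        (cnj (rep_L2 g (snd z)) * rep_L2 g' (snd z))) \<in> borel_measurable lebesgue"
      using * by (rule borel_measurable_times)
  qed (intro borel_measurable_times borel_measurable_cnj rep_L2_measurable)
  also have "\<dots> = cinner f f' * cinner g g'"
    unfolding cinner_rep by (intro lebesgue_integral_product square_integrable_mult rep_L2)
  finally show ?thesis .
qed

lemma norm_tensor: "norm (f \<otimes> g) = norm f * norm g"
proof -
  have "complex_of_real ((norm (f \<otimes> g))\<^sup>2) = complex_of_real ((norm f * norm g)\<^sup>2)"
    using cinner_tensor[of f g f g] by (simp only: cinner_self of_real_mult power_mult_distrib)
  then have "(norm (f \<otimes> g))\<^sup>2 = (norm f * norm g)\<^sup>2"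
    using of_real_eq_iff by blast
  then show ?thesis by (simp add: power2_eq_iff_nonneg)
qed

lemma tensor_bilinear:
  "bounded_bilinear (tensor :: 'a::euclidean_space L2 \<Rightarrow> 'b::euclidean_space L2 \<Rightarrow> ('a \<times> 'b) L2)"
proof
  show "\<exists>K. \<forall>a b. norm (a \<otimes> b :: ('a \<times> 'b) L2) \<le> norm (a::'a L2) * norm (b::'b L2) * K"
    by (rule exI[of _ 1]) (simp add: norm_tensor)
qed (simp_all add: tensor_add_left tensor_add_right tensor_scaleC_left tensor_scaleC_right
      scaleR_scaleC)

lemmas tensor_zero_left [simp] = bounded_bilinear.zero_left[OF tensor_bilinear]
  and tensor_zero_right [simp] = bounded_bilinear.zero_right[OF tensor_bilinear]
  and tensor_diff_left = bounded_bilinear.diff_left[OF tensor_bilinear]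
  and tensor_diff_right = bounded_bilinear.diff_right[OF tensor_bilinear]
  and tensor_sum_left = bounded_bilinear.sum_left[OF tensor_bilinear]
  and tensor_sum_right = bounded_bilinear.sum_right[OF tensor_bilinear]
  and tensor_scaleR_left = bounded_bilinear.scaleR_left[OF tensor_bilinear]
  and tensor_scaleR_right = bounded_bilinear.scaleR_right[OF tensor_bilinear]

lemma square_integrable_indicator:
  assumes "E \<in> lmeasurable"
  shows "square_integrable (\<lambda>x. indicator E x :: complex)"
proof -
  have "E \<in> sets lebesgue" using assms by auto
  moreover have "integrable lebesgue (\<lambda>x. indicator E x :: real)"
    using assms by (simp add: lmeasurable_iff_integrable)
  moreover have "(\<lambda>x. (cmod (indicator E x))\<^sup>2) = (\<lambda>x. indicator E x :: real)"
    by (auto simp: indicator_def)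
  ultimately show ?thesis
    unfolding square_integrable_def by (auto intro: borel_measurable_indicator)
qed

lemma integral_Times_eq_0:
  fixes v :: "('a::euclidean_space \<times> 'b::euclidean_space) L2"
  assumes v: "\<And>f g. cinner (f \<otimes> g) v = 0" and A: "A \<in> lmeasurable" and B: "B \<in> lmeasurable"
  shows "(\<integral>z. indicator (A \<times> B) z * rep_L2 v z \<partial>lebesgue) = 0"
proof -
  define f g where "f = abs_L2 (\<lambda>x. indicator A x :: complex)" "g = abs_L2 (\<lambda>x. indicator B x :: complex)"
  note fA = rep_abs_L2[OF square_integrable_indicator[OF A]]
  note gB = rep_abs_L2[OF square_integrable_indicator[OF B]]
  have ae: "AE z in lebesgue. cnj (rep_L2 (f \<otimes> g) z) * rep_L2 v z = indicator (A \<times> B) z * rep_L2 v z"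
    using rep_L2_tensor[of f g] AE_lebesgue_fst[OF fA, where 'b = 'b]
      AE_lebesgue_snd[OF gB, where 'a = 'a] unfolding f_g_def
    by eventually_elim (auto simp: indicator_def split: if_splits)
  have "A \<times> B = (A \<times> UNIV) \<inter> (UNIV \<times> B)" by auto
  then have "A \<times> B \<in> sets lebesgue"
    using A B by (metis Times_UNIV_lebesgue fmeasurableD sets.Int)
  then have "(\<integral>z. indicator (A \<times> B) z * rep_L2 v z \<partial>lebesgue) = cinner (f \<otimes> g) v"
    unfolding cinner_rep using ae
    by (intro integral_cong_AE borel_measurable_times borel_measurable_cnj rep_L2_measurable
        borel_measurable_indicator) auto
  with v show ?thesis by simp
qed

text \<open>Rectangles form an intersection-stable generator of the Borel sets, and the sets over
  which \<open>w\<close> integrates to zero are closed under complements and countable disjoint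
  unions.\<close>

lemma set_integral_eq_0_if_Times:
  fixes w :: "'a::euclidean_space \<times> 'b::euclidean_space \<Rightarrow> complex"
  assumes w: "integrable lborel w"
    and prod: "\<And>A B. A \<in> sets borel \<Longrightarrow> B \<in> sets borel \<Longrightarrow> set_lebesgue_integral lborel (A \<times> B) w = 0"
    and E: "E \<in> sets borel"
  shows "set_lebesgue_integral lborel E w = 0"
proof -
  let ?G = "{a \<times> b | a b. a \<in> sets borel \<and> b \<in> sets borel} :: ('a \<times> 'b) set set"
  have G: "sets (borel :: ('a \<times> 'b) measure) = sigma_sets UNIV ?G"
    by (subst borel_prod[symmetric]) (simp add: sets_pair_measure)
  have int: "set_integrable lborel A w" if "A \<in> sets borel" for A
    using w that unfolding set_integrable_def by (intro integrable_mult_indicator) auto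
  have "Int_stable ?G"
  proof (rule Int_stableI)
    fix a b assume "a \<in> ?G" "b \<in> ?G"
    then obtain a1 a2 b1 b2 where "a = a1 \<times> a2" "b = b1 \<times> b2"
      "a1 \<in> sets borel" "a2 \<in> sets borel" "b1 \<in> sets borel" "b2 \<in> sets borel" by auto
    then show "a \<inter> b \<in> ?G" by (auto simp: Times_Int_Times)
  qed
  moreover have "?G \<subseteq> Pow UNIV" by auto
  moreover have "E \<in> sigma_sets UNIV ?G" using E G by simp
  ultimately show ?thesis
  proof (induction E rule: sigma_sets_induct_disjoint)
    case (basic A)
    then show ?case using prod by auto
  next
    case empty
    show ?case by (simp add: set_lebesgue_integral_def)
  next
    case (compl A)
    then have A: "A \<in> sets borel" using G by simp
    have "set_lebesgue_integral lborel (UNIV - A) w = set_lebesgue_integral lborel UNIV w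
        - set_lebesgue_integral lborel A w"
      using set_integral_Un[of A "UNIV - A" lborel w] int[OF A] int[of "UNIV - A"] A
      by (simp add: sets.compl_sets)
    then show ?case using compl prod[of UNIV UNIV] by simp
  next
    case (union A)
    have A: "A i \<in> sets borel" for i
      using union(2) G by (simp add: range_subsetD)
    have "set_lebesgue_integral lborel (\<Union> (range A)) w = (\<Sum>i. set_lebesgue_integral lborel (A i) w)"
    proof (rule lebesgue_integral_countable_add)
      show "set_integrable lborel (\<Union> (range A)) w"
        by (rule int) (use A in \<open>auto intro: sets.countable_UN\<close>)
      show "i \<noteq> j \<Longrightarrow> A i \<inter> A j = {}" for i j
        using union(1) by (simp add: disjoint_family_on_def)
    qed (use A in simp)
    also have "\<dots> = 0" by (simp only: union(3)) simp
    finally show ?case .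
  qed
qed

text \<open>Testing with indicators of rectangles shows that \<open>v\<close> integrates to zero
  over every Borel subset of a bounded product, hence vanishes there. The exhaustion by bounded
  products is needed because \<open>v\<close> is integrable on these but not necessarily on the
  whole space.\<close>

theorem tensor_total:
  fixes v :: "('a::euclidean_space \<times> 'b::euclidean_space) L2"
  assumes v: "\<And>f g. cinner (f \<otimes> g) v = 0"
  shows "v = 0"
proof -
  have "AE z in lebesgue. z \<in> cball 0 (real n) \<times> cball 0 (real n) \<longrightarrow> rep_L2 v z = 0" for n
  proof -
    let ?Q = "cball 0 (real n) \<times> cball 0 (real n) :: ('a \<times> 'b) set"
    have "?Q \<in> lmeasurable" by (intro lmeasurable_compact compact_Times compact_cball)
    define q where "q = abs_L2 (\<lambda>z. indicator ?Q z :: complex)"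
    have q: "AE z in lebesgue. rep_L2 q z = indicator ?Q z"
      unfolding q_def by (rule rep_abs_L2[OF square_integrable_indicator]) fact
    define k where "k = (\<lambda>z. indicator ?Q z * rep_L2 v z)"
    have k_m: "k \<in> borel_measurable lebesgue" unfolding k_def
      using \<open>?Q \<in> lmeasurable\<close>
      by (intro borel_measurable_times rep_L2_measurable borel_measurable_indicator) auto
    have k_int: "integrable lebesgue k"
    proof (subst integrable_cong_AE)
      show "AE z in lebesgue. k z = cnj (rep_L2 q z) * rep_L2 v z"
        using q unfolding k_def by eventually_elim (auto simp: indicator_def)
      show "integrable lebesgue (\<lambda>z. cnj (rep_L2 q z) * rep_L2 v z)"
        by (intro square_integrable_mult rep_L2)
    qed (use k_m in \<open>auto intro!: borel_measurable_times borel_measurable_cnj rep_L2_measurable\<close>)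
    obtain w where w: "w \<in> borel_measurable borel" "AE z in lebesgue. k z = w z"
      using ex_borel_version[OF k_m] .
    note w_int = integrable_lebesgue_borel_version[OF k_int w]
    have prod: "set_lebesgue_integral lborel (A \<times> B) w = 0"
      if AB: "A \<in> sets borel" "B \<in> sets borel" for A B
    proof -
      have m: "A \<times> B \<in> sets borel" using AB by (auto simp: borel_prod[symmetric])
      have "set_lebesgue_integral lborel (A \<times> B) w = (\<integral>z. indicator (A \<times> B) z * k z \<partial>lebesgue)"
        unfolding set_lebesgue_integral_def
      proof (rule integrable_lebesgue_borel_version(2)[symmetric])
        show "integrable lebesgue (\<lambda>z. indicator (A \<times> B) z * k z)"
        proof -
          have "(\<lambda>z. indicator (A \<times> B) z * k z) = (\<lambda>z. indicator (A \<times> B) z *\<^sub>R k z)"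
            by (auto simp: indicator_def fun_eq_iff)
          then show ?thesis
            using integrable_mult_indicator[OF _ k_int, of "A \<times> B"] m by (simp only:) simp
        qed
        show "(\<lambda>z. indicator (A \<times> B) z *\<^sub>R w z) \<in> borel_measurable borel"
          using w(1) m by auto
        show "AE z in lebesgue. indicator (A \<times> B) z * k z = indicator (A \<times> B) z *\<^sub>R w z"
          using w(2) by eventually_elim (auto simp: indicator_def)
      qed
      also have "(\<lambda>z. indicator (A \<times> B) z * k z)
          = (\<lambda>z. indicator ((A \<inter> cball 0 (real n)) \<times> (B \<inter> cball 0 (real n))) z * rep_L2 v z)"
        by (auto simp: k_def indicator_def fun_eq_iff)
      also have "integral\<^sup>L lebesgue \<dots> = 0"
        using AB by (intro integral_Times_eq_0 v fmeasurable_Int_fmeasurable[of "cball 0 _", simplified Int_commute])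
          auto
      finally show ?thesis .
    qed
    have "AE z in lborel. w z \<in> {0}"
    proof (rule sigma_finite_measure.averaging_theorem[OF sigma_finite_lborel w_int(1)])
      fix A :: "('a \<times> 'b) set" assume "A \<in> sets lborel"
      then have "set_lebesgue_integral lborel A w = 0"
        by (intro set_integral_eq_0_if_Times[OF w_int(1) prod]) auto
      then show "(1 / measure lborel A) *\<^sub>R set_lebesgue_integral lborel A w \<in> {0}" by simp
    qed simp
    then have "AE z in lebesgue. w z = 0" by (simp add: AE_completion_iff)
    with w(2) show ?thesis
      by eventually_elim (auto simp: k_def indicator_def split: if_splits)
  qed
  then have "AE z in lebesgue. \<forall>n. z \<in> cball 0 (real n) \<times> cball 0 (real n) \<longrightarrow> rep_L2 v z = 0"
    unfolding AE_all_countable by blast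
  then have "AE z in lebesgue. rep_L2 v z = rep_L2 0 z"
    using rep_L2_zero
  proof eventually_elim
    case (elim z)
    obtain n :: nat where "max (norm (fst z)) (norm (snd z)) \<le> real n"
      using real_arch_simple by blast
    with elim show ?case by (cases z) auto
  qed
  then show ?thesis by (rule L2_eqI)
qed

subsection \<open>Orthonormal families\<close>

text \<open>The index set lets finite families, sequences and, through \<open>id\<close>, sets of
  vectors fall under one notion.\<close>

definition orthonormal_on :: "'i set \<Rightarrow> ('i \<Rightarrow> 'a::euclidean_space L2) \<Rightarrow> bool" where
  "orthonormal_on I e \<longleftrightarrow> (\<forall>i\<in>I. \<forall>j\<in>I. cinner (e i) (e j) = (if i = j then 1 else 0))"

lemma orthonormal_seq_iff: "orthonormal_seq e \<longleftrightarrow> orthonormal_on UNIV e"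
  by (simp add: orthonormal_seq_def orthonormal_on_def)

lemma orthonormal_on_subset: "orthonormal_on I e \<Longrightarrow> K \<subseteq> I \<Longrightarrow> orthonormal_on K e"
  by (simp add: orthonormal_on_def subset_iff)

lemma norm_eq_1_if_cinner: "cinner f f = 1 \<Longrightarrow> norm f = 1"
  by (metis cinner_self norm_ge_zero of_real_eq_1_iff power2_eq_1_iff not_one_le_zero neg_0_le_iff_le
      order_trans zero_le_one)

lemma orthonormal_on_norm: "orthonormal_on I e \<Longrightarrow> i \<in> I \<Longrightarrow> norm (e i) = 1"
  by (rule norm_eq_1_if_cinner) (simp add: orthonormal_on_def)

lemma orthonormal_residual:
  assumes "finite I" "orthonormal_on I e" "j \<in> I"
  shows "cinner (e j) (v - (\<Sum>i\<in>I. cinner (e i) v *\<^sub>C e i)) = 0"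
proof -
  have "(\<Sum>i\<in>I. cinner (e i) v * cinner (e j) (e i)) = (\<Sum>i\<in>I. if i = j then cinner (e i) v else 0)"
    using assms by (intro sum.cong) (auto simp: orthonormal_on_def)
  then show ?thesis
    using assms by (simp add: cinner_diff_right cinner_sum_right cinner_scaleC_right)
qed

lemma norm_add_sq_orthogonal: "cinner f g = 0 \<Longrightarrow> (norm (f + g))\<^sup>2 = (norm f)\<^sup>2 + (norm g)\<^sup>2"
  by (simp add: power2_norm_eq_inner inner_L2_def cinner_add_left cinner_add_right cinner_commute[of g f])

lemma norm_orthonormal_sum:
  assumes "finite I" "orthonormal_on I e"
  shows "(norm (\<Sum>i\<in>I. c i *\<^sub>C e i))\<^sup>2 = (\<Sum>i\<in>I. (cmod (c i))\<^sup>2)"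
  using assms
proof (induction I rule: finite_induct)
  case (insert j I)
  have "cinner (c j *\<^sub>C e j) (\<Sum>i\<in>I. c i *\<^sub>C e i) = 0"
    using insert by (auto simp: cinner_sum_right cinner_scaleC_left cinner_scaleC_right
        orthonormal_on_def intro!: sum.neutral)
  moreover have "norm (e j) = 1" using insert.prems by (rule orthonormal_on_norm) simp
  ultimately show ?case
    using insert by (simp add: norm_add_sq_orthogonal power_mult_distrib orthonormal_on_def)
qed simp

lemma norm_orthonormal_residual:
  assumes "finite I" "orthonormal_on I e"
  shows "(norm (v - (\<Sum>i\<in>I. cinner (e i) v *\<^sub>C e i)))\<^sup>2 = (norm v)\<^sup>2 - (\<Sum>i\<in>I. (cmod (cinner (e i) v))\<^sup>2)"
proof -
  let ?p = "\<Sum>i\<in>I. cinner (e i) v *\<^sub>C e i"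
  have "cinner ?p (v - ?p) = 0"
    using orthonormal_residual[OF assms] by (simp add: cinner_sum_left cinner_scaleC_left)
  from norm_add_sq_orthogonal[OF this] norm_orthonormal_sum[OF assms] show ?thesis by simp
qed

lemma bessel:
  assumes "finite I" "orthonormal_on I e"
  shows "(\<Sum>i\<in>I. (cmod (cinner (e i) v))\<^sup>2) \<le> (norm v)\<^sup>2"
  using norm_orthonormal_residual[OF assms, of v] by (smt (verit) zero_le_power2)

text \<open>Indicators of disjoint unit cubes along the diagonal. Infinite dimension matters because
  \<open>is_svd\<close> asks for infinite orthonormal sequences even when the rank is
  finite.\<close>

lemma ex_orthonormal_seq: "\<exists>e :: nat \<Rightarrow> 'a::euclidean_space L2. orthonormal_seq e"
proof -
  define S where "S = (\<lambda>i::nat. box (real i *\<^sub>R One) (real (Suc i) *\<^sub>R One) :: 'a set)"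
  have S: "S i \<in> lmeasurable" "measure lebesgue (S i) = 1" for i
    by (auto simp: S_def measure_lborel_box_eq algebra_simps inner_Basis)
  have disj: "S i \<inter> S j = {}" if "i < j" for i j
  proof (rule ccontr)
    assume "S i \<inter> S j \<noteq> {}"
    then obtain x where x: "x \<in> S i" "x \<in> S j" by auto
    obtain b :: 'a where b: "b \<in> Basis" using nonempty_Basis by blast
    then have "x \<bullet> b < real (Suc i)" "real j < x \<bullet> b"
      using x unfolding S_def by (auto simp: mem_box)
    with that show False by simp
  qed
  define e where "e = (\<lambda>i. abs_L2 (\<lambda>x. indicator (S i) x :: complex))"
  have "cinner (e i) (e j) = (if i = j then 1 else 0)" for i j
  proof -
    have "cinner (e i) (e j) = (\<integral>x. complex_of_real (indicator (S i \<inter> S j) x) \<partial>lebesgue)"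
      unfolding cinner_rep
    proof (intro integral_cong_AE)
      show "AE x in lebesgue. cnj (rep_L2 (e i) x) * rep_L2 (e j) x = complex_of_real (indicator (S i \<inter> S j) x)"
        using rep_abs_L2[OF square_integrable_indicator[OF S(1)], of i]
          rep_abs_L2[OF square_integrable_indicator[OF S(1)], of j] unfolding e_def
        by eventually_elim (auto split: split_indicator)
    qed (use S(1) in \<open>auto intro!: borel_measurable_times borel_measurable_cnj rep_L2_measurable\<close>)
    also have "\<dots> = complex_of_real (measure lebesgue (S i \<inter> S j))"
      using S(1) by simp
    also have "\<dots> = (if i = j then 1 else 0)"
      using S(2) disj[of i j] disj[of j i] by (cases i j rule: linorder_cases) (auto simp: Int_commute)
    finally show ?thesis .
  qed
  then have "\<forall>i j. cinner (e i) (e j) = (if i = j then 1 else 0)" by (intro allI)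
  then have "orthonormal_seq e" unfolding orthonormal_seq_def .
  then show ?thesis by (rule exI[of _ e])
qed

text \<open>If the span of the \<open>e i\<close> contained a whole orthonormal sequence
  \<open>d\<close>, the squared coefficients of \<open>card I + 1\<close> of its members would add
  up to \<open>card I + 1\<close>; Bessel's inequality for the \<open>e i\<close> with respect to
  \<open>d\<close> allows only \<open>card I\<close>.\<close>

lemma ex_unit_orthogonal:
  fixes e :: "'i \<Rightarrow> 'a::euclidean_space L2"
  assumes "finite I" "orthonormal_on I e"
  shows "\<exists>f. norm f = 1 \<and> (\<forall>i\<in>I. cinner (e i) f = 0)"
proof -
  obtain d :: "nat \<Rightarrow> 'a L2" where "orthonormal_seq d" using ex_orthonormal_seq by blast
  then have d: "orthonormal_on UNIV d" by (simp add: orthonormal_seq_iff)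
  let ?r = "\<lambda>j. d j - (\<Sum>i\<in>I. cinner (e i) (d j) *\<^sub>C e i)"
  have "\<exists>j. ?r j \<noteq> 0"
  proof (rule ccontr)
    assume "\<nexists>j. ?r j \<noteq> 0"
    then have *: "(\<Sum>i\<in>I. (cmod (cinner (e i) (d j)))\<^sup>2) = 1" for j
      using norm_orthonormal_residual[OF assms, of "d j"] orthonormal_on_norm[OF d, of j] by auto
    have "real (Suc (card I)) = (\<Sum>j\<le>card I. \<Sum>i\<in>I. (cmod (cinner (e i) (d j)))\<^sup>2)"
      by (simp only: *) simp
    also have "\<dots> = (\<Sum>i\<in>I. \<Sum>j\<le>card I. (cmod (cinner (d j) (e i)))\<^sup>2)"
      by (subst sum.swap) (simp add: cinner_commute[of "d _"])
    also have "\<dots> \<le> (\<Sum>i\<in>I. (norm (e i))\<^sup>2)"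
      by (intro sum_mono bessel orthonormal_on_subset[OF d]) auto
    also have "\<dots> = real (card I)"
      using orthonormal_on_norm[OF assms(2)] by simp
    finally show False by simp
  qed
  then obtain j where j: "?r j \<noteq> 0" by blast
  have "norm (inverse (norm (?r j)) *\<^sub>R ?r j) = 1"
    using j by simp
  moreover have "cinner (e i) (inverse (norm (?r j)) *\<^sub>R ?r j) = 0" if "i \<in> I" for i
    using orthonormal_residual[OF assms that] by (simp add: cinner_scaleR_right)
  ultimately show ?thesis by blast
qed

subsection \<open>Existence of the singular value decomposition\<close>

lemma orthonormal_on_tensor:
  "orthonormal_on I e \<Longrightarrow> orthonormal_on I d \<Longrightarrow> orthonormal_on I (\<lambda>i. e i \<otimes> d i)"
  by (auto simp: orthonormal_on_def cinner_tensor)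

lemma orthonormal_on_tensor_left:
  "orthonormal_on I e \<Longrightarrow> (\<And>i. i \<in> I \<Longrightarrow> norm (d i) = 1) \<Longrightarrow> orthonormal_on I (\<lambda>i. e i \<otimes> d i)"
  by (auto simp: orthonormal_on_def cinner_tensor cinner_self)

lemma cmod_cinner_tensor_le: "cmod (cinner (f \<otimes> g) v) \<le> norm v * norm f * norm g"
  using cinner_cauchy_schwarz[of "f \<otimes> g" v] by (simp add: norm_tensor mult_ac)

lemma tensor_bound_if_unit:
  assumes K: "\<And>c f. f \<in> K \<Longrightarrow> c *\<^sub>R f \<in> K" and L: "\<And>c g. g \<in> L \<Longrightarrow> c *\<^sub>R g \<in> L"
    and s: "\<And>f g. f \<in> K \<Longrightarrow> g \<in> L \<Longrightarrow> norm f = 1 \<Longrightarrow> norm g = 1 \<Longrightarrow> cmod (cinner (f \<otimes> g) v) \<le> s"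
    and f: "f \<in> K" and g: "g \<in> L"
  shows "cmod (cinner (f \<otimes> g) v) \<le> s * norm f * norm g"
proof (cases "f = 0 \<or> g = 0")
  case False
  then have nf: "norm f > 0" and ng: "norm g > 0" by auto
  let ?f = "inverse (norm f) *\<^sub>R f" and ?g = "inverse (norm g) *\<^sub>R g"
  have "cinner (?f \<otimes> ?g) v = complex_of_real (inverse (norm f) * inverse (norm g)) * cinner (f \<otimes> g) v"
    by (simp only: tensor_scaleR_left tensor_scaleR_right cinner_scaleR_left of_real_mult mult_ac)
  then have "cmod (cinner (?f \<otimes> ?g) v) = inverse (norm f) * inverse (norm g) * cmod (cinner (f \<otimes> g) v)"
    using nf ng by (simp only: norm_mult norm_of_real) simp
  moreover have "cmod (cinner (?f \<otimes> ?g) v) \<le> s"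
    using False by (intro s K L f g) auto
  ultimately have "inverse (norm f) * inverse (norm g) * cmod (cinner (f \<otimes> g) v) \<le> s" by simp
  then show ?thesis using nf ng by (simp add: field_simps)
qed auto

text \<open>
  This is what makes the form \<open>(f, g) \<mapsto> \<langle>f \<otimes> g, v\<rangle>\<close> compact: the sums of \<open>\<bar>\<langle>e\<^sub>i \<otimes> d\<^sub>i, v\<rangle>\<bar>\<^sup>2\<close> over
  orthonormal \<open>e\<^sub>i\<close> and unit \<open>d\<^sub>i\<close> are bounded by Bessel's inequality, and a family that nearly
  attains their supremum leaves nothing for the orthogonal complement.
\<close>

lemma small_on_complement:
  fixes v :: "('a::euclidean_space \<times> 'b::euclidean_space) L2"
  assumes "0 < \<epsilon>"
  shows "\<exists>(n::nat) e. orthonormal_on {..<n} e \<and>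
    (\<forall>f g. (\<forall>i<n. cinner (e i) f = 0) \<longrightarrow> cmod (cinner (f \<otimes> g) v) \<le> \<epsilon> * norm f * norm g)"
proof -
  define M where "M = {(\<Sum>i<n. (cmod (cinner (e i \<otimes> d i) v))\<^sup>2) | (n::nat) e d.
    orthonormal_on {..<n} e \<and> (\<forall>i<n. norm (d i) = 1)}"
  have bdd: "bdd_above M"
  proof (rule bdd_aboveI)
    fix x assume "x \<in> M"
    then obtain n :: nat and e d where "orthonormal_on {..<n} e" "\<forall>i<n. norm (d i) = 1"
      and x: "x = (\<Sum>i<n. (cmod (cinner (e i \<otimes> d i) v))\<^sup>2)" by (auto simp: M_def)
    then show "x \<le> (norm v)\<^sup>2"
      using bessel[OF _ orthonormal_on_tensor_left[of "{..<n}" e d], of v] by simp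
  qed
  have "0 \<in> M" unfolding M_def by (auto intro!: exI[of _ "0::nat"] simp: orthonormal_on_def)
  then have "\<exists>x\<in>M. Sup M - \<epsilon>\<^sup>2 < x"
    using assms bdd by (intro less_cSupD) auto
  then obtain n :: nat and e d where on: "orthonormal_on {..<n} e" and d: "\<forall>i<n. norm (d i) = 1"
    and big: "Sup M - \<epsilon>\<^sup>2 < (\<Sum>i<n. (cmod (cinner (e i \<otimes> d i) v))\<^sup>2)" by (auto simp: M_def)
  have unit: "cmod (cinner (f \<otimes> g) v) \<le> \<epsilon>"
    if f: "f \<in> {f. \<forall>i<n. cinner (e i) f = 0}" and nf: "norm f = 1" and ng: "norm g = 1" for f g
  proof -
    define e' d' where "e' = e(n := f)" and "d' = d(n := g)"
    have "cinner f (e i) = 0" if "i < n" for i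
      using f that cinner_commute[of f "e i"] by simp
    then have "orthonormal_on {..<Suc n} e'"
      using on f nf cinner_self[of f] by (auto simp: orthonormal_on_def e'_def less_Suc_eq)
    moreover have "\<forall>i<Suc n. norm (d' i) = 1" using d ng by (auto simp: d'_def less_Suc_eq)
    ultimately have "(\<Sum>i<Suc n. (cmod (cinner (e' i \<otimes> d' i) v))\<^sup>2) \<le> Sup M"
      by (intro cSup_upper[OF _ bdd]) (auto simp: M_def simp del: sum.lessThan_Suc)
    also have "(\<Sum>i<Suc n. (cmod (cinner (e' i \<otimes> d' i) v))\<^sup>2)
        = (\<Sum>i<n. (cmod (cinner (e i \<otimes> d i) v))\<^sup>2) + (cmod (cinner (f \<otimes> g) v))\<^sup>2"
      by (simp add: e'_def d'_def)
    finally have "(cmod (cinner (f \<otimes> g) v))\<^sup>2 \<le> \<epsilon>\<^sup>2" using big by simp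
    then show ?thesis using assms by (auto intro: power2_le_imp_le)
  qed
  have "cmod (cinner (f \<otimes> g) v) \<le> \<epsilon> * norm f * norm g"
    if "\<forall>i<n. cinner (e i) f = 0" for f g
    by (rule tensor_bound_if_unit[where K = "{f. \<forall>i<n. cinner (e i) f = 0}" and L = UNIV])
      (use that unit in \<open>auto simp: cinner_scaleR_right\<close>)
  with on show ?thesis by blast
qed

text \<open>A diagonal subsequence makes all coefficients with respect to the vectors of
  \<open>small_on_complement\<close> converge, for \<epsilon> = 1, 1/2, 1/3 and so on; the
  orthogonal remainder is small by that lemma. The vectors \<open>f (r n)\<close> themselves need
  not converge, only their pairings with \<open>v\<close>, uniformly in unit
  \<open>g\<close>.\<close>

lemma ex_slice_Cauchy_subseq:
  fixes v :: "('a::euclidean_space \<times> 'b::euclidean_space) L2" and f :: "nat \<Rightarrow> 'a L2"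
  assumes f: "\<And>n. norm (f n) = 1"
  shows "\<exists>r :: nat \<Rightarrow> nat. strict_mono r \<and> (\<forall>\<epsilon>>0. \<exists>N. \<forall>m\<ge>N. \<forall>n\<ge>N. \<forall>g.
    cmod (cinner ((f (r m) - f (r n)) \<otimes> g) v) \<le> \<epsilon> * norm g)"
proof -
  have "\<forall>k::nat. \<exists>(n::nat) e. orthonormal_on {..<n} e \<and>
    (\<forall>f g. (\<forall>i<n. cinner (e i) f = 0) \<longrightarrow> cmod (cinner (f \<otimes> g) v) \<le> (1 / real (Suc k)) * norm f * norm g)"
    by (intro allI small_on_complement) simp
  then obtain d :: "nat \<Rightarrow> nat" and e where on: "\<And>k. orthonormal_on {..<d k} (e k)"
    and small: "\<And>k f g. (\<forall>i<d k. cinner (e k i) f = 0) \<Longrightarrow>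
        cmod (cinner (f \<otimes> g) v) \<le> (1 / real (Suc k)) * norm f * norm g"
    by metis
  \<comment> \<open>All finite families are enumerated as a single sequence, padded with 0, to fit
    the diagonal argument.\<close>
  define e' where "e' = (\<lambda>n. case prod_decode n of (k, i) \<Rightarrow> if i < d k then e k i else 0)"
  interpret subseqs "\<lambda>n s. convergent (\<lambda>m. cinner (e' n) (f (s m)))"
  proof
    fix n and s :: "nat \<Rightarrow> nat" assume "strict_mono s"
    have "cmod (cinner (e' n) (f (s m))) \<le> norm (e' n)" for m
      using cinner_cauchy_schwarz[of "e' n" "f (s m)"] f[of "s m"] by simp
    then have "bounded (range (\<lambda>m. cinner (e' n) (f (s m))))"
      by (intro boundedI[of _ "norm (e' n)"]) auto
    from bounded_imp_convergent_subsequence[OF this] obtain l and r :: "nat \<Rightarrow> nat"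
      where "strict_mono r" "((\<lambda>m. cinner (e' n) (f (s m))) \<circ> r) \<longlonglongrightarrow> l" by blast
    then show "\<exists>r'. strict_mono r' \<and> convergent (\<lambda>m. cinner (e' n) (f ((s \<circ> r') m)))"
      by (auto simp: o_def convergent_def)
  qed
  define r where "r = diagseq"
  have r: "strict_mono r" unfolding r_def by (rule subseq_diagseq)
  have conv: "convergent (\<lambda>m. cinner (e' n) (f (r m)))" for n
  proof -
    have "convergent (\<lambda>m. cinner (e' n) (f ((diagseq \<circ> (+) (Suc n)) m)))"
    proof (rule diagseq_holds)
      fix r' s :: "nat \<Rightarrow> nat" and k
      assume "strict_mono r'" and conv: "convergent (\<lambda>m. cinner (e' k) (f (s m)))"
      from conv obtain l where "(\<lambda>m. cinner (e' k) (f (s m))) \<longlonglongrightarrow> l"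
        unfolding convergent_def by blast
      from LIMSEQ_subseq_LIMSEQ[OF this \<open>strict_mono r'\<close>]
      show "convergent (\<lambda>m. cinner (e' k) (f ((s \<circ> r') m)))"
        unfolding convergent_def o_def by blast
    qed
    then have "convergent (\<lambda>m. cinner (e' n) (f (r (m + Suc n))))"
      by (simp add: o_def add.commute r_def)
    then show ?thesis using convergent_ignore_initial_segment by blast
  qed
  have "\<exists>N. \<forall>m\<ge>N. \<forall>n\<ge>N. \<forall>g. cmod (cinner ((f (r m) - f (r n)) \<otimes> g) v) \<le> \<epsilon> * norm g"
    if \<epsilon>: "\<epsilon> > 0" for \<epsilon>
  proof -
    \<comment> \<open>A difference of two unit vectors leaves an orthogonal remainder of norm at
      most 2, and its contribution is to stay below \<epsilon> / 2.\<close>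
    obtain k :: nat where k: "4 / \<epsilon> < real k" using reals_Archimedean2 by blast
    then have k': "(1 / real (Suc k)) * 2 \<le> \<epsilon> / 2" using \<epsilon> by (simp add: field_simps)
    let ?p = "\<lambda>x. \<Sum>i<d k. cinner (e k i) x *\<^sub>C e k i"
    have "Cauchy (\<lambda>m. ?p (f (r m)))"
    proof -
      have "convergent (\<lambda>m. cinner (e k i) (f (r m)) *\<^sub>C e k i)" if "i < d k" for i
      proof -
        have "e' (prod_encode (k, i)) = e k i" using that by (simp add: e'_def)
        with conv[of "prod_encode (k, i)"] obtain l where "(\<lambda>m. cinner (e k i) (f (r m))) \<longlonglongrightarrow> l"
          by (auto simp: convergent_def)
        from bounded_bilinear.tendsto[OF scaleC_bilinear this tendsto_const[of "e k i"]]
        show ?thesis by (rule convergentI)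
      qed
      then have "convergent (\<lambda>m. ?p (f (r m)))" by (intro convergent_sum) auto
      then show ?thesis by (rule convergent_Cauchy)
    qed
    moreover have "0 < \<epsilon> / (2 * (norm v + 1))" 
      using \<epsilon> by (intro divide_pos_pos mult_pos_pos add_nonneg_pos) auto
    ultimately obtain N where N: "\<And>m n. m \<ge> N \<Longrightarrow> n \<ge> N \<Longrightarrow>
        norm (?p (f (r m)) - ?p (f (r n))) < \<epsilon> / (2 * (norm v + 1))"
      unfolding Cauchy_def dist_norm by blast
    have "cmod (cinner ((f (r m) - f (r n)) \<otimes> g) v) \<le> \<epsilon> * norm g" if mn: "m \<ge> N" "n \<ge> N" for m n g
    proof -
      define x where "x = f (r m) - f (r n)"
      have px: "norm (?p x) \<le> \<epsilon> / (2 * (norm v + 1))"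
      proof -
        have "?p x = ?p (f (r m)) - ?p (f (r n))"
          by (simp add: x_def cinner_diff_right bounded_bilinear.diff_left[OF scaleC_bilinear] sum_subtractf)
        then show ?thesis using N[OF mn] by simp
      qed
      have nx: "norm (x - ?p x) \<le> 2"
      proof -
        have "norm x \<le> 2" using f norm_triangle_ineq4[of "f (r m)" "f (r n)"] by (simp add: x_def)
        moreover have "(norm (x - ?p x))\<^sup>2 \<le> (norm x)\<^sup>2"
          using norm_orthonormal_residual[OF finite_lessThan on, where v = x] by (simp add: sum_nonneg)
        then have "norm (x - ?p x) \<le> norm x" by (rule power2_le_imp_le) simp
        ultimately show ?thesis by simp
      qed
      have "cinner (x \<otimes> g) v = cinner ((x - ?p x) \<otimes> g) v + cinner (?p x \<otimes> g) v"
        by (simp add: tensor_diff_left cinner_diff_left)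
      also have "cmod \<dots> \<le> (1 / real (Suc k)) * norm (x - ?p x) * norm g + norm v * norm (?p x) * norm g"
        using orthonormal_residual[OF finite_lessThan on, where v = x]
        by (intro norm_triangle_le add_mono small cmod_cinner_tensor_le allI impI) simp_all
      also have "\<dots> \<le> (1 / real (Suc k)) * 2 * norm g + norm v * (\<epsilon> / (2 * (norm v + 1))) * norm g"
        using px nx by (intro add_mono mult_right_mono mult_left_mono) auto
      also have "\<dots> \<le> \<epsilon> / 2 * norm g + \<epsilon> / 2 * norm g"
      proof (intro add_mono mult_right_mono k')
        have c: "0 < norm v + 1" by (intro add_nonneg_pos) auto
        then have "norm v / (norm v + 1) * (\<epsilon> / 2) \<le> 1 * (\<epsilon> / 2)"
          using \<epsilon> by (intro mult_right_mono) auto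
        then show "norm v * (\<epsilon> / (2 * (norm v + 1))) \<le> \<epsilon> / 2"
          by (simp add: algebra_simps)
      qed auto
      finally show ?thesis by (simp add: x_def)
    qed
    then show ?thesis by blast
  qed
  with r show ?thesis by blast
qed

text \<open>By the parallelogram law, unit vectors whose sum has norm nearly 2 are close to each
  other.\<close>

lemma Cauchy_unit_vectors:
  fixes x :: "nat \<Rightarrow> 'h::real_inner"
  assumes n1: "\<And>n. norm (x n) = 1"
    and mid: "\<And>\<epsilon>. \<epsilon> > 0 \<Longrightarrow> \<exists>N. \<forall>m\<ge>N. \<forall>n\<ge>N. norm (x m + x n) \<ge> 2 - \<epsilon>"
  shows "Cauchy x"
proof (rule metric_CauchyI)
  fix e :: real assume e: "0 < e"
  define \<epsilon> where "\<epsilon> = min 1 (e\<^sup>2 / 8)"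
  have \<epsilon>: "0 < \<epsilon>" "\<epsilon> \<le> 1" "4 * \<epsilon> < e\<^sup>2" using e by (auto simp: \<epsilon>_def min_def)
  from mid[OF \<epsilon>(1)] obtain N where N: "\<And>m n. m \<ge> N \<Longrightarrow> n \<ge> N \<Longrightarrow> norm (x m + x n) \<ge> 2 - \<epsilon>"
    by blast
  have "dist (x m) (x n) < e" if mn: "m \<ge> N" "n \<ge> N" for m n
  proof -
    have "(norm (x m - x n))\<^sup>2 + (norm (x m + x n))\<^sup>2 = 2 * (norm (x m))\<^sup>2 + 2 * (norm (x n))\<^sup>2"
      by (simp add: power2_norm_eq_inner inner_diff_left inner_diff_right inner_add_left
          inner_add_right inner_commute)
    moreover have "(2 - \<epsilon>)\<^sup>2 \<le> (norm (x m + x n))\<^sup>2" using N[OF mn] \<epsilon> by (intro power_mono) auto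
    ultimately have "(norm (x m - x n))\<^sup>2 \<le> 4 * \<epsilon> - \<epsilon>\<^sup>2"
      using n1 by (simp add: power2_diff)
    also have "\<dots> < e\<^sup>2" using \<epsilon> zero_le_power2[of \<epsilon>] by linarith
    finally have "norm (x m - x n) < e" by (rule power2_less_imp_less) (use e in simp)
    then show ?thesis by (simp add: dist_norm)
  qed
  then show "\<exists>M. \<forall>m\<ge>M. \<forall>n\<ge>M. dist (x m) (x n) < e" by blast
qed

lemma ex_phase: "\<exists>c. cmod c = 1 \<and> cnj c * z = complex_of_real (cmod z)"
proof (cases "z = 0")
  case False
  have "cnj (z / cmod z) * z = complex_of_real (cmod z)"
    using False complex_norm_square[of z] by (simp add: field_simps power2_eq_square)
  then show ?thesis using False by (intro exI[of _ "z / cmod z"]) (simp add: norm_divide)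
qed (auto intro: exI[of _ 1])

lemma continuous_form_bound:
  assumes "f \<longlonglongrightarrow> f0" "g \<longlonglongrightarrow> g0"
  shows "(\<lambda>n. cinner (f n \<otimes> g n) v) \<longlonglongrightarrow> cinner (f0 \<otimes> g0) v"
  by (intro bounded_bilinear.tendsto[OF cinner_bilinear] bounded_bilinear.tendsto[OF tensor_bilinear]
      assms tendsto_const)

definition closed_csubspace :: "'a::euclidean_space L2 set \<Rightarrow> bool" where
  "closed_csubspace K \<longleftrightarrow> closed K \<and> (\<forall>f\<in>K. \<forall>g\<in>K. f + g \<in> K) \<and> (\<forall>c. \<forall>f\<in>K. c *\<^sub>C f \<in> K)"

lemma closed_csubspace_orthogonal: "closed_csubspace {f. \<forall>a\<in>A. cinner a f = 0}"
proof -
  have "closed {f. cinner a f = 0}" for a :: "'a L2"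
    by (intro closed_Collect_eq continuous_intros
        bounded_linear.continuous_on[OF bounded_bilinear.bounded_linear_right[OF cinner_bilinear]])
  then have "closed (\<Inter>a\<in>A. {f. cinner a f = 0})" by auto
  also have "(\<Inter>a\<in>A. {f. cinner a f = 0}) = {f. \<forall>a\<in>A. cinner a f = 0}" by auto
  finally show ?thesis
    by (auto simp: closed_csubspace_def cinner_add_right cinner_scaleC_right)
qed

text \<open>A maximizing sequence can be made to converge. Along the subsequence of
  \<open>ex_slice_Cauchy_subseq\<close> the first factors are nearly interchangeable in the form, so
  testing the sum of two of them with one second factor gives nearly 2 s, and its norm must be
  nearly 2. With the limit \<open>f0\<close> frozen, the second factors are treated
  likewise.\<close>

lemma form_attains_max:
  fixes v :: "('a::euclidean_space \<times> 'b::euclidean_space) L2"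
  assumes K: "closed_csubspace K" and L: "closed_csubspace L"
    and ne: "\<exists>f\<in>K. norm f = 1" "\<exists>g\<in>L. norm g = 1"
  shows "\<exists>f g s. f \<in> K \<and> g \<in> L \<and> norm f = 1 \<and> norm g = 1 \<and> 0 \<le> s \<and>
    cinner (f \<otimes> g) v = complex_of_real s \<and>
    (\<forall>f\<in>K. \<forall>g\<in>L. cmod (cinner (f \<otimes> g) v) \<le> s * norm f * norm g)"
proof -
  define M where "M = {cmod (cinner (f \<otimes> g) v) | f g. f \<in> K \<and> g \<in> L \<and> norm f = 1 \<and> norm g = 1}"
  define s where "s = Sup M"
  have bdd: "bdd_above M"
  proof (rule bdd_aboveI)
    fix x assume "x \<in> M"
    then obtain f g where "x = cmod (cinner (f \<otimes> g) v)" "norm f = 1" "norm g = 1"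
      by (auto simp: M_def)
    then show "x \<le> norm v" using cmod_cinner_tensor_le[of f g v] by simp
  qed
  have ne': "M \<noteq> {}" using ne by (auto simp: M_def)
  have KR: "c *\<^sub>R f \<in> K" "f \<in> K \<Longrightarrow> f' \<in> K \<Longrightarrow> f + f' \<in> K" if "f \<in> K" for c f f'
    using K that by (auto simp: closed_csubspace_def scaleR_scaleC)
  have LR: "c *\<^sub>R g \<in> L" "c' *\<^sub>C g \<in> L" "g' \<in> L \<Longrightarrow> g + g' \<in> L" if "g \<in> L" for c c' g g'
    using L that by (auto simp: closed_csubspace_def scaleR_scaleC)
  have unit: "cmod (cinner (f \<otimes> g) v) \<le> s" if "f \<in> K" "g \<in> L" "norm f = 1" "norm g = 1" for f g
    unfolding s_def using that by (intro cSup_upper[OF _ bdd]) (auto simp: M_def)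
  have bound: "cmod (cinner (f \<otimes> g) v) \<le> s * norm f * norm g" if "f \<in> K" "g \<in> L" for f g
    by (rule tensor_bound_if_unit[where K = K and L = L]) (use that KR LR unit in auto)
  have s0: "0 \<le> s" using ne unit norm_ge_zero order_trans by blast
  show ?thesis
  proof (cases "s = 0")
    case True
    from ne obtain f g where fg: "f \<in> K" "norm f = 1" "g \<in> L" "norm g = 1" by blast
    with bound[of f g] True have "cinner (f \<otimes> g) v = 0" by simp
    with fg s0 bound True show ?thesis
      by (intro exI[of _ f] exI[of _ g] exI[of _ s]) auto
  next
    case False
    with s0 have s: "0 < s" by simp
    have "\<forall>n::nat. \<exists>f g. f \<in> K \<and> g \<in> L \<and> norm f = 1 \<and> norm g = 1 \<and>
        s - inverse (real (Suc n)) < cmod (cinner (f \<otimes> g) v)"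
    proof
      fix n :: nat
      have "\<exists>x\<in>M. s - inverse (real (Suc n)) < x"
        unfolding s_def using ne' bdd by (intro less_cSupD) auto
      then show "\<exists>f g. f \<in> K \<and> g \<in> L \<and> norm f = 1 \<and> norm g = 1 \<and>
        s - inverse (real (Suc n)) < cmod (cinner (f \<otimes> g) v)" by (auto simp: M_def)
    qed
    then obtain f g where fg: "\<And>n. f n \<in> K" "\<And>n. g n \<in> L" "\<And>n. norm (f n) = 1" "\<And>n. norm (g n) = 1"
      and near: "\<And>n::nat. s - inverse (real (Suc n)) < cmod (cinner (f n \<otimes> g n) v)" by metis
    obtain r :: "nat \<Rightarrow> nat" where r: "strict_mono r"
      and slice: "\<And>\<epsilon>. \<epsilon> > 0 \<Longrightarrow> \<exists>N. \<forall>m\<ge>N. \<forall>n\<ge>N. \<forall>g. cmod (cinner ((f (r m) - f (r n)) \<otimes> g) v) \<le> \<epsilon> * norm g"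
      using ex_slice_Cauchy_subseq[of f v, OF fg(3)] by blast
    have lim: "(\<lambda>n. cmod (cinner (f (r n) \<otimes> g (r n)) v)) \<longlonglongrightarrow> s"
    proof (rule tendsto_sandwich[OF _ _ _ tendsto_const[of s]])
      have "(\<lambda>n. s - inverse (real (Suc n))) \<longlonglongrightarrow> s - 0"
        by (intro tendsto_intros LIMSEQ_inverse_real_of_nat)
      from LIMSEQ_subseq_LIMSEQ[OF this r]
      show "(\<lambda>n. s - inverse (real (Suc (r n)))) \<longlonglongrightarrow> s" by (simp add: o_def)
      show "\<forall>\<^sub>F n in sequentially. s - inverse (real (Suc (r n))) \<le> cmod (cinner (f (r n) \<otimes> g (r n)) v)"
        using near by (auto intro!: always_eventually less_imp_le)
      show "\<forall>\<^sub>F n in sequentially. cmod (cinner (f (r n) \<otimes> g (r n)) v) \<le> s"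
        using unit fg by (auto intro!: always_eventually)
    qed
    have "Cauchy (\<lambda>n. f (r n))"
    proof (rule Cauchy_unit_vectors)
      fix \<epsilon> :: real assume "\<epsilon> > 0"
      then have \<delta>: "\<epsilon> * s / 4 > 0" using s by simp
      from slice[OF \<delta>] obtain N1 where N1: "\<And>m n g. m \<ge> N1 \<Longrightarrow> n \<ge> N1 \<Longrightarrow>
          cmod (cinner ((f (r m) - f (r n)) \<otimes> g) v) \<le> \<epsilon> * s / 4 * norm g" by blast
      from LIMSEQ_D[OF lim \<delta>] obtain N2 where N2: "\<And>n. n \<ge> N2 \<Longrightarrow>
          \<bar>cmod (cinner (f (r n) \<otimes> g (r n)) v) - s\<bar> < \<epsilon> * s / 4" by auto
      have "norm (f (r m) + f (r n)) \<ge> 2 - \<epsilon>" if mn: "m \<ge> max N1 N2" "n \<ge> max N1 N2" for m n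
      proof -
        have "cinner ((f (r m) + f (r n)) \<otimes> g (r n)) v =
            2 * cinner (f (r n) \<otimes> g (r n)) v + cinner ((f (r m) - f (r n)) \<otimes> g (r n)) v"
          by (simp add: tensor_add_left tensor_diff_left cinner_add_left cinner_diff_left)
        then have "2 * cmod (cinner (f (r n) \<otimes> g (r n)) v)
            - cmod (cinner ((f (r m) - f (r n)) \<otimes> g (r n)) v)
            \<le> cmod (cinner ((f (r m) + f (r n)) \<otimes> g (r n)) v)"
          by (metis norm_diff_ineq norm_mult norm_numeral)
        moreover have "\<dots> \<le> s * norm (f (r m) + f (r n))"
          using bound[of "f (r m) + f (r n)" "g (r n)"] KR fg by simp
        moreover have "cmod (cinner ((f (r m) - f (r n)) \<otimes> g (r n)) v) \<le> \<epsilon> * s / 4"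
          using N1[of m n "g (r n)"] mn fg by simp
        moreover have "s - \<epsilon> * s / 4 \<le> cmod (cinner (f (r n) \<otimes> g (r n)) v)"
        proof -
          have "n \<ge> N2" using mn(2) by simp
          from N2[OF this] show ?thesis by linarith
        qed
        ultimately have "s * (2 - \<epsilon>) \<le> s * norm (f (r m) + f (r n))"
          using \<delta> by (simp add: algebra_simps)
        then show ?thesis using s by simp
      qed
      then show "\<exists>N. \<forall>m\<ge>N. \<forall>n\<ge>N. 2 - \<epsilon> \<le> norm (f (r m) + f (r n))" by blast
    qed (use fg in auto)
    then obtain f0 where f0: "(\<lambda>n. f (r n)) \<longlonglongrightarrow> f0" using Cauchy_convergent convergent_def by blast
    have "f0 \<in> K"
      using K fg(1) f0 closed_sequentially[of K "\<lambda>n. f (r n)" f0] by (simp add: closed_csubspace_def)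
    have "norm f0 = 1"
      using tendsto_norm[OF f0] fg(3) LIMSEQ_unique[OF _ tendsto_const[of 1]] by simp
    have lim': "(\<lambda>n. cmod (cinner (f0 \<otimes> g (r n)) v)) \<longlonglongrightarrow> s"
    proof -
      have "(\<lambda>n. norm v * norm (f (r n) - f0)) \<longlonglongrightarrow> norm v * norm (f0 - f0)"
        by (intro tendsto_intros f0)
      then have null: "(\<lambda>n. norm v * norm (f (r n) - f0)) \<longlonglongrightarrow> 0" by simp
      have "norm (cmod (cinner (f (r n) \<otimes> g (r n)) v) - cmod (cinner (f0 \<otimes> g (r n)) v))
          \<le> norm v * norm (f (r n) - f0)" for n
      proof -
        have "cinner (f (r n) \<otimes> g (r n)) v - cinner (f0 \<otimes> g (r n)) v = cinner ((f (r n) - f0) \<otimes> g (r n)) v"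
          by (simp add: tensor_diff_left cinner_diff_left)
        then show ?thesis
          using norm_triangle_ineq3[of "cinner (f (r n) \<otimes> g (r n)) v" "cinner (f0 \<otimes> g (r n)) v"]
            cmod_cinner_tensor_le[of "f (r n) - f0" "g (r n)" v] fg(4)[of "r n"] by simp
      qed
      then have "(\<lambda>n. cmod (cinner (f (r n) \<otimes> g (r n)) v) - cmod (cinner (f0 \<otimes> g (r n)) v)) \<longlonglongrightarrow> 0"
        by (intro Lim_null_comparison[OF always_eventually null] allI)
      from tendsto_diff[OF lim this] show ?thesis by simp
    qed
    \<comment> \<open>Only the modulus of the form is known to approach \<open>s\<close>. The phases
      make its values nonnegative, so that they add without cancellation in the sum
      \<open>h m + h n\<close>.\<close>
    have "\<forall>n. \<exists>c. cmod c = 1 \<and> cnj c * cinner (f0 \<otimes> g (r n)) v = complex_of_real (cmod (cinner (f0 \<otimes> g (r n)) v))"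
      using ex_phase by blast
    then obtain c where c: "\<And>n. cmod (c n) = 1"
      "\<And>n. cnj (c n) * cinner (f0 \<otimes> g (r n)) v = complex_of_real (cmod (cinner (f0 \<otimes> g (r n)) v))"
      by metis
    define h where "h = (\<lambda>n. c n *\<^sub>C g (r n))"
    have h: "h n \<in> L" "norm (h n) = 1" for n
      using LR fg c by (auto simp: h_def)
    have hv: "cinner (f0 \<otimes> h n) v = complex_of_real (cmod (cinner (f0 \<otimes> g (r n)) v))" for n
      using c by (simp add: h_def tensor_scaleC_right cinner_scaleC_left)
    have "Cauchy h"
    proof (rule Cauchy_unit_vectors)
      fix \<epsilon> :: real assume "\<epsilon> > 0"
      then have \<delta>: "\<epsilon> * s / 2 > 0" using s by simp
      from LIMSEQ_D[OF lim' \<delta>] obtain N where N: "\<And>n. n \<ge> N \<Longrightarrow>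
          \<bar>cmod (cinner (f0 \<otimes> g (r n)) v) - s\<bar> < \<epsilon> * s / 2" by auto
      have "norm (h m + h n) \<ge> 2 - \<epsilon>" if mn: "m \<ge> N" "n \<ge> N" for m n
      proof -
        have "cinner (f0 \<otimes> (h m + h n)) v =
            complex_of_real (cmod (cinner (f0 \<otimes> g (r m)) v) + cmod (cinner (f0 \<otimes> g (r n)) v))"
          by (simp add: tensor_add_right cinner_add_left hv)
        then have "cmod (cinner (f0 \<otimes> (h m + h n)) v) =
            cmod (cinner (f0 \<otimes> g (r m)) v) + cmod (cinner (f0 \<otimes> g (r n)) v)"
          by (simp only: norm_of_real) simp
        moreover have "cmod (cinner (f0 \<otimes> (h m + h n)) v) \<le> s * norm (h m + h n)"
          using bound[of f0 "h m + h n"] LR h \<open>f0 \<in> K\<close> \<open>norm f0 = 1\<close> by simp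
        moreover have "s - \<epsilon> * s / 2 \<le> cmod (cinner (f0 \<otimes> g (r m)) v)"
          using N[OF mn(1)] by linarith
        moreover have "s - \<epsilon> * s / 2 \<le> cmod (cinner (f0 \<otimes> g (r n)) v)"
          using N[OF mn(2)] by linarith
        ultimately have "s * (2 - \<epsilon>) \<le> s * norm (h m + h n)"
          by (simp add: algebra_simps)
        then show ?thesis using s by simp
      qed
      then show "\<exists>N. \<forall>m\<ge>N. \<forall>n\<ge>N. 2 - \<epsilon> \<le> norm (h m + h n)" by blast
    qed (use h in auto)
    then obtain g0 where g0: "h \<longlonglongrightarrow> g0" using Cauchy_convergent convergent_def by blast
    have "g0 \<in> L"
      using L h g0 closed_sequentially[of L h g0] by (simp add: closed_csubspace_def)
    have "norm g0 = 1"
      using tendsto_norm[OF g0] h(2) LIMSEQ_unique[OF _ tendsto_const[of 1]] by simp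
    have "(\<lambda>n. cinner (f0 \<otimes> h n) v) \<longlonglongrightarrow> cinner (f0 \<otimes> g0) v"
      by (intro continuous_form_bound g0 tendsto_const)
    moreover have "(\<lambda>n. cinner (f0 \<otimes> h n) v) \<longlonglongrightarrow> complex_of_real s"
      unfolding hv by (intro tendsto_of_real lim')
    ultimately have "cinner (f0 \<otimes> g0) v = complex_of_real s" by (rule LIMSEQ_unique)
    with \<open>f0 \<in> K\<close> \<open>g0 \<in> L\<close> \<open>norm f0 = 1\<close> \<open>norm g0 = 1\<close> s0 bound show ?thesis by blast
  qed
qed

lemma orthonormal_summable:
  fixes e :: "nat \<Rightarrow> 'a::euclidean_space L2"
  assumes "orthonormal_on UNIV e" "summable (\<lambda>k. (c k)\<^sup>2)"
  shows "summable (\<lambda>k. c k *\<^sub>R e k)"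
  unfolding summable_Cauchy
proof (intro allI impI)
  fix \<epsilon> :: real assume \<epsilon>: "0 < \<epsilon>"
  then have "0 < \<epsilon>\<^sup>2" by simp
  with assms(2) obtain N where N: "\<And>m n. m \<ge> N \<Longrightarrow> norm (sum (\<lambda>k. (c k)\<^sup>2) {m..<n}) < \<epsilon>\<^sup>2"
    unfolding summable_Cauchy by blast
  have "norm (sum (\<lambda>k. c k *\<^sub>R e k) {m..<n}) < \<epsilon>" if "m \<ge> N" for m n
  proof -
    have "(norm (sum (\<lambda>k. c k *\<^sub>R e k) {m..<n}))\<^sup>2 = sum (\<lambda>k. (c k)\<^sup>2) {m..<n}"
      using norm_orthonormal_sum[of "{m..<n}" e "\<lambda>k. complex_of_real (c k)"]
        orthonormal_on_subset[OF assms(1)] by (simp add: scaleR_scaleC)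
    also have "\<dots> < \<epsilon>\<^sup>2" using N[OF that, of n] by simp
    finally show ?thesis by (rule power2_less_imp_less) (use \<epsilon> in simp)
  qed
  then show "\<exists>N. \<forall>m\<ge>N. \<forall>n. norm (sum (\<lambda>k. c k *\<^sub>R e k) {m..<n}) < \<epsilon>" by blast
qed

text \<open>First-order optimality: moving from \<open>g\<close> in an orthogonal direction changes
  the norm only to second order. For the test vector \<open>x\<close> the bound \<open>max\<close>
  would fail by exactly |z|^2 (s^2 t^2 + |z|^2), after squaring.\<close>

lemma maximizer_orthogonal:
  fixes \<phi> :: "'a::euclidean_space L2 \<Rightarrow> complex"
  assumes add: "\<And>x y. \<phi> (x + y) = \<phi> x + \<phi> y" and scale: "\<And>c x. \<phi> (c *\<^sub>C x) = cnj c * \<phi> x"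
    and max: "\<And>x. cmod (\<phi> x) \<le> s * norm x"
    and g: "norm g = 1" "\<phi> g = complex_of_real s" and orth: "cinner g g' = 0"
  shows "\<phi> g' = 0"
proof (rule ccontr)
  assume z0: "\<phi> g' \<noteq> 0"
  define z where "z = \<phi> g'"
  define t where "t = norm g'"
  define x where "x = complex_of_real (s * t\<^sup>2) *\<^sub>C g + z *\<^sub>C g'"
  have s0: "0 \<le> s" using max[of g] g order_trans[OF norm_ge_zero] by fastforce
  have t: "t > 0" using max[of g'] z0 by (auto simp: t_def)
  have "(norm x)\<^sup>2 = (s * t\<^sup>2)\<^sup>2 + (cmod z * t)\<^sup>2"
    using orth g unfolding x_def by (subst norm_add_sq_orthogonal)
      (auto simp: cinner_scaleC_left cinner_scaleC_right t_def norm_mult power_mult_distrib norm_power)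
  then have "(s * norm x)\<^sup>2 = s\<^sup>2 * ((s * t\<^sup>2)\<^sup>2 + (cmod z * t)\<^sup>2)"
    by (simp add: power_mult_distrib)
  moreover have "\<phi> x = complex_of_real (s * t\<^sup>2 * s + (cmod z)\<^sup>2)"
    using complex_norm_square[of z]
    by (simp add: x_def add scale g z_def[symmetric] mult.commute)
  then have "cmod (\<phi> x) = s * t\<^sup>2 * s + (cmod z)\<^sup>2"
    using s0 by (simp only: norm_of_real) simp
  moreover have "(cmod (\<phi> x))\<^sup>2 \<le> (s * norm x)\<^sup>2"
    by (intro power_mono max norm_ge_zero)
  ultimately have "(s * t\<^sup>2 * s + (cmod z)\<^sup>2)\<^sup>2 \<le> s\<^sup>2 * ((s * t\<^sup>2)\<^sup>2 + (cmod z * t)\<^sup>2)"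
    by simp
  then have "(cmod z)\<^sup>2 * (s\<^sup>2 * t\<^sup>2 + (cmod z)\<^sup>2) \<le> 0"
    by (simp add: power2_eq_square algebra_simps)
  moreover have "0 < (cmod z)\<^sup>2 * (s\<^sup>2 * t\<^sup>2 + (cmod z)\<^sup>2)"
    using z0 by (intro mult_pos_pos add_nonneg_pos) (auto simp: z_def)
  ultimately show False by simp
qed

text \<open>The invariant of the greedy construction: \<open>A\<close> and \<open>B\<close> collect
  the singular vectors found so far, and the remainder \<open>v\<close> pairs to zero with each of
  them.\<close>

definition deflated :: "'a::euclidean_space L2 set \<Rightarrow> 'b::euclidean_space L2 set \<Rightarrow> ('a \<times> 'b) L2 \<Rightarrow> bool" where
  "deflated A B v \<longleftrightarrow> finite A \<and> finite B \<and> orthonormal_on A id \<and> orthonormal_on B id \<and>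
     (\<forall>a\<in>A. \<forall>g. cinner (a \<otimes> g) v = 0) \<and> (\<forall>b\<in>B. \<forall>f. cinner (f \<otimes> b) v = 0)"

lemma orthonormal_on_insert_id:
  assumes "orthonormal_on A id" "norm a = 1" "\<forall>x\<in>A. cinner x a = 0"
  shows "orthonormal_on (insert a A) id"
proof -
  have "cinner a x = 0" if "x \<in> A" for x using assms(3) that cinner_commute[of a x] by simp
  moreover have "a \<notin> A" using assms cinner_self[of a] by fastforce
  ultimately show ?thesis
    using assms cinner_self[of a] by (auto simp: orthonormal_on_def)
qed

definition deflating_triple :: "'a::euclidean_space L2 set \<Rightarrow> 'b::euclidean_space L2 set \<Rightarrow>
    ('a \<times> 'b) L2 \<Rightarrow> 'a L2 \<Rightarrow> 'b L2 \<Rightarrow> real \<Rightarrow> bool" where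
  "deflating_triple A B v a b s \<longleftrightarrow> norm a = 1 \<and> norm b = 1 \<and> (\<forall>x\<in>A. cinner x a = 0) \<and> (\<forall>y\<in>B. cinner y b = 0) \<and>
    0 \<le> s \<and> cinner (a \<otimes> b) v = complex_of_real s \<and>
    (\<forall>f g. cmod (cinner (f \<otimes> g) v) \<le> s * norm f * norm g) \<and>
    deflated (insert a A) (insert b B) (v - s *\<^sub>R (a \<otimes> b))"

text \<open>The maximum over the complements of \<open>A\<close> and \<open>B\<close> bounds the
  form everywhere, because projecting onto the complements does not change its values. Optimality in
  each argument separately then makes the remainder vanish against \<open>a\<close> and against
  \<open>b\<close>.\<close>

lemma deflation_step:
  assumes "deflated A B v"
  shows "\<exists>a b s. deflating_triple A B v a b s"
proof -
  note d = assms[unfolded deflated_def]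
  let ?K = "{f. \<forall>a\<in>A. cinner a f = 0}" and ?L = "{g. \<forall>b\<in>B. cinner b g = 0}"
  have "\<exists>f\<in>?K. norm f = 1" "\<exists>g\<in>?L. norm g = 1"
    using ex_unit_orthogonal[of A id] ex_unit_orthogonal[of B id] d by auto
  from form_attains_max[OF closed_csubspace_orthogonal closed_csubspace_orthogonal this, of v]
  obtain a b s where ab: "a \<in> ?K" "b \<in> ?L" "norm a = 1" "norm b = 1" "0 \<le> s"
    and s: "cinner (a \<otimes> b) v = complex_of_real s"
    and max: "\<And>f g. f \<in> ?K \<Longrightarrow> g \<in> ?L \<Longrightarrow> cmod (cinner (f \<otimes> g) v) \<le> s * norm f * norm g" by blast
  have bound: "cmod (cinner (f \<otimes> g) v) \<le> s * norm f * norm g" for f g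
  proof -
    define f' g' where "f' = f - (\<Sum>a\<in>A. cinner a f *\<^sub>C a)" and "g' = g - (\<Sum>b\<in>B. cinner b g *\<^sub>C b)"
    have f': "f' \<in> ?K" "norm f' \<le> norm f"
      using d orthonormal_residual[of A id _ f] norm_orthonormal_residual[of A id f]
      by (auto simp: f'_def sum_nonneg intro: power2_le_imp_le)
    have g': "g' \<in> ?L" "norm g' \<le> norm g"
      using d orthonormal_residual[of B id _ g] norm_orthonormal_residual[of B id g]
      by (auto simp: g'_def sum_nonneg intro: power2_le_imp_le)
    have "cinner (f \<otimes> g) v = cinner (f \<otimes> g') v"
      using d by (simp add: g'_def tensor_diff_right tensor_sum_right tensor_scaleC_right
          cinner_diff_left cinner_sum_left cinner_scaleC_left)
    also have "\<dots> = cinner (f' \<otimes> g') v"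
      using d by (simp add: f'_def tensor_diff_left tensor_sum_left tensor_scaleC_left
          cinner_diff_left cinner_sum_left cinner_scaleC_left)
    also have "cmod \<dots> \<le> s * norm f' * norm g'" by (rule max[OF f'(1) g'(1)])
    also have "\<dots> \<le> s * norm f * norm g"
      using f' g' ab by (intro mult_mono) auto
    finally show ?thesis .
  qed
  define w where "w = v - s *\<^sub>R (a \<otimes> b)"
  have wform: "cinner (f \<otimes> g) w = cinner (f \<otimes> g) v - complex_of_real s * (cinner f a * cinner g b)" for f g
    by (simp add: w_def cinner_diff_right cinner_scaleR_right cinner_tensor)
  have orth: "cinner (a \<otimes> g) v = 0" if "cinner b g = 0" for g
    by (rule maximizer_orthogonal[where s = s and g = b])
      (use bound[of a] ab s that in \<open>auto simp: tensor_add_right tensor_scaleC_right cinner_add_left cinner_scaleC_left\<close>)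
  have orth': "cinner (f \<otimes> b) v = 0" if "cinner a f = 0" for f
    by (rule maximizer_orthogonal[where s = s and g = a])
      (use bound[of _ b] ab s that in \<open>auto simp: tensor_add_left tensor_scaleC_left cinner_add_left cinner_scaleC_left\<close>)
  have a1: "cinner a a = 1" and b1: "cinner b b = 1" using ab by (simp_all add: cinner_self)
  have wa: "cinner (a \<otimes> g) w = 0" for g
  proof -
    have "cinner b (g - cinner b g *\<^sub>C b) = 0" by (simp add: cinner_diff_right cinner_scaleC_right b1)
    from orth[OF this] have "cinner (a \<otimes> g) v = cnj (cinner b g) * complex_of_real s"
      by (simp add: tensor_diff_right tensor_scaleC_right cinner_diff_left cinner_scaleC_left s)
    then show ?thesis using cinner_commute[of g b] by (simp add: wform a1)
  qed
  have wb: "cinner (f \<otimes> b) w = 0" for f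
  proof -
    have "cinner a (f - cinner a f *\<^sub>C a) = 0" by (simp add: cinner_diff_right cinner_scaleC_right a1)
    from orth'[OF this] have "cinner (f \<otimes> b) v = cnj (cinner a f) * complex_of_real s"
      by (simp add: tensor_diff_left tensor_scaleC_left cinner_diff_left cinner_scaleC_left s)
    then show ?thesis using cinner_commute[of f a] by (simp add: wform b1)
  qed
  have "cinner (x \<otimes> g) w = 0" if "x \<in> A" for x g using d that ab by (simp add: wform)
  moreover have "cinner (f \<otimes> y) w = 0" if "y \<in> B" for y f using d that ab by (simp add: wform)
  ultimately have "deflated (insert a A) (insert b B) w"
    unfolding deflated_def using d ab wa wb by (auto intro: orthonormal_on_insert_id)
  with ab s bound have "deflating_triple A B v a b s"
    unfolding w_def deflating_triple_def by simp
  then show ?thesis by blast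
qed

text \<open>Repeated deflation produces the singular triples. Bessel's inequality drives the maxima
  \<open>\<sigma> n\<close> to zero, so the limiting remainder is orthogonal to all elementary
  tensors and is zero by \<open>tensor_total\<close>.\<close>

theorem ex_svd:
  fixes v :: "('a::euclidean_space \<times> 'b::euclidean_space) L2"
  shows "\<exists>\<sigma> a b. is_svd v \<sigma> a b"
proof -
  obtain \<alpha> \<beta> \<sigma>' where "\<And>A B (v :: ('a \<times> 'b) L2). deflated A B v \<Longrightarrow>
      deflating_triple A B v (\<alpha> A B v) (\<beta> A B v) (\<sigma>' A B v)"
    using deflation_step by metis
  note step = this[unfolded deflating_triple_def]
  define st where "st = rec_nat ({}, {}, v) (\<lambda>_ (A, B, w).
    (insert (\<alpha> A B w) A, insert (\<beta> A B w) B, w - \<sigma>' A B w *\<^sub>R (\<alpha> A B w \<otimes> \<beta> A B w)))"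
  define A where "A = (\<lambda>n. fst (st n))"
  define B where "B = (\<lambda>n. fst (snd (st n)))"
  define w where "w = (\<lambda>n. snd (snd (st n)))"
  define a b \<sigma> where "a = (\<lambda>n. \<alpha> (A n) (B n) (w n))" and "b = (\<lambda>n. \<beta> (A n) (B n) (w n))"
    and "\<sigma> = (\<lambda>n. \<sigma>' (A n) (B n) (w n))"
  have st0: "A 0 = {}" "B 0 = {}" "w 0 = v" by (simp_all add: A_def B_def w_def st_def)
  have stS: "A (Suc n) = insert (a n) (A n)" "B (Suc n) = insert (b n) (B n)"
    "w (Suc n) = w n - \<sigma> n *\<^sub>R (a n \<otimes> b n)" for n
    by (simp_all add: A_def B_def w_def st_def a_def b_def \<sigma>_def split: prod.split)
  have defl: "deflated (A n) (B n) (w n)" for n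
  proof (induction n)
    case 0
    show ?case by (simp add: st0 deflated_def orthonormal_on_def)
  next
    case (Suc n)
    then show ?case using step[OF Suc] by (simp add: stS a_def b_def \<sigma>_def)
  qed
  have n1: "norm (a n) = 1" "norm (b n) = 1" and
    orth: "x \<in> A n \<Longrightarrow> cinner x (a n) = 0" "y \<in> B n \<Longrightarrow> cinner y (b n) = 0" and
    s0: "0 \<le> \<sigma> n" and sv: "cinner (a n \<otimes> b n) (w n) = complex_of_real (\<sigma> n)" and
    bound: "cmod (cinner (f \<otimes> g) (w n)) \<le> \<sigma> n * norm f * norm g" for n x y f g
    using step[OF defl[of n]] unfolding a_def b_def \<sigma>_def by blast+
  have mem: "a i \<in> A n" "b i \<in> B n" if "i < n" for i n
    using that by (induction n) (auto simp: stS less_Suc_eq)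
  have ona: "orthonormal_on UNIV a"
    unfolding orthonormal_on_def
  proof (intro ballI)
    fix i j
    show "cinner (a i) (a j) = (if i = j then 1 else 0)"
      using orth(1)[OF mem(1), of i j] orth(1)[OF mem(1), of j i] n1(1)[of i] cinner_commute[of "a i" "a j"]
      by (cases i j rule: linorder_cases) (simp_all add: cinner_self)
  qed
  have onb: "orthonormal_on UNIV b"
    unfolding orthonormal_on_def
  proof (intro ballI)
    fix i j
    show "cinner (b i) (b j) = (if i = j then 1 else 0)"
      using orth(2)[OF mem(2), of i j] orth(2)[OF mem(2), of j i] n1(2)[of i] cinner_commute[of "b i" "b j"]
      by (cases i j rule: linorder_cases) (simp_all add: cinner_self)
  qed
  define e where "e = (\<lambda>n. a n \<otimes> b n)"
  have one: "orthonormal_on UNIV e" unfolding e_def using ona onb by (rule orthonormal_on_tensor)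
  have w: "w n = v - (\<Sum>i<n. \<sigma> i *\<^sub>R e i)" for n
    by (induction n) (simp_all add: st0 stS e_def)
  have sv': "cinner (e n) v = complex_of_real (\<sigma> n)" for n
  proof -
    have "cinner (e n) (\<Sum>i<n. \<sigma> i *\<^sub>R e i) = 0"
      using one by (auto simp: cinner_sum_right cinner_scaleR_right orthonormal_on_def intro!: sum.neutral)
    then show ?thesis using sv[of n] by (simp add: w cinner_diff_right e_def)
  qed
  have "(\<Sum>k<n. (\<sigma> k)\<^sup>2) \<le> (norm v)\<^sup>2" for n
    using bessel[OF _ orthonormal_on_subset[OF one], of "{..<n}" v] s0 by (simp add: sv')
  then have summ: "summable (\<lambda>k. (\<sigma> k)\<^sup>2)"
    by (intro summableI_nonneg_bounded[of _ "(norm v)\<^sup>2"]) auto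
  then have "(\<lambda>k. (\<sigma> k)\<^sup>2) \<longlonglongrightarrow> 0" by (rule summable_LIMSEQ_zero)
  then have "(\<lambda>k. sqrt ((\<sigma> k)\<^sup>2)) \<longlonglongrightarrow> sqrt 0" by (rule tendsto_real_sqrt)
  then have \<sigma>0: "\<sigma> \<longlonglongrightarrow> 0" using s0 by simp
  \<comment> \<open>The pair found at step n + 1 already competed at step n, where the form has the
    same value on it because \<open>e n\<close> is orthogonal to \<open>e (Suc n)\<close>.\<close>
  have dec: "decseq \<sigma>"
  proof (rule decseq_SucI)
    fix n
    have "cinner (e (Suc n)) (e n) = 0" using one by (simp add: orthonormal_on_def)
    then have "cinner (a (Suc n) \<otimes> b (Suc n)) (w n) = complex_of_real (\<sigma> (Suc n))"
      using sv[of "Suc n"] by (simp add: stS cinner_diff_right cinner_scaleR_right e_def)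
    then have "cmod (complex_of_real (\<sigma> (Suc n))) \<le> \<sigma> n"
      using bound[of "a (Suc n)" "b (Suc n)" n] n1 by simp
    then show "\<sigma> (Suc n) \<le> \<sigma> n" by simp
  qed
  have "summable (\<lambda>k. \<sigma> k *\<^sub>R e k)" by (rule orthonormal_summable[OF one summ])
  then obtain v' where v': "(\<lambda>k. \<sigma> k *\<^sub>R e k) sums v'" by (auto simp: summable_def)
  then have wlim: "w \<longlonglongrightarrow> v - v'"
    unfolding w sums_def by (intro tendsto_intros)
  have "cinner (f \<otimes> g) (v - v') = 0" for f g
  proof -
    have "(\<lambda>n. cinner (f \<otimes> g) (w n)) \<longlonglongrightarrow> cinner (f \<otimes> g) (v - v')"
      by (intro bounded_bilinear.tendsto[OF cinner_bilinear] wlim tendsto_const)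
    moreover have "(\<lambda>n. \<sigma> n * norm f * norm g) \<longlonglongrightarrow> 0 * norm f * norm g"
      by (intro tendsto_intros \<sigma>0)
    then have "(\<lambda>n. \<sigma> n * norm f * norm g) \<longlonglongrightarrow> 0" by simp
    then have "(\<lambda>n. cinner (f \<otimes> g) (w n)) \<longlonglongrightarrow> 0"
      by (rule Lim_null_comparison[OF always_eventually, rotated]) (simp add: bound)
    ultimately show ?thesis by (rule LIMSEQ_unique)
  qed
  then have "v - v' = 0" by (rule tensor_total)
  with v' s0 dec ona onb have "is_svd v \<sigma> a b"
    by (simp add: is_svd_def orthonormal_seq_iff e_def)
  then show ?thesis by blast
qed

subsection \<open>Singular values, thresholding and rank\<close>

abbreviation left_vec :: "('a::euclidean_space \<times> 'b::euclidean_space) L2 \<Rightarrow> nat \<Rightarrow> 'a L2" where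
  "left_vec v \<equiv> fst (snd (svd v))"

abbreviation right_vec :: "('a::euclidean_space \<times> 'b::euclidean_space) L2 \<Rightarrow> nat \<Rightarrow> 'b L2" where
  "right_vec v \<equiv> snd (snd (svd v))"

lemma is_svd_svd: "is_svd v (sing_val v) (left_vec v) (right_vec v)"
proof -
  have "\<exists>p. case p of (\<sigma>, a, b) \<Rightarrow> is_svd v \<sigma> a b" using ex_svd[of v] by auto
  from someI_ex[OF this] show ?thesis
    by (simp add: svd_def[symmetric] sing_val_def split: prod.splits)
qed

lemma sing_val_nonneg [simp]: "0 \<le> sing_val v k"
  and sing_val_decseq: "decseq (sing_val v)"
  and left_vec_orthonormal: "orthonormal_on UNIV (left_vec v)"
  and right_vec_orthonormal: "orthonormal_on UNIV (right_vec v)"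
  and sing_val_sums: "(\<lambda>k. sing_val v k *\<^sub>R sing_term v k) sums v"
  using is_svd_svd[of v] by (auto simp: is_svd_def orthonormal_seq_iff sing_term_def)

lemma sing_val_mono: "i \<le> j \<Longrightarrow> sing_val v j \<le> sing_val v i"
  using sing_val_decseq[of v] unfolding decseq_def by blast

lemma sing_term_orthonormal: "orthonormal_on UNIV (sing_term v)"
  using orthonormal_on_tensor[OF left_vec_orthonormal right_vec_orthonormal, of v v]
  by (simp add: orthonormal_on_def sing_term_def)

lemma orthonormal_coeff:
  assumes "orthonormal_on UNIV e" "(\<lambda>k. c k *\<^sub>R e k) sums x"
  shows "cinner (e k) x = complex_of_real (c k)"
proof -
  have "(\<lambda>j. cinner (e k) (c j *\<^sub>R e j)) sums cinner (e k) x"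
    by (rule bounded_linear.sums[OF bounded_bilinear.bounded_linear_right[OF cinner_bilinear] assms(2)])
  moreover have "(\<lambda>j. cinner (e k) (c j *\<^sub>R e j)) = (\<lambda>j. if j = k then complex_of_real (c k) else 0)"
    using assms(1) by (auto simp: orthonormal_on_def cinner_scaleR_right fun_eq_iff)
  ultimately show ?thesis using sums_single[of k "\<lambda>_. complex_of_real (c k)"] sums_unique2
    by (metis (no_types, lifting) sums_cong)
qed

lemma orthonormal_inner_sums:
  assumes "orthonormal_on UNIV e" "(\<lambda>k. c k *\<^sub>R e k) sums x" "(\<lambda>k. d k *\<^sub>R e k) sums y"
  shows "(\<lambda>k. c k * d k) sums inner x y"
proof -
  have "(\<lambda>j. inner (c j *\<^sub>R e j) y) sums inner x y"
    by (rule bounded_linear.sums[OF bounded_linear_inner_left assms(2)])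
  moreover have "inner (e j) y = d j" for j
    using orthonormal_coeff[OF assms(1,3), of j] by (simp add: inner_L2_def)
  ultimately show ?thesis by simp
qed

lemma orthonormal_norm_sums:
  assumes "orthonormal_on UNIV e" "(\<lambda>k. c k *\<^sub>R e k) sums x"
  shows "(\<lambda>k. (c k)\<^sup>2) sums (norm x)\<^sup>2"
  using orthonormal_inner_sums[OF assms assms(2)] by (simp add: power2_eq_square dot_square_norm)

lemma sing_val_sq_sums: "(\<lambda>k. (sing_val v k)\<^sup>2) sums (norm v)\<^sup>2"
  by (rule orthonormal_norm_sums[OF sing_term_orthonormal sing_val_sums])

lemma sing_val_tendsto_0: "sing_val v \<longlonglongrightarrow> 0"
proof -
  have "(\<lambda>k. (sing_val v k)\<^sup>2) \<longlonglongrightarrow> 0"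
    using sing_val_sq_sums by (intro summable_LIMSEQ_zero) (rule sums_summable)
  then have "(\<lambda>k. sqrt ((sing_val v k)\<^sup>2)) \<longlonglongrightarrow> sqrt 0" by (rule tendsto_real_sqrt)
  then show ?thesis by simp
qed

lemma sing_val_le_norm: "sing_val v k \<le> norm v"
proof -
  have "(sing_val v k)\<^sup>2 \<le> (norm v)\<^sup>2"
    using sing_val_sq_sums[of v] by (intro sums_le[OF _ sums_single[of k "\<lambda>k. (sing_val v k)\<^sup>2"]]) auto
  then show ?thesis by (rule power2_le_imp_le) simp
qed

lemma sing_coeff_sums:
  assumes "\<And>k. \<bar>c k\<bar> \<le> sing_val v k"
  shows "(\<lambda>k. c k *\<^sub>R sing_term v k) sums (\<Sum>k. c k *\<^sub>R sing_term v k)"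
proof (rule summable_sums, rule orthonormal_summable[OF sing_term_orthonormal])
  show "summable (\<lambda>k. (c k)\<^sup>2)"
  proof (rule summable_comparison_test'[where N = 0])
    show "summable (\<lambda>k. (sing_val v k)\<^sup>2)" using sing_val_sq_sums by (rule sums_summable)
    show "norm ((c k)\<^sup>2) \<le> (sing_val v k)\<^sup>2" for k
      using power_mono[OF assms, of k 2] by simp
  qed
qed

text \<open>Expanding in singular vectors, Cauchy--Schwarz separates the coefficients of
  \<open>f\<close> from those of \<open>g\<close>, and Bessel's inequality bounds each of the two
  sums.\<close>

lemma sing_form_bound:
  assumes c: "\<And>k. \<bar>c k\<bar> \<le> s" and x: "(\<lambda>k. c k *\<^sub>R sing_term v k) sums x"
  shows "cmod (cinner (f \<otimes> g) x) \<le> s * norm f * norm g"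
proof -
  have lim: "(\<lambda>n. cmod (cinner (f \<otimes> g) (\<Sum>k<n. c k *\<^sub>R sing_term v k))) \<longlonglongrightarrow> cmod (cinner (f \<otimes> g) x)"
    using x unfolding sums_def
    by (intro tendsto_norm bounded_bilinear.tendsto[OF cinner_bilinear] tendsto_const)
  have s0: "0 \<le> s" using c[of 0] by linarith
  have L2b: "L2_set (\<lambda>k. cmod (cinner h (e k))) {..<n} \<le> norm h"
    if "orthonormal_on UNIV e" for e :: "nat \<Rightarrow> 'x::euclidean_space L2" and h n
  proof -
    have "(\<Sum>k<n. (cmod (cinner h (e k)))\<^sup>2) = (\<Sum>k<n. (cmod (cinner (e k) h))\<^sup>2)"
      by (intro sum.cong refl) (metis cinner_commute complex_mod_cnj)
    also have "\<dots> \<le> (norm h)\<^sup>2"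
      using that by (intro bessel orthonormal_on_subset[OF that]) auto
    finally show ?thesis unfolding L2_set_def by (rule real_le_lsqrt[OF norm_ge_zero])
  qed
  have "cmod (cinner (f \<otimes> g) (\<Sum>k<n. c k *\<^sub>R sing_term v k)) \<le> s * norm f * norm g" for n
  proof -
    have "cmod (cinner (f \<otimes> g) (\<Sum>k<n. c k *\<^sub>R sing_term v k))
        \<le> (\<Sum>k<n. cmod (cinner (f \<otimes> g) (c k *\<^sub>R sing_term v k)))"
      by (simp only: cinner_sum_right norm_sum)
    also have "\<dots> \<le> (\<Sum>k<n. s * (\<bar>cmod (cinner f (left_vec v k))\<bar> * \<bar>cmod (cinner g (right_vec v k))\<bar>))"
      by (intro sum_mono) (simp add: cinner_scaleR_right sing_term_def cinner_tensor norm_mult c mult_right_mono)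
    also have "\<dots> \<le> s * (norm f * norm g)"
      unfolding sum_distrib_left[symmetric]
      by (intro mult_left_mono s0 order_trans[OF L2_set_mult_ineq] mult_mono L2b
          left_vec_orthonormal right_vec_orthonormal) auto
    finally show ?thesis by (simp add: mult_ac)
  qed
  then show ?thesis by (intro LIMSEQ_le_const2[OF lim]) auto
qed

lemma sing_val_form_bound: "cmod (cinner (f \<otimes> g) v) \<le> sigma_max v * norm f * norm g"
  by (rule sing_form_bound[OF _ sing_val_sums]) (simp add: sigma_max_def sing_val_mono)

lemma cinner_sing_term: "cinner (sing_term v k) v = complex_of_real (sing_val v k)"
  by (rule orthonormal_coeff[OF sing_term_orthonormal sing_val_sums])

lemma norm_left_vec [simp]: "norm (left_vec v k) = 1" and norm_right_vec [simp]: "norm (right_vec v k) = 1"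
  using orthonormal_on_norm[OF left_vec_orthonormal] orthonormal_on_norm[OF right_vec_orthonormal] by auto

text \<open>Together with \<open>sing_val_form_bound\<close> this identifies the largest singular
  value as the norm of a sesquilinear form, which can be estimated without touching the selected
  decomposition.\<close>

lemma sigma_max_le:
  assumes "\<And>f g. cmod (cinner (f \<otimes> g) v) \<le> s * norm f * norm g"
  shows "sigma_max v \<le> s"
  using assms[of "left_vec v 0" "right_vec v 0"] cinner_sing_term[of v 0]
  by (simp add: sing_term_def sigma_max_def)

section \<open>Soft and hard thresholding\<close>

lemma soft_sums:
  "0 \<le> \<alpha> \<Longrightarrow> (\<lambda>k. max (sing_val v k - \<alpha>) 0 *\<^sub>R sing_term v k) sums soft_threshold \<alpha> v"
  unfolding soft_threshold_def by (rule sing_coeff_sums) (auto simp: max_def)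

lemma soft_residual_sums:
  assumes "0 \<le> \<alpha>"
  shows "(\<lambda>k. min (sing_val v k) \<alpha> *\<^sub>R sing_term v k) sums (v - soft_threshold \<alpha> v)"
proof -
  have "(\<lambda>k. sing_val v k *\<^sub>R sing_term v k - max (sing_val v k - \<alpha>) 0 *\<^sub>R sing_term v k) sums
      (v - soft_threshold \<alpha> v)"
    by (intro sums_diff sing_val_sums soft_sums assms)
  moreover have "sing_val v k *\<^sub>R sing_term v k - max (sing_val v k - \<alpha>) 0 *\<^sub>R sing_term v k
      = min (sing_val v k) \<alpha> *\<^sub>R sing_term v k" for k
    by (simp add: scaleR_left_diff_distrib[symmetric] min_def max_def)
  ultimately show ?thesis by simp
qed

lemma soft_residual_norm:
  "0 \<le> \<alpha> \<Longrightarrow> (\<lambda>k. (min (sing_val v k) \<alpha>)\<^sup>2) sums (norm (v - soft_threshold \<alpha> v))\<^sup>2"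
  by (rule orthonormal_norm_sums[OF sing_term_orthonormal soft_residual_sums])

lemma ex_sing_val_le: "0 < \<alpha> \<Longrightarrow> \<exists>n. \<forall>k\<ge>n. sing_val v k < \<alpha>"
  using LIMSEQ_D[OF sing_val_tendsto_0[of v]] by fastforce

text \<open>The number \<open>m\<close> is the nuclear norm of the thresholded element. Any soft
  thresholding residual has spectral norm at most \<alpha>, so by duality its pairing is at most
  \<alpha> \<open>m\<close>, and the residual of \<open>v\<close> itself attains this: the
  variational inequality of the proximal map.\<close>

lemma soft_inner_bound:
  assumes "0 < \<alpha>"
  obtains m where
    "inner (soft_threshold \<alpha> v) (v - soft_threshold \<alpha> v) = \<alpha> * m"
    "\<And>w. inner (soft_threshold \<alpha> v) (w - soft_threshold \<alpha> w) \<le> \<alpha> * m"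
proof -
  obtain n where n: "\<And>k. k \<ge> n \<Longrightarrow> sing_val v k < \<alpha>" using ex_sing_val_le[OF assms] by blast
  define c where "c = (\<lambda>k. max (sing_val v k - \<alpha>) 0)"
  have c0: "c k = 0" if "k \<notin> {..<n}" for k using n[of k] that by (simp add: c_def max_def)
  have p: "soft_threshold \<alpha> v = (\<Sum>k<n. c k *\<^sub>R sing_term v k)"
  proof (rule sums_unique2)
    show "(\<lambda>k. c k *\<^sub>R sing_term v k) sums soft_threshold \<alpha> v"
      using soft_sums[of \<alpha> v] assms by (simp add: c_def)
    show "(\<lambda>k. c k *\<^sub>R sing_term v k) sums (\<Sum>k<n. c k *\<^sub>R sing_term v k)"
      by (rule sums_finite) (use c0 in auto)
  qed
  show ?thesis
  proof (rule that[of "\<Sum>k<n. c k"])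
    have "inner (sing_term v k) (v - soft_threshold \<alpha> v) = min (sing_val v k) \<alpha>" for k
      using orthonormal_coeff[OF sing_term_orthonormal soft_residual_sums[of \<alpha> v], of k] assms
      by (simp add: inner_L2_def)
    then have "inner (soft_threshold \<alpha> v) (v - soft_threshold \<alpha> v) = (\<Sum>k<n. c k * min (sing_val v k) \<alpha>)"
      by (subst p) (simp add: inner_sum_left)
    also have "\<dots> = (\<Sum>k<n. \<alpha> * c k)"
      by (intro sum.cong) (auto simp: c_def max_def min_def)
    finally show "inner (soft_threshold \<alpha> v) (v - soft_threshold \<alpha> v) = \<alpha> * (\<Sum>k<n. c k)"
      by (simp add: sum_distrib_left)
    fix w :: "('a \<times> 'b) L2"
    have "inner (sing_term v k) (w - soft_threshold \<alpha> w) \<le> \<alpha>" for k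
    proof -
      have "cmod (cinner (sing_term v k) (w - soft_threshold \<alpha> w)) \<le> \<alpha> * 1 * 1"
        using sing_form_bound[OF _ soft_residual_sums[of \<alpha> w], of \<alpha> "left_vec v k" "right_vec v k"] assms
        by (simp add: sing_term_def min_def)
      then show ?thesis
        using complex_Re_le_cmod[of "cinner (sing_term v k) (w - soft_threshold \<alpha> w)"]
        by (simp add: inner_L2_def)
    qed
    then have "inner (soft_threshold \<alpha> v) (w - soft_threshold \<alpha> w) \<le> (\<Sum>k<n. c k * \<alpha>)"
      by (subst p) (auto simp: inner_sum_left c_def intro!: sum_mono mult_left_mono)
    then show "inner (soft_threshold \<alpha> v) (w - soft_threshold \<alpha> w) \<le> \<alpha> * (\<Sum>k<n. c k)"
      by (simp add: sum_distrib_left mult.commute)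
  qed
qed

lemma soft_threshold_0 [simp]: "soft_threshold 0 v = v"
  using sums_unique2[OF soft_sums[of 0 v, simplified]] sing_val_sums[of v] by simp

text \<open>
  Soft thresholding is the proximal map of \<open>\<alpha>\<close> times the nuclear norm, so \<open>v - soft_threshold \<alpha> v\<close>
  is a monotone function of \<open>soft_threshold \<alpha> v\<close>.
\<close>

theorem soft_threshold_nonexpansive:
  assumes "0 \<le> \<alpha>"
  shows "norm (soft_threshold \<alpha> v - soft_threshold \<alpha> w) \<le> norm (v - w)"
proof (cases "\<alpha> = 0")
  case False
  with assms have \<alpha>: "0 < \<alpha>" by simp
  let ?p = "soft_threshold \<alpha> v" and ?q = "soft_threshold \<alpha> w"
  obtain m where m: "inner ?p (v - ?p) = \<alpha> * m" "inner ?p (w - ?q) \<le> \<alpha> * m"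
    using soft_inner_bound[OF \<alpha>, of v] by metis
  obtain m' where m': "inner ?q (w - ?q) = \<alpha> * m'" "inner ?q (v - ?p) \<le> \<alpha> * m'"
    using soft_inner_bound[OF \<alpha>, of w] by metis
  have "inner (?p - ?q) (v - w) = (norm (?p - ?q))\<^sup>2 + inner (?p - ?q) ((v - ?p) - (w - ?q))"
    unfolding power2_norm_eq_inner by (simp add: inner_diff_left inner_diff_right)
  moreover have "inner (?p - ?q) ((v - ?p) - (w - ?q)) \<ge> 0"
    using m m' unfolding inner_diff_left[of ?p] inner_diff_right[of _ "v - ?p" "w - ?q"] by linarith
  moreover have "inner (?p - ?q) (v - w) \<le> norm (?p - ?q) * norm (v - w)"
    by (rule norm_cauchy_schwarz)
  ultimately have "norm (?p - ?q) * norm (?p - ?q) \<le> norm (?p - ?q) * norm (v - w)"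
    by (simp add: power2_eq_square)
  then show ?thesis
    by (cases "norm (?p - ?q) = 0") auto
qed simp

lemma soft_threshold_eq_0: "sigma_max v \<le> \<alpha> \<Longrightarrow> soft_threshold \<alpha> v = 0"
  unfolding soft_threshold_def sigma_max_def
proof -
  assume "sing_val v 0 \<le> \<alpha>"
  then have "max (sing_val v k - \<alpha>) 0 = 0" for k using sing_val_mono[of 0 k v] by simp
  then show "(\<Sum>k. max (sing_val v k - \<alpha>) 0 *\<^sub>R sing_term v k) = 0" by simp
qed

lemma hard_residual_norm:
  shows "(\<lambda>k. (if sing_val v k > \<alpha> then 0 else sing_val v k)\<^sup>2) sums (norm (v - hard_threshold \<alpha> v))\<^sup>2"
proof (rule orthonormal_norm_sums[OF sing_term_orthonormal])
  have "(\<lambda>k. sing_val v k *\<^sub>R sing_term v k - (if sing_val v k > \<alpha> then sing_val v k else 0) *\<^sub>R sing_term v k) sums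
      (v - hard_threshold \<alpha> v)"
    unfolding hard_threshold_def by (intro sums_diff sing_val_sums sing_coeff_sums) auto
  moreover have "(\<lambda>k. sing_val v k *\<^sub>R sing_term v k - (if sing_val v k > \<alpha> then sing_val v k else 0) *\<^sub>R sing_term v k)
      = (\<lambda>k. (if sing_val v k > \<alpha> then 0 else sing_val v k) *\<^sub>R sing_term v k)"
    by auto
  ultimately show "(\<lambda>k. (if sing_val v k > \<alpha> then 0 else sing_val v k) *\<^sub>R sing_term v k) sums
      (v - hard_threshold \<alpha> v)" by simp
qed

lemma hard_residual_le_soft:
  assumes "0 \<le> \<alpha>"
  shows "norm (v - hard_threshold \<alpha> v) \<le> norm (v - soft_threshold \<alpha> v)"
proof (rule power2_le_imp_le)
  show "(norm (v - hard_threshold \<alpha> v))\<^sup>2 \<le> (norm (v - soft_threshold \<alpha> v))\<^sup>2"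
    by (rule sums_le[OF _ hard_residual_norm soft_residual_norm[OF assms]])
      (use assms in \<open>auto intro!: power_mono\<close>)
qed simp

text \<open>Termwise, min(\<sigma>, \<gamma>) / \<gamma> does not increase with \<gamma>. This
  controls thresholds above the largest admissible one, where the residual may exceed
  \<eta>.\<close>

lemma soft_residual_scale:
  assumes "0 < \<alpha>" "\<alpha> \<le> \<beta>"
  shows "norm (v - soft_threshold \<beta> v) \<le> \<beta> / \<alpha> * norm (v - soft_threshold \<alpha> v)"
proof (rule power2_le_imp_le)
  have S\<alpha>: "(\<lambda>k. (\<beta> / \<alpha>)\<^sup>2 * (min (sing_val v k) \<alpha>)\<^sup>2) sums ((\<beta> / \<alpha>)\<^sup>2 * (norm (v - soft_threshold \<alpha> v))\<^sup>2)"
    using assms by (intro sums_mult soft_residual_norm) auto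
  have S\<beta>: "(\<lambda>k. (min (sing_val v k) \<beta>)\<^sup>2) sums (norm (v - soft_threshold \<beta> v))\<^sup>2"
    using assms by (intro soft_residual_norm) auto
  have "(min (sing_val v k) \<beta>)\<^sup>2 \<le> (\<beta> / \<alpha>)\<^sup>2 * (min (sing_val v k) \<alpha>)\<^sup>2" for k
  proof -
    have "min (sing_val v k) \<beta> \<le> \<beta> / \<alpha> * min (sing_val v k) \<alpha>"
      using assms sing_val_nonneg[of v k] mult_right_mono[OF assms(2) sing_val_nonneg[of v k]]
      by (auto simp: min_def field_simps)
    then have "(min (sing_val v k) \<beta>)\<^sup>2 \<le> (\<beta> / \<alpha> * min (sing_val v k) \<alpha>)\<^sup>2"
      using assms by (intro power_mono) auto
    then show ?thesis by (simp only: power_mult_distrib)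
  qed
  then have "(norm (v - soft_threshold \<beta> v))\<^sup>2 \<le> (\<beta> / \<alpha>)\<^sup>2 * (norm (v - soft_threshold \<alpha> v))\<^sup>2"
    using S\<beta> S\<alpha> by (rule sums_le)
  then show "(norm (v - soft_threshold \<beta> v))\<^sup>2 \<le> (\<beta> / \<alpha> * norm (v - soft_threshold \<alpha> v))\<^sup>2"
    by (simp only: power_mult_distrib)
qed (use assms in simp)

lemma soft_residual_mono:
  assumes "0 \<le> \<alpha>" "\<alpha> \<le> \<beta>"
  shows "norm (v - soft_threshold \<alpha> v) \<le> norm (v - soft_threshold \<beta> v)"
proof (rule power2_le_imp_le)
  show "(norm (v - soft_threshold \<alpha> v))\<^sup>2 \<le> (norm (v - soft_threshold \<beta> v))\<^sup>2"
    by (rule sums_le[OF _ soft_residual_norm soft_residual_norm])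
      (use assms in \<open>auto intro!: power_mono\<close>)
qed simp

text \<open>Each singular value above \<alpha> contributes \<alpha>^2 to the squared residual. This
  is the origin of r_n = \<eta>^2 / \<alpha>_n^2 as a rank.\<close>

lemma card_sing_val_gt:
  assumes "0 < \<alpha>" "norm (v - soft_threshold \<alpha> v) \<le> \<eta>"
  shows "finite {k. sing_val v k > \<alpha>}" "real (card {k. sing_val v k > \<alpha>}) \<le> \<eta>\<^sup>2 / \<alpha>\<^sup>2"
proof -
  obtain n where n: "\<And>k. k \<ge> n \<Longrightarrow> sing_val v k < \<alpha>" using ex_sing_val_le[OF assms(1)] by blast
  then have "{k. sing_val v k > \<alpha>} \<subseteq> {..<n}" by (auto simp: not_less[symmetric] dest: less_asym)
  then show fin: "finite {k. sing_val v k > \<alpha>}" using finite_subset by blast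
  have "real (card {k. sing_val v k > \<alpha>}) * \<alpha>\<^sup>2 = (\<Sum>k\<in>{k. sing_val v k > \<alpha>}. (min (sing_val v k) \<alpha>)\<^sup>2)"
    using assms(1) by simp
  also have "\<dots> \<le> (norm (v - soft_threshold \<alpha> v))\<^sup>2"
    unfolding sums_unique[OF soft_residual_norm[OF less_imp_le[OF assms(1)], of v]]
    by (rule sum_le_suminf[OF sums_summable[OF soft_residual_norm[OF less_imp_le[OF assms(1)]]] fin]) simp
  also have "\<dots> \<le> \<eta>\<^sup>2" using assms by (intro power_mono) auto
  finally show "real (card {k. sing_val v k > \<alpha>}) \<le> \<eta>\<^sup>2 / \<alpha>\<^sup>2"
    using assms(1) by (simp add: field_simps)
qed

text \<open>A decomposition-free form of the rank; the agreement with the count of nonzero singular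
  values is \<open>rank_L2_le_if\<close> and \<open>tensor_rank_le_if_rank\<close>.\<close>

fun tensor_rank_le :: "nat \<Rightarrow> ('a::euclidean_space \<times> 'b::euclidean_space) L2 \<Rightarrow> bool" where
  "tensor_rank_le 0 x \<longleftrightarrow> x = 0"
| "tensor_rank_le (Suc p) x \<longleftrightarrow> (\<exists>y f g. tensor_rank_le p y \<and> x = y + f \<otimes> g)"

lemma tensor_rank_le_Suc: "tensor_rank_le p x \<Longrightarrow> tensor_rank_le (Suc p) x"
  unfolding tensor_rank_le.simps(2) by (intro exI[of _ x] exI[of _ 0]) simp

lemma tensor_rank_le_mono: "tensor_rank_le p x \<Longrightarrow> p \<le> q \<Longrightarrow> tensor_rank_le q x"
  by (induction q) (auto simp: le_Suc_eq simp del: tensor_rank_le.simps(2) intro: tensor_rank_le_Suc)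

lemma tensor_rank_le_0 [simp]: "tensor_rank_le p 0"
  by (rule tensor_rank_le_mono[of 0]) auto

lemma tensor_rank_le_add: "tensor_rank_le p x \<Longrightarrow> tensor_rank_le q y \<Longrightarrow> tensor_rank_le (p + q) (x + y)"
proof (induction q arbitrary: y)
  case (Suc q)
  then obtain y' f g where "tensor_rank_le q y'" "y = y' + f \<otimes> g" by auto
  with Suc show ?case by (auto intro!: exI[of _ "x + y'"] exI[of _ f] exI[of _ g] simp: add.assoc)
qed simp

lemma tensor_rank_le_linear:
  assumes add: "\<And>x y. F (x + y) = F x + F y" and tensor: "\<And>f g. \<exists>f' g'. F (f \<otimes> g) = f' \<otimes> g'"
  shows "tensor_rank_le p x \<Longrightarrow> tensor_rank_le p (F x)"
proof (induction p arbitrary: x)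
  case 0
  have "F 0 = 0" using add[of 0 0] by simp
  with 0 show ?case by simp
next
  case (Suc p)
  then obtain y f g where "tensor_rank_le p y" "x = y + f \<otimes> g" by auto
  moreover obtain f' g' where "F (f \<otimes> g) = f' \<otimes> g'" using tensor by blast
  ultimately show ?case using Suc.IH by (auto simp: add)
qed

lemma tensor_rank_le_scaleC: "tensor_rank_le p x \<Longrightarrow> tensor_rank_le p (c *\<^sub>C x)"
  by (erule tensor_rank_le_linear[rotated -1]) (auto simp: scaleC_add_right tensor_scaleC_left[symmetric])

lemma tensor_rank_le_sum:
  assumes "finite I" "\<And>i. i \<in> I \<Longrightarrow> tensor_rank_le (p i) (x i)"
  shows "tensor_rank_le (\<Sum>i\<in>I. p i) (\<Sum>i\<in>I. x i)"
  using assms by (induction I rule: finite_induct) (auto intro: tensor_rank_le_add)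

lemma tensor_rank_le_single: "tensor_rank_le 1 (f \<otimes> g)"
  by (simp add: exI[of _ f] exI[of _ g])

lemma tensor_rank_le_sing_sum: "finite I \<Longrightarrow> tensor_rank_le (card I) (\<Sum>k\<in>I. c k *\<^sub>R sing_term v k)"
proof -
  have "tensor_rank_le 1 (c k *\<^sub>R sing_term v k)" for k
    unfolding sing_term_def tensor_scaleR_left[symmetric] by (rule tensor_rank_le_single)
  moreover assume "finite I"
  ultimately have "tensor_rank_le (\<Sum>k\<in>I. 1) (\<Sum>k\<in>I. c k *\<^sub>R sing_term v k)"
    by (intro tensor_rank_le_sum)
  then show ?thesis by simp
qed

text \<open>Gram--Schmidt on the left factors: the part of a new left factor inside the old span is
  moved into the right factors already present.\<close>

lemma tensor_rank_le_orthonormal: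
  "tensor_rank_le p x \<Longrightarrow> \<exists>d\<le>p. \<exists>q g. orthonormal_on {..<d} q \<and> x = (\<Sum>l<d. q l \<otimes> g l)"
proof (induction p arbitrary: x)
  case 0
  then show ?case by (auto simp: orthonormal_on_def)
next
  case (Suc p)
  then obtain y f h where "tensor_rank_le p y" and x: "x = y + f \<otimes> h" by auto
  from Suc.IH[OF this(1)] obtain d q g where d: "d \<le> p" and q: "orthonormal_on {..<d} q"
    and y: "y = (\<Sum>l<d. q l \<otimes> g l)" by blast
  define r where "r = f - (\<Sum>l<d. cinner (q l) f *\<^sub>C q l)"
  have r: "cinner (q l) r = 0" if "l < d" for l
    using orthonormal_residual[OF finite_lessThan q, of l f] that by (simp add: r_def)
  have x': "x = (\<Sum>l<d. q l \<otimes> (g l + cinner (q l) f *\<^sub>C h)) + r \<otimes> h"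
    by (simp add: x y r_def tensor_diff_left tensor_sum_left tensor_add_right sum.distrib
        tensor_scaleC_left tensor_scaleC_right)
  show ?case
  proof (cases "r = 0")
    case True
    then show ?thesis using d q x'
      by (intro exI[of _ d] conjI exI[of _ q] exI[of _ "\<lambda>l. g l + cinner (q l) f *\<^sub>C h"]) auto
  next
    case False
    define q' where "q' = q(d := inverse (norm r) *\<^sub>R r)"
    define g' where "g' = (\<lambda>l. g l + cinner (q l) f *\<^sub>C h)(d := norm r *\<^sub>R h)"
    have "cinner r (q l) = 0" if "l < d" for l using r[OF that] cinner_commute[of r "q l"] by simp
    moreover have "cinner (inverse (norm r) *\<^sub>R r) (inverse (norm r) *\<^sub>R r) = 1"
      using False cinner_self[of "inverse (norm r) *\<^sub>R r"] by simp
    ultimately have "orthonormal_on {..<Suc d} q'"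
      using q r by (auto simp: orthonormal_on_def q'_def less_Suc_eq cinner_scaleR_left cinner_scaleR_right)
    moreover have "x = (\<Sum>l<Suc d. q' l \<otimes> g' l)"
      using False by (simp add: x' q'_def g'_def tensor_scaleR_left tensor_scaleR_right)
    ultimately show ?thesis using d by (intro exI[of _ "Suc d"] conjI exI[of _ q'] exI[of _ g']) auto
  qed
qed

text \<open>
  Eckart--Young: with \<open>Q\<close> the projection onto the span of the left factors of \<open>x\<close>, testing \<open>v - x\<close>
  against \<open>\<Sum>k<n. \<sigma>\<^sub>k (1 - Q) a\<^sub>k \<otimes> b\<^sub>k\<close>, which is orthogonal to \<open>x\<close>, suffices.
\<close>

lemma eckart_young_finite:
  assumes "tensor_rank_le p x"
  shows "(\<Sum>k=p..<n. (sing_val v k)\<^sup>2) \<le> (norm (v - x))\<^sup>2"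
proof (cases "p \<le> n")
  case pn: True
  obtain d q g where d: "d \<le> p" and q: "orthonormal_on {..<d} q" and x: "x = (\<Sum>l<d. q l \<otimes> g l)"
    using tensor_rank_le_orthonormal[OF assms] by blast
  define a b where "a = left_vec v" "b = right_vec v"
  define \<sigma> where "\<sigma> = sing_val v"
  have a: "orthonormal_on UNIV a" and b: "orthonormal_on UNIV b"
    by (simp_all add: a_b_def left_vec_orthonormal right_vec_orthonormal)
  define y where "y = (\<lambda>k. a k - (\<Sum>l<d. cinner (q l) (a k) *\<^sub>C q l))"
  \<comment> \<open>\<open>W k\<close> is the squared length of the projection of \<open>a k\<close>
    onto the left factors of \<open>x\<close>. These weights lie between 0 and 1, and by Bessel's
    inequality they sum to at most \<open>d\<close>.\<close>
  define W where "W = (\<lambda>k. \<Sum>l<d. (cmod (cinner (q l) (a k)))\<^sup>2)"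
  define Y where "Y = (\<Sum>k<n. \<sigma> k *\<^sub>R (y k \<otimes> b k))"
  have yn: "(norm (y k))\<^sup>2 = 1 - W k" for k
    using norm_orthonormal_residual[OF finite_lessThan q, of "a k"] orthonormal_on_norm[OF a, of k]
    by (simp add: y_def W_def)
  have "cinner (q l) (y k) = 0" if "l < d" for l k
    using orthonormal_residual[OF finite_lessThan q, of l "a k"] that by (simp add: y_def)
  then have yq: "cinner (y k) (q l) = 0" if "l < d" for l k
    using cinner_commute[of "y k" "q l"] that by simp
  have ya: "cinner (y k) (a k) = complex_of_real ((norm (y k))\<^sup>2)" for k
  proof -
    have "a k = y k + (\<Sum>l<d. cinner (q l) (a k) *\<^sub>C q l)" by (simp add: y_def)
    then have "cinner (y k) (a k) = cinner (y k) (y k) + (\<Sum>l<d. cinner (q l) (a k) * cinner (y k) (q l))"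
      by (metis (no_types, lifting) cinner_add_right cinner_scaleC_right cinner_sum_right sum.cong)
    then show ?thesis using yq by (simp add: cinner_self)
  qed
  have Yx: "cinner Y x = 0"
    using yq by (simp add: Y_def x cinner_sum_left cinner_sum_right cinner_scaleR_left cinner_tensor)
  have Yv: "cinner Y v = complex_of_real (\<Sum>k<n. (\<sigma> k)\<^sup>2 * (norm (y k))\<^sup>2)"
  proof -
    have "cinner (y k \<otimes> b k) v = complex_of_real (\<sigma> k) * cinner (y k) (a k)" for k
    proof -
      have "(\<lambda>j. cinner (y k \<otimes> b k) (\<sigma> j *\<^sub>R sing_term v j)) sums cinner (y k \<otimes> b k) v"
        unfolding \<sigma>_def
        by (rule bounded_linear.sums[OF bounded_bilinear.bounded_linear_right[OF cinner_bilinear] sing_val_sums])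
      moreover have "(\<lambda>j. cinner (y k \<otimes> b k) (\<sigma> j *\<^sub>R sing_term v j))
          = (\<lambda>j. if j = k then complex_of_real (\<sigma> k) * cinner (y k) (a k) else 0)"
        using b by (auto simp: orthonormal_on_def cinner_scaleR_right sing_term_def cinner_tensor
            a_b_def[symmetric] fun_eq_iff)
      ultimately show ?thesis
        using sums_single[of k "\<lambda>_. complex_of_real (\<sigma> k) * cinner (y k) (a k)"] sums_unique2 by fastforce
    qed
    then show ?thesis
      by (simp add: Y_def cinner_sum_left cinner_scaleR_left ya power2_eq_square mult_ac)
  qed
  have YY: "(norm Y)\<^sup>2 = (\<Sum>k<n. (\<sigma> k)\<^sup>2 * (norm (y k))\<^sup>2)"
  proof -
    have "cinner Y Y = (\<Sum>k<n. \<Sum>j<n. complex_of_real (\<sigma> k * \<sigma> j) * (cinner (y k) (y j) * cinner (b k) (b j)))"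
      by (simp add: Y_def cinner_sum_left cinner_sum_right cinner_scaleR_left cinner_scaleR_right
          cinner_tensor mult_ac sum_distrib_left)
        (subst sum.swap, simp add: mult_ac)
    also have "\<dots> = (\<Sum>k<n. \<Sum>j<n. if j = k then complex_of_real ((\<sigma> k)\<^sup>2 * (norm (y k))\<^sup>2) else 0)"
      using b by (intro sum.cong) (auto simp: orthonormal_on_def cinner_self power2_eq_square)
    also have "\<dots> = complex_of_real (\<Sum>k<n. (\<sigma> k)\<^sup>2 * (norm (y k))\<^sup>2)"
      by (simp cong: if_cong)
    finally show ?thesis by (simp only: cinner_self of_real_eq_iff)
  qed
  have "(norm Y)\<^sup>2 = Re (cinner Y (v - x))" by (simp add: cinner_diff_right Yx Yv YY)
  also have "\<dots> \<le> norm Y * norm (v - x)"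
    using complex_Re_le_cmod cinner_cauchy_schwarz order_trans by blast
  finally have "norm Y \<le> norm (v - x)"
    by (cases "norm Y = 0") (auto simp: power2_eq_square)
  then have "(\<Sum>k<n. (\<sigma> k)\<^sup>2 * (1 - W k)) \<le> (norm (v - x))\<^sup>2"
    using YY power_mono[of "norm Y" "norm (v - x)" 2] by (simp add: yn)
  \<comment> \<open>Rearrangement: weights in [0, 1] of total at most p can remove from a decreasing
    sequence no more than its first p terms.\<close>
  moreover have "(\<Sum>k=p..<n. (\<sigma> k)\<^sup>2) \<le> (\<Sum>k<n. (\<sigma> k)\<^sup>2 * (1 - W k))"
  proof -
    have W0: "0 \<le> W k" "W k \<le> 1" for k
      using yn[of k] zero_le_power2[of "norm (y k)"] by (auto simp: W_def sum_nonneg simp del: zero_le_power2)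
    have "(\<Sum>k<n. W k) = (\<Sum>l<d. \<Sum>k<n. (cmod (cinner (a k) (q l)))\<^sup>2)"
      unfolding W_def by (subst sum.swap) (simp add: cinner_commute[of "a _"])
    also have "\<dots> \<le> (\<Sum>l<d. (norm (q l))\<^sup>2)"
      by (intro sum_mono bessel orthonormal_on_subset[OF a]) auto
    also have "\<dots> \<le> real p" using orthonormal_on_norm[OF q] d by simp
    finally have Wp: "(\<Sum>k<n. W k) \<le> real p" .
    have mono: "(\<sigma> j)\<^sup>2 \<le> (\<sigma> k)\<^sup>2" if "k \<le> j" for j k
      unfolding \<sigma>_def by (intro power_mono sing_val_mono that) simp
    have "(\<Sum>k<n. (\<sigma> k)\<^sup>2 * W k) = (\<Sum>k<p. (\<sigma> k)\<^sup>2 * W k) + (\<Sum>k=p..<n. (\<sigma> k)\<^sup>2 * W k)"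
      using pn by (simp add: lessThan_atLeast0 sum.atLeastLessThan_concat)
    also have "\<dots> \<le> (\<Sum>k<p. (\<sigma> k)\<^sup>2 * W k) + (\<Sum>k=p..<n. (\<sigma> p)\<^sup>2 * W k)"
      using W0 mono by (intro add_left_mono sum_mono mult_right_mono) auto
    also have "(\<Sum>k=p..<n. (\<sigma> p)\<^sup>2 * W k) \<le> (\<sigma> p)\<^sup>2 * (\<Sum>k<p. 1 - W k)"
    proof -
      have "(\<Sum>k<n. W k) = (\<Sum>k<p. W k) + (\<Sum>k=p..<n. W k)"
        using pn by (simp add: lessThan_atLeast0 sum.atLeastLessThan_concat)
      then have "(\<Sum>k=p..<n. W k) \<le> (\<Sum>k<p. 1 - W k)" using Wp by (simp add: sum_subtractf)
      then show ?thesis by (simp add: sum_distrib_left[symmetric] mult_left_mono)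
    qed
    also have "(\<sigma> p)\<^sup>2 * (\<Sum>k<p. 1 - W k) \<le> (\<Sum>k<p. (\<sigma> k)\<^sup>2 * (1 - W k))"
      unfolding sum_distrib_left using W0 mono by (intro sum_mono mult_right_mono) auto
    finally have "(\<Sum>k<n. (\<sigma> k)\<^sup>2 * W k) \<le> (\<Sum>k<p. (\<sigma> k)\<^sup>2)"
      by (simp add: sum.distrib[symmetric] algebra_simps)
    moreover have "(\<Sum>k<n. (\<sigma> k)\<^sup>2) = (\<Sum>k<p. (\<sigma> k)\<^sup>2) + (\<Sum>k=p..<n. (\<sigma> k)\<^sup>2)"
      using pn by (simp add: lessThan_atLeast0 sum.atLeastLessThan_concat)
    ultimately show ?thesis by (simp add: algebra_simps sum_subtractf)
  qed
  ultimately show ?thesis by (simp add: \<sigma>_def)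
qed simp

definition tail_sq :: "('a::euclidean_space \<times> 'b::euclidean_space) L2 \<Rightarrow> nat \<Rightarrow> real" where
  "tail_sq v p = (\<Sum>k. (sing_val v (k + p))\<^sup>2)"

lemma tail_summable: "summable (\<lambda>k. (sing_val v (k + p))\<^sup>2)"
  using sums_summable[OF sing_val_sq_sums[of v]] by (rule summable_ignore_initial_segment)

theorem eckart_young: "tensor_rank_le p x \<Longrightarrow> tail_sq v p \<le> (norm (v - x))\<^sup>2"
  unfolding tail_sq_def
proof (rule suminf_le_const[OF tail_summable])
  fix n assume "tensor_rank_le p x"
  from eckart_young_finite[OF this, where n = "n + p" and v = v]
  show "(\<Sum>k<n. (sing_val v (k + p))\<^sup>2) \<le> (norm (v - x))\<^sup>2"
    using sum.shift_bounds_nat_ivl[of "\<lambda>k. (sing_val v k)\<^sup>2" 0 p n]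
    by (simp add: lessThan_atLeast0)
qed

lemma sing_val_eq_0_if_rank:
  assumes "tensor_rank_le p v" "p \<le> k"
  shows "sing_val v k = 0"
proof -
  have "tail_sq v p \<le> 0" using eckart_young[OF assms(1), of v] by simp
  moreover have "(sing_val v ((k - p) + p))\<^sup>2 \<le> tail_sq v p"
    using sum_le_suminf[OF tail_summable[of v p], of "{k - p}"] by (simp add: tail_sq_def)
  ultimately have "(sing_val v ((k - p) + p))\<^sup>2 \<le> 0" by linarith
  then show ?thesis using assms by simp
qed

lemma rank_L2_le_if: "tensor_rank_le p v \<Longrightarrow> rank_L2 v \<le> enat p"
proof -
  assume "tensor_rank_le p v"
  then have *: "{k. sing_val v k \<noteq> 0} \<subseteq> {..<p}" using sing_val_eq_0_if_rank not_less by fastforce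
  from finite_subset[OF this] card_mono[OF _ this] show ?thesis by (simp add: rank_L2_def)
qed

lemma tensor_rank_le_if_rank: "rank_L2 v \<le> enat p \<Longrightarrow> tensor_rank_le p v"
proof -
  assume *: "rank_L2 v \<le> enat p"
  then have fin: "finite {k. sing_val v k \<noteq> 0}" and le: "card {k. sing_val v k \<noteq> 0} \<le> p"
    by (auto simp: rank_L2_def split: if_splits)
  have "v = (\<Sum>k\<in>{k. sing_val v k \<noteq> 0}. sing_val v k *\<^sub>R sing_term v k)"
    by (rule sums_unique2[OF sing_val_sums sums_finite[OF fin]]) simp
  moreover have "tensor_rank_le p (\<Sum>k\<in>{k. sing_val v k \<noteq> 0}. sing_val v k *\<^sub>R sing_term v k)"
    using tensor_rank_le_sing_sum[OF fin] le by (rule tensor_rank_le_mono)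
  ultimately show ?thesis by simp
qed

lemma coeff_tensor_rank:
  assumes "finite {k. c k \<noteq> 0}" "(\<lambda>k. c k *\<^sub>R sing_term v k) sums x"
  shows "tensor_rank_le (card {k. c k \<noteq> 0}) x"
proof -
  have "x = (\<Sum>k\<in>{k. c k \<noteq> 0}. c k *\<^sub>R sing_term v k)"
    by (rule sums_unique2[OF assms(2) sums_finite[OF assms(1)]]) simp
  then show ?thesis using tensor_rank_le_sing_sum[OF assms(1), of c v] by (simp only:)
qed

lemma soft_threshold_rank:
  assumes "0 < \<alpha>"
  shows "tensor_rank_le (card {k. sing_val v k > \<alpha>}) (soft_threshold \<alpha> v)"
proof -
  have "{k. max (sing_val v k - \<alpha>) 0 \<noteq> 0} = {k. sing_val v k > \<alpha>}" by (auto simp: max_def)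
  then show ?thesis
    using coeff_tensor_rank[OF _ soft_sums[OF less_imp_le[OF assms], of v]]
      card_sing_val_gt(1)[OF assms order_refl, of v] by (simp only:)
qed

lemma hard_threshold_rank:
  assumes "0 < \<alpha>"
  shows "tensor_rank_le (card {k. sing_val v k > \<alpha>}) (hard_threshold \<alpha> v)"
proof -
  let ?c = "\<lambda>k. if sing_val v k > \<alpha> then sing_val v k else 0"
  have "{k. ?c k \<noteq> 0} = {k. sing_val v k > \<alpha>}" using assms by auto
  moreover have "(\<lambda>k. ?c k *\<^sub>R sing_term v k) sums hard_threshold \<alpha> v"
    unfolding hard_threshold_def by (rule sing_coeff_sums) auto
  ultimately show ?thesis
    using coeff_tensor_rank[of ?c v "hard_threshold \<alpha> v"] card_sing_val_gt(1)[OF assms order_refl, of v]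
    by (simp only:)
qed

text \<open>Beyond the first p indices, every singular value above \<beta> adds \<beta>^2 to a tail
  that Eckart--Young bounds by M^2.\<close>

lemma card_sing_val_gt_perturb:
  assumes "tensor_rank_le p x" "0 < \<beta>" "norm (w - x) \<le> M"
  shows "real (card {k. sing_val w k > \<beta>}) \<le> real p + M\<^sup>2 / \<beta>\<^sup>2"
proof -
  let ?S = "{k. sing_val w k > \<beta>}"
  have fin: "finite ?S" using card_sing_val_gt(1)[OF assms(2) order_refl] .
  let ?I = "(\<lambda>k. k - p) ` (?S - {..<p})"
  have inj: "inj_on (\<lambda>k. k - p) (?S - {..<p})" by (auto simp: inj_on_def)
  have "real (card (?S - {..<p})) * \<beta>\<^sup>2 = (\<Sum>k\<in>?S - {..<p}. \<beta>\<^sup>2)" by simp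
  also have "\<dots> \<le> (\<Sum>k\<in>?S - {..<p}. (sing_val w (k - p + p))\<^sup>2)"
    using assms(2) by (intro sum_mono power_mono) auto
  also have "\<dots> = (\<Sum>k\<in>?I. (sing_val w (k + p))\<^sup>2)"
    by (subst sum.reindex[OF inj]) simp
  also have "\<dots> \<le> tail_sq w p"
    unfolding tail_sq_def using fin by (intro sum_le_suminf tail_summable) auto
  also have "\<dots> \<le> (norm (w - x))\<^sup>2" by (rule eckart_young[OF assms(1)])
  also have "\<dots> \<le> M\<^sup>2" using assms by (intro power_mono) auto
  finally have "real (card (?S - {..<p})) \<le> M\<^sup>2 / \<beta>\<^sup>2"
    using assms(2) by (simp add: field_simps)
  moreover have "card ?S \<le> card (?S - {..<p}) + card {..<p}"
    using fin by (intro order_trans[OF card_mono card_Un_le]) auto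
  ultimately show ?thesis by simp
qed

section \<open>Recompression\<close>

lemma tail_sq_tendsto_0: "tail_sq v \<longlonglongrightarrow> 0"
proof -
  have "tail_sq v = (\<lambda>p. (norm v)\<^sup>2 - (\<Sum>k<p. (sing_val v k)\<^sup>2))"
    using suminf_minus_initial_segment[OF sums_summable[OF sing_val_sq_sums[of v]]]
      sums_unique[OF sing_val_sq_sums[of v]] by (auto simp: tail_sq_def)
  moreover have "(\<lambda>p. (norm v)\<^sup>2 - (\<Sum>k<p. (sing_val v k)\<^sup>2)) \<longlonglongrightarrow> (norm v)\<^sup>2 - (norm v)\<^sup>2"
    using sing_val_sq_sums[of v] unfolding sums_def by (intro tendsto_intros)
  ultimately show ?thesis by simp
qed

lemma recompress_props:
  assumes "0 < \<delta>"
  obtains r where "tensor_rank_le r (recompress \<delta> v)" "norm (v - recompress \<delta> v) \<le> \<delta>"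
    "\<And>q. tail_sq v q \<le> \<delta>\<^sup>2 \<Longrightarrow> r \<le> q" "recompress \<delta> v = (\<Sum>k<r. sing_val v k *\<^sub>R sing_term v k)"
proof -
  define r where "r = (LEAST r. tail_sq v r \<le> \<delta>\<^sup>2)"
  have "0 < \<delta>\<^sup>2" using assms by simp
  from LIMSEQ_D[OF tail_sq_tendsto_0 this, of v] obtain q where "tail_sq v q \<le> \<delta>\<^sup>2"
    by (auto simp: abs_less_iff dest: less_imp_le)
  then have r: "tail_sq v r \<le> \<delta>\<^sup>2" "\<And>q. tail_sq v q \<le> \<delta>\<^sup>2 \<Longrightarrow> r \<le> q"
    unfolding r_def by (auto intro: LeastI Least_le)
  have rec: "recompress \<delta> v = (\<Sum>k<r. sing_val v k *\<^sub>R sing_term v k)"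
    by (simp add: recompress_def r_def tail_sq_def)
  have "(\<lambda>k. if k < r then sing_val v k *\<^sub>R sing_term v k else 0) sums recompress \<delta> v"
    unfolding rec using sums_If_finite_set[of "{..<r}" "\<lambda>k. sing_val v k *\<^sub>R sing_term v k"] by simp
  from sums_diff[OF sing_val_sums this]
  have "(\<lambda>k. (if k < r then 0 else sing_val v k) *\<^sub>R sing_term v k) sums (v - recompress \<delta> v)"
    by (rule sums_cong[THEN iffD1, rotated]) auto
  from orthonormal_norm_sums[OF sing_term_orthonormal this]
  have "(\<lambda>k. (if k < r then 0 else sing_val v k)\<^sup>2) sums (norm (v - recompress \<delta> v))\<^sup>2" .
  from sums_split_initial_segment[OF this, of r]
  have "(\<lambda>k. (sing_val v (k + r))\<^sup>2) sums (norm (v - recompress \<delta> v))\<^sup>2" by simp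
  then have "(norm (v - recompress \<delta> v))\<^sup>2 \<le> \<delta>\<^sup>2"
    using r(1) sums_unique by (fastforce simp: tail_sq_def)
  then have "norm (v - recompress \<delta> v) \<le> \<delta>" using assms by (auto intro: power2_le_imp_le)
  with that[of r] r rec tensor_rank_le_sing_sum[of "{..<r}" "sing_val v" v] show ?thesis by simp
qed

text \<open>
  The tail of \<open>v\<close> beyond \<open>p\<close> consists of \<open>P - p\<close> squared singular values in decreasing order, so
  keeping \<open>c\<close> of them leaves at most the fraction \<open>(P - p - c) / (P - p)\<close> of it.
\<close>

lemma tail_sq_fraction:
  assumes "tensor_rank_le (p + Q) v" "c \<le> Q"
  shows "real Q * tail_sq v (p + c) \<le> real (Q - c) * tail_sq v p"
proof -
  define s where "s = (\<lambda>k. (sing_val v (k + p))\<^sup>2)"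
  have mono: "s j \<le> s i" if "i \<le> j" for i j
    unfolding s_def using that by (intro power_mono sing_val_mono) auto
  have s0: "s k = 0" if "Q \<le> k" for k using sing_val_eq_0_if_rank[OF assms(1)] that by (simp add: s_def)
  have tail: "tail_sq v (p + c) = (\<Sum>k=c..<Q. s k)" if "c \<le> Q" for c
  proof -
    have "(\<lambda>k. s (k + c)) sums (\<Sum>k<Q - c. s (k + c))"
      by (rule sums_finite) (use s0 in auto)
    then have "tail_sq v (p + c) = (\<Sum>k<Q - c. s (k + c))"
      using sums_unique by (fastforce simp: tail_sq_def s_def add_ac)
    also have "\<dots> = (\<Sum>k=c..<Q. s k)"
      using sum.shift_bounds_nat_ivl[of s 0 c "Q - c"] that by (simp add: lessThan_atLeast0)
    finally show ?thesis .
  qed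
  define H T where "H = (\<Sum>k<c. s k)" and "T = (\<Sum>k=c..<Q. s k)"
  have HT: "tail_sq v p = H + T" using tail[of 0] assms(2)
    by (simp add: H_def T_def lessThan_atLeast0 sum.atLeastLessThan_concat)
  have "T \<le> (\<Sum>k=c..<Q. s c)" unfolding T_def by (intro sum_mono mono) auto
  then have T: "T \<le> real (Q - c) * s c" by simp
  have "(\<Sum>k<c. s c) \<le> H" unfolding H_def by (intro sum_mono mono) auto
  then have H: "real c * s c \<le> H" by simp
  have "real c * T \<le> real c * (real (Q - c) * s c)" by (intro mult_left_mono T) simp
  also have "\<dots> \<le> real (Q - c) * H" using mult_left_mono[OF H, of "real (Q - c)"] by (simp add: mult_ac)
  finally show ?thesis
    using assms(2) tail[OF assms(2)] HT by (simp add: T_def[symmetric] of_nat_diff algebra_simps)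
qed

text \<open>The tail beyond p is at most M^2 by Eckart--Young. Keeping the fraction 1 - \<delta>^2 /
  M^2 of the excess singular values, the largest ones, leaves at most \<delta>^2; the summand 1 pays
  for rounding their number up.\<close>

lemma recompress_rank:
  assumes P: "tensor_rank_le P v" and x: "tensor_rank_le p x" "norm (v - x) \<le> M" and \<delta>: "0 < \<delta>" "\<delta> \<le> M"
  obtains r where "tensor_rank_le r (recompress \<delta> v)"
    "real r \<le> max (real p) (real p + 1 + (1 - \<delta>\<^sup>2 / M\<^sup>2) * (real P - real p))"
proof -
  obtain r where r: "tensor_rank_le r (recompress \<delta> v)" "\<And>q. tail_sq v q \<le> \<delta>\<^sup>2 \<Longrightarrow> r \<le> q"
    using recompress_props[OF \<delta>(1), of v] by metis
  have "real r \<le> max (real p) (real p + 1 + (1 - \<delta>\<^sup>2 / M\<^sup>2) * (real P - real p))"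
  proof (cases "P \<le> p")
    case True
    have "tail_sq v p \<le> 0" using eckart_young[OF tensor_rank_le_mono[OF P True], of v] by simp
    then have "r \<le> p" using \<delta> by (intro r(2)) (auto intro: order_trans)
    then show ?thesis by simp
  next
    case False
    define Q where "Q = P - p"
    have M: "0 < M" using \<delta> by simp
    have frac: "0 \<le> 1 - \<delta>\<^sup>2 / M\<^sup>2" "1 - \<delta>\<^sup>2 / M\<^sup>2 \<le> 1"
      using \<delta> M power_mono[OF \<delta>(2), of 2] by (auto simp: field_simps)
    define c where "c = nat \<lceil>(1 - \<delta>\<^sup>2 / M\<^sup>2) * real Q\<rceil>"
    have c: "(1 - \<delta>\<^sup>2 / M\<^sup>2) * real Q \<le> real c" "real c \<le> 1 + (1 - \<delta>\<^sup>2 / M\<^sup>2) * real Q"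
    proof -
      have "0 \<le> (1 - \<delta>\<^sup>2 / M\<^sup>2) * real Q" using frac by simp
      then show "(1 - \<delta>\<^sup>2 / M\<^sup>2) * real Q \<le> real c" "real c \<le> 1 + (1 - \<delta>\<^sup>2 / M\<^sup>2) * real Q"
        unfolding c_def by linarith+
    qed
    have cQ: "c \<le> Q"
    proof -
      have "(1 - \<delta>\<^sup>2 / M\<^sup>2) * real Q \<le> 1 * real Q" using frac by (intro mult_right_mono) auto
      then show ?thesis unfolding c_def by (simp add: nat_le_iff ceiling_le_iff)
    qed
    have tM: "tail_sq v p \<le> M\<^sup>2"
      using eckart_young[OF x(1), of v] power_mono[OF x(2), of 2] by simp
    have "real Q * tail_sq v (p + c) \<le> real (Q - c) * tail_sq v p"
      using tail_sq_fraction[of p Q v c] P False cQ by (simp add: Q_def)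
    also have "\<dots> \<le> (real Q * (\<delta>\<^sup>2 / M\<^sup>2)) * M\<^sup>2"
    proof (rule mult_mono[OF _ tM])
      show "real (Q - c) \<le> real Q * (\<delta>\<^sup>2 / M\<^sup>2)"
        using c(1) cQ by (simp add: of_nat_diff algebra_simps)
      show "0 \<le> tail_sq v p" unfolding tail_sq_def by (intro suminf_nonneg tail_summable) simp
    qed simp
    finally have "tail_sq v (p + c) \<le> \<delta>\<^sup>2" using False M by (simp add: Q_def)
    then have "r \<le> p + c" by (rule r(2))
    then have "real r \<le> real p + (1 + (1 - \<delta>\<^sup>2 / M\<^sup>2) * real Q)" using c(2) by linarith
    also have "real Q = real P - real p" using False by (simp add: Q_def of_nat_diff)
    finally show ?thesis by simp
  qed
  with r(1) that show ?thesis by blast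
qed

subsection \<open>Gauss--Legendre quadrature\<close>

lemma coeff_funpow_pderiv:
  "coeff ((pderiv ^^ n) p) i = fact (i + n) / fact i * coeff (p :: real poly) (i + n)"
proof (induction n arbitrary: i)
  case (Suc n)
  have "coeff ((pderiv ^^ Suc n) p) i = real (Suc i) * (fact (Suc i + n) / fact (Suc i) * coeff p (Suc i + n))"
    by (simp add: coeff_pderiv Suc.IH del: of_nat_Suc fact_Suc)
  also have "\<dots> = fact (i + Suc n) / fact i * coeff p (i + Suc n)"
    by (simp add: fact_Suc[of i] del: of_nat_Suc)
  finally show ?case .
qed simp

lemma pderiv_sum: "pderiv (\<Sum>i\<in>I. p i) = (\<Sum>i\<in>I. pderiv (p i))"
  by (induction I rule: infinite_finite_induct) (simp_all add: pderiv_add)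

lemma funpow_pderiv_monic:
  assumes "degree p = n" "lead_coeff p = 1"
  shows "(pderiv ^^ n) p = [:fact n :: real:]"
proof (rule poly_eqI)
  fix i
  show "coeff ((pderiv ^^ n) p) i = coeff [:fact n:] i"
    using assms by (cases i) (auto simp: coeff_funpow_pderiv coeff_eq_0)
qed

lemma funpow_pderiv_eq_0: "degree p < n \<Longrightarrow> (pderiv ^^ n) (p :: real poly) = 0"
  by (intro poly_eqI) (simp add: coeff_funpow_pderiv coeff_eq_0)

lemma funpow_pderiv_pcompose_linear:
  "(pderiv ^^ n) (pcompose p [:a, b:]) = smult (b ^ n) (pcompose ((pderiv ^^ n) p) [:a, b :: real:])"
  by (induction n) (simp_all add: pderiv_smult pderiv_pcompose pderiv_pCons mult.commute)

lemma integral_pderiv: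
  fixes a b :: real
  assumes "a \<le> b"
  shows "integral {a..b} (poly (pderiv P)) = poly P b - poly P a"
  by (rule integral_unique, rule fundamental_theorem_of_calculus[OF assms])
    (auto simp: has_real_derivative_iff_has_vector_derivative[symmetric] intro: poly_DERIV has_field_derivative_at_within)

lemma poly_integrable: "poly p integrable_on {a..b :: real}"
  by (intro integrable_continuous_interval continuous_intros)

lemma integral_poly_by_parts:
  fixes a b :: real
  assumes ab: "a \<le> b" and W: "\<And>k. k < n \<Longrightarrow> poly ((pderiv ^^ k) W) a = 0 \<and> poly ((pderiv ^^ k) W) b = 0"
  shows "integral {a..b} (poly ((pderiv ^^ n) W * q)) = (-1) ^ n * integral {a..b} (poly (W * (pderiv ^^ n) q))"
  using W
proof (induction n arbitrary: q)
  case (Suc n)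
  let ?A = "(pderiv ^^ n) W"
  have "0 = integral {a..b} (poly (pderiv (?A * q)))"
    using Suc.prems[of n] by (simp add: integral_pderiv[OF ab])
  also have "\<dots> = integral {a..b} (\<lambda>x. poly (?A * pderiv q) x + poly ((pderiv ^^ Suc n) W * q) x)"
    by (intro arg_cong[where f = "integral _"] ext) (simp add: pderiv_mult mult.commute)
  also have "\<dots> = integral {a..b} (poly (?A * pderiv q)) + integral {a..b} (poly ((pderiv ^^ Suc n) W * q))"
    by (intro Henstock_Kurzweil_Integration.integral_add poly_integrable)
  finally have "integral {a..b} (poly ((pderiv ^^ Suc n) W * q)) = - integral {a..b} (poly (?A * pderiv q))"
    by simp
  also have "\<dots> = - ((-1) ^ n * integral {a..b} (poly (W * (pderiv ^^ n) (pderiv q))))"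
    using Suc.prems by (subst Suc.IH) auto
  also have "\<dots> = (-1) ^ Suc n * integral {a..b} (poly (W * (pderiv ^^ Suc n) q))"
    unfolding funpow_Suc_right o_apply by simp
  finally show ?case .
qed simp

lemma root_funpow_pderiv:
  assumes "[:-c, 1:] ^ n dvd p" "k < n"
  shows "poly ((pderiv ^^ k) p) (c :: real) = 0"
proof -
  have "[:-c, 1:] ^ (n - k) dvd (pderiv ^^ k) p" if "k \<le> n" for k
    using that
  proof (induction k)
    case 0
    then show ?case using assms(1) by simp
  next
    case (Suc k)
    then obtain r where r: "(pderiv ^^ k) p = [:-c, 1:] ^ Suc (n - Suc k) * r"
      by (auto simp: Suc_diff_Suc dvd_def)
    have "(pderiv ^^ Suc k) p = [:-c, 1:] ^ (n - Suc k) *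
        ([:-c, 1:] * pderiv r + smult (of_nat (Suc (n - Suc k))) (r * pderiv [:-c, 1:]))"
      by (simp only: funpow.simps o_apply r pderiv_mult pderiv_power_Suc) (simp add: algebra_simps)
    then show ?case by simp
  qed
  from this[of k] assms(2) have "[:-c, 1:] dvd (pderiv ^^ k) p"
    by (metis Suc_diff_Suc dvd_mult_left less_imp_le power_Suc)
  then show ?thesis by (simp add: poly_eq_0_iff_dvd)
qed

lemma integral_beta:
  assumes "0 \<le> (h::real)"
  shows "integral {0..h} (\<lambda>t. t ^ a * (h - t) ^ b) = fact a * fact b / fact (a + b + 1) * h ^ (a + b + 1)"
proof (induction a arbitrary: b)
  case 0
  define F where "F = (\<lambda>t. - ((h - t) ^ Suc b / real (Suc b)))"
  have "(F has_real_derivative (h - t) ^ b) (at t within {0..h})" for t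
    unfolding F_def by (auto intro!: derivative_eq_intros simp del: of_nat_Suc power_Suc)
  then have "((\<lambda>t. (h - t) ^ b) has_integral F h - F 0) {0..h}"
    by (intro fundamental_theorem_of_calculus[OF assms])
      (simp add: has_real_derivative_iff_has_vector_derivative)
  then show ?case by (simp add: integral_unique F_def)
next
  case (Suc a)
  have "((\<lambda>t. t ^ Suc a * (h - t) ^ Suc b) has_real_derivative
      real (Suc a) * (t ^ a * (h - t) ^ Suc b) - real (Suc b) * (t ^ Suc a * (h - t) ^ b)) (at t within {0..h})" for t
    by (auto intro!: derivative_eq_intros simp: algebra_simps simp del: power_Suc of_nat_Suc)
  then have "((\<lambda>t. real (Suc a) * (t ^ a * (h - t) ^ Suc b) - real (Suc b) * (t ^ Suc a * (h - t) ^ b)) has_integral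
      (h ^ Suc a * (h - h) ^ Suc b - 0 ^ Suc a * (h - 0) ^ Suc b)) {0..h}"
    by (intro fundamental_theorem_of_calculus[OF assms])
      (simp only: has_real_derivative_iff_has_vector_derivative)
  then have "integral {0..h} (\<lambda>t. real (Suc a) * (t ^ a * (h - t) ^ Suc b) - real (Suc b) * (t ^ Suc a * (h - t) ^ b)) = 0"
    by (simp add: integral_unique)
  also have "integral {0..h} (\<lambda>t. real (Suc a) * (t ^ a * (h - t) ^ Suc b) - real (Suc b) * (t ^ Suc a * (h - t) ^ b))
    = real (Suc a) * integral {0..h} (\<lambda>t. t ^ a * (h - t) ^ Suc b) - real (Suc b) * integral {0..h} (\<lambda>t. t ^ Suc a * (h - t) ^ b)"
    by (subst Henstock_Kurzweil_Integration.integral_diff)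
      (auto intro!: integrable_continuous_interval continuous_intros simp del: power_Suc of_nat_Suc)
  finally have *: "integral {0..h} (\<lambda>t. t ^ Suc a * (h - t) ^ b)
      = real (Suc a) / real (Suc b) * integral {0..h} (\<lambda>t. t ^ a * (h - t) ^ Suc b)"
    by (simp add: field_simps del: power_Suc of_nat_Suc)
  show ?case unfolding * Suc.IH
    by (simp add: fact_Suc[of a] fact_Suc[of b] del: fact_Suc of_nat_Suc power_Suc)
qed

lemma ex_antiderivative_poly:
  "\<exists>P :: real poly. pderiv P = p \<and> poly P 0 = 0 \<and> degree P \<le> Suc (degree p)"
proof (intro exI conjI)
  let ?P = "\<Sum>i\<le>degree p. monom (coeff p i / real (Suc i)) (Suc i)"
  show "pderiv ?P = p"
    by (simp add: pderiv_sum pderiv_monom poly_as_sum_of_monoms del: of_nat_Suc)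
  show "poly ?P 0 = 0" by (simp add: poly_sum poly_monom)
  show "degree ?P \<le> Suc (degree p)"
    by (intro degree_sum_le) (auto intro: order_trans[OF degree_monom_le])
qed

text \<open>The new zeros lie strictly between consecutive elements of \<open>Z\<close>.\<close>

lemma rolle_finite:
  fixes f f' :: "real \<Rightarrow> real"
  assumes "finite Z" "Z \<noteq> {}" "Z \<subseteq> {a..b}" "\<And>z. z \<in> Z \<Longrightarrow> f z = 0"
    and d: "\<And>t. t \<in> {a..b} \<Longrightarrow> (f has_vector_derivative f' t) (at t within {a..b})"
  shows "\<exists>Z'. finite Z' \<and> card Z' = card Z - 1 \<and> Z' \<subseteq> {Min Z..Max Z} \<and> Z' \<inter> Z = {} \<and> (\<forall>z\<in>Z'. f' z = 0)"
  using assms(1-4)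
proof (induction Z rule: finite_linorder_max_induct)
  case (insert y A)
  show ?case
  proof (cases "A = {}")
    case True
    then show ?thesis by (intro exI[of _ "{}"]) auto
  next
    case False
    with insert obtain Z' where Z': "finite Z'" "card Z' = card A - 1" "Z' \<subseteq> {Min A..Max A}"
      "Z' \<inter> A = {}" "\<forall>z\<in>Z'. f' z = 0" by auto
    let ?x = "Max A"
    have x: "?x \<in> A" using False insert.hyps by simp
    then have xy: "?x < y" "?x \<in> {a..b}" "y \<in> {a..b}" "f ?x = 0" "f y = 0" using insert by auto
    have "\<exists>z. ?x < z \<and> z < y \<and> (\<lambda>v. v * f' z) = (\<lambda>v. 0)"
    proof (rule Rolle_deriv[OF xy(1), of f "\<lambda>z v. v * f' z"])
      show "f ?x = f y" using xy by simp
      have "continuous_on {a..b} f"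
        using d by (intro continuous_on_vector_derivative) auto
      then show "continuous_on {?x..y} f" using xy by (rule_tac continuous_on_subset) auto
      fix z assume z: "?x < z" "z < y"
      then have "at z within {a..b} = at z" using xy by (intro at_within_interior) auto
      then show "(f has_derivative (\<lambda>v. v * f' z)) (at z)"
        using d[of z] z xy by (auto simp: has_vector_derivative_def)
    qed
    then obtain z where z: "?x < z" "z < y" "f' z = 0" by (metis mult_1)
    have zA: "z \<notin> A" using z(1) Max_ge[OF insert.hyps(1), of z] by auto
    have zZ: "z \<notin> Z'" using z Z'(3) by auto
    have card: "card (insert z Z') = card (insert y A) - 1"
    proof -
      have "card A > 0" using False insert.hyps by (simp add: card_gt_0_iff)
      moreover have "y \<notin> A" using insert.hyps by auto
      ultimately show ?thesis using Z' zZ insert.hyps(1) by simp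
    qed
    have mx: "Max (insert y A) = y" "Min (insert y A) = Min A"
      using False insert.hyps x by (auto intro!: Max_eqI Min_eqI less_imp_le)
    have "Min A \<le> ?x" using x insert.hyps by simp
    then have "insert z Z' \<subseteq> {Min A..y}" using z Z'(3) xy by (auto intro: order_trans less_imp_le)
    moreover have "insert z Z' \<inter> insert y A = {}" using z zA Z'(3,4) xy by auto
    ultimately show ?thesis using z Z' card mx by (intro exI[of _ "insert z Z'"]) auto
  qed
qed simp

lemma rolle_finite_within:
  fixes f f' :: "real \<Rightarrow> real"
  assumes Z: "finite Z" "Z \<noteq> {}" "Z \<subseteq> {a..b}" "\<And>z. z \<in> Z \<Longrightarrow> f z = 0"
    and "\<And>t. t \<in> {a..b} \<Longrightarrow> (f has_vector_derivative f' t) (at t within {a..b})"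
  obtains Z' where "finite Z'" "card Z' = card Z - 1" "Z' \<subseteq> {a..b}" "Z' \<inter> Z = {}" "\<forall>z\<in>Z'. f' z = 0"
proof -
  obtain Z' where Z': "finite Z'" "card Z' = card Z - 1" "Z' \<subseteq> {Min Z..Max Z}" "Z' \<inter> Z = {}" "\<forall>z\<in>Z'. f' z = 0"
    using rolle_finite[OF assms] by blast
  have "Min Z \<in> Z" "Max Z \<in> Z" using Z by auto
  then have "Z' \<subseteq> {a..b}" using Z'(3) Z(3) by fastforce
  with Z' that show ?thesis by blast
qed

lemma rolle_iterated:
  fixes F :: "nat \<Rightarrow> real \<Rightarrow> real"
  assumes "finite Z" "card Z \<ge> Suc n" "Z \<subseteq> {a..b}" "\<And>z. z \<in> Z \<Longrightarrow> F 0 z = 0"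
    and "\<And>m t. m < n \<Longrightarrow> t \<in> {a..b} \<Longrightarrow> (F m has_vector_derivative F (Suc m) t) (at t within {a..b})"
  shows "\<exists>\<xi>\<in>{a..b}. F n \<xi> = 0"
  using assms
proof (induction n arbitrary: F Z)
  case 0
  then obtain z where "z \<in> Z" by (cases "Z = {}") auto
  with 0 show ?case by auto
next
  case (Suc n)
  then have ne: "Z \<noteq> {}" by auto
  have d0: "(F 0 has_vector_derivative F (Suc 0) t) (at t within {a..b})" if "t \<in> {a..b}" for t
    using Suc.prems(5)[of 0 t] that by simp
  obtain Z' where Z': "finite Z'" "card Z' = card Z - 1" "Z' \<subseteq> {a..b}" "\<forall>z\<in>Z'. F (Suc 0) z = 0"
    by (rule rolle_finite_within[OF Suc.prems(1) ne Suc.prems(3) Suc.prems(4) d0]) blast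
  show ?case using Suc.IH[of Z' "\<lambda>m. F (Suc m)"] Z' Suc.prems by auto
qed

section \<open>The node polynomial and its orthogonality\<close>

locale gauss_nodes =
  fixes J :: nat and h :: real and \<tau> :: "nat \<Rightarrow> real"
  assumes J1: "1 \<le> J" and h0: "0 < h" and nodes: "gauss_legendre_nodes J h \<tau>"
begin

lemma node_in: "j \<in> {1..J} \<Longrightarrow> 0 < \<tau> j \<and> \<tau> j < h"
  using nodes by (auto simp: gauss_legendre_nodes_def)

lemma node_inj: "inj_on \<tau> {1..J}"
  using nodes strict_mono_on_imp_inj_on by (auto simp: gauss_legendre_nodes_def)

lemma node_eq_iff: "i \<in> {1..J} \<Longrightarrow> j \<in> {1..J} \<Longrightarrow> \<tau> i = \<tau> j \<longleftrightarrow> i = j"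
  by (rule inj_on_eq_iff[OF node_inj])

lemma nodes_subset: "\<tau> ` {1..J} \<subseteq> {0..h}"
  using node_in by (force intro: less_imp_le)

lemma card_nodes: "card (\<tau> ` {1..J}) = J"
  using node_inj by (simp add: card_image)

definition node_poly :: "real poly" where
  "node_poly = (\<Prod>j\<in>{1..J}. [:- \<tau> j, 1:])"

lemma node_poly_degree: "degree node_poly = J"
  unfolding node_poly_def by (subst degree_prod_eq_sum_degree) auto

lemma node_poly_monic: "lead_coeff node_poly = 1"
  unfolding node_poly_def by (simp add: lead_coeff_prod)

lemma node_poly_nonzero: "node_poly \<noteq> 0"
  using node_poly_monic by force

lemma poly_node_poly: "poly node_poly t = (\<Prod>j\<in>{1..J}. t - \<tau> j)"
  by (simp add: node_poly_def poly_prod)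

lemma node_poly_root [simp]: "j \<in> {1..J} \<Longrightarrow> poly node_poly (\<tau> j) = 0"
  by (auto simp: poly_node_poly)

lemma node_poly_eq_0_iff: "poly node_poly t = 0 \<longleftrightarrow> t \<in> \<tau> ` {1..J}"
  by (auto simp: poly_node_poly)

text \<open>This is t^J (t - h)^J, the Rodrigues polynomial transplanted from [-1, 1] to
  [0, h].\<close>

definition rodrigues :: "real poly" where
  "rodrigues = [:0, - h, 1:] ^ J"

text \<open>Substituting 2 t / h - 1 in the Legendre polynomial shows that the J-th derivative
  vanishes at the nodes. Its degree is at most J, so these J zeros and the leading coefficient
  determine it.\<close>

lemma rodrigues_deriv: "(pderiv ^^ J) rodrigues = smult (fact (2 * J) / fact J) node_poly"
proof -
  let ?R = "(pderiv ^^ J) rodrigues"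
  have deg: "degree rodrigues = 2 * J" "lead_coeff rodrigues = 1"
  proof -
    show "degree rodrigues = 2 * J" by (simp add: rodrigues_def degree_power_eq)
    show "lead_coeff rodrigues = 1" unfolding rodrigues_def lead_coeff_power by simp
  qed
  have coeffR: "coeff ?R J = fact (2 * J) / fact J"
    using deg by (simp add: coeff_funpow_pderiv mult_2)
  have degR: "degree ?R \<le> J"
    by (rule degree_le) (use deg in \<open>auto simp: coeff_funpow_pderiv coeff_eq_0\<close>)
  have root: "poly ?R (\<tau> j) = 0" if "j \<in> {1..J}" for j
  proof -
    have "pcompose ([:-1, 0, 1:] ^ n) [:-1, 2 / h:] = smult ((4 / h\<^sup>2) ^ n) ([:0, - h, 1:] ^ n)" for n
    proof -
      have "pcompose [:-1, 0, 1:] [:-1, 2 / h:] = smult (4 / h\<^sup>2) [:0, - h, 1:]"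
        using h0 by (simp add: pcompose_pCons power2_eq_square)
      moreover have "pcompose (p ^ n) q = pcompose p q ^ n" for p q :: "real poly"
        by (induction n) (simp_all add: pcompose_mult pcompose_1)
      ultimately show ?thesis by (simp only: smult_power)
    qed
    then have "(pderiv ^^ J) (smult ((4 / h\<^sup>2) ^ J) rodrigues)
        = smult ((2 / h) ^ J) (pcompose ((pderiv ^^ J) ([:-1, 0, 1:] ^ J)) [:-1, 2 / h:])"
      by (simp only: rodrigues_def funpow_pderiv_pcompose_linear[symmetric])
    moreover have "(pderiv ^^ n) (smult c p) = smult c ((pderiv ^^ n) p)" for n c and p :: "real poly"
      by (induction n) (simp_all add: pderiv_smult)
    ultimately have "smult ((4 / h\<^sup>2) ^ J) ?R
        = smult ((2 / h) ^ J) (pcompose ((pderiv ^^ J) ([:-1, 0, 1:] ^ J)) [:-1, 2 / h:])" by simp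
    from arg_cong[OF this, of "\<lambda>p. poly p (\<tau> j)"]
    have "(4 / h\<^sup>2) ^ J * poly ?R (\<tau> j)
        = (2 / h) ^ J * poly ((pderiv ^^ J) ([:-1, 0, 1:] ^ J)) (poly [:-1, 2 / h:] (\<tau> j))"
      by (simp only: poly_smult poly_pcompose)
    also have "poly [:-1, 2 / h:] (\<tau> j) = 2 * \<tau> j / h - 1" by simp
    also have "(2 / h) ^ J * poly ((pderiv ^^ J) ([:-1, 0, 1:] ^ J)) (2 * \<tau> j / h - 1) = 0"
      using nodes that by (auto simp: gauss_legendre_nodes_def legendre_def)
    finally show ?thesis using h0 by simp
  qed
  show ?thesis
  proof (rule poly_eqI_degree_lead_coeff[where A = "\<tau> ` {1..J}" and n = J])
    show "coeff ?R J = coeff (smult (fact (2 * J) / fact J) node_poly) J"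
      using coeffR node_poly_monic by (simp add: node_poly_degree)
    show "J \<le> card (\<tau> ` {1..J})" by (simp only: card_nodes)
    show "degree (smult (fact (2 * J) / fact J) node_poly) \<le> J" by (simp add: node_poly_degree)
    show "poly ?R x = poly (smult (fact (2 * J) / fact J) node_poly) x" if "x \<in> \<tau> ` {1..J}" for x
      using that root by auto
  qed (rule degR)
qed

lemma rodrigues_boundary:
  assumes "k < J"
  shows "poly ((pderiv ^^ k) rodrigues) 0 = 0 \<and> poly ((pderiv ^^ k) rodrigues) h = 0"
proof -
  have "[:0, - h, 1:] = [:-0, 1:] * [:-h, 1:]" by simp
  then have "rodrigues = [:-0, 1:] ^ J * [:-h, 1:] ^ J"
    unfolding rodrigues_def by (metis power_mult_distrib)
  then have "[:-0, 1:] ^ J dvd rodrigues" "[:-h, 1:] ^ J dvd rodrigues" by auto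
  with assms show ?thesis using root_funpow_pderiv by blast
qed

text \<open>J integrations by parts, whose boundary terms vanish by
  \<open>rodrigues_boundary\<close>. Both the orthogonality of the node polynomial and its norm
  follow by choosing \<open>q\<close>.\<close>

lemma integral_node_poly_mult:
  "fact (2 * J) / fact J * integral {0..h} (poly (node_poly * q))
    = (-1) ^ J * integral {0..h} (poly (rodrigues * (pderiv ^^ J) q))"
proof -
  have "integral {0..h} (poly ((pderiv ^^ J) rodrigues * q))
    = (-1) ^ J * integral {0..h} (poly (rodrigues * (pderiv ^^ J) q))"
    using h0 rodrigues_boundary by (intro integral_poly_by_parts) auto
  moreover have "poly ((pderiv ^^ J) rodrigues * q) = (\<lambda>t. fact (2 * J) / fact J * poly (node_poly * q) t)"
    by (auto simp: rodrigues_deriv fun_eq_iff)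
  ultimately show ?thesis by (simp only: integral_mult_right)
qed

lemma integral_node_poly_orth: "degree q < J \<Longrightarrow> integral {0..h} (poly (node_poly * q)) = 0"
proof -
  assume "degree q < J"
  moreover have "poly (0 :: real poly) = (\<lambda>_. 0)" by auto
  ultimately show ?thesis using integral_node_poly_mult[of q] by (simp add: funpow_pderiv_eq_0)
qed

text \<open>The squared L2 norm of the monic shifted Legendre polynomial on [0, 1]. Both error
  constants of the theorem derive from it.\<close>

definition node_sq_const :: real where
  "node_sq_const = (fact J) ^ 4 / ((2 * real J + 1) * (fact (2 * J))\<^sup>2)"

lemma node_sq_const_pos: "0 < node_sq_const"
  by (simp add: node_sq_const_def)

lemma integral_node_poly_sq:
  "integral {0..h} (\<lambda>t. (poly node_poly t)\<^sup>2) = node_sq_const * h ^ (2 * J + 1)"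
proof -
  have "(pderiv ^^ J) node_poly = [:fact J:]"
    by (rule funpow_pderiv_monic[OF node_poly_degree node_poly_monic])
  moreover have "(-1) ^ J * poly (rodrigues * [:fact J:]) t = fact J * (t ^ J * (h - t) ^ J)" for t
  proof -
    have "(-1) ^ J * poly rodrigues t = ((-1) * (t * (t - h))) ^ J"
      by (simp only: rodrigues_def poly_power power_mult_distrib) (simp add: algebra_simps power_mult_distrib[symmetric])
    also have "(-1) * (t * (t - h)) = t * (h - t)" by (simp add: algebra_simps)
    finally show ?thesis by (simp add: power_mult_distrib mult_ac)
  qed
  ultimately have "fact (2 * J) / fact J * integral {0..h} (poly (node_poly * node_poly))
      = fact J * integral {0..h} (\<lambda>t. t ^ J * (h - t) ^ J)"
    using integral_node_poly_mult[of node_poly] by (simp only: integral_mult_right[symmetric])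
  also have "integral {0..h} (\<lambda>t. t ^ J * (h - t) ^ J) = fact J * fact J / fact (2 * J + 1) * h ^ (2 * J + 1)"
    unfolding mult_2 by (rule integral_beta) (use h0 in simp)
  finally have eq: "fact (2 * J) / fact J * integral {0..h} (poly (node_poly * node_poly))
      = fact J * (fact J * fact J / fact (2 * J + 1) * h ^ (2 * J + 1))" .
  have "A / f * I = f * (f * f / B * H) \<Longrightarrow> A > 0 \<Longrightarrow> f > 0 \<Longrightarrow> I = f * f * (f * f) / (A * B) * H"
    for A f I B H :: real
  proof -
    assume eq: "A / f * I = f * (f * f / B * H)" and pos: "A > 0" "f > 0"
    have "I = (A / f * I) * (f / A)" using pos by simp
    also have "\<dots> = f * (f * f / B * H) * (f / A)" by (simp only: eq)
    also have "\<dots> = f * f * (f * f) / (A * B) * H" by (simp add: mult_ac)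
    finally show ?thesis .
  qed
  from this[OF eq] have "integral {0..h} (poly (node_poly * node_poly))
      = fact J * fact J * (fact J * fact J) / (fact (2 * J) * fact (2 * J + 1)) * h ^ (2 * J + 1)"
    by simp
  also have "fact J * fact J * (fact J * fact J) / (fact (2 * J) * fact (2 * J + 1)) = node_sq_const"
    by (simp add: node_sq_const_def power4_eq_xxxx power2_eq_square field_simps)
  finally show ?thesis by (simp add: power2_eq_square)
qed

section \<open>Interpolation and quadrature at the nodes\<close>

definition lag_poly :: "nat \<Rightarrow> real poly" where
  "lag_poly m = (\<Prod>j\<in>{1..J} - {m}. smult (1 / (\<tau> m - \<tau> j)) [:- \<tau> j, 1:])"

lemma poly_lag_poly: "poly (lag_poly m) t = lagrange_basis J \<tau> m t"
  by (simp add: lag_poly_def lagrange_basis_def poly_prod diff_divide_distrib)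

lemma lag_poly_degree: "m \<in> {1..J} \<Longrightarrow> degree (lag_poly m) < J"
proof -
  assume m: "m \<in> {1..J}"
  have "degree (lag_poly m) \<le> (\<Sum>j\<in>{1..J} - {m}. 1)"
    unfolding lag_poly_def
    by (rule order_trans[OF degree_prod_sum_le])
      (auto simp del: degree_smult_eq sum_constant smult_pCons intro!: sum_mono order_trans[OF degree_smult_le])
  also have "\<dots> < J" using m J1 by simp
  finally show ?thesis .
qed

lemma lagrange_basis_node:
  assumes "m \<in> {1..J}" "j \<in> {1..J}"
  shows "lagrange_basis J \<tau> m (\<tau> j) = (if j = m then 1 else 0)"
proof (cases "j = m")
  case True
  then show ?thesis using assms node_eq_iff by (auto simp: lagrange_basis_def intro!: prod.neutral)
next
  case False
  then show ?thesis using assms by (auto simp: lagrange_basis_def intro!: prod_zero bexI[of _ j])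
qed

definition interp :: "(nat \<Rightarrow> real) \<Rightarrow> real poly" where
  "interp y = (\<Sum>m=1..J. smult (y m) (lag_poly m))"

lemma poly_interp: "poly (interp y) t = (\<Sum>m=1..J. lagrange_basis J \<tau> m t * y m)"
  by (simp add: interp_def poly_sum poly_lag_poly mult.commute)

lemma interp_degree: "degree (interp y) < J"
proof -
  have "degree (smult (y m) (lag_poly m)) \<le> J - 1" if "m \<in> {1..J}" for m
    using degree_smult_le[of "y m" "lag_poly m"] lag_poly_degree[OF that] by linarith
  then have "degree (interp y) \<le> J - 1" unfolding interp_def by (intro degree_sum_le) auto
  then show ?thesis using J1 by simp
qed

lemma interp_node: "j \<in> {1..J} \<Longrightarrow> poly (interp y) (\<tau> j) = y j"
proof -
  assume j: "j \<in> {1..J}"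
  then have "(\<Sum>m=1..J. lagrange_basis J \<tau> m (\<tau> j) * y m) = (\<Sum>m=1..J. if m = j then y m else 0)"
    by (intro sum.cong) (auto simp: lagrange_basis_node)
  then show ?thesis using j by (simp add: poly_interp)
qed

lemma interp_unique:
  assumes "degree p < J" "\<And>j. j \<in> {1..J} \<Longrightarrow> poly p (\<tau> j) = y j"
  shows "p = interp y"
proof (rule poly_eqI_degree[of "\<tau> ` {1..J}"])
  show "poly p x = poly (interp y) x" if "x \<in> \<tau> ` {1..J}" for x
    using that assms interp_node by auto
qed (use assms interp_degree card_nodes in auto)

lemma sum_lagrange_basis: "(\<Sum>m=1..J. lagrange_basis J \<tau> m t) = 1"
proof -
  have "1 = interp (\<lambda>_. 1)" by (rule interp_unique) (use J1 in auto)
  from arg_cong[OF this, of "\<lambda>p. poly p t"] show ?thesis by (simp add: poly_interp)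
qed

lemma lagrange_basis_continuous: "continuous_on A (lagrange_basis J \<tau> m)"
  unfolding poly_lag_poly[symmetric, abs_def] by (intro continuous_intros)

lemma lagrange_basis_integrable: "lagrange_basis J \<tau> m integrable_on {a..b}"
  by (intro integrable_continuous_interval lagrange_basis_continuous)

text \<open>The Lagrange basis sums to 1. Consequently h C \<le> \<rho> < 1, which makes the
  differential equation itself solvable by a single contraction on [0, h].\<close>

lemma mean_lebesgue_const_ge_1: "1 \<le> mean_lebesgue_const J h \<tau>"
proof -
  have "h = integral {0..h} (\<lambda>_. 1 :: real)" using h0 by simp
  also have "\<dots> \<le> integral {0..h} (\<lambda>s. \<Sum>m=1..J. \<bar>lagrange_basis J \<tau> m s\<bar>)"
  proof (rule integral_le)
    show "(\<lambda>s. \<Sum>m=1..J. \<bar>lagrange_basis J \<tau> m s\<bar>) integrable_on {0..h}"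
      by (intro integrable_continuous_interval continuous_intros lagrange_basis_continuous)
    fix s
    show "1 \<le> (\<Sum>m=1..J. \<bar>lagrange_basis J \<tau> m s\<bar>)"
      using sum_lagrange_basis[of s] sum_abs[of "\<lambda>m. lagrange_basis J \<tau> m s" "{1..J}"] by linarith
  qed auto
  finally show ?thesis using h0 by (simp add: mean_lebesgue_const_def field_simps)
qed

text \<open>The remainder of Q modulo the node polynomial has degree below J and vanishes at J
  points, so Q is the node polynomial times a factor of degree below J, and orthogonality
  applies.\<close>

lemma integral_eq_0_if_node_roots:
  assumes "degree Q < 2 * J" "\<And>j. j \<in> {1..J} \<Longrightarrow> poly Q (\<tau> j) = 0"
  shows "integral {0..h} (poly Q) = 0"
proof -
  define q r where "q = Q div node_poly" and "r = Q mod node_poly"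
  have Q: "Q = node_poly * q + r" by (simp add: q_def r_def)
  have "r = interp (\<lambda>_. 0)"
  proof (rule interp_unique)
    show "degree r < J"
      using degree_mod_less[OF node_poly_nonzero, of Q] J1 by (auto simp: r_def node_poly_degree)
    show "poly r (\<tau> j) = 0" if "j \<in> {1..J}" for j
      using assms(2)[OF that] that by (simp add: Q)
  qed
  then have Q': "Q = node_poly * q" using Q by (simp add: interp_def)
  have "degree q < J"
  proof (cases "q = 0")
    case False
    then have "degree Q = J + degree q"
      by (simp add: Q' degree_mult_eq node_poly_nonzero node_poly_degree)
    with assms(1) show ?thesis by simp
  qed (use J1 in simp)
  then show ?thesis unfolding Q' by (rule integral_node_poly_orth)
qed

lemma poly_funpow_has_vector_derivative:
  "(poly ((pderiv ^^ k) p) has_vector_derivative poly ((pderiv ^^ Suc k) p) t) (at t within S)"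
  using poly_DERIV[of "(pderiv ^^ k) p" t]
  by (simp add: has_real_derivative_iff_has_vector_derivative[symmetric] has_field_derivative_at_within)

text \<open>The constant \<open>c\<close> is chosen so that the auxiliary function vanishes at t as
  well as at the nodes; Rolle's theorem then gives a zero of its J-th derivative, which evaluates
  \<open>c\<close>.\<close>

lemma interpolation_error:
  fixes F :: "nat \<Rightarrow> real \<Rightarrow> real"
  assumes F: "\<And>m t. m < J \<Longrightarrow> t \<in> {0..h} \<Longrightarrow> (F m has_vector_derivative F (Suc m) t) (at t within {0..h})"
    and M: "\<And>t. t \<in> {0..h} \<Longrightarrow> \<bar>F J t\<bar> \<le> M" and t: "t \<in> {0..h}"
  shows "\<bar>F 0 t - (\<Sum>m=1..J. lagrange_basis J \<tau> m t * F 0 (\<tau> m))\<bar> \<le> M / fact J * \<bar>poly node_poly t\<bar>"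
proof (cases "t \<in> \<tau> ` {1..J}")
  case True
  then obtain j where j: "j \<in> {1..J}" "t = \<tau> j" by auto
  then have "(\<Sum>m=1..J. lagrange_basis J \<tau> m t * F 0 (\<tau> m)) = F 0 t"
    using interp_node[OF j(1), of "\<lambda>m. F 0 (\<tau> m)"] by (simp only: poly_interp)
  then show ?thesis using j by simp
next
  case False
  define p where "p = interp (\<lambda>m. F 0 (\<tau> m))"
  define c where "c = (F 0 t - poly p t) / poly node_poly t"
  define G where "G = (\<lambda>k s. F k s - poly ((pderiv ^^ k) p) s - c * poly ((pderiv ^^ k) node_poly) s)"
  have nz: "poly node_poly t \<noteq> 0" using False node_poly_eq_0_iff by simp
  have "\<exists>\<xi>\<in>{0..h}. G J \<xi> = 0"
  proof (rule rolle_iterated[of "insert t (\<tau> ` {1..J})"])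
    show "Suc J \<le> card (insert t (\<tau> ` {1..J}))" using False card_nodes by simp
    show "insert t (\<tau> ` {1..J}) \<subseteq> {0..h}" using t nodes_subset by simp
    show "G 0 z = 0" if "z \<in> insert t (\<tau> ` {1..J})" for z
      using that nz by (auto simp: G_def p_def interp_node c_def)
    show "(G m has_vector_derivative G (Suc m) t) (at t within {0..h})" if "m < J" "t \<in> {0..h}" for m t
      unfolding G_def
      by (intro has_vector_derivative_diff F that poly_funpow_has_vector_derivative
          has_vector_derivative_mult_right)
  qed simp
  then obtain \<xi> where \<xi>: "\<xi> \<in> {0..h}" "G J \<xi> = 0" by blast
  have "(pderiv ^^ J) p = 0" unfolding p_def by (intro funpow_pderiv_eq_0 interp_degree)
  moreover have "(pderiv ^^ J) node_poly = [:fact J:]"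
    by (rule funpow_pderiv_monic[OF node_poly_degree node_poly_monic])
  ultimately have "F J \<xi> = c * fact J" using \<xi>(2) by (simp add: G_def)
  then have "\<bar>c\<bar> \<le> M / fact J" using M[OF \<xi>(1)] by (simp add: field_simps abs_mult)
  then have "\<bar>c\<bar> * \<bar>poly node_poly t\<bar> \<le> M / fact J * \<bar>poly node_poly t\<bar>" by (rule mult_right_mono) simp
  moreover have "F 0 t - poly p t = c * poly node_poly t" using nz by (simp add: c_def)
  then have "\<bar>F 0 t - poly p t\<bar> = \<bar>c\<bar> * \<bar>poly node_poly t\<bar>" by (simp only: abs_mult)
  ultimately show ?thesis by (simp only: p_def poly_interp)
qed

lemma node_poly_simple_root: "j \<in> {1..J} \<Longrightarrow> poly (pderiv node_poly) (\<tau> j) \<noteq> 0"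
proof -
  assume j: "j \<in> {1..J}"
  define q where "q = (\<Prod>i\<in>{1..J} - {j}. [:- \<tau> i, 1:])"
  have "node_poly = [:- \<tau> j, 1:] * q"
    using j unfolding node_poly_def q_def by (subst prod.remove[of _ j]) auto
  then have "poly (pderiv node_poly) (\<tau> j) = poly q (\<tau> j)"
    by (simp only: pderiv_mult) (simp add: pderiv_pCons)
  also have "\<dots> \<noteq> 0" using j node_eq_iff by (auto simp: q_def poly_prod)
  finally show ?thesis .
qed

text \<open>Hermite interpolation at the nodes; its integral vanishes because the nodal values do.\<close>

lemma quadrature_error:
  fixes F :: "nat \<Rightarrow> real \<Rightarrow> real"
  assumes F: "\<And>m t. m < 2 * J \<Longrightarrow> t \<in> {0..h} \<Longrightarrow> (F m has_vector_derivative F (Suc m) t) (at t within {0..h})"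
    and M: "\<And>t. t \<in> {0..h} \<Longrightarrow> \<bar>F (2 * J) t\<bar> \<le> M"
    and zero: "\<And>j. j \<in> {1..J} \<Longrightarrow> F 0 (\<tau> j) = 0"
  shows "\<bar>integral {0..h} (F 0)\<bar> \<le> M / fact (2 * J) * (node_sq_const * h ^ (2 * J + 1))"
proof -
  \<comment> \<open>At a node the derivative of \<open>P\<close> is \<open>q\<close> times the
    derivative of the node polynomial, so these values of \<open>q\<close> make \<open>P\<close>
    match F to first order.\<close>
  define q where "q = interp (\<lambda>m. F 1 (\<tau> m) / poly (pderiv node_poly) (\<tau> m))"
  define P where "P = node_poly * q"
  have degP: "degree P < 2 * J"
    using degree_mult_le[of node_poly q] interp_degree[folded q_def]
    by (simp add: P_def q_def node_poly_degree le_less_trans[OF _ add_strict_left_mono] mult_2)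
  have intP: "integral {0..h} (poly P) = 0"
    unfolding P_def q_def by (intro integral_node_poly_orth interp_degree)
  have P0: "poly P (\<tau> j) = 0" and P1: "poly (pderiv P) (\<tau> j) = F 1 (\<tau> j)" if "j \<in> {1..J}" for j
    using that node_poly_simple_root[OF that] by (simp_all add: P_def pderiv_mult q_def interp_node)
  have err: "\<bar>F 0 t - poly P t\<bar> \<le> M / fact (2 * J) * (poly node_poly t)\<^sup>2" if t: "t \<in> {0..h}" for t
  proof (cases "t \<in> \<tau> ` {1..J}")
    case True
    then show ?thesis using P0 zero by auto
  next
    case False
    define S where "S = node_poly ^ 2"
    define c where "c = (F 0 t - poly P t) / poly S t"
    define G where "G = (\<lambda>k s. F k s - poly ((pderiv ^^ k) P) s - c * poly ((pderiv ^^ k) S) s)"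
    have nz: "poly S t \<noteq> 0" using False node_poly_eq_0_iff by (simp add: S_def)
    have dG: "(G m has_vector_derivative G (Suc m) t) (at t within {0..h})" if "m < 2 * J" "t \<in> {0..h}" for m t
      unfolding G_def
      by (intro has_vector_derivative_diff F that poly_funpow_has_vector_derivative
          has_vector_derivative_mult_right)
    let ?Z = "insert t (\<tau> ` {1..J})"
    have Zh: "?Z \<subseteq> {0..h}" using t nodes_subset by simp
    have G0: "G 0 z = 0" if "z \<in> ?Z" for z
      using that nz zero P0 by (auto simp: G_def c_def S_def)
    have dG0: "(G 0 has_vector_derivative G 1 t) (at t within {0..h})" if "t \<in> {0..h}" for t
      using dG[of 0 t] that J1 by simp
    obtain Z' where Z': "finite Z'" "card Z' = card ?Z - 1" "Z' \<subseteq> {0..h}" "Z' \<inter> ?Z = {}"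
      "\<forall>z\<in>Z'. G 1 z = 0"
      by (rule rolle_finite_within[OF _ _ Zh G0 dG0]) auto
    have card_Z': "card Z' = J" using Z'(2) False card_nodes by simp
    \<comment> \<open>\<open>G 1\<close> has 2 J distinct zeros: J from Rolle's theorem, disjoint
      from the zeros of \<open>G 0\<close> used there, and the J nodes, where \<open>P\<close>
      matches the derivative and \<open>S\<close> has double zeros. The remaining 2 J - 1
      derivatives leave one of them.\<close>
    have "\<exists>\<xi>\<in>{0..h}. G (Suc (2 * J - 1)) \<xi> = 0"
    proof (rule rolle_iterated[of "Z' \<union> \<tau> ` {1..J}" "2 * J - 1" 0 h "\<lambda>m. G (Suc m)"])
      have "card (Z' \<union> \<tau> ` {1..J}) = J + J"
        using Z'(1,4) card_Z' card_nodes by (subst card_Un_disjoint) auto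
      then show "Suc (2 * J - 1) \<le> card (Z' \<union> \<tau> ` {1..J})" using J1 by simp
      show "Z' \<union> \<tau> ` {1..J} \<subseteq> {0..h}" using Z'(3) Zh by auto
      show "G (Suc 0) z = 0" if z: "z \<in> Z' \<union> \<tau> ` {1..J}" for z
      proof (cases "z \<in> Z'")
        case True
        then show ?thesis using Z' by simp
      next
        case False
        with z obtain j where j: "j \<in> {1..J}" "z = \<tau> j" by auto
        then have "poly (pderiv S) z = 0" by (simp add: S_def power2_eq_square pderiv_mult)
        then show ?thesis using P1 j by (simp add: G_def)
      qed
      show "(G (Suc m) has_vector_derivative G (Suc (Suc m)) t) (at t within {0..h})"
        if "m < 2 * J - 1" "t \<in> {0..h}" for m t
        using dG[of "Suc m" t] that by simp
    qed (use Z'(1) in simp)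
    then obtain \<xi> where \<xi>: "\<xi> \<in> {0..h}" "G (2 * J) \<xi> = 0" using J1 by auto
    have "(pderiv ^^ (2 * J)) P = 0" by (rule funpow_pderiv_eq_0[OF degP])
    moreover have "(pderiv ^^ (2 * J)) S = [:fact (2 * J):]"
    proof (rule funpow_pderiv_monic)
      show "degree S = 2 * J" by (simp add: S_def degree_power_eq node_poly_nonzero node_poly_degree)
      show "lead_coeff S = 1" by (simp add: S_def lead_coeff_power node_poly_monic)
    qed
    ultimately have "F (2 * J) \<xi> = c * fact (2 * J)" using \<xi>(2) by (simp add: G_def)
    then have "\<bar>c\<bar> \<le> M / fact (2 * J)" using M[OF \<xi>(1)] by (simp add: field_simps abs_mult)
    then have "\<bar>c\<bar> * (poly node_poly t)\<^sup>2 \<le> M / fact (2 * J) * (poly node_poly t)\<^sup>2" by (rule mult_right_mono) simp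
    moreover have "F 0 t - poly P t = c * (poly node_poly t)\<^sup>2" using nz by (simp add: c_def S_def)
    then have "\<bar>F 0 t - poly P t\<bar> = \<bar>c\<bar> * (poly node_poly t)\<^sup>2" by (simp add: abs_mult)
    ultimately show ?thesis by (simp only:)
  qed
  have "continuous_on {0..h} (F 0)"
    using F[of 0] J1 by (intro continuous_on_vector_derivative[of _ _ "F 1"]) auto
  then have F0: "F 0 integrable_on {0..h}" by (rule integrable_continuous_interval)
  have "integral {0..h} (F 0) = integral {0..h} (\<lambda>t. F 0 t - poly P t)"
    using intP by (subst Henstock_Kurzweil_Integration.integral_diff[OF F0 poly_integrable]) simp
  also have "\<bar>\<dots>\<bar> \<le> integral {0..h} (\<lambda>t. M / fact (2 * J) * (poly node_poly t)\<^sup>2)"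
    using err unfolding real_norm_def[symmetric]
    by (intro integral_norm_bound_integral Henstock_Kurzweil_Integration.integrable_diff F0 poly_integrable
        integrable_continuous_interval continuous_intros) auto
  also have "\<dots> = M / fact (2 * J) * (node_sq_const * h ^ (2 * J + 1))"
    by (simp only: integral_mult_right integral_node_poly_sq)
  finally show ?thesis .
qed

text \<open>Cauchy--Schwarz on [0, h], in the form |p| \<le> c / 2 + p^2 / (2 c) with
  \<open>c\<close> the root mean square of p.\<close>

lemma integral_abs_node_poly:
  assumes "t \<in> {0..h}"
  shows "integral {0..t} (\<lambda>s. \<bar>poly node_poly s\<bar>) \<le> sqrt node_sq_const * h ^ (J + 1)"
proof -
  have ab: "(\<lambda>s. \<bar>poly node_poly s\<bar>) integrable_on {a..b}" for a b
    by (intro integrable_continuous_interval continuous_intros)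
  define c where "c = sqrt node_sq_const * h ^ J"
  have c: "0 < c" "c\<^sup>2 = node_sq_const * h ^ (2 * J)"
    using node_sq_const_pos h0 by (simp_all add: c_def power_mult_distrib power_mult[symmetric] mult.commute)
  have "integral {0..t} (\<lambda>s. \<bar>poly node_poly s\<bar>) \<le> integral {0..h} (\<lambda>s. \<bar>poly node_poly s\<bar>)"
    using assms by (intro integral_subset_le ab) auto
  also have "\<dots> \<le> integral {0..h} (\<lambda>s. c / 2 + 1 / (2 * c) * (poly node_poly s)\<^sup>2)"
  proof (intro integral_le ab)
    show "(\<lambda>s. c / 2 + 1 / (2 * c) * (poly node_poly s)\<^sup>2) integrable_on {0..h}"
      by (intro integrable_continuous_interval continuous_intros)
    fix s
    have "0 \<le> (c - \<bar>poly node_poly s\<bar>)\<^sup>2" by simp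
    then show "\<bar>poly node_poly s\<bar> \<le> c / 2 + 1 / (2 * c) * (poly node_poly s)\<^sup>2"
      using c(1) by (simp add: power2_diff field_simps power2_eq_square)
  qed
  also have "\<dots> = c / 2 * h + 1 / (2 * c) * (node_sq_const * h ^ (2 * J + 1))"
    using h0 c(1) by (subst Henstock_Kurzweil_Integration.integral_add)
      (auto intro!: integrable_continuous_interval continuous_intros simp: integral_node_poly_sq)
  also have "\<dots> = c / 2 * h + 1 / (2 * c) * (c\<^sup>2 * h)" by (simp add: c(2))
  also have "\<dots> = c * h" using c(1) by (simp add: power2_eq_square)
  finally show ?thesis by (simp add: c_def mult_ac)
qed

lemma sqrt_node_sq_const: "sqrt node_sq_const = (fact J)\<^sup>2 / (sqrt (2 * real J + 1) * fact (2 * J))"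
proof -
  have "sqrt ((fact J) ^ 4) = (fact J)\<^sup>2"
    by (rule real_sqrt_unique) (simp_all add: power_mult[symmetric])
  then show ?thesis
    by (simp add: node_sq_const_def real_sqrt_divide real_sqrt_mult)
qed

text \<open>At each s the scalar remainder is applied to the component of \<open>g\<close> in the
  direction of the error at s. Integrating the node polynomial in modulus produces the constant that
  defines \<open>\<kappa>\<^sub>J\<close>.\<close>

theorem integral_interpolation_error:
  fixes g :: "nat \<Rightarrow> real \<Rightarrow> 'h::{real_inner, banach}"
  assumes g: "\<And>m t. m < J \<Longrightarrow> t \<in> {0..h} \<Longrightarrow> (g m has_vector_derivative g (Suc m) t) (at t within {0..h})"
    and M: "\<And>t. t \<in> {0..h} \<Longrightarrow> norm (g J t) \<le> M" and t: "t \<in> {0..h}"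
  shows "norm (integral {0..t} (\<lambda>s. g 0 s - (\<Sum>m=1..J. lagrange_basis J \<tau> m s *\<^sub>R g 0 (\<tau> m))))
    \<le> fact J / (sqrt (2 * real J + 1) * fact (2 * J)) * M * h ^ (J + 1)" (is "norm (integral _ ?e) \<le> _")
proof -
  have M0: "0 \<le> M" using M[OF t] norm_ge_zero order_trans by blast
  have "continuous_on {0..h} (g 0)"
    using g[of 0] J1 by (intro continuous_on_vector_derivative[of _ _ "g 1"]) auto
  then have "continuous_on {0..t} (g 0)" by (rule continuous_on_subset) (use t in auto)
  then have cont: "continuous_on {0..t} ?e"
    by (intro continuous_intros lagrange_basis_continuous)
  have "norm (?e s) \<le> M / fact J * \<bar>poly node_poly s\<bar>" if "s \<in> {0..h}" for s
  proof (cases "?e s = 0")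
    case False
    define \<phi> where "\<phi> = sgn (?e s)"
    have \<phi>: "norm \<phi> = 1" using False by (simp add: \<phi>_def norm_sgn)
    define F where "F = (\<lambda>m t. inner \<phi> (g m t))"
    have "\<bar>F 0 s - (\<Sum>m=1..J. lagrange_basis J \<tau> m s * F 0 (\<tau> m))\<bar> \<le> M / fact J * \<bar>poly node_poly s\<bar>"
    proof (rule interpolation_error[OF _ _ that])
      show "(F m has_vector_derivative F (Suc m) t) (at t within {0..h})" if "m < J" "t \<in> {0..h}" for m t
        unfolding F_def
        by (rule bounded_linear.has_vector_derivative[OF bounded_linear_inner_right g[OF that]])
      show "\<bar>F J t\<bar> \<le> M" if "t \<in> {0..h}" for t
        using Cauchy_Schwarz_ineq2[of \<phi> "g J t"] M[OF that] \<phi> by (simp add: F_def)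
    qed
    also have "F 0 s - (\<Sum>m=1..J. lagrange_basis J \<tau> m s * F 0 (\<tau> m)) = inner \<phi> (?e s)"
      by (simp add: F_def inner_diff_right inner_sum_right)
    also have "\<dots> = norm (?e s)"
      using False by (simp add: \<phi>_def sgn_div_norm dot_square_norm power2_eq_square)
    finally show ?thesis by simp
  qed (use M0 in simp)
  then have "norm (integral {0..t} ?e) \<le> integral {0..t} (\<lambda>s. M / fact J * \<bar>poly node_poly s\<bar>)"
    using t by (intro integral_norm_bound_integral integrable_continuous_interval cont continuous_intros) auto
  also have "\<dots> = M / fact J * integral {0..t} (\<lambda>s. \<bar>poly node_poly s\<bar>)"
    by (simp only: integral_mult_right)
  also have "\<dots> \<le> M / fact J * (sqrt node_sq_const * h ^ (J + 1))"
    using M0 by (intro mult_left_mono integral_abs_node_poly t) auto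
  also have "\<dots> = fact J / (sqrt (2 * real J + 1) * fact (2 * J)) * M * h ^ (J + 1)"
    by (simp add: sqrt_node_sq_const power2_eq_square)
  finally show ?thesis .
qed

text \<open>
  The derivative of \<open>(norm (d t))\<^sup>2\<close> has degree below \<open>2 J\<close> and vanishes at the nodes, so the
  quadrature shows that its integral is zero.
\<close>

theorem collocation_norm_conserved:
  fixes d0 :: "'h::real_inner" and k :: "nat \<Rightarrow> 'h"
  defines "d \<equiv> \<lambda>t. d0 + (\<Sum>m=1..J. integral {0..t} (lagrange_basis J \<tau> m) *\<^sub>R k m)"
  assumes orth: "\<And>m. m \<in> {1..J} \<Longrightarrow> inner (k m) (d (\<tau> m)) = 0"
  shows "norm (d h) = norm d0"
proof -
  have "\<forall>m. \<exists>P. pderiv P = lag_poly m \<and> poly P 0 = 0 \<and> degree P \<le> Suc (degree (lag_poly m))"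
    using ex_antiderivative_poly by blast
  then obtain L where L: "\<And>m. pderiv (L m) = lag_poly m" "\<And>m. poly (L m) 0 = 0"
    "\<And>m. degree (L m) \<le> Suc (degree (lag_poly m))" by metis
  have intL: "integral {0..t} (lagrange_basis J \<tau> m) = poly (L m) t" if "0 \<le> t" for t m
    using integral_pderiv[OF that, of "L m"] by (simp add: L poly_lag_poly[abs_def])
  define e where "e = (\<lambda>t. d0 + (\<Sum>m=1..J. poly (L m) t *\<^sub>R k m))"
  have de: "d t = e t" if "0 \<le> t" for t
    using intL[OF that] by (simp add: d_def e_def)
  \<comment> \<open>The squared norm of \<open>e t\<close> as a polynomial in t with real
    coefficients, so that the exactness of the quadrature can be applied to its derivative.\<close>
  define N where "N = [:inner d0 d0:] + (\<Sum>m=1..J. smult (2 * inner (k m) d0) (L m))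
     + (\<Sum>m=1..J. \<Sum>l=1..J. smult (inner (k m) (k l)) (L m * L l))"
  have N: "poly N t = (norm (e t))\<^sup>2" for t
    by (simp add: N_def e_def power2_norm_eq_inner poly_sum inner_add_left inner_add_right
        inner_sum_left inner_sum_right inner_commute sum_distrib_left mult_ac sum.distrib)
  define Q where "Q = (\<Sum>m=1..J. lag_poly m * (smult 2 ([:inner (k m) d0:] + (\<Sum>l=1..J. smult (inner (k m) (k l)) (L l)))))"
  have dN: "pderiv N = Q"
  proof -
    have "pderiv N = (\<Sum>m=1..J. smult (2 * inner (k m) d0) (lag_poly m))
      + ((\<Sum>m=1..J. \<Sum>l=1..J. smult (inner (k m) (k l)) (L m * lag_poly l))
      + (\<Sum>m=1..J. \<Sum>l=1..J. smult (inner (k m) (k l)) (L l * lag_poly m)))"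
      by (simp add: N_def pderiv_add pderiv_sum pderiv_smult pderiv_mult L pderiv_pCons smult_add_right sum.distrib)
    also have "(\<Sum>m=1..J. \<Sum>l=1..J. smult (inner (k m) (k l)) (L m * lag_poly l))
      = (\<Sum>m=1..J. \<Sum>l=1..J. smult (inner (k m) (k l)) (L l * lag_poly m))"
      by (subst sum.swap) (simp add: inner_commute)
    finally have "pderiv N = (\<Sum>m=1..J. smult (2 * inner (k m) d0) (lag_poly m))
      + ((\<Sum>m=1..J. \<Sum>l=1..J. smult (inner (k m) (k l)) (L l * lag_poly m))
      + (\<Sum>m=1..J. \<Sum>l=1..J. smult (inner (k m) (k l)) (L l * lag_poly m)))" .
    also have "\<dots> = Q"
      unfolding poly_eq_poly_eq_iff[symmetric]
      by (rule ext) (simp add: Q_def poly_sum sum.distrib sum_distrib_left algebra_simps)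
    finally show ?thesis .
  qed
  have "integral {0..h} (poly Q) = 0"
  proof (rule integral_eq_0_if_node_roots)
    have "degree Q \<le> 2 * J - 1" unfolding Q_def
    proof (intro degree_sum_le)
      have degL: "degree (L l) \<le> J" if "l \<in> {1..J}" for l
        using L(3)[of l] lag_poly_degree[OF that] by simp
      fix m assume m: "m \<in> {1..J}"
      have "degree (smult 2 ([:inner (k m) d0:] + (\<Sum>l=1..J. smult (inner (k m) (k l)) (L l)))) \<le> J"
        using degL by (intro order_trans[OF degree_smult_le] degree_add_le degree_sum_le) auto
      then show "degree (lag_poly m * smult 2 ([:inner (k m) d0:] + (\<Sum>l=1..J. smult (inner (k m) (k l)) (L l)))) \<le> 2 * J - 1"
        using lag_poly_degree[OF m] by (intro order_trans[OF degree_mult_le]) linarith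
    qed simp
    then show "degree Q < 2 * J" using J1 by simp
    fix j assume j: "j \<in> {1..J}"
    have "poly Q (\<tau> j) = (\<Sum>m=1..J. lagrange_basis J \<tau> m (\<tau> j) * (2 * inner (k m) (e (\<tau> j))))"
      unfolding Q_def poly_sum
      by (intro sum.cong refl) (simp add: poly_sum poly_lag_poly e_def inner_add_right inner_sum_right
          sum_distrib_left algebra_simps)
    also have "\<dots> = (\<Sum>m=1..J. if m = j then 2 * inner (k j) (e (\<tau> j)) else 0)"
      using j by (intro sum.cong) (auto simp: lagrange_basis_node)
    also have "\<dots> = 0" using j orth[OF j] de[of "\<tau> j"] node_in[OF j] by simp
    finally show "poly Q (\<tau> j) = 0" .
  qed
  moreover have "integral {0..h} (poly Q) = poly N h - poly N 0"
    using h0 integral_pderiv[of 0 h N] by (simp add: dN)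
  ultimately have "(norm (e h))\<^sup>2 = (norm (e 0))\<^sup>2" by (simp add: N)
  moreover have "e 0 = d0" by (simp add: e_def L)
  ultimately show ?thesis using de[of h] h0 by (simp add: power2_eq_iff_nonneg)
qed

end

subsection \<open>Multiplication operators\<close>

definition multipliable :: "('a::euclidean_space \<Rightarrow> real) \<Rightarrow> 'a L2 \<Rightarrow> bool" where
  "multipliable V f \<longleftrightarrow> square_integrable (\<lambda>x. complex_of_real (V x) * rep_L2 f x)"

lemma rep_mult_op:
  "multipliable V f \<Longrightarrow> AE x in lebesgue. rep_L2 (mult_op V f) x = complex_of_real (V x) * rep_L2 f x"
  unfolding mult_op_def multipliable_def by (rule rep_abs_L2)

lemma mult_op_add:
  assumes "multipliable V f" "multipliable V g" "multipliable V (f + g)"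
  shows "mult_op V (f + g) = mult_op V f + mult_op V g"
proof (rule L2_eqI)
  show "AE x in lebesgue. rep_L2 (mult_op V (f + g)) x = rep_L2 (mult_op V f + mult_op V g) x"
    using rep_mult_op[OF assms(1)] rep_mult_op[OF assms(2)] rep_mult_op[OF assms(3)]
      rep_L2_add[of f g] rep_L2_add[of "mult_op V f" "mult_op V g"]
    by eventually_elim (simp add: ring_distribs)
qed

lemma mult_op_scaleC:
  assumes "multipliable V f" "multipliable V (c *\<^sub>C f)"
  shows "mult_op V (c *\<^sub>C f) = c *\<^sub>C mult_op V f"
proof (rule L2_eqI)
  show "AE x in lebesgue. rep_L2 (mult_op V (c *\<^sub>C f)) x = rep_L2 (c *\<^sub>C mult_op V f) x"
    using rep_mult_op[OF assms(1)] rep_mult_op[OF assms(2)] rep_L2_scaleC[of c f]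
      rep_L2_scaleC[of c "mult_op V f"]
    by eventually_elim simp
qed

lemma mult_op_symmetric:
  assumes "multipliable V f" "multipliable V g"
  shows "cinner (mult_op V f) g = cinner f (mult_op V g)"
  unfolding cinner_rep
proof (intro integral_cong_AE)
  show "AE x in lebesgue. cnj (rep_L2 (mult_op V f) x) * rep_L2 g x = cnj (rep_L2 f x) * rep_L2 (mult_op V g) x"
    using rep_mult_op[OF assms(1)] rep_mult_op[OF assms(2)] by eventually_elim simp
qed (intro borel_measurable_times borel_measurable_cnj rep_L2_measurable)+

lemma L2_on_iff: "f \<in> L2_on \<Omega> \<longleftrightarrow> (AE x in lebesgue. x \<notin> \<Omega> \<longrightarrow> rep_L2 f x = 0)"
  by (simp add: L2_on_def vanishes_outside_def)

text \<open>The orthogonal projection onto \<open>L2_on \<Omega>\<close>. Composing with it turns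
  operators specified only on that subspace into total linear ones.\<close>

definition proj_L2 :: "'a::euclidean_space set \<Rightarrow> 'a L2 \<Rightarrow> 'a L2" where
  "proj_L2 \<Omega> = mult_op (indicator \<Omega>)"

lemma multipliable_indicator: "\<Omega> \<in> sets lebesgue \<Longrightarrow> multipliable (indicator \<Omega>) f"
proof -
  assume \<Omega>: "\<Omega> \<in> sets lebesgue"
  have "integrable lebesgue (\<lambda>x. (cmod (complex_of_real (indicator \<Omega> x) * rep_L2 f x))\<^sup>2)"
  proof (rule Bochner_Integration.integrable_bound)
    show "integrable lebesgue (\<lambda>x. (cmod (rep_L2 f x))\<^sup>2)"
      using rep_L2 by (simp add: square_integrable_def)
    show "(\<lambda>x. (cmod (complex_of_real (indicator \<Omega> x) * rep_L2 f x))\<^sup>2) \<in> borel_measurable lebesgue"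
      using \<Omega> by measurable
  qed (auto simp: indicator_def)
  moreover have "(\<lambda>x. complex_of_real (indicator \<Omega> x) * rep_L2 f x) \<in> borel_measurable lebesgue"
    using \<Omega> by measurable
  ultimately show ?thesis unfolding multipliable_def square_integrable_def by simp
qed

lemma rep_proj_L2:
  "\<Omega> \<in> sets lebesgue \<Longrightarrow> AE x in lebesgue. rep_L2 (proj_L2 \<Omega> f) x = indicator \<Omega> x * rep_L2 f x"
  using rep_mult_op[OF multipliable_indicator, of \<Omega> f] by (simp add: proj_L2_def of_real_indicator)

context
  fixes \<Omega> :: "'a::euclidean_space set"
  assumes \<Omega>: "\<Omega> \<in> sets lebesgue"
begin

lemma proj_L2_add: "proj_L2 \<Omega> (f + g) = proj_L2 \<Omega> f + proj_L2 \<Omega> g"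
  unfolding proj_L2_def by (intro mult_op_add multipliable_indicator \<Omega>)

lemma proj_L2_scaleC: "proj_L2 \<Omega> (c *\<^sub>C f) = c *\<^sub>C proj_L2 \<Omega> f"
  unfolding proj_L2_def by (intro mult_op_scaleC multipliable_indicator \<Omega>)

lemma proj_L2_symmetric: "cinner (proj_L2 \<Omega> f) g = cinner f (proj_L2 \<Omega> g)"
  unfolding proj_L2_def by (intro mult_op_symmetric multipliable_indicator \<Omega>)

lemma proj_L2_in: "proj_L2 \<Omega> f \<in> L2_on \<Omega>"
  unfolding L2_on_iff using rep_proj_L2[OF \<Omega>, of f] by eventually_elim (auto simp: indicator_def)

lemma proj_L2_eq_iff: "proj_L2 \<Omega> f = f \<longleftrightarrow> f \<in> L2_on \<Omega>"
proof
  assume f: "f \<in> L2_on \<Omega>"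
  show "proj_L2 \<Omega> f = f"
  proof (rule L2_eqI)
    show "AE x in lebesgue. rep_L2 (proj_L2 \<Omega> f) x = rep_L2 f x"
      using rep_proj_L2[OF \<Omega>, of f] f[unfolded L2_on_iff] by eventually_elim (auto simp: indicator_def)
  qed
qed (metis proj_L2_in)

lemma proj_L2_idem: "proj_L2 \<Omega> (proj_L2 \<Omega> f) = proj_L2 \<Omega> f"
  using proj_L2_eq_iff proj_L2_in by blast

lemma norm_proj_L2_le: "norm (proj_L2 \<Omega> f) \<le> norm f"
proof -
  have "cinner (proj_L2 \<Omega> f) (proj_L2 \<Omega> f) = cinner f (proj_L2 \<Omega> f)"
    by (simp add: proj_L2_symmetric proj_L2_idem)
  then have "cmod (complex_of_real ((norm (proj_L2 \<Omega> f))\<^sup>2)) \<le> norm f * norm (proj_L2 \<Omega> f)"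
    using cinner_cauchy_schwarz[of f "proj_L2 \<Omega> f"] by (simp only: cinner_self)
  then show ?thesis
    by (cases "norm (proj_L2 \<Omega> f) = 0") (auto simp: power2_eq_square norm_mult)
qed

lemma proj_L2_bounded_linear: "bounded_linear (proj_L2 \<Omega>)"
  by (rule bounded_linear_intro[of _ 1])
    (simp_all add: proj_L2_add proj_L2_scaleC scaleR_scaleC norm_proj_L2_le)

lemma L2_on_add: "f \<in> L2_on \<Omega> \<Longrightarrow> g \<in> L2_on \<Omega> \<Longrightarrow> f + g \<in> L2_on \<Omega>"
  by (simp add: proj_L2_eq_iff[symmetric] proj_L2_add)

lemma L2_on_scaleC: "f \<in> L2_on \<Omega> \<Longrightarrow> c *\<^sub>C f \<in> L2_on \<Omega>"
  by (simp add: proj_L2_eq_iff[symmetric] proj_L2_scaleC)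

lemma L2_on_closed: "closed (L2_on \<Omega>)"
proof -
  have "L2_on \<Omega> = {f. proj_L2 \<Omega> f = f}" by (simp add: proj_L2_eq_iff)
  also have "closed \<dots>"
    by (intro closed_Collect_eq continuous_intros bounded_linear.continuous_on[OF proj_L2_bounded_linear])
  finally show ?thesis .
qed

lemma L2_on_subspace: "subspace (L2_on \<Omega>)"
  unfolding subspace_def scaleR_scaleC
  using L2_on_add L2_on_scaleC proj_L2_eq_iff[of 0]
    linear_0[OF bounded_linear.linear[OF proj_L2_bounded_linear]] by simp

end

lemma Times_lebesgue:
  "\<Omega>\<^sub>1 \<in> sets lebesgue \<Longrightarrow> \<Omega>\<^sub>2 \<in> sets lebesgue \<Longrightarrow> \<Omega>\<^sub>1 \<times> \<Omega>\<^sub>2 \<in> sets lebesgue"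
proof -
  assume "\<Omega>\<^sub>1 \<in> sets lebesgue" "\<Omega>\<^sub>2 \<in> sets lebesgue"
  then have "(\<Omega>\<^sub>1 \<times> UNIV) \<inter> (UNIV \<times> \<Omega>\<^sub>2) \<in> sets lebesgue"
    by (intro sets.Int Times_UNIV_lebesgue)
  also have "(\<Omega>\<^sub>1 \<times> UNIV) \<inter> (UNIV \<times> \<Omega>\<^sub>2) = \<Omega>\<^sub>1 \<times> \<Omega>\<^sub>2" by auto
  finally show ?thesis .
qed

lemma proj_L2_tensor:
  fixes f :: "'a::euclidean_space L2" and g :: "'b::euclidean_space L2"
  assumes \<Omega>: "\<Omega>\<^sub>1 \<in> sets lebesgue" "\<Omega>\<^sub>2 \<in> sets lebesgue"
  shows "proj_L2 (\<Omega>\<^sub>1 \<times> \<Omega>\<^sub>2) (f \<otimes> g) = proj_L2 \<Omega>\<^sub>1 f \<otimes> proj_L2 \<Omega>\<^sub>2 g"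
proof (rule L2_eqI)
  show "AE z in lebesgue. rep_L2 (proj_L2 (\<Omega>\<^sub>1 \<times> \<Omega>\<^sub>2) (f \<otimes> g)) z = rep_L2 (proj_L2 \<Omega>\<^sub>1 f \<otimes> proj_L2 \<Omega>\<^sub>2 g) z"
    using rep_proj_L2[OF Times_lebesgue[OF \<Omega>], of "f \<otimes> g"] rep_L2_tensor[of f g]
      rep_L2_tensor[of "proj_L2 \<Omega>\<^sub>1 f" "proj_L2 \<Omega>\<^sub>2 g"]
      AE_lebesgue_fst[OF rep_proj_L2[OF \<Omega>(1), of f], where 'b = 'b]
      AE_lebesgue_snd[OF rep_proj_L2[OF \<Omega>(2), of g], where 'a = 'a]
    by eventually_elim (auto simp: indicator_def)
qed

lemma tensor_in_L2_on:
  assumes \<Omega>: "\<Omega>\<^sub>1 \<in> sets lebesgue" "\<Omega>\<^sub>2 \<in> sets lebesgue" and fg: "f \<in> L2_on \<Omega>\<^sub>1" "g \<in> L2_on \<Omega>\<^sub>2"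
  shows "f \<otimes> g \<in> L2_on (\<Omega>\<^sub>1 \<times> \<Omega>\<^sub>2)"
  using proj_L2_tensor[OF \<Omega>, of f g] fg proj_L2_eq_iff[OF \<Omega>(1), of f] proj_L2_eq_iff[OF \<Omega>(2), of g]
    proj_L2_eq_iff[OF Times_lebesgue[OF \<Omega>], of "f \<otimes> g"] by simp

text \<open>The projection fixes \<open>v\<close> and acts factorwise on tensors. The part of
  \<open>a\<close> outside the first domain, tensored with \<open>b\<close>, therefore pairs to zero
  with \<open>v\<close>, whereas this pairing is the nonzero singular value times the squared norm
  of that part.\<close>

lemma sing_term_in_L2_on:
  fixes v :: "('a::euclidean_space \<times> 'b::euclidean_space) L2"
  assumes \<Omega>: "\<Omega>\<^sub>1 \<in> sets lebesgue" "\<Omega>\<^sub>2 \<in> sets lebesgue" and v: "v \<in> L2_on (\<Omega>\<^sub>1 \<times> \<Omega>\<^sub>2)"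
    and nz: "sing_val v k \<noteq> 0"
  shows "sing_term v k \<in> L2_on (\<Omega>\<^sub>1 \<times> \<Omega>\<^sub>2)"
proof -
  define a b where "a = left_vec v k" and "b = right_vec v k"
  have form: "cinner (f \<otimes> g) v = cinner (proj_L2 \<Omega>\<^sub>1 f \<otimes> proj_L2 \<Omega>\<^sub>2 g) v" for f g
    using proj_L2_symmetric[OF Times_lebesgue[OF \<Omega>], of "f \<otimes> g" v] v
      proj_L2_eq_iff[OF Times_lebesgue[OF \<Omega>], of v] by (simp add: proj_L2_tensor[OF \<Omega>])
  have exp1: "cinner (f \<otimes> b) v = complex_of_real (sing_val v k) * cinner f a" for f
  proof -
    have "(\<lambda>j. cinner (f \<otimes> b) (sing_val v j *\<^sub>R sing_term v j)) sums cinner (f \<otimes> b) v"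
      by (rule bounded_linear.sums[OF bounded_bilinear.bounded_linear_right[OF cinner_bilinear] sing_val_sums])
    moreover have "(\<lambda>j. cinner (f \<otimes> b) (sing_val v j *\<^sub>R sing_term v j))
        = (\<lambda>j. if j = k then complex_of_real (sing_val v k) * cinner f a else 0)"
      using right_vec_orthonormal[of v]
      by (auto simp: orthonormal_on_def cinner_scaleR_right sing_term_def cinner_tensor a_def b_def fun_eq_iff)
    ultimately show ?thesis
      using sums_single[of k "\<lambda>_. complex_of_real (sing_val v k) * cinner f a"] sums_unique2 by fastforce
  qed
  have exp2: "cinner (a \<otimes> g) v = complex_of_real (sing_val v k) * cinner g b" for g
  proof -
    have "(\<lambda>j. cinner (a \<otimes> g) (sing_val v j *\<^sub>R sing_term v j)) sums cinner (a \<otimes> g) v"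
      by (rule bounded_linear.sums[OF bounded_bilinear.bounded_linear_right[OF cinner_bilinear] sing_val_sums])
    moreover have "(\<lambda>j. cinner (a \<otimes> g) (sing_val v j *\<^sub>R sing_term v j))
        = (\<lambda>j. if j = k then complex_of_real (sing_val v k) * cinner g b else 0)"
      using left_vec_orthonormal[of v]
      by (auto simp: orthonormal_on_def cinner_scaleR_right sing_term_def cinner_tensor a_def b_def fun_eq_iff)
    ultimately show ?thesis
      using sums_single[of k "\<lambda>_. complex_of_real (sing_val v k) * cinner g b"] sums_unique2 by fastforce
  qed
  have "proj_L2 \<Omega>\<^sub>1 a = a"
  proof -
    define f where "f = a - proj_L2 \<Omega>\<^sub>1 a"
    have pf: "proj_L2 \<Omega>\<^sub>1 f = 0"
      by (simp add: f_def linear_diff[OF bounded_linear.linear[OF proj_L2_bounded_linear[OF \<Omega>(1)]]]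
          proj_L2_idem[OF \<Omega>(1)])
    have "cinner (f \<otimes> b) v = 0" using form[of f b] pf by simp
    then have fa: "cinner f a = 0" using exp1[of f] nz by simp
    have "cinner f (proj_L2 \<Omega>\<^sub>1 a) = 0" using proj_L2_symmetric[OF \<Omega>(1), of f a] pf by simp
    with fa have "cinner f f = 0" by (simp add: f_def cinner_diff_right)
    then have "f = 0" by (simp add: cinner_self)
    then show ?thesis by (simp add: f_def)
  qed
  moreover have "proj_L2 \<Omega>\<^sub>2 b = b"
  proof -
    define g where "g = b - proj_L2 \<Omega>\<^sub>2 b"
    have pg: "proj_L2 \<Omega>\<^sub>2 g = 0"
      by (simp add: g_def linear_diff[OF bounded_linear.linear[OF proj_L2_bounded_linear[OF \<Omega>(2)]]]
          proj_L2_idem[OF \<Omega>(2)])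
    have "cinner (a \<otimes> g) v = 0" using form[of a g] pg by simp
    then have gb: "cinner g b = 0" using exp2[of g] nz by simp
    have "cinner g (proj_L2 \<Omega>\<^sub>2 b) = 0" using proj_L2_symmetric[OF \<Omega>(2), of g b] pg by simp
    with gb have "cinner g g = 0" by (simp add: g_def cinner_diff_right)
    then have "g = 0" by (simp add: cinner_self)
    then show ?thesis by (simp add: g_def)
  qed
  ultimately show ?thesis
    using tensor_in_L2_on[OF \<Omega>, of a b] proj_L2_in[OF \<Omega>(1), of a] proj_L2_in[OF \<Omega>(2), of b]
    by (simp add: sing_term_def a_def b_def)
qed

lemma sing_sum_in_L2_on:
  fixes v :: "('a::euclidean_space \<times> 'b::euclidean_space) L2"
  assumes \<Omega>: "\<Omega>\<^sub>1 \<in> sets lebesgue" "\<Omega>\<^sub>2 \<in> sets lebesgue" and v: "v \<in> L2_on (\<Omega>\<^sub>1 \<times> \<Omega>\<^sub>2)"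
    and x: "(\<lambda>k. c k *\<^sub>R sing_term v k) sums x" and c: "\<And>k. sing_val v k = 0 \<Longrightarrow> c k = 0"
  shows "x \<in> L2_on (\<Omega>\<^sub>1 \<times> \<Omega>\<^sub>2)"
proof -
  note P = proj_L2_bounded_linear[OF Times_lebesgue[OF \<Omega>]]
  have "(\<lambda>k. proj_L2 (\<Omega>\<^sub>1 \<times> \<Omega>\<^sub>2) (c k *\<^sub>R sing_term v k)) sums proj_L2 (\<Omega>\<^sub>1 \<times> \<Omega>\<^sub>2) x"
    by (rule bounded_linear.sums[OF P x])
  moreover have "proj_L2 (\<Omega>\<^sub>1 \<times> \<Omega>\<^sub>2) (c k *\<^sub>R sing_term v k) = c k *\<^sub>R sing_term v k" for k
    using sing_term_in_L2_on[OF \<Omega> v, of k] c[of k] proj_L2_eq_iff[OF Times_lebesgue[OF \<Omega>]]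
    by (cases "sing_val v k = 0") (simp_all add: linear_scale[OF bounded_linear.linear[OF P]]
        linear_0[OF bounded_linear.linear[OF P]])
  ultimately have "proj_L2 (\<Omega>\<^sub>1 \<times> \<Omega>\<^sub>2) x = x" using x sums_unique2 by auto
  then show ?thesis by (simp add: proj_L2_eq_iff[OF Times_lebesgue[OF \<Omega>]])
qed

lemma threshold_in_L2_on:
  fixes v :: "('a::euclidean_space \<times> 'b::euclidean_space) L2"
  assumes \<Omega>: "\<Omega>\<^sub>1 \<in> sets lebesgue" "\<Omega>\<^sub>2 \<in> sets lebesgue" and v: "v \<in> L2_on (\<Omega>\<^sub>1 \<times> \<Omega>\<^sub>2)"
  shows "0 \<le> \<alpha> \<Longrightarrow> soft_threshold \<alpha> v \<in> L2_on (\<Omega>\<^sub>1 \<times> \<Omega>\<^sub>2)"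
    and "hard_threshold \<alpha> v \<in> L2_on (\<Omega>\<^sub>1 \<times> \<Omega>\<^sub>2)"
    and "0 < \<delta> \<Longrightarrow> recompress \<delta> v \<in> L2_on (\<Omega>\<^sub>1 \<times> \<Omega>\<^sub>2)"
proof -
  show "soft_threshold \<alpha> v \<in> L2_on (\<Omega>\<^sub>1 \<times> \<Omega>\<^sub>2)" if "0 \<le> \<alpha>"
    by (rule sing_sum_in_L2_on[OF \<Omega> v soft_sums[OF that]]) (use that in simp)
  have "(\<lambda>k. (if sing_val v k > \<alpha> then sing_val v k else 0) *\<^sub>R sing_term v k) sums hard_threshold \<alpha> v"
    unfolding hard_threshold_def by (rule sing_coeff_sums) auto
  then show "hard_threshold \<alpha> v \<in> L2_on (\<Omega>\<^sub>1 \<times> \<Omega>\<^sub>2)"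
    by (rule sing_sum_in_L2_on[OF \<Omega> v]) simp
  show "recompress \<delta> v \<in> L2_on (\<Omega>\<^sub>1 \<times> \<Omega>\<^sub>2)" if \<delta>: "0 < \<delta>"
  proof -
    obtain r where r: "recompress \<delta> v = (\<Sum>k<r. sing_val v k *\<^sub>R sing_term v k)"
      using recompress_props[OF \<delta>, of v] by metis
    have "(\<lambda>k. (if k < r then sing_val v k else 0) *\<^sub>R sing_term v k) sums
        (\<Sum>k<r. (if k < r then sing_val v k else 0) *\<^sub>R sing_term v k)"
      by (rule sums_finite) auto
    then have "(\<lambda>k. (if k < r then sing_val v k else 0) *\<^sub>R sing_term v k) sums recompress \<delta> v"
      unfolding r by simp
    then show ?thesis by (rule sing_sum_in_L2_on[OF \<Omega> v]) simp
  qed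
qed

subsection \<open>The rank of a product with the potential\<close>

text \<open>By Eckart--Young the tail of \<open>x\<close> beyond p is at most the squared distance
  to any element of rank p, hence zero.\<close>

lemma tensor_rank_le_closed:
  assumes "\<And>\<epsilon>. 0 < \<epsilon> \<Longrightarrow> \<exists>y. tensor_rank_le p y \<and> norm (x - y) < \<epsilon>"
  shows "tensor_rank_le p x"
proof -
  have "tail_sq x p \<le> 0"
  proof (rule field_le_epsilon)
    fix e :: real assume "0 < e"
    then obtain y where y: "tensor_rank_le p y" "norm (x - y) < sqrt e" using assms[of "sqrt e"] by auto
    have "tail_sq x p \<le> (norm (x - y))\<^sup>2" by (rule eckart_young[OF y(1)])
    also have "\<dots> \<le> (sqrt e)\<^sup>2" using y(2) by (intro power_mono) auto
    finally show "tail_sq x p \<le> 0 + e" using \<open>0 < e\<close> by simp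
  qed
  have "sing_val x k = 0" if "p \<le> k" for k
  proof -
    have "(sing_val x ((k - p) + p))\<^sup>2 \<le> tail_sq x p"
      using sum_le_suminf[OF tail_summable[of x p], of "{k - p}"] by (simp add: tail_sq_def)
    with \<open>tail_sq x p \<le> 0\<close> have "(sing_val x ((k - p) + p))\<^sup>2 \<le> 0" by linarith
    with that show ?thesis by simp
  qed
  then have sub: "{k. sing_val x k \<noteq> 0} \<subseteq> {..<p}" using not_less by blast
  then have "rank_L2 x \<le> enat p"
    using finite_subset[OF sub] card_mono[OF _ sub] by (simp add: rank_L2_def)
  then show ?thesis by (rule tensor_rank_le_if_rank)
qed

text \<open>
  The factors need not be square integrable, so they are truncated to sets on which they are bounded.
\<close>

lemma tensor_rank_le_products:
  fixes x :: "('a::euclidean_space \<times> 'b::euclidean_space) L2"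
    and F :: "nat \<Rightarrow> 'a \<Rightarrow> complex" and G :: "nat \<Rightarrow> 'b \<Rightarrow> complex"
  assumes F: "\<And>l. F l \<in> borel_measurable lebesgue" and G: "\<And>l. G l \<in> borel_measurable lebesgue"
    and x: "AE z in lebesgue. rep_L2 x z = (\<Sum>l<R. F l (fst z) * G l (snd z))"
  shows "tensor_rank_le R x"
proof -
  note [measurable] = F G
  define A where "A = (\<lambda>n::nat. {s. norm s \<le> real n \<and> (\<forall>l<R. cmod (F l s) \<le> real n)})"
  define B where "B = (\<lambda>n::nat. {s. norm s \<le> real n \<and> (\<forall>l<R. cmod (G l s) \<le> real n)})"
  have trunc: "square_integrable (\<lambda>s. indicator {s. norm s \<le> real n \<and> (\<forall>l<R. cmod (H l s) \<le> real n)} s * H l s)"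
    and meas: "{s. norm s \<le> real n \<and> (\<forall>l<R. cmod (H l s) \<le> real n)} \<in> sets lebesgue"
    if H: "\<And>l. H l \<in> borel_measurable lebesgue" and l: "l < R"
    for H :: "nat \<Rightarrow> 'c::euclidean_space \<Rightarrow> complex" and n l
  proof -
    note [measurable] = H
    let ?S = "{s. norm s \<le> real n \<and> (\<forall>l<R. cmod (H l s) \<le> real n)}"
    have "?S = cball 0 (real n) \<inter> (\<Inter>l\<in>{..<R}. {s\<in>space lebesgue. cmod (H l s) \<le> real n})"
      using l by auto
    also have "\<dots> \<in> sets lebesgue"
    proof (intro sets.Int sets.finite_INT)
      show "{s\<in>space lebesgue. cmod (H k s) \<le> real n} \<in> sets lebesgue" for k by measurable
    qed (use l in auto)
    finally show S: "?S \<in> sets lebesgue" .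
    define T where "T = ?S"
    have T: "T \<in> sets lebesgue" unfolding T_def by (rule S)
    have m: "(\<lambda>s. indicator T s * H l s) \<in> borel_measurable lebesgue"
      by (intro borel_measurable_times borel_measurable_indicator T H)
    have int: "integrable lebesgue (\<lambda>s::'c. (real n)\<^sup>2 * indicator (cball 0 (real n)) s)"
      by (rule integrable_mult_right) (rule lmeasurable_cball[unfolded lmeasurable_iff_integrable])
    have "integrable lebesgue (\<lambda>s. (cmod (indicator T s * H l s))\<^sup>2)"
    proof (rule Bochner_Integration.integrable_bound[OF int])
      show "(\<lambda>s. (cmod (indicator T s * H l s))\<^sup>2) \<in> borel_measurable lebesgue"
        by (rule borel_measurable_power, rule measurable_compose[OF m borel_measurable_norm])
      show "AE s in lebesgue. norm ((cmod (indicator T s * H l s))\<^sup>2)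
          \<le> norm ((real n)\<^sup>2 * indicator (cball 0 (real n)) s)"
        using l by (intro AE_I2) (auto simp: indicator_def power_mono T_def)
    qed
    with m have "square_integrable (\<lambda>s. indicator T s * H l s)"
      unfolding square_integrable_def by blast
    then show "square_integrable (\<lambda>s. indicator ?S s * H l s)" unfolding T_def .
  qed
  show ?thesis
  proof (cases "R = 0")
    case True
    have "AE z in lebesgue. rep_L2 x z = rep_L2 0 z"
      using x rep_L2_zero by eventually_elim (simp add: True)
    then have "x = 0" by (rule L2_eqI)
    then show ?thesis by simp
  next
    case False
    define y where "y = (\<lambda>n. \<Sum>l<R. abs_L2 (\<lambda>s. indicator (A n) s * F l s) \<otimes> abs_L2 (\<lambda>s. indicator (B n) s * G l s))"
    have AB: "A n \<in> sets lebesgue" "B n \<in> sets lebesgue" for n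
    proof -
      have "0 < R" using False by simp
      then show "A n \<in> sets lebesgue" "B n \<in> sets lebesgue"
        unfolding A_def B_def by (rule meas[OF F], rule meas[OF G])
    qed
    have rank: "tensor_rank_le R (y n)" for n
    proof -
      have "tensor_rank_le (\<Sum>l<R. 1) (y n)"
        unfolding y_def by (intro tensor_rank_le_sum finite_lessThan tensor_rank_le_single)
      then show ?thesis by simp
    qed
    have y: "AE z in lebesgue. rep_L2 (y n) z = indicator (A n \<times> B n) z * rep_L2 x z" for n
    proof -
      have "AE z in lebesgue. rep_L2 (\<Sum>l<r. abs_L2 (\<lambda>s. indicator (A n) s * F l s) \<otimes> abs_L2 (\<lambda>s. indicator (B n) s * G l s)) z
          = indicator (A n \<times> B n) z * (\<Sum>l<r. F l (fst z) * G l (snd z))" if "r \<le> R" for r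
        using that
      proof (induction r)
        case 0
        show ?case using rep_L2_zero by eventually_elim simp
      next
        case (Suc r)
        let ?f = "abs_L2 (\<lambda>s. indicator (A n) s * F r s)" and ?g = "abs_L2 (\<lambda>s. indicator (B n) s * G r s)"
        let ?y = "\<Sum>l<r. abs_L2 (\<lambda>s. indicator (A n) s * F l s) \<otimes> abs_L2 (\<lambda>s. indicator (B n) s * G l s)"
        have f: "AE s in lebesgue. rep_L2 ?f s = indicator (A n) s * F r s"
          unfolding A_def by (rule rep_abs_L2[OF trunc[OF F]]) (use Suc.prems in simp)
        have g: "AE s in lebesgue. rep_L2 ?g s = indicator (B n) s * G r s"
          unfolding B_def by (rule rep_abs_L2[OF trunc[OF G]]) (use Suc.prems in simp)
        have "AE z in lebesgue. rep_L2 (?y + ?f \<otimes> ?g) z = indicator (A n \<times> B n) z * (\<Sum>l<Suc r. F l (fst z) * G l (snd z))"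
          using Suc.IH[OF Suc_leD[OF Suc.prems]] rep_L2_add[of ?y "?f \<otimes> ?g"] rep_L2_tensor[of ?f ?g]
            AE_lebesgue_fst[OF f, where 'b = 'b] AE_lebesgue_snd[OF g, where 'a = 'a]
          by eventually_elim (auto simp: indicator_times algebra_simps)
        then show ?case by simp
      qed
      from this[OF order_refl] x show ?thesis unfolding y_def by eventually_elim simp
    qed
    have "(\<lambda>n. \<integral>z. (cmod (rep_L2 (x - y n) z))\<^sup>2 \<partial>lebesgue) \<longlonglongrightarrow> integral\<^sup>L (lebesgue :: ('a \<times> 'b) measure) (\<lambda>_. 0 :: real)"
    proof (rule integral_dominated_convergence[where w = "\<lambda>z. (cmod (rep_L2 x z))\<^sup>2"])
      show "integrable lebesgue (\<lambda>z. (cmod (rep_L2 x z))\<^sup>2)"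
        using rep_L2 by (simp add: square_integrable_def)
      show "(\<lambda>z. (cmod (rep_L2 (x - y n) z))\<^sup>2) \<in> borel_measurable lebesgue" for n by measurable
      have yall: "AE z in lebesgue. \<forall>n. rep_L2 (x - y n) z = (1 - indicator (A n \<times> B n) z) * rep_L2 x z"
        unfolding AE_all_countable
      proof
        fix n
        show "AE z in lebesgue. rep_L2 (x - y n) z = (1 - indicator (A n \<times> B n) z) * rep_L2 x z"
          using y[of n] rep_L2_diff[of x "y n"] by eventually_elim (simp add: algebra_simps)
      qed
      show "AE z in lebesgue. norm ((cmod (rep_L2 (x - y n) z))\<^sup>2) \<le> (cmod (rep_L2 x z))\<^sup>2" for n
        using yall by eventually_elim (auto simp: indicator_def)
      show "AE z in lebesgue. (\<lambda>n. (cmod (rep_L2 (x - y n) z))\<^sup>2) \<longlonglongrightarrow> 0"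
        using yall
      proof eventually_elim
        case (elim z)
        define S where "S = norm (fst z) + norm (snd z) + (\<Sum>l<R. cmod (F l (fst z)) + cmod (G l (snd z)))"
        obtain N :: nat where N: "S \<le> real N" using real_arch_simple by blast
        have S0: "0 \<le> (\<Sum>l<R. cmod (F l (fst z)) + cmod (G l (snd z)))" by (intro sum_nonneg) auto
        have Sl: "cmod (F l (fst z)) + cmod (G l (snd z)) \<le> (\<Sum>l<R. cmod (F l (fst z)) + cmod (G l (snd z)))"
          if "l < R" for l
          using that by (intro member_le_sum) auto
        have "z \<in> A n \<times> B n" if "N \<le> n" for n
        proof -
          have "real N \<le> real n" using that by simp
          then have le: "S \<le> real n" using N by simp
          have F': "cmod (F l (fst z)) \<le> real n" "cmod (G l (snd z)) \<le> real n" if "l < R" for l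
            using Sl[OF that] le norm_ge_zero[of "fst z"] norm_ge_zero[of "snd z"]
              norm_ge_zero[of "F l (fst z)"] norm_ge_zero[of "G l (snd z)"] unfolding S_def by linarith+
          have "norm (fst z) \<le> real n" "norm (snd z) \<le> real n"
            using S0 le norm_ge_zero[of "fst z"] norm_ge_zero[of "snd z"] unfolding S_def by linarith+
          with F' show ?thesis by (cases z) (auto simp: A_def B_def)
        qed
        then have "(cmod (rep_L2 (x - y n) z))\<^sup>2 = 0" if "N \<le> n" for n
          using elim that by simp
        then show ?case
          by (intro tendsto_eventually eventually_sequentiallyI[of N]) auto
      qed
    qed simp
    moreover have "(\<integral>z. (cmod (rep_L2 w z))\<^sup>2 \<partial>lebesgue) = (norm w)\<^sup>2" for w :: "('a \<times> 'b) L2"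
      using norm_abs_L2[OF rep_L2[of w]] by simp
    ultimately have lim: "(\<lambda>n. (norm (x - y n))\<^sup>2) \<longlonglongrightarrow> 0" by simp
    show ?thesis
    proof (rule tensor_rank_le_closed)
      fix \<epsilon> :: real assume \<epsilon>: "0 < \<epsilon>"
      then have "0 < \<epsilon>\<^sup>2" by simp
      from LIMSEQ_D[OF lim this] obtain n where "(norm (x - y n))\<^sup>2 < \<epsilon>\<^sup>2" by auto
      then have "norm (x - y n) < \<epsilon>" by (rule power2_less_imp_less) (use \<epsilon> in simp)
      with rank show "\<exists>y. tensor_rank_le R y \<and> norm (x - y) < \<epsilon>" by blast
    qed
  qed
qed

lemma rep_L2_tensor_sum:
  "AE z in lebesgue. rep_L2 (\<Sum>l<(R::nat). f l \<otimes> g l) z = (\<Sum>l<R. rep_L2 (f l) (fst z) * rep_L2 (g l) (snd z))"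
proof (induction R)
  case 0
  show ?case using rep_L2_zero by eventually_elim simp
next
  case (Suc R)
  have "AE z in lebesgue. rep_L2 ((\<Sum>l<R. f l \<otimes> g l) + f R \<otimes> g R) z
      = (\<Sum>l<Suc R. rep_L2 (f l) (fst z) * rep_L2 (g l) (snd z))"
    using Suc.IH rep_L2_add[of "\<Sum>l<R. f l \<otimes> g l" "f R \<otimes> g R"] rep_L2_tensor[of "f R" "g R"]
    by eventually_elim simp
  then show ?case by simp
qed

text \<open>A factor of V times \<open>f\<close> or \<open>g\<close> is a product of two square
  integrable functions and in general only integrable, which is why
  \<open>tensor_rank_le_products\<close> works with measurable factors.\<close>

lemma mult_op_tensor_rank:
  assumes \<Omega>: "\<Omega>\<^sub>1 \<in> sets lebesgue" "\<Omega>\<^sub>2 \<in> sets lebesgue" and V: "separable_repr \<Omega>\<^sub>1 \<Omega>\<^sub>2 V R"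
    and f: "f \<in> L2_on \<Omega>\<^sub>1" and g: "g \<in> L2_on \<Omega>\<^sub>2" and m: "multipliable V (f \<otimes> g)"
  shows "tensor_rank_le R (mult_op V (f \<otimes> g))"
proof -
  obtain V\<^sub>1 V\<^sub>2 where V': "AE z in lebesgue. z \<in> \<Omega>\<^sub>1 \<times> \<Omega>\<^sub>2 \<longrightarrow>
      complex_of_real (V z) = rep_L2 (\<Sum>l<R. V\<^sub>1 l \<otimes> V\<^sub>2 l) z"
    using V unfolding separable_repr_def by blast
  show ?thesis
  proof (rule tensor_rank_le_products)
    show "(\<lambda>s. rep_L2 (V\<^sub>1 l) s * rep_L2 f s) \<in> borel_measurable lebesgue" for l
      by (intro borel_measurable_times rep_L2_measurable)
    show "(\<lambda>s. rep_L2 (V\<^sub>2 l) s * rep_L2 g s) \<in> borel_measurable lebesgue" for l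
      by (intro borel_measurable_times rep_L2_measurable)
    show "AE z in lebesgue. rep_L2 (mult_op V (f \<otimes> g)) z =
        (\<Sum>l<R. rep_L2 (V\<^sub>1 l) (fst z) * rep_L2 f (fst z) * (rep_L2 (V\<^sub>2 l) (snd z) * rep_L2 g (snd z)))"
      using V' rep_mult_op[OF m] rep_L2_tensor[of f g] rep_L2_tensor_sum[where R = R and f = V\<^sub>1 and g = V\<^sub>2]
        tensor_in_L2_on[OF \<Omega> f g, unfolded L2_on_iff]
    proof eventually_elim
      case (elim z)
      show ?case
      proof (cases "z \<in> \<Omega>\<^sub>1 \<times> \<Omega>\<^sub>2")
        case True
        with elim show ?thesis by (simp add: sum_distrib_left sum_distrib_right mult_ac)
      next
        case False
        with elim have "rep_L2 f (fst z) * rep_L2 g (snd z) = 0" by simp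
        with elim False show ?thesis by (auto intro!: sum.neutral)
      qed
    qed
  qed
qed

subsection \<open>Unitary groups\<close>

lemma inner_eq_if_norm_eq:
  fixes x y :: "'a::real_inner" and x' y' :: "'b::real_inner"
  assumes "norm (x' + y') = norm (x + y)" "norm x' = norm x" "norm y' = norm y"
  shows "inner x' y' = inner x y"
  using assms by (simp add: dot_norm)

lemma cinner_eq_if_inner:
  assumes "\<And>c. inner (c *\<^sub>C f) g = inner (c *\<^sub>C f') g'"
  shows "cinner f g = cinner f' g'"
proof (rule complex_eqI)
  show "Re (cinner f g) = Re (cinner f' g')" using assms[of 1] by (simp add: inner_L2_def)
  show "Im (cinner f g) = Im (cinner f' g')"
    using assms[of \<i>] by (simp add: inner_L2_def cinner_scaleC_left)
qed

lemma proj_L2_on: "\<Omega> \<in> sets lebesgue \<Longrightarrow> f \<in> L2_on \<Omega> \<Longrightarrow> proj_L2 \<Omega> f = f"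
  by (simp add: proj_L2_eq_iff)

locale unitary_group =
  fixes \<Omega> :: "'a::euclidean_space set" and U :: "real \<Rightarrow> 'a L2 \<Rightarrow> 'a L2"
  assumes \<Omega>: "\<Omega> \<in> sets lebesgue" and U: "unitary_group_on (L2_on \<Omega>) U"
begin

text \<open>\<open>U\<close> is specified on the subspace only. This extension by zero on the
  orthogonal complement makes linearity and norm bounds hold without side conditions.\<close>

definition W :: "real \<Rightarrow> 'a L2 \<Rightarrow> 'a L2" where
  "W t f = U t (proj_L2 \<Omega> f)"

lemma W_eq_U: "f \<in> L2_on \<Omega> \<Longrightarrow> W t f = U t f"
  by (simp add: W_def proj_L2_on[OF \<Omega>])

lemma W_in: "W t f \<in> L2_on \<Omega>"
  using U proj_L2_in[OF \<Omega>, of f] by (simp add: W_def unitary_group_on_def)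

lemma proj_W [simp]: "proj_L2 \<Omega> (W t f) = W t f"
  using W_in proj_L2_eq_iff[OF \<Omega>] by blast

lemma W_proj [simp]: "W t (proj_L2 \<Omega> f) = W t f"
  by (simp add: W_def proj_L2_idem[OF \<Omega>])

lemma W_add: "W t (f + g) = W t f + W t g"
  using U proj_L2_in[OF \<Omega>] by (simp add: W_def unitary_group_on_def proj_L2_add[OF \<Omega>])

lemma W_scaleC: "W t (c *\<^sub>C f) = c *\<^sub>C W t f"
  using U proj_L2_in[OF \<Omega>] by (simp add: W_def unitary_group_on_def proj_L2_scaleC[OF \<Omega>])

lemma norm_W: "norm (W t f) = norm (proj_L2 \<Omega> f)"
  using U proj_L2_in[OF \<Omega>, of f] by (simp add: W_def unitary_group_on_def)

lemma norm_W_le: "norm (W t f) \<le> norm f"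
  by (simp add: norm_W norm_proj_L2_le[OF \<Omega>])

lemma norm_W_on: "f \<in> L2_on \<Omega> \<Longrightarrow> norm (W t f) = norm f"
  by (simp add: norm_W proj_L2_on[OF \<Omega>])

lemma W_0: "W 0 f = proj_L2 \<Omega> f"
  using U proj_L2_in[OF \<Omega>, of f] by (simp add: W_def unitary_group_on_def)

lemma W_W: "W s (W t f) = W (s + t) f"
  using U proj_L2_in[OF \<Omega>, of f] W_in[of t f]
  by (simp add: W_eq_U) (simp add: W_def unitary_group_on_def)

lemma W_bounded_linear: "bounded_linear (W t)"
  by (rule bounded_linear_intro[of _ 1]) (simp_all add: W_add W_scaleC scaleR_scaleC norm_W_le)

lemmas W_linear = bounded_linear.linear[OF W_bounded_linear]
lemmas W_zero [simp] = linear_0[OF W_linear]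
  and W_diff = linear_diff[OF W_linear]
  and W_scaleR = linear_scale[OF W_linear]
  and W_sum = linear_sum[OF W_linear]

lemma W_continuous: "continuous_on A (\<lambda>t. W t f)"
proof -
  have "continuous_on UNIV (\<lambda>t. W t f)"
    using U proj_L2_in[OF \<Omega>, of f] by (simp add: W_def unitary_group_on_def)
  then show ?thesis by (rule continuous_on_subset) simp
qed

lemma W_tendsto:
  assumes "(\<phi> \<longlongrightarrow> t) F" "(x \<longlongrightarrow> y) F"
  shows "((\<lambda>s. W (\<phi> s) (x s)) \<longlongrightarrow> W t y) F"
proof -
  have "isCont (\<lambda>t. W t y) t" using W_continuous[of UNIV y] by (simp add: continuous_on_eq_continuous_at)
  then have 1: "((\<lambda>s. W (\<phi> s) y) \<longlongrightarrow> W t y) F" by (rule isCont_tendsto_compose[OF _ assms(1)])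
  have "((\<lambda>s. x s - y) \<longlongrightarrow> y - y) F" by (intro tendsto_intros assms)
  then have "((\<lambda>s. norm (x s - y)) \<longlongrightarrow> 0) F" by (simp add: tendsto_norm_zero)
  then have 2: "((\<lambda>s. W (\<phi> s) (x s - y)) \<longlongrightarrow> 0) F"
    by (rule Lim_null_comparison[OF always_eventually, rotated]) (simp add: norm_W_le)
  from tendsto_add[OF 1 2] show ?thesis by (simp add: W_diff)
qed

lemma W_continuous_on:
  assumes "continuous_on A \<phi>" "continuous_on A x"
  shows "continuous_on A (\<lambda>s. W (\<phi> s) (x s))"
  using assms unfolding continuous_on_def by (auto intro: W_tendsto)

text \<open>Polarization turns preservation of norms into preservation of inner products, and on the
  subspace \<open>W (- t)\<close> is the inverse of \<open>W t\<close>.\<close>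

lemma W_adjoint: "inner (W t f) g = inner f (W (- t) g)"
proof -
  let ?P = "proj_L2 \<Omega>"
  have P: "inner (?P x) y = inner x (?P y)" for x y by (simp add: inner_L2_def proj_L2_symmetric[OF \<Omega>])
  have iso: "inner (W t x) (W t y) = inner (?P x) (?P y)" for x y
  proof (rule inner_eq_if_norm_eq)
    show "norm (W t x + W t y) = norm (?P x + ?P y)"
      by (simp only: W_add[symmetric] norm_W proj_L2_add[OF \<Omega>])
  qed (simp_all add: norm_W)
  have "inner (W t f) g = inner (W t f) (?P g)" using P[of "W t f" g] by simp
  also have "?P g = W t (W (- t) g)" by (simp add: W_W W_0)
  also have "inner (W t f) (W t (W (- t) g)) = inner f (W (- t) g)"
    using P[of f "W (- t) g"] by (simp add: iso)
  finally show ?thesis .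
qed

lemma W_cadjoint: "cinner (W t f) g = cinner f (W (- t) g)"
  by (rule cinner_eq_if_inner) (simp add: W_scaleC[symmetric] W_adjoint)

lemma generator_derivative:
  assumes A: "is_exp_i (L2_on \<Omega>) A U" and f: "f \<in> L2_on \<Omega>" "(f, a) \<in> A"
  shows "((\<lambda>s. W s f) has_vector_derivative W t (\<i> *\<^sub>C a)) (at t within I)"
proof -
  have "((\<lambda>s. W s f) has_vector_derivative \<i> *\<^sub>C a) (at (t - t))"
    using A f by (simp add: is_exp_i_def W_eq_U)
  moreover have "((\<lambda>s. s - t) has_vector_derivative 1) (at t)"
    by (auto intro!: derivative_eq_intros)
  ultimately have "((\<lambda>s. W (s - t) f) has_vector_derivative 1 *\<^sub>R (\<i> *\<^sub>C a)) (at t)"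
    using vector_diff_chain_at[of "\<lambda>s. s - t" 1 t "\<lambda>s. W s f" "\<i> *\<^sub>C a"] by (simp add: o_def)
  from bounded_linear.has_vector_derivative[OF W_bounded_linear[of t] this]
  have "((\<lambda>s. W s f) has_vector_derivative W t (\<i> *\<^sub>C a)) (at t)"
    by (simp add: W_W)
  then show ?thesis by (rule has_vector_derivative_at_within)
qed

lemma generator_invariant:
  assumes A: "is_exp_i (L2_on \<Omega>) A U" and f: "f \<in> L2_on \<Omega>" "(f, a) \<in> A"
  shows "(W t f, W t a) \<in> A"
proof -
  have "((\<lambda>s. W t (W s f)) has_vector_derivative W t (W 0 (\<i> *\<^sub>C a))) (at 0)"
    by (intro bounded_linear.has_vector_derivative[OF W_bounded_linear] generator_derivative[OF A f])
  then have "((\<lambda>s. U s (W t f)) has_vector_derivative \<i> *\<^sub>C W t a) (at 0)"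
    by (simp add: W_W W_scaleC add.commute W_eq_U[OF W_in, symmetric])
  then show ?thesis using A W_in unfolding is_exp_i_def by blast
qed

text \<open>The orbit of a vector under the group is known to be differentiable only for vectors in
  the domain of the generator. The value \<open>w t\<close>, which lies there, is split off; for the
  increment \<open>w s - w t\<close>, strong continuity and the norm bound of \<open>W\<close>
  suffice.\<close>

lemma twisted_derivative:
  assumes A: "is_exp_i (L2_on \<Omega>) A U" and a: "w t \<in> L2_on \<Omega>" "(w t, a) \<in> A"
    and w: "(w has_vector_derivative w') (at t within I)"
  shows "((\<lambda>s. W (- s) (w s)) has_vector_derivative W (- t) (w' - \<i> *\<^sub>C a)) (at t within I)"
proof -
  have "((\<lambda>s. W s (w t)) has_vector_derivative W (- t) (\<i> *\<^sub>C a)) (at (- t) within uminus ` I)"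
    by (rule generator_derivative[OF A a])
  moreover have "((\<lambda>s. - s) has_vector_derivative -1) (at t within I)"
    by (auto intro!: derivative_eq_intros)
  ultimately have 1: "((\<lambda>s. W (- s) (w t)) has_vector_derivative - W (- t) (\<i> *\<^sub>C a)) (at t within I)"
    using vector_diff_chain_within[of uminus "-1" t I "\<lambda>s. W s (w t)" "W (- t) (\<i> *\<^sub>C a)"]
    by (simp add: o_def)
  have 2: "((\<lambda>s. W (- s) (w s - w t)) has_vector_derivative W (- t) w') (at t within I)"
    unfolding has_vector_derivative_def has_derivative_within
  proof (intro conjI bounded_linear_scaleR_left)
    let ?q = "\<lambda>s. (1 / norm (s - t)) *\<^sub>R (w s - (w t + (s - t) *\<^sub>R w'))"
    have q: "(?q \<longlongrightarrow> 0) (at t within I)"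
      using w unfolding has_vector_derivative_def has_derivative_within by blast
    have "((\<lambda>s. W (- s) w' - W (- t) w') \<longlongrightarrow> W (- t) w' - W (- t) w') (at t within I)"
      by (intro tendsto_diff tendsto_const W_tendsto tendsto_minus tendsto_ident_at)
    then have d: "((\<lambda>s. norm (?q s) + norm (W (- s) w' - W (- t) w')) \<longlongrightarrow> 0 + 0) (at t within I)"
      by (intro tendsto_add tendsto_norm_zero q) simp
    then have d0: "((\<lambda>s. norm (?q s) + norm (W (- s) w' - W (- t) w')) \<longlongrightarrow> 0) (at t within I)"
      by (simp only: add_0_left)
    show "((\<lambda>s. (1 / norm (s - t)) *\<^sub>R (W (- s) (w s - w t) - (W (- t) (w t - w t) + (s - t) *\<^sub>R W (- t) w'))) \<longlongrightarrow> 0)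
      (at t within I)"
    proof (rule Lim_null_comparison[OF _ d0], rule always_eventually, rule allI)
      fix s
      define d where "d = s - t"
      have "(1 / norm (s - t)) *\<^sub>R (W (- s) (w s - w t) - (W (- t) (w t - w t) + (s - t) *\<^sub>R W (- t) w'))
        = W (- s) (?q s) + (1 / norm (s - t) * (s - t)) *\<^sub>R (W (- s) w' - W (- t) w')"
        unfolding d_def[symmetric]
        by (simp add: W_scaleR W_diff W_add scaleR_diff_right scaleR_add_right)
      also have "norm \<dots> \<le> norm (?q s) + 1 * norm (W (- s) w' - W (- t) w')"
      proof -
        have n1: "norm (W (- s) (?q s)) \<le> norm (?q s)" by (rule norm_W_le)
        have "\<bar>1 / norm (s - t) * (s - t)\<bar> \<le> 1" by (cases "s = t") auto
        then have "norm ((1 / norm (s - t) * (s - t)) *\<^sub>R (W (- s) w' - W (- t) w')) \<le> 1 * norm (W (- s) w' - W (- t) w')"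
          unfolding norm_scaleR by (rule mult_right_mono) simp
        with n1 show ?thesis by (rule norm_triangle_mono)
      qed
      finally show "norm ((1 / norm (s - t)) *\<^sub>R (W (- s) (w s - w t) - (W (- t) (w t - w t) + (s - t) *\<^sub>R W (- t) w')))
        \<le> norm (?q s) + norm (W (- s) w' - W (- t) w')" by simp
    qed
  qed
  from has_vector_derivative_add[OF 1 2] show ?thesis by (simp add: W_diff)
qed

end

section \<open>Groups acting factorwise on tensors\<close>

locale tensor_unitary_group =
  G1: unitary_group \<Omega>\<^sub>1 U\<^sub>1 + G2: unitary_group \<Omega>\<^sub>2 U\<^sub>2 + G: unitary_group "\<Omega>\<^sub>1 \<times> \<Omega>\<^sub>2" U
  for \<Omega>\<^sub>1 :: "'a::euclidean_space set" and \<Omega>\<^sub>2 :: "'b::euclidean_space set"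
    and U\<^sub>1 U\<^sub>2 and U :: "real \<Rightarrow> ('a \<times> 'b) L2 \<Rightarrow> ('a \<times> 'b) L2" +
  fixes \<Delta>\<^sub>1 :: "'a L2 rel" and \<Delta>\<^sub>2 :: "'b L2 rel"
  assumes exp1: "is_exp_i (L2_on \<Omega>\<^sub>1) \<Delta>\<^sub>1 U\<^sub>1" and exp2: "is_exp_i (L2_on \<Omega>\<^sub>2) \<Delta>\<^sub>2 U\<^sub>2"
    and exp: "is_exp_i (L2_on (\<Omega>\<^sub>1 \<times> \<Omega>\<^sub>2)) (tensor_sum \<Delta>\<^sub>1 \<Delta>\<^sub>2) U"
    and sa1: "self_adjoint_on (L2_on \<Omega>\<^sub>1) \<Delta>\<^sub>1" and sa2: "self_adjoint_on (L2_on \<Omega>\<^sub>2) \<Delta>\<^sub>2"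
begin

lemma tensor_sum_mem:
  "(f, f') \<in> \<Delta>\<^sub>1 \<Longrightarrow> (g, g') \<in> \<Delta>\<^sub>2 \<Longrightarrow> (f \<otimes> g, f' \<otimes> g + f \<otimes> g') \<in> tensor_sum \<Delta>\<^sub>1 \<Delta>\<^sub>2"
  unfolding tensor_sum_def by (rule subsetD[OF closure_subset], rule span_base) blast

lemma tensor_sum_subset: "tensor_sum \<Delta>\<^sub>1 \<Delta>\<^sub>2 \<subseteq> L2_on (\<Omega>\<^sub>1 \<times> \<Omega>\<^sub>2) \<times> L2_on (\<Omega>\<^sub>1 \<times> \<Omega>\<^sub>2)"
  unfolding tensor_sum_def
proof (rule closure_minimal[OF span_minimal])
  let ?S = "L2_on (\<Omega>\<^sub>1 \<times> \<Omega>\<^sub>2)"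
  have "\<Delta>\<^sub>1 \<subseteq> L2_on \<Omega>\<^sub>1 \<times> L2_on \<Omega>\<^sub>1" "\<Delta>\<^sub>2 \<subseteq> L2_on \<Omega>\<^sub>2 \<times> L2_on \<Omega>\<^sub>2"
    using sa1 sa2 by (auto simp: self_adjoint_on_def)
  then show "{(f \<otimes> g, f' \<otimes> g + f \<otimes> g') |f f' g g'. (f, f') \<in> \<Delta>\<^sub>1 \<and> (g, g') \<in> \<Delta>\<^sub>2} \<subseteq> ?S \<times> ?S"
    by (auto intro!: tensor_in_L2_on[OF G1.\<Omega> G2.\<Omega>] L2_on_add[OF G.\<Omega>])
  show "subspace (?S \<times> ?S)" by (intro subspace_Times L2_on_subspace G.\<Omega>)
  show "closed (?S \<times> ?S)" by (intro closed_Times L2_on_closed G.\<Omega>)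
qed

text \<open>The factorwise evolution \<open>y\<close> stays in the domain of the tensor sum and
  solves its evolution equation, so pulling it back by \<open>W (- s)\<close> gives a
  constant.\<close>

lemma W_tensor_domain:
  assumes f: "(f, f') \<in> \<Delta>\<^sub>1" and g: "(g, g') \<in> \<Delta>\<^sub>2"
  shows "G.W t (f \<otimes> g) = G1.W t f \<otimes> G2.W t g"
proof -
  have S: "f \<in> L2_on \<Omega>\<^sub>1" "g \<in> L2_on \<Omega>\<^sub>2"
    using sa1 sa2 f g by (auto simp: self_adjoint_on_def)
  define y where "y = (\<lambda>s. G1.W s f \<otimes> G2.W s g)"
  define a where "a = (\<lambda>s. G1.W s f' \<otimes> G2.W s g + G1.W s f \<otimes> G2.W s g')"
  have ya: "(y s, a s) \<in> tensor_sum \<Delta>\<^sub>1 \<Delta>\<^sub>2" for s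
    unfolding y_def a_def
    by (intro tensor_sum_mem G1.generator_invariant[OF exp1] G2.generator_invariant[OF exp2] S f g)
  have yS: "y s \<in> L2_on (\<Omega>\<^sub>1 \<times> \<Omega>\<^sub>2)" for s
    unfolding y_def by (intro tensor_in_L2_on[OF G1.\<Omega> G2.\<Omega>] G1.W_in G2.W_in)
  have dy: "(y has_vector_derivative \<i> *\<^sub>C a s) (at s within UNIV)" for s
  proof -
    have "(y has_vector_derivative (G1.W s f \<otimes> G2.W s (\<i> *\<^sub>C g') + G1.W s (\<i> *\<^sub>C f') \<otimes> G2.W s g)) (at s within UNIV)"
      unfolding y_def
      by (intro bounded_bilinear.has_vector_derivative[OF tensor_bilinear]
          G1.generator_derivative[OF exp1] G2.generator_derivative[OF exp2] S f g)
    then show ?thesis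
      by (simp add: a_def G1.W_scaleC G2.W_scaleC tensor_scaleC_left tensor_scaleC_right
          scaleC_add_right add.commute)
  qed
  have "((\<lambda>s. G.W (- s) (y s)) has_vector_derivative 0) (at s within UNIV)" for s
    using G.twisted_derivative[OF exp yS ya dy, of s] by simp
  then obtain c where c: "\<And>s. G.W (- s) (y s) = c"
    using has_vector_derivative_zero_constant[of UNIV "\<lambda>s. G.W (- s) (y s)"] by auto
  have "y t = G.W t (G.W (- t) (y t))"
    using yS[of t] by (simp add: G.W_W G.W_0 proj_L2_on[OF G.\<Omega>])
  also have "G.W (- t) (y t) = G.W (- 0) (y 0)" by (simp only: c)
  also have "G.W t (G.W (- 0) (y 0)) = G.W t (f \<otimes> g)"
    using S by (simp add: G.W_W y_def G1.W_0 G2.W_0 proj_L2_on[OF G1.\<Omega>] proj_L2_on[OF G2.\<Omega>])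
  finally show ?thesis by (simp add: y_def)
qed

text \<open>Density of the domains extends the identity one factor at a time. Outside the subspaces
  both sides depend only on the projections of the factors.\<close>

lemma W_tensor: "G.W t (f \<otimes> g) = G1.W t f \<otimes> G2.W t g"
proof -
  note cont = bounded_linear.continuous_on[OF G.W_bounded_linear]
    bounded_linear.continuous_on[OF G1.W_bounded_linear] bounded_linear.continuous_on[OF G2.W_bounded_linear]
    bounded_bilinear.continuous_on[OF tensor_bilinear]
  have 1: "G.W t (f \<otimes> g) = G1.W t f \<otimes> G2.W t g" if "f \<in> L2_on \<Omega>\<^sub>1" "(g, g') \<in> \<Delta>\<^sub>2" for f g g'
  proof -
    have "closure (Domain \<Delta>\<^sub>1) \<subseteq> {f. G.W t (f \<otimes> g) = G1.W t f \<otimes> G2.W t g}"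
    proof (rule closure_minimal)
      show "Domain \<Delta>\<^sub>1 \<subseteq> {f. G.W t (f \<otimes> g) = G1.W t f \<otimes> G2.W t g}"
        using W_tensor_domain that(2) by auto
      show "closed {f. G.W t (f \<otimes> g) = G1.W t f \<otimes> G2.W t g}"
        by (intro closed_Collect_eq cont continuous_on_const continuous_on_id)
    qed
    then show ?thesis using sa1 that(1) by (auto simp: self_adjoint_on_def)
  qed
  have 2: "G.W t (f \<otimes> g) = G1.W t f \<otimes> G2.W t g" if "f \<in> L2_on \<Omega>\<^sub>1" "g \<in> L2_on \<Omega>\<^sub>2" for f g
  proof -
    have "closure (Domain \<Delta>\<^sub>2) \<subseteq> {g. G.W t (f \<otimes> g) = G1.W t f \<otimes> G2.W t g}"
    proof (rule closure_minimal)
      show "Domain \<Delta>\<^sub>2 \<subseteq> {g. G.W t (f \<otimes> g) = G1.W t f \<otimes> G2.W t g}"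
        using 1[OF that(1)] by auto
      show "closed {g. G.W t (f \<otimes> g) = G1.W t f \<otimes> G2.W t g}"
        by (intro closed_Collect_eq cont continuous_on_const continuous_on_id)
    qed
    then show ?thesis using sa2 that(2) by (auto simp: self_adjoint_on_def)
  qed
  have "G.W t (f \<otimes> g) = G.W t (proj_L2 (\<Omega>\<^sub>1 \<times> \<Omega>\<^sub>2) (f \<otimes> g))" by simp
  also have "\<dots> = G1.W t (proj_L2 \<Omega>\<^sub>1 f) \<otimes> G2.W t (proj_L2 \<Omega>\<^sub>2 g)"
    unfolding proj_L2_tensor[OF G1.\<Omega> G2.\<Omega>] by (intro 2 proj_L2_in G1.\<Omega> G2.\<Omega>)
  finally show ?thesis by simp
qed

lemma W_tensor_rank: "tensor_rank_le p x \<Longrightarrow> tensor_rank_le p (G.W t x)"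
  by (erule tensor_rank_le_linear[rotated -1]) (auto simp: G.W_add W_tensor)

lemma sigma_max_W: "sigma_max (G.W t x) \<le> sigma_max x"
proof (rule sigma_max_le)
  fix f g
  have "cinner (f \<otimes> g) (G.W t x) = cinner (G1.W (- t) f \<otimes> G2.W (- t) g) x"
    using G.W_cadjoint[of "- t" "f \<otimes> g" x] by (simp add: W_tensor)
  also have "cmod \<dots> \<le> sigma_max x * norm (G1.W (- t) f) * norm (G2.W (- t) g)"
    by (rule sing_val_form_bound)
  also have "\<dots> \<le> sigma_max x * norm f * norm g"
    by (intro mult_mono G1.norm_W_le G2.norm_W_le) (auto simp: sigma_max_def)
  finally show "cmod (cinner (f \<otimes> g) (G.W t x)) \<le> sigma_max x * norm f * norm g" .
qed

end

subsection \<open>The interaction picture\<close>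

locale potential_group = unitary_group \<Omega> U for \<Omega> :: "'a::euclidean_space set" and U +
  fixes V :: "'a \<Rightarrow> real" and C :: real
  assumes V: "bounded_potential \<Omega> V" and C: "C = op_norm_on (L2_on \<Omega>) (mult_op V)" and C0: "0 \<le> C"
begin

definition Vop :: "'a L2 \<Rightarrow> 'a L2" where
  "Vop f = mult_op V (proj_L2 \<Omega> f)"

lemma Vop_multipliable: "f \<in> L2_on \<Omega> \<Longrightarrow> multipliable V f"
  using V by (simp add: bounded_potential_def multipliable_def)

lemma Vop_eq: "f \<in> L2_on \<Omega> \<Longrightarrow> Vop f = mult_op V f"
  by (simp add: Vop_def proj_L2_on[OF \<Omega>])

lemma Vop_add: "Vop (f + g) = Vop f + Vop g"
  unfolding Vop_def proj_L2_add[OF \<Omega>]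
  by (intro mult_op_add Vop_multipliable L2_on_add[OF \<Omega>] proj_L2_in[OF \<Omega>])

lemma Vop_scaleC: "Vop (c *\<^sub>C f) = c *\<^sub>C Vop f"
  unfolding Vop_def proj_L2_scaleC[OF \<Omega>]
  by (intro mult_op_scaleC Vop_multipliable L2_on_scaleC[OF \<Omega>] proj_L2_in[OF \<Omega>])

lemma Vop_in: "Vop f \<in> L2_on \<Omega>"
  unfolding L2_on_iff Vop_def
  using rep_mult_op[OF Vop_multipliable[OF proj_L2_in[OF \<Omega>, of f]]] proj_L2_in[OF \<Omega>, of f, unfolded L2_on_iff]
  by eventually_elim simp

lemma Vop_symmetric: "inner (Vop f) g = inner f (Vop g)"
proof -
  have "cinner (Vop f) g = cinner (Vop f) (proj_L2 \<Omega> g)"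
    using proj_L2_symmetric[OF \<Omega>, of "Vop f" g] Vop_in proj_L2_eq_iff[OF \<Omega>] by metis
  also have "\<dots> = cinner (proj_L2 \<Omega> f) (Vop g)"
    unfolding Vop_def by (intro mult_op_symmetric Vop_multipliable proj_L2_in[OF \<Omega>])
  also have "\<dots> = cinner f (Vop g)"
    using proj_L2_symmetric[OF \<Omega>, of f "Vop g"] Vop_in proj_L2_eq_iff[OF \<Omega>] by metis
  finally show ?thesis by (simp add: inner_L2_def)
qed

lemma norm_Vop_le: "norm (Vop f) \<le> C * norm f"
proof -
  have on: "norm (mult_op V f) \<le> C * norm f" if f: "f \<in> L2_on \<Omega>" for f
  proof (cases "f = 0")
    case True
    have "Vop 0 = 0" using Vop_scaleC[of 0 0] by (simp add: bounded_bilinear.zero_left[OF scaleC_bilinear])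
    then show ?thesis using True Vop_eq[OF f] by simp
  next
    case False
    obtain B where B: "\<And>f. f \<in> L2_on \<Omega> \<Longrightarrow> norm (mult_op V f) \<le> B * norm f"
      using V by (auto simp: bounded_potential_def)
    have "norm (mult_op V f) / norm f \<le> (SUP f\<in>L2_on \<Omega> - {0}. norm (mult_op V f) / norm f)"
    proof (rule cSUP_upper)
      show "bdd_above ((\<lambda>f. norm (mult_op V f) / norm f) ` (L2_on \<Omega> - {0}))"
      proof (rule bdd_aboveI)
        fix x assume "x \<in> (\<lambda>f. norm (mult_op V f) / norm f) ` (L2_on \<Omega> - {0})"
        then obtain f where f: "f \<in> L2_on \<Omega>" "f \<noteq> 0" "x = norm (mult_op V f) / norm f" by blast
        then show "x \<le> B" using B[OF f(1)] by (simp add: pos_divide_le_eq)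
      qed
    qed (use f False in simp)
    then show ?thesis using False by (simp add: C op_norm_on_def divide_le_eq)
  qed
  have "norm (Vop f) \<le> C * norm (proj_L2 \<Omega> f)"
    unfolding Vop_def by (intro on proj_L2_in[OF \<Omega>])
  also have "\<dots> \<le> C * norm f" by (intro mult_left_mono norm_proj_L2_le \<Omega> C0)
  finally show ?thesis .
qed

lemma Vop_bounded_linear: "bounded_linear Vop"
  by (rule bounded_linear_intro[of _ C])
    (simp_all add: Vop_add Vop_scaleC scaleR_scaleC norm_Vop_le mult.commute)

definition G :: "real \<Rightarrow> 'a L2 \<Rightarrow> 'a L2" where
  "G t f = - (\<i> *\<^sub>C W (- t) (Vop (W t f)))"

lemma G_bounded_linear: "bounded_linear (G t)"
  unfolding G_def
  by (intro bounded_linear_minus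
      bounded_linear_compose[OF bounded_bilinear.bounded_linear_right[OF scaleC_bilinear]]
      bounded_linear_compose[OF W_bounded_linear] bounded_linear_compose[OF Vop_bounded_linear] W_bounded_linear)

lemma norm_G_le: "norm (G t f) \<le> C * norm f"
proof -
  have "norm (G t f) \<le> norm (Vop (W t f))" by (simp add: G_def norm_W_le)
  also have "\<dots> \<le> C * norm (W t f)" by (rule norm_Vop_le)
  also have "\<dots> \<le> C * norm f" by (intro mult_left_mono norm_W_le C0)
  finally show ?thesis .
qed

lemma G_skew: "inner (G t f) g = - inner f (G t g)"
proof -
  have "inner (G t f) g = - inner (\<i> *\<^sub>C W (- t) (Vop (W t f))) g" by (simp add: G_def)
  also have "\<dots> = inner (W (- t) (Vop (W t f))) (\<i> *\<^sub>C g)" by (simp add: cinner_scaleC_i_skew)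
  also have "\<dots> = inner f (W (- t) (Vop (W t (\<i> *\<^sub>C g))))"
    using W_adjoint[of "- t"] W_adjoint[of t] by (simp add: Vop_symmetric)
  also have "\<dots> = - inner f (G t g)" by (simp add: G_def W_scaleC Vop_scaleC)
  finally show ?thesis .
qed

lemma G_self: "inner (G t f) f = 0"
  using G_skew[of t f f] by (simp add: inner_commute)

lemma G_in: "G t f \<in> L2_on \<Omega>"
  using W_in[of "- t" "Vop (W t f)"] L2_on_scaleC[OF \<Omega>, of _ "- \<i>"] by (simp add: G_def scaleC_minus_left)

lemma G_continuous_on:
  assumes "continuous_on A x"
  shows "continuous_on A (\<lambda>s. G s (x s))"
  unfolding G_def
  by (intro continuous_on_minus bounded_linear.continuous_on[OF bounded_bilinear.bounded_linear_right[OF scaleC_bilinear]]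
      W_continuous_on bounded_linear.continuous_on[OF Vop_bounded_linear] continuous_on_id assms)

end

text \<open>The hypothesis \<open>h C < 1\<close> lets a single contraction cover the whole interval.\<close>

lemma linear_ode_backward:
  fixes L :: "real \<Rightarrow> 'h::banach \<Rightarrow> 'h"
  assumes h: "0 \<le> h" and lin: "\<And>t. bounded_linear (L t)" and bound: "\<And>t x. norm (L t x) \<le> C * norm x"
    and cont: "\<And>x. continuous_on {0..h} x \<Longrightarrow> continuous_on {0..h} (\<lambda>s. L s (x s))"
    and C: "0 \<le> C" "h * C < 1"
  obtains \<phi> where "\<phi> h = y" "\<And>t. t \<in> {0..h} \<Longrightarrow> (\<phi> has_vector_derivative L t (\<phi> t)) (at t within {0..h})"
proof -
  define F where "F = (\<lambda>\<phi> t. y - integral {t..h} (\<lambda>s. L s (\<phi> s)))"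
  \<comment> \<open>Banach's theorem is applied in the space of bounded continuous functions on the
    whole line; clamping the argument extends a function from [0, h] to it.\<close>
  define clamp where "clamp = (\<lambda>t. max 0 (min h t))"
  have clamp: "clamp t \<in> {0..h}" "t \<in> {0..h} \<Longrightarrow> clamp t = t" for t
    using h by (auto simp: clamp_def)
  have contF: "continuous_on {0..h} (F \<phi>)" if \<phi>: "continuous_on {0..h} \<phi>" for \<phi>
  proof -
    have "(\<lambda>s. L s (\<phi> s)) integrable_on {0..h}" by (intro integrable_continuous_interval cont \<phi>)
    then show ?thesis unfolding F_def by (intro continuous_intros indefinite_integral_continuous_1')
  qed
  have clampc: "continuous_on UNIV clamp" unfolding clamp_def by (intro continuous_intros)
  have bc: "(\<lambda>t. F \<phi> (clamp t)) \<in> bcontfun" if \<phi>: "continuous_on {0..h} \<phi>" for \<phi>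
    unfolding bcontfun_def mem_Collect_eq
  proof (intro conjI)
    show "continuous_on UNIV (\<lambda>t. F \<phi> (clamp t))"
      by (rule continuous_on_compose2[OF contF[OF \<phi>] clampc]) (use clamp in auto)
    have "compact (F \<phi> ` {0..h})" by (intro compact_continuous_image contF \<phi>) simp
    then have "bounded (F \<phi> ` {0..h})" by (rule compact_imp_bounded)
    then show "bounded (range (\<lambda>t. F \<phi> (clamp t)))"
      by (rule bounded_subset) (use clamp in auto)
  qed
  define \<Phi> where "\<Phi> = (\<lambda>f :: real \<Rightarrow>\<^sub>C 'h. Bcontfun (\<lambda>t. F (apply_bcontfun f) (clamp t)))"
  have capp: "continuous_on A (apply_bcontfun f)" for f :: "real \<Rightarrow>\<^sub>C 'h" and A
    by (rule continuous_on_apply_bcontfun)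
  have \<Phi>: "apply_bcontfun (\<Phi> f) t = F (apply_bcontfun f) (clamp t)" for f t
    unfolding \<Phi>_def by (subst Bcontfun_inverse[OF bc[OF capp]]) simp
  have contr: "dist (\<Phi> f) (\<Phi> g) \<le> h * C * dist f g" for f g
  proof (rule dist_bound)
    fix t
    define s where "s = clamp t"
    have s: "s \<in> {0..h}" using clamp by (simp add: s_def)
    have int: "(\<lambda>r. L r (apply_bcontfun f r)) integrable_on {s..h}" for f
    proof -
      have "(\<lambda>r. L r (apply_bcontfun f r)) integrable_on {0..h}"
        by (intro integrable_continuous_interval cont capp)
      then show ?thesis by (rule integrable_on_subinterval) (use s in auto)
    qed
    have "apply_bcontfun (\<Phi> f) t - apply_bcontfun (\<Phi> g) t =
        - integral {s..h} (\<lambda>r. L r (apply_bcontfun f r - apply_bcontfun g r))"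
      using linear_diff[OF bounded_linear.linear[OF lin]]
      by (simp add: \<Phi> F_def s_def[symmetric] Henstock_Kurzweil_Integration.integral_diff[OF int int])
    then have "dist (apply_bcontfun (\<Phi> f) t) (apply_bcontfun (\<Phi> g) t) =
        norm (integral {s..h} (\<lambda>r. L r (apply_bcontfun f r - apply_bcontfun g r)))"
      by (simp add: dist_norm)
    also have "\<dots> \<le> (C * dist f g) * (h - s)"
    proof (rule integral_bound)
      show "continuous_on {s..h} (\<lambda>r. L r (apply_bcontfun f r - apply_bcontfun g r))"
        by (rule continuous_on_subset[OF cont]) (use s in \<open>auto intro!: continuous_intros capp\<close>)
      show "norm (L r (apply_bcontfun f r - apply_bcontfun g r)) \<le> C * dist f g" for r
        by (rule order_trans[OF bound]) (use C dist_bounded[of f r g] in \<open>auto simp: dist_norm intro!: mult_left_mono\<close>)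
    qed (use s in auto)
    also have "\<dots> \<le> (C * dist f g) * h" using s C by (intro mult_left_mono) auto
    finally show "dist (apply_bcontfun (\<Phi> f) t) (apply_bcontfun (\<Phi> g) t) \<le> h * C * dist f g"
      by (simp add: mult_ac)
  qed
  have "\<exists>!f. \<Phi> f = f"
    by (rule banach_fix_type[of "h * C"]) (use contr h C in auto)
  then obtain f where f: "\<Phi> f = f" by blast
  define \<phi> where "\<phi> = apply_bcontfun f"
  have eq: "\<phi> t = F \<phi> t" if "t \<in> {0..h}" for t
    using \<Phi>[of f t] clamp(2)[OF that] by (simp add: f \<phi>_def)
  show ?thesis
  proof
    show "\<phi> h = y" using eq[of h] h by (simp add: F_def)
    fix t assume t: "t \<in> {0..h}"
    have "continuous_on {0..h} (\<lambda>s. L s (\<phi> s))" unfolding \<phi>_def by (intro cont capp)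
    from integral_has_vector_derivative'[OF this t]
    have "(F \<phi> has_vector_derivative 0 - - L t (\<phi> t)) (at t within {0..h})"
      unfolding F_def by (intro has_vector_derivative_diff has_vector_derivative_const)
    then show "(\<phi> has_vector_derivative L t (\<phi> t)) (at t within {0..h})"
      using has_vector_derivative_transform[OF t, of \<phi> "F \<phi>"] eq by auto
  qed
qed

subsection \<open>Collocation\<close>

locale collocation = potential_group \<Omega> U V C + gauss_nodes J h \<tau>
  for \<Omega> :: "'a::euclidean_space set" and U V C J h \<tau> +
  fixes \<rho> :: real
  assumes \<rho>: "\<rho> = h * mean_lebesgue_const J h \<tau> * C" and \<rho>1: "\<rho> < 1"
begin

definition Lint :: "nat \<Rightarrow> real \<Rightarrow> real" where
  "Lint m t = integral {0..t} (lagrange_basis J \<tau> m)"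

lemma \<rho>0: "0 \<le> \<rho>"
  using h0 C0 mean_lebesgue_const_ge_1 by (simp add: \<rho>)

lemma hC: "h * C < 1"
proof -
  have "h * 1 * C \<le> h * mean_lebesgue_const J h \<tau> * C"
    using h0 C0 mean_lebesgue_const_ge_1 by (intro mult_right_mono mult_left_mono) auto
  then show ?thesis using \<rho> \<rho>1 by simp
qed

text \<open>The source of the contraction factor: integrals of the basis functions over [0, t] are
  dominated by integrals of their moduli over [0, h].\<close>

lemma sum_abs_Lint:
  assumes "t \<in> {0..h}"
  shows "(\<Sum>m=1..J. \<bar>Lint m t\<bar>) * C \<le> \<rho>"
proof -
  have int: "(\<lambda>s. \<Sum>m=1..J. \<bar>lagrange_basis J \<tau> m s\<bar>) integrable_on {0..r}" for r
    by (intro integrable_continuous_interval continuous_intros lagrange_basis_continuous)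
  have int1: "(\<lambda>s. \<bar>lagrange_basis J \<tau> m s\<bar>) integrable_on {0..r}" for r m
    by (intro integrable_continuous_interval continuous_intros lagrange_basis_continuous)
  have "\<bar>Lint m t\<bar> \<le> integral {0..t} (\<lambda>s. \<bar>lagrange_basis J \<tau> m s\<bar>)" for m
    unfolding Lint_def real_norm_def[symmetric]
    by (intro integral_norm_bound_integral lagrange_basis_integrable int1[unfolded real_norm_def[symmetric]]) auto
  then have "(\<Sum>m=1..J. \<bar>Lint m t\<bar>) \<le> (\<Sum>m=1..J. integral {0..t} (\<lambda>s. \<bar>lagrange_basis J \<tau> m s\<bar>))"
    by (intro sum_mono)
  also have "\<dots> = integral {0..t} (\<lambda>s. \<Sum>m=1..J. \<bar>lagrange_basis J \<tau> m s\<bar>)"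
    by (rule Henstock_Kurzweil_Integration.integral_sum[symmetric]) (use int1 in auto)
  also have "\<dots> \<le> integral {0..h} (\<lambda>s. \<Sum>m=1..J. \<bar>lagrange_basis J \<tau> m s\<bar>)"
    using assms by (intro integral_subset_le int) (auto intro: sum_nonneg)
  also have "\<dots> = h * mean_lebesgue_const J h \<tau>"
    using h0 by (simp add: mean_lebesgue_const_def)
  finally have "(\<Sum>m=1..J. \<bar>Lint m t\<bar>) * C \<le> h * mean_lebesgue_const J h \<tau> * C"
    using C0 by (rule mult_right_mono)
  then show ?thesis by (simp only: \<rho>)
qed

text \<open>Up to the free propagation, the Picard map depends on t only through scalar polynomial
  weights. This makes the polynomial quadrature results applicable to it.\<close>

lemma picard_twisted:
  assumes u0: "u0 \<in> L2_on \<Omega>" and w: "\<And>m. m \<in> {1..J} \<Longrightarrow> w m \<in> L2_on \<Omega>" and t: "0 \<le> t"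
  shows "picard_map U V J \<tau> u0 w t = W t (u0 + (\<Sum>m=1..J. Lint m t *\<^sub>R G (\<tau> m) (W (- \<tau> m) (w m))))"
proof -
  let ?c = "\<lambda>m. W (t - \<tau> m) (Vop (w m))"
  have "integral {0..t} (\<lambda>s. \<Sum>m=1..J. lagrange_basis J \<tau> m s *\<^sub>R U (t - \<tau> m) (mult_op V (w m)))
    = integral {0..t} (\<lambda>s. \<Sum>m=1..J. lagrange_basis J \<tau> m s *\<^sub>R ?c m)"
    by (intro arg_cong[where f = "integral _"] ext sum.cong refl)
      (simp add: Vop_eq[OF w, symmetric] W_eq_U[OF Vop_in, symmetric] atLeastAtMost_iff)
  also have "\<dots> = (\<Sum>m=1..J. Lint m t *\<^sub>R ?c m)"
    unfolding Lint_def
    by (intro integral_unique has_integral_sum has_integral_scaleR_left integrable_integral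
        lagrange_basis_integrable) simp
  finally have "picard_map U V J \<tau> u0 w t = W t u0 - \<i> *\<^sub>C (\<Sum>m=1..J. Lint m t *\<^sub>R ?c m)"
    using u0 by (simp add: picard_map_def W_eq_U)
  also have "\<dots> = W t u0 + (\<Sum>m=1..J. Lint m t *\<^sub>R W t (G (\<tau> m) (W (- \<tau> m) (w m))))"
  proof -
    have "W t (G (\<tau> m) (W (- \<tau> m) (w m))) = - (\<i> *\<^sub>C ?c m)" if "m \<in> {1..J}" for m
      using w[OF that] by (simp add: G_def W_W W_0 linear_neg[OF W_linear] W_scaleC proj_L2_on[OF \<Omega>])
    then have "(\<Sum>m=1..J. Lint m t *\<^sub>R W t (G (\<tau> m) (W (- \<tau> m) (w m)))) = (\<Sum>m=1..J. - (\<i> *\<^sub>C (Lint m t *\<^sub>R ?c m)))"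
      by (intro sum.cong refl) (simp only: scaleC_scaleR scaleR_minus_right)
    then show ?thesis by (simp only: sum_negf scaleC_sum_right) simp
  qed
  also have "\<dots> = W t (u0 + (\<Sum>m=1..J. Lint m t *\<^sub>R G (\<tau> m) (W (- \<tau> m) (w m))))"
    by (simp only: W_add W_sum W_scaleR)
  finally show ?thesis .
qed

lemma picard_in:
  assumes "u0 \<in> L2_on \<Omega>" "\<And>m. m \<in> {1..J} \<Longrightarrow> w m \<in> L2_on \<Omega>" "0 \<le> t"
  shows "picard_map U V J \<tau> u0 w t \<in> L2_on \<Omega>"
proof -
  have "picard_map U V J \<tau> u0 w t = W t (u0 + (\<Sum>m=1..J. Lint m t *\<^sub>R G (\<tau> m) (W (- \<tau> m) (w m))))"
    by (rule picard_twisted) (fact assms)+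
  then show ?thesis by (simp only: W_in)
qed

lemma picard_contraction:
  assumes u0: "u0 \<in> L2_on \<Omega>" "v0 \<in> L2_on \<Omega>"
    and w: "\<And>m. m \<in> {1..J} \<Longrightarrow> w m \<in> L2_on \<Omega>" "\<And>m. m \<in> {1..J} \<Longrightarrow> w' m \<in> L2_on \<Omega>"
    and D: "\<And>m. m \<in> {1..J} \<Longrightarrow> norm (w m - w' m) \<le> D" and t: "t \<in> {0..h}"
  shows "norm (picard_map U V J \<tau> u0 w t - picard_map U V J \<tau> v0 w' t) \<le> norm (u0 - v0) + \<rho> * D"
proof -
  have D0: "0 \<le> D" using D[of 1] J1 order_trans[OF norm_ge_zero] by simp
  let ?k = "\<lambda>m. G (\<tau> m) (W (- \<tau> m) (w m - w' m))"
  have t0: "0 \<le> t" using t by simp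
  have "picard_map U V J \<tau> u0 w t - picard_map U V J \<tau> v0 w' t = W t ((u0 - v0) + (\<Sum>m=1..J. Lint m t *\<^sub>R ?k m))"
    unfolding picard_twisted[of u0 w t, OF u0(1) w(1) t0, simplified] picard_twisted[of v0 w' t, OF u0(2) w(2) t0, simplified]
    by (simp add: W_add W_diff W_sum W_scaleR
        linear_diff[OF bounded_linear.linear[OF G_bounded_linear]] scaleR_diff_right sum_subtractf)
  also have "norm \<dots> \<le> norm (u0 - v0) + (\<Sum>m=1..J. \<bar>Lint m t\<bar> * (C * D))"
  proof (rule order_trans[OF norm_W_le], rule norm_triangle_le, rule add_left_mono, rule sum_norm_le)
    fix m assume m: "m \<in> {1..J}"
    have "norm (?k m) \<le> C * norm (W (- \<tau> m) (w m - w' m))" by (rule norm_G_le)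
    also have "\<dots> \<le> C * D" by (intro mult_left_mono C0 order_trans[OF norm_W_le D[OF m]])
    finally show "norm (Lint m t *\<^sub>R ?k m) \<le> \<bar>Lint m t\<bar> * (C * D)" by (simp add: mult_left_mono)
  qed
  also have "(\<Sum>m=1..J. \<bar>Lint m t\<bar> * (C * D)) = ((\<Sum>m=1..J. \<bar>Lint m t\<bar>) * C) * D"
    by (simp only: sum_distrib_right mult.assoc)
  also have "\<dots> \<le> \<rho> * D" by (intro mult_right_mono sum_abs_Lint t D0)
  finally show ?thesis by simp
qed

text \<open>With D the maximum of the \<open>d j\<close> themselves, the term \<rho> D is absorbed
  into the left-hand side, and no a priori bound on them is required.\<close>

lemma absorb_max:
  fixes d :: "nat \<Rightarrow> real"
  assumes "\<And>D j. (\<And>m. m \<in> {1..J} \<Longrightarrow> d m \<le> D) \<Longrightarrow> j \<in> {1..J} \<Longrightarrow> d j \<le> A + \<rho> * D" and j: "j \<in> {1..J}"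
  shows "d j \<le> A / (1 - \<rho>)"
proof -
  define D where "D = Max (d ` {1..J})"
  have ne: "d ` {1..J} \<noteq> {}" using J1 by auto
  have le: "d m \<le> D" if "m \<in> {1..J}" for m using that by (simp add: D_def)
  obtain i where i: "i \<in> {1..J}" "D = d i"
    using Max_in[OF _ ne] by (auto simp: D_def)
  have "D \<le> A + \<rho> * D" using assms(1)[OF le i(1)] i(2) by simp
  then have "D * (1 - \<rho>) \<le> A" by (simp add: algebra_simps)
  then have "D \<le> A / (1 - \<rho>)" using \<rho>1 by (simp add: pos_le_divide_eq)
  with le[OF j] show ?thesis by simp
qed

section \<open>Collocation solutions\<close>

definition collocation_solution :: "'a L2 \<Rightarrow> (real \<Rightarrow> 'a L2) \<Rightarrow> bool" where
  "collocation_solution c0 c \<longleftrightarrow> (\<forall>t\<in>{0..h}. c t \<in> L2_on \<Omega> \<and> c t = picard_map U V J \<tau> c0 (\<lambda>m. c (\<tau> m)) t)"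

lemma node_closed: "m \<in> {1..J} \<Longrightarrow> \<tau> m \<in> {0..h}"
  using nodes_subset by blast

lemma collocation_solutionD:
  assumes "collocation_solution c0 c" "t \<in> {0..h}"
  shows "c t \<in> L2_on \<Omega>" "c t = picard_map U V J \<tau> c0 (\<lambda>m. c (\<tau> m)) t"
  using bspec[OF assms(1)[unfolded collocation_solution_def] assms(2)] by (rule conjunct1, rule conjunct2)

lemma collocation_twisted:
  assumes c0: "c0 \<in> L2_on \<Omega>" and c: "collocation_solution c0 c" and t: "t \<in> {0..h}"
  shows "c t = W t (c0 + (\<Sum>m=1..J. Lint m t *\<^sub>R G (\<tau> m) (W (- \<tau> m) (c (\<tau> m)))))"
  by (rule trans[OF collocation_solutionD(2)[OF c t]], rule picard_twisted[OF c0])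
    (fact collocation_solutionD(1)[OF c node_closed], use t in simp)

text \<open>After twisting, the difference of two collocation solutions is a polynomial in time
  whose slope at each node is \<open>G\<close> applied to its value there, hence orthogonal to that
  value.\<close>

lemma collocation_conserved:
  assumes c0: "c0 \<in> L2_on \<Omega>" "c0' \<in> L2_on \<Omega>"
    and c: "collocation_solution c0 c" "collocation_solution c0' c'"
  shows "norm (c h - c' h) = norm (c0 - c0')"
proof -
  let ?k = "\<lambda>m. G (\<tau> m) (W (- \<tau> m) (c (\<tau> m) - c' (\<tau> m)))"
  let ?d = "\<lambda>t. (c0 - c0') + (\<Sum>m=1..J. Lint m t *\<^sub>R ?k m)"
  have dS: "?d t \<in> L2_on \<Omega>" for t
  proof -
    have "c0 + (-1) *\<^sub>C c0' \<in> L2_on \<Omega>" by (intro L2_on_add[OF \<Omega>] L2_on_scaleC[OF \<Omega>] c0)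
    then have "c0 - c0' \<in> L2_on \<Omega>" by (simp add: scaleC_minus_one)
    then show ?thesis
      by (intro subspace_add[OF L2_on_subspace[OF \<Omega>]] subspace_sum[OF L2_on_subspace[OF \<Omega>]]
          subspace_scale[OF L2_on_subspace[OF \<Omega>]] G_in)
  qed
  have diff: "c t - c' t = W t (?d t)" if "t \<in> {0..h}" for t
    using collocation_twisted[OF c0(1) c(1) that] collocation_twisted[OF c0(2) c(2) that]
    by (simp add: W_add W_diff W_sum W_scaleR linear_diff[OF bounded_linear.linear[OF G_bounded_linear]]
        scaleR_diff_right sum_subtractf)
  have d: "?d t = W (- t) (c t - c' t)" if "t \<in> {0..h}" for t
    using dS[of t] by (simp only: diff[OF that] W_W W_0 add.left_inverse proj_L2_on[OF \<Omega>])
  have "norm (?d h) = norm (c0 - c0')"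
    unfolding Lint_def
  proof (rule collocation_norm_conserved)
    fix m assume m: "m \<in> {1..J}"
    have "inner (?k m) (?d (\<tau> m)) = 0"
      unfolding d[OF node_closed[OF m]] by (rule G_self)
    then show "inner (?k m) ((c0 - c0') + (\<Sum>l=1..J. integral {0..\<tau> m} (lagrange_basis J \<tau> l) *\<^sub>R ?k l)) = 0"
      by (simp only: Lint_def)
  qed
  moreover have "norm (c h - c' h) = norm (?d h)"
    using h0 by (simp only: diff atLeastAtMost_iff less_imp_le order_refl norm_W_on[OF dS])
  ultimately show ?thesis by (simp only:)
qed

lemma ex_collocation_solution:
  assumes u0: "u0 \<in> L2_on \<Omega>"
  obtains c where "collocation_solution u0 c"
proof -
  \<comment> \<open>The projection makes the map meaningful for all bounded continuous functions;
    its fixed point turns out to take values in the subspace.\<close>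
  define P where "P = (\<lambda>f. picard_map U V J \<tau> u0 (\<lambda>m. proj_L2 \<Omega> (f (\<tau> m))))"
  define clamp where "clamp = (\<lambda>t. max 0 (min h t))"
  have clamp: "clamp t \<in> {0..h}" "t \<in> {0..h} \<Longrightarrow> clamp t = t" for t
    using h0 by (auto simp: clamp_def)
  have contP: "continuous_on {0..h} (P f)" for f
  proof (rule continuous_on_eq)
    show "continuous_on {0..h} (\<lambda>t. W t (u0 + (\<Sum>m=1..J. Lint m t *\<^sub>R G (\<tau> m) (W (- \<tau> m) (proj_L2 \<Omega> (f (\<tau> m)))))))"
      unfolding Lint_def
      by (intro W_continuous_on continuous_intros indefinite_integral_continuous_1 lagrange_basis_integrable)
    show "W t (u0 + (\<Sum>m=1..J. Lint m t *\<^sub>R G (\<tau> m) (W (- \<tau> m) (proj_L2 \<Omega> (f (\<tau> m)))))) = P f t" if "t \<in> {0..h}" for t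
      unfolding P_def by (rule picard_twisted[symmetric, OF u0 proj_L2_in[OF \<Omega>]]) (use that in simp)
  qed
  have bc: "(\<lambda>t. P f (clamp t)) \<in> bcontfun" for f
    unfolding bcontfun_def mem_Collect_eq
  proof (intro conjI)
    have "continuous_on UNIV clamp" unfolding clamp_def by (intro continuous_intros)
    then show "continuous_on UNIV (\<lambda>t. P f (clamp t))"
      by (rule continuous_on_compose2[OF contP]) (use clamp in auto)
    have "compact (P f ` {0..h})" by (intro compact_continuous_image contP) simp
    then have "bounded (P f ` {0..h})" by (rule compact_imp_bounded)
    then show "bounded (range (\<lambda>t. P f (clamp t)))"
      by (rule bounded_subset) (use clamp in auto)
  qed
  define \<Psi> where "\<Psi> = (\<lambda>f :: real \<Rightarrow>\<^sub>C 'a L2. Bcontfun (\<lambda>t. P (apply_bcontfun f) (clamp t)))"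
  have \<Psi>: "apply_bcontfun (\<Psi> f) t = P (apply_bcontfun f) (clamp t)" for f t
    unfolding \<Psi>_def by (subst Bcontfun_inverse[OF bc]) simp
  have contr: "dist (\<Psi> f) (\<Psi> g) \<le> \<rho> * dist f g" for f g
  proof (rule dist_bound)
    fix t
    have "norm (P (apply_bcontfun f) (clamp t) - P (apply_bcontfun g) (clamp t)) \<le> norm (u0 - u0) + \<rho> * dist f g"
      unfolding P_def
    proof (rule picard_contraction[OF u0 u0 proj_L2_in[OF \<Omega>] proj_L2_in[OF \<Omega>] _ clamp(1)])
      fix m
      have "norm (proj_L2 \<Omega> (apply_bcontfun f (\<tau> m) - apply_bcontfun g (\<tau> m))) \<le> norm (apply_bcontfun f (\<tau> m) - apply_bcontfun g (\<tau> m))"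
        by (rule norm_proj_L2_le[OF \<Omega>])
      also have "\<dots> \<le> dist f g" using dist_bounded[of f "\<tau> m" g] by (simp add: dist_norm)
      finally show "norm (proj_L2 \<Omega> (apply_bcontfun f (\<tau> m)) - proj_L2 \<Omega> (apply_bcontfun g (\<tau> m))) \<le> dist f g"
        by (simp add: linear_diff[OF bounded_linear.linear[OF proj_L2_bounded_linear[OF \<Omega>]]])
    qed
    then show "dist (apply_bcontfun (\<Psi> f) t) (apply_bcontfun (\<Psi> g) t) \<le> \<rho> * dist f g"
      by (simp add: \<Psi> dist_norm)
  qed
  have "\<exists>!f. \<Psi> f = f"
    by (rule banach_fix_type[of \<rho>]) (use contr \<rho>0 \<rho>1 in auto)
  then obtain f where f: "\<Psi> f = f" by blast
  define c where "c = apply_bcontfun f"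
  have c: "c t = P c t" if "t \<in> {0..h}" for t
    using \<Psi>[of f t] clamp(2)[OF that] by (simp add: f c_def)
  have cS: "c t \<in> L2_on \<Omega>" if "t \<in> {0..h}" for t
    unfolding c[OF that] P_def by (rule picard_in[OF u0 proj_L2_in[OF \<Omega>]]) (use that in simp)
  have "P c = picard_map U V J \<tau> u0 (\<lambda>m. c (\<tau> m))"
    unfolding P_def picard_map_def
    by (intro ext arg_cong2[where f = "(-)"] refl arg_cong[where f = "scaleC _"] arg_cong[where f = "integral _"] sum.cong)
      (simp only: proj_L2_on[OF \<Omega> cS[OF node_closed]])
  with c cS have "collocation_solution u0 c" unfolding collocation_solution_def by simp
  then show ?thesis by (rule that)
qed

lemma flow_inner_const:
  assumes "\<And>t. t \<in> {0..a} \<Longrightarrow> (\<phi> has_vector_derivative G t (\<phi> t)) (at t within {0..a})"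
    and "\<And>t. t \<in> {0..a} \<Longrightarrow> (\<psi> has_vector_derivative G t (\<psi> t)) (at t within {0..a})"
    and t: "t \<in> {0..a}"
  shows "inner (\<phi> t) (\<psi> t) = inner (\<phi> 0) (\<psi> 0)"
proof -
  have "((\<lambda>t. inner (\<phi> t) (\<psi> t)) has_vector_derivative 0) (at t within {0..a})" if t: "t \<in> {0..a}" for t
    using bounded_bilinear.has_vector_derivative[OF bounded_bilinear_inner assms(1)[OF t] assms(2)[OF t]]
    by (simp add: G_skew)
  then obtain c where "\<And>t. t \<in> {0..a} \<Longrightarrow> inner (\<phi> t) (\<psi> t) = c"
    using has_vector_derivative_zero_constant[of "{0..a}" "\<lambda>t. inner (\<phi> t) (\<psi> t)"] by auto
  with t show ?thesis by auto
qed

text \<open>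
  Testing with the backward solution \<open>\<phi>\<close> of the twisted equation turns \<open>z 0 - v\<close> at the endpoint
  into the integral of \<open>\<langle>\<phi>, z 1\<rangle>\<close>, which vanishes at the nodes.
\<close>

lemma superconvergence:
  assumes z: "\<And>m t. m < 2 * J + 1 \<Longrightarrow> t \<in> {0..h} \<Longrightarrow>
      (z m has_vector_derivative z (Suc m) t + G t (z m t)) (at t within {0..h})"
    and M: "\<And>t. t \<in> {0..h} \<Longrightarrow> norm (z (2 * J + 1) t) \<le> M"
    and zero: "\<And>j. j \<in> {1..J} \<Longrightarrow> z 1 (\<tau> j) = 0"
    and v: "\<And>t. t \<in> {0..h} \<Longrightarrow> (v has_vector_derivative G t (v t)) (at t within {0..h})" "v 0 = z 0 0"
  shows "norm (z 0 h - v h) \<le> (fact J) ^ 4 / (fact (2 * J + 1) * (fact (2 * J))\<^sup>2) * M * h ^ (2 * J + 1)"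
proof -
  define y where "y = z 0 h - v h"
  obtain \<phi> where \<phi>: "\<phi> h = y" "\<And>t. t \<in> {0..h} \<Longrightarrow> (\<phi> has_vector_derivative G t (\<phi> t)) (at t within {0..h})"
    using linear_ode_backward[OF less_imp_le[OF h0] G_bounded_linear norm_G_le G_continuous_on C0 hC] by blast
  have \<phi>n: "norm (\<phi> t) = norm y" if "t \<in> {0..h}" for t
    using flow_inner_const[OF \<phi>(2) \<phi>(2) that] flow_inner_const[OF \<phi>(2) \<phi>(2), of h] h0 \<phi>(1)
    by (simp add: norm_eq_sqrt_inner)
  \<comment> \<open>Both arguments carry the same skew term \<open>G\<close>, which cancels in the
    derivative, so differentiating \<open>H m\<close> merely raises the index m.\<close>
  define H where "H = (\<lambda>m t. inner (\<phi> t) (z m t))"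
  have dH: "(H m has_vector_derivative H (Suc m) t) (at t within {0..h})" if "m < 2 * J + 1" "t \<in> {0..h}" for m t
    using bounded_bilinear.has_vector_derivative[OF bounded_bilinear_inner \<phi>(2)[OF that(2)] z[OF that]]
    by (simp add: H_def G_skew inner_add_right)
  have "\<bar>integral {0..h} (H (Suc 0))\<bar> \<le> (norm y * M) / fact (2 * J) * (node_sq_const * h ^ (2 * J + 1))"
  proof (rule quadrature_error[of "\<lambda>m. H (Suc m)"])
    show "(H (Suc m) has_vector_derivative H (Suc (Suc m)) t) (at t within {0..h})"
      if "m < 2 * J" "t \<in> {0..h}" for m t using dH[of "Suc m" t] that by simp
    show "\<bar>H (Suc (2 * J)) t\<bar> \<le> norm y * M" if t: "t \<in> {0..h}" for t
    proof -
      have "\<bar>H (Suc (2 * J)) t\<bar> \<le> norm (\<phi> t) * norm (z (2 * J + 1) t)"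
        using Cauchy_Schwarz_ineq2[of "\<phi> t" "z (2 * J + 1) t"] by (simp add: H_def)
      also have "\<dots> \<le> norm y * M" using M[OF t] by (simp add: \<phi>n[OF t] mult_left_mono)
      finally show ?thesis .
    qed
    show "H (Suc 0) (\<tau> j) = 0" if "j \<in> {1..J}" for j
      using zero[OF that] by (simp add: H_def)
  qed
  also have "integral {0..h} (H (Suc 0)) = H 0 h - H 0 0"
    using dH[of 0] h0 by (intro integral_unique fundamental_theorem_of_calculus) auto
  also have "H 0 h - H 0 0 = (norm y)\<^sup>2"
    using flow_inner_const[OF \<phi>(2) v(1), of h] h0 \<phi>(1) v(2)
    by (simp add: H_def y_def power2_norm_eq_inner inner_diff_right)
  finally have "norm y * norm y \<le> norm y * (M / fact (2 * J) * (node_sq_const * h ^ (2 * J + 1)))"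
    by (simp add: power2_eq_square mult_ac)
  moreover have "0 \<le> M" using M[of 0] h0 order_trans[OF norm_ge_zero] by simp
  ultimately have "norm y \<le> M / fact (2 * J) * (node_sq_const * h ^ (2 * J + 1))"
    using h0 node_sq_const_pos
    by (cases "norm y = 0", force) (simp only: mult_le_cancel_left_pos zero_less_norm_iff norm_eq_zero not_False_eq_True)
  also have "\<dots> = (node_sq_const / fact (2 * J)) * M * h ^ (2 * J + 1)" by simp
  also have "node_sq_const / fact (2 * J) = (fact J) ^ 4 / (fact (2 * J + 1) * (fact (2 * J))\<^sup>2)"
  proof -
    have "fact (2 * J + 1) = (2 * real J + 1) * fact (2 * J)" by (simp add: algebra_simps)
    then show ?thesis unfolding node_sq_const_def by (simp only:) (simp add: mult_ac)
  qed
  finally show ?thesis by (simp add: y_def)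
qed

text \<open>Since v is the integral of \<open>q 0\<close>, the Picard map differs from it by the
  integral of the interpolation error of \<open>q 0\<close> at the nodes.\<close>

lemma interpolation_residual:
  assumes vS: "\<And>t. t \<in> {0..h} \<Longrightarrow> v t \<in> L2_on \<Omega>"
    and v: "\<And>t. t \<in> {0..h} \<Longrightarrow> (v has_vector_derivative G t (v t)) (at t within {0..h})"
    and q: "\<And>m t. m < J \<Longrightarrow> t \<in> {0..h} \<Longrightarrow> (q m has_vector_derivative q (Suc m) t) (at t within {0..h})"
      "\<And>t. t \<in> {0..h} \<Longrightarrow> q 0 t = G t (v t)"
    and M: "\<And>t. t \<in> {0..h} \<Longrightarrow> norm (q J t) \<le> M" and t: "t \<in> {0..h}"
  shows "norm (picard_map U V J \<tau> (v 0) (\<lambda>m. W (\<tau> m) (v (\<tau> m))) t - W t (v t))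
    \<le> fact J / (sqrt (2 * real J + 1) * fact (2 * J)) * M * h ^ (J + 1)"
proof -
  let ?e = "\<lambda>s. q 0 s - (\<Sum>m=1..J. lagrange_basis J \<tau> m s *\<^sub>R q 0 (\<tau> m))"
  have sub: "{0..t} \<subseteq> {0..h}" using t by auto
  have "(v has_vector_derivative q 0 s) (at s within {0..t})" if "s \<in> {0..t}" for s
    using has_vector_derivative_within_subset[OF v sub, of s] q(2)[of s] that sub by auto
  then have I1: "(q 0 has_integral (v t - v 0)) {0..t}"
    using t by (intro fundamental_theorem_of_calculus) auto
  have I2: "((\<lambda>s. \<Sum>m=1..J. lagrange_basis J \<tau> m s *\<^sub>R q 0 (\<tau> m)) has_integral
      (\<Sum>m=1..J. Lint m t *\<^sub>R q 0 (\<tau> m))) {0..t}"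
    unfolding Lint_def
    by (intro has_integral_sum has_integral_scaleR_left integrable_integral lagrange_basis_integrable) simp
  from has_integral_diff[OF I1 I2]
  have I: "integral {0..t} ?e = v t - v 0 - (\<Sum>m=1..J. Lint m t *\<^sub>R q 0 (\<tau> m))"
    by (rule integral_unique)
  have "picard_map U V J \<tau> (v 0) (\<lambda>m. W (\<tau> m) (v (\<tau> m))) t
      = W t (v 0 + (\<Sum>m=1..J. Lint m t *\<^sub>R G (\<tau> m) (W (- \<tau> m) (W (\<tau> m) (v (\<tau> m))))))"
    using t h0 by (intro picard_twisted vS W_in) auto
  also have "(\<Sum>m=1..J. Lint m t *\<^sub>R G (\<tau> m) (W (- \<tau> m) (W (\<tau> m) (v (\<tau> m))))) = (\<Sum>m=1..J. Lint m t *\<^sub>R q 0 (\<tau> m))"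
    by (intro sum.cong refl) (simp only: W_W W_0 add.left_inverse q(2)[OF node_closed] proj_L2_on[OF \<Omega> vS[OF node_closed]])
  finally have "picard_map U V J \<tau> (v 0) (\<lambda>m. W (\<tau> m) (v (\<tau> m))) t - W t (v t) = W t (- integral {0..t} ?e)"
    by (simp only: I W_diff[symmetric]) (simp add: algebra_simps)
  also have "norm \<dots> \<le> norm (integral {0..t} ?e)"
    using norm_W_le[of t "- integral {0..t} ?e"] by simp
  also have "\<dots> \<le> fact J / (sqrt (2 * real J + 1) * fact (2 * J)) * M * h ^ (J + 1)"
    by (rule integral_interpolation_error[OF q(1) M t])
  finally show ?thesis .
qed

end

subsection \<open>The largest admissible threshold\<close>

lemma ex_small_soft_residual:
  assumes "0 < e"
  shows "\<exists>\<alpha>>0. norm (v - soft_threshold \<alpha> v) \<le> e"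
proof -
  have "0 < e\<^sup>2 / 2" using assms by simp
  from LIMSEQ_D[OF tail_sq_tendsto_0 this, of v] obtain n where "\<forall>k\<ge>n. norm (tail_sq v k - 0) < e\<^sup>2 / 2" ..
  then have "norm (tail_sq v n - 0) < e\<^sup>2 / 2" by blast
  then have n: "tail_sq v n < e\<^sup>2 / 2" by simp
  \<comment> \<open>Half of the budget e^2 covers the tail beyond n; the other half is shared among
    the first n singular values, each truncated to at most \<alpha>.\<close>
  define \<alpha> where "\<alpha> = e / sqrt (2 * real (Suc n))"
  have \<alpha>: "0 < \<alpha>" "real (Suc n) * \<alpha>\<^sup>2 = e\<^sup>2 / 2"
    using assms by (simp_all add: \<alpha>_def power_divide field_simps)
  have S: "(\<lambda>k. (min (sing_val v k) \<alpha>)\<^sup>2) sums (norm (v - soft_threshold \<alpha> v))\<^sup>2"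
    using \<alpha>(1) by (intro soft_residual_norm) simp
  have "(norm (v - soft_threshold \<alpha> v))\<^sup>2 = (\<Sum>k<n. (min (sing_val v k) \<alpha>)\<^sup>2) + (\<Sum>k. (min (sing_val v (k + n)) \<alpha>)\<^sup>2)"
    using suminf_split_initial_segment[OF sums_summable[OF S], of n] sums_unique[OF S] by simp
  also have "(\<Sum>k<n. (min (sing_val v k) \<alpha>)\<^sup>2) \<le> (\<Sum>k<n. \<alpha>\<^sup>2)"
    using \<alpha>(1) by (intro sum_mono power_mono) auto
  also have "(\<Sum>k. (min (sing_val v (k + n)) \<alpha>)\<^sup>2) \<le> tail_sq v n"
    unfolding tail_sq_def
    using \<alpha>(1) summable_ignore_initial_segment[OF sums_summable[OF S], of n]
    by (intro suminf_le tail_summable power_mono) auto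
  also have "(\<Sum>k<n. \<alpha>\<^sup>2) + tail_sq v n \<le> e\<^sup>2"
  proof -
    have "(\<Sum>k<n. \<alpha>\<^sup>2) \<le> real (Suc n) * \<alpha>\<^sup>2" by (simp add: algebra_simps)
    with n \<alpha>(2) show ?thesis by linarith
  qed
  finally have "(norm (v - soft_threshold \<alpha> v))\<^sup>2 \<le> e\<^sup>2" by simp
  then have "norm (v - soft_threshold \<alpha> v) \<le> e" by (rule power2_le_imp_le) (use assms in simp)
  with \<alpha>(1) show ?thesis by blast
qed

text \<open>A threshold valid for all t comes from a finite cover of the orbit by balls of radius
  \<eta> / 3 and nonexpansiveness. Thresholds above the norm of \<open>u t\<close> annihilate it and
  are excluded by \<open>big\<close>, so the supremum is finite. It is attained because, by
  \<open>soft_residual_scale\<close>, the residual grows at most linearly with the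
  threshold.\<close>

lemma largest_threshold_props:
  fixes u :: "real \<Rightarrow> ('a::euclidean_space \<times> 'b::euclidean_space) L2"
  assumes \<eta>: "0 < \<eta>" and I: "compact I" "I \<noteq> {}" and u: "continuous_on I u" and big: "\<And>t. t \<in> I \<Longrightarrow> \<eta> < norm (u t)"
  shows "0 < largest_threshold \<eta> u I"
    and "\<And>t. t \<in> I \<Longrightarrow> norm (u t - soft_threshold (largest_threshold \<eta> u I) (u t)) \<le> \<eta>"
    and "\<And>\<beta>. 0 < \<beta> \<Longrightarrow> (\<And>t. t \<in> I \<Longrightarrow> norm (u t - soft_threshold \<beta> (u t)) \<le> \<eta>) \<Longrightarrow> \<beta> \<le> largest_threshold \<eta> u I"
proof -
  define P where "P = (\<lambda>\<alpha>. 0 < \<alpha> \<and> (\<forall>t\<in>I. norm (u t - soft_threshold \<alpha> (u t)) \<le> \<eta>))"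
  have "\<exists>\<alpha>. P \<alpha>"
  proof -
    have "compact (u ` I)" by (rule compact_continuous_image[OF u I(1)])
    then obtain K where K: "finite K" "u ` I \<subseteq> (\<Union>x\<in>K. ball x (\<eta> / 3))"
    proof (rule compactE_image[of "u ` I" "u ` I" "\<lambda>x. ball x (\<eta> / 3)"])
      have "x \<in> ball x (\<eta> / 3)" for x :: "('a \<times> 'b) L2" using \<eta> by simp
      then show "u ` I \<subseteq> (\<Union>x\<in>u ` I. ball x (\<eta> / 3))" by blast
    qed auto
    have "\<forall>v :: ('a \<times> 'b) L2. \<exists>\<alpha>>0. norm (v - soft_threshold \<alpha> v) \<le> \<eta> / 3"
      by (intro allI ex_small_soft_residual) (use \<eta> in simp)
    then obtain a where a: "\<And>v :: ('a \<times> 'b) L2. 0 < a v" "\<And>v. norm (v - soft_threshold (a v) v) \<le> \<eta> / 3" by metis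
    define \<alpha> where "\<alpha> = Min (insert 1 (a ` K))"
    have \<alpha>: "0 < \<alpha>" "\<And>x. x \<in> K \<Longrightarrow> \<alpha> \<le> a x" using K(1) a by (auto simp: \<alpha>_def)
    have "norm (u t - soft_threshold \<alpha> (u t)) \<le> \<eta>" if t: "t \<in> I" for t
    proof -
      obtain x where x: "x \<in> K" "norm (x - u t) < \<eta> / 3" using K(2) t by (auto simp: dist_norm)
      have "u t - soft_threshold \<alpha> (u t) = (u t - x) + ((x - soft_threshold \<alpha> x) + (soft_threshold \<alpha> x - soft_threshold \<alpha> (u t)))"
        by simp
      also have "norm \<dots> \<le> \<eta> / 3 + (\<eta> / 3 + \<eta> / 3)"
      proof (intro norm_triangle_mono)
        show "norm (u t - x) \<le> \<eta> / 3" using x by (simp add: norm_minus_commute)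
        show "norm (x - soft_threshold \<alpha> x) \<le> \<eta> / 3"
          using soft_residual_mono[of \<alpha> "a x" x] \<alpha> x(1) a(2)[of x] by simp
        show "norm (soft_threshold \<alpha> x - soft_threshold \<alpha> (u t)) \<le> \<eta> / 3"
          using soft_threshold_nonexpansive[of \<alpha> x "u t"] \<alpha> x(2) by simp
      qed
      finally show ?thesis by simp
    qed
    with \<alpha>(1) show ?thesis by (auto simp: P_def)
  qed
  then obtain \<alpha>0 where \<alpha>0: "P \<alpha>0" by blast
  obtain t0 where t0: "t0 \<in> I" using I(2) by blast
  have le: "\<alpha> \<le> norm (u t0)" if "P \<alpha>" for \<alpha>
  proof (rule ccontr)
    assume "\<not> \<alpha> \<le> norm (u t0)"
    then have "sigma_max (u t0) \<le> \<alpha>" using sing_val_le_norm[of "u t0" 0] by (simp add: sigma_max_def)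
    then have "soft_threshold \<alpha> (u t0) = 0" by (rule soft_threshold_eq_0)
    then have "norm (u t0) \<le> \<eta>" using that t0 by (auto simp: P_def)
    with big[OF t0] show False by simp
  qed
  define s where "s = Sup {\<alpha>. P \<alpha>}"
  have bdd: "bdd_above {\<alpha>. P \<alpha>}" using le by (intro bdd_aboveI[of _ "norm (u t0)"]) auto
  have s_upper: "\<alpha> \<le> s" if "P \<alpha>" for \<alpha> unfolding s_def using that bdd by (intro cSup_upper) auto
  have s0: "0 < s" using \<alpha>0 s_upper[OF \<alpha>0] by (auto simp: P_def)
  have Ps: "P s"
    unfolding P_def
  proof (intro conjI ballI s0)
    fix t assume t: "t \<in> I"
    show "norm (u t - soft_threshold s (u t)) \<le> \<eta>"
    proof (rule ccontr)
      assume "\<not> norm (u t - soft_threshold s (u t)) \<le> \<eta>"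
      then have gt: "\<eta> < norm (u t - soft_threshold s (u t))" (is "_ < ?n") by simp
      have "s * \<eta> / ?n < s" using gt s0 less_trans[OF \<eta> gt] by (simp only: pos_divide_less_eq mult_less_cancel_left_pos)
      then have "\<exists>\<alpha>\<in>{\<alpha>. P \<alpha>}. s * \<eta> / ?n < \<alpha>"
        unfolding s_def using \<alpha>0 bdd by (subst less_cSup_iff[symmetric]) auto
      then obtain \<alpha> where \<alpha>: "P \<alpha>" "s * \<eta> / ?n < \<alpha>" by blast
      have "0 < \<alpha>" using \<alpha>(1) by (simp add: P_def)
      have "?n \<le> s / \<alpha> * norm (u t - soft_threshold \<alpha> (u t))"
        by (intro soft_residual_scale s_upper \<alpha>(1) \<open>0 < \<alpha>\<close>)
      also have "\<dots> \<le> s / \<alpha> * \<eta>"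
        using \<alpha>(1) t s0 by (intro mult_left_mono) (auto simp: P_def)
      finally have "?n * \<alpha> \<le> s * \<eta>" using \<open>0 < \<alpha>\<close> by (simp add: pos_le_divide_eq)
      moreover have "s * \<eta> < \<alpha> * ?n" using \<alpha>(2) by (simp only: pos_divide_less_eq[OF less_trans[OF \<eta> gt]])
      ultimately show False by (simp add: mult.commute)
    qed
  qed
  have eq: "largest_threshold \<eta> u I = s"
    unfolding largest_threshold_def using Ps s_upper by (intro Greatest_equality) (auto simp: P_def)
  show "0 < largest_threshold \<eta> u I" by (simp add: eq s0)
  show "norm (u t - soft_threshold (largest_threshold \<eta> u I) (u t)) \<le> \<eta>" if "t \<in> I" for t
    using Ps that by (simp add: eq P_def)
  show "\<beta> \<le> largest_threshold \<eta> u I"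
    if "0 < \<beta>" "\<And>t. t \<in> I \<Longrightarrow> norm (u t - soft_threshold \<beta> (u t)) \<le> \<eta>" for \<beta>
    unfolding eq using that by (intro s_upper) (simp add: P_def)
qed

text \<open>A continuous function that exceeds K at one point of a nondegenerate interval does so on
  a set of positive measure. This lets the essential supremum in \<open>W_norm\<close> be read
  pointwise.\<close>

lemma le_if_AE_le:
  fixes g :: "real \<Rightarrow> real"
  assumes g: "continuous_on {a..b} g" and ab: "a < b" and ae: "AE x in lebesgue_on {a..b}. g x \<le> K" and x: "x \<in> {a..b}"
  shows "g x \<le> K"
proof (rule ccontr)
  assume "\<not> g x \<le> K"
  then have "K < g x" by simp
  have "(g \<longlongrightarrow> g x) (at x within {a..b})" using g x by (auto simp: continuous_on_def)
  then have "\<forall>\<^sub>F y in at x within {a..b}. K < g y" by (rule order_tendstoD) fact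
  then obtain e where e0: "e > 0" "\<forall>y\<in>{a..b}. y \<noteq> x \<and> dist y x < e \<longrightarrow> K < g y"
    unfolding eventually_at by blast
  have e: "K < g y" if "y \<in> {a..b}" "dist y x < e" for y
    using e0 \<open>K < g x\<close> that by (cases "y = x") simp_all
  define c d where "c = max a (x - e)" and "d = min b (x + e)"
  have cd: "c < d" using e0(1) ab x by (auto simp: c_def d_def)
  have sub: "{c<..<d} \<subseteq> {a..b}" by (auto simp: c_def d_def)
  have "AE y in lebesgue. y \<in> {a..b} \<longrightarrow> g y \<le> K"
    using ae by (subst (asm) AE_restrict_space_iff) auto
  then have "AE y in lebesgue. y \<notin> {c<..<d}"
  proof eventually_elim
    case (elim y)
    show ?case
    proof
      assume y: "y \<in> {c<..<d}"
      then have "dist y x < e" by (auto simp: c_def d_def dist_real_def)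
      with e[of y] y sub elim show False by auto
    qed
  qed
  then have "AE y in lborel. y \<notin> {c<..<d}" by (simp add: AE_completion_iff)
  then have "emeasure lborel {c<..<d} = 0"
    by (subst (asm) AE_iff_measurable[OF _ refl]) (auto simp: greaterThanLessThan_def greaterThan_def lessThan_def Int_def)
  then show False using cd by simp
qed

lemma W_norm_bound:
  fixes f :: "real \<Rightarrow> 'a::euclidean_space L2"
  assumes f: "continuous_on {a..b} f" and ab: "a < b" and t: "t \<in> {a..b}"
    and c: "0 \<le> c" "ereal c * W_norm a b f \<le> ereal \<kappa>"
  shows "c * norm (f t) \<le> \<kappa>"
proof -
  have cont: "continuous_on {a..b} (\<lambda>s. norm (f s))" by (intro continuous_intros f)
  have ae: "AE s in lebesgue_on {a..b}. ereal (norm (f s)) \<le> W_norm a b f"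
    unfolding W_norm_def by (intro esssup_AE)
  have "ereal (norm (f t)) \<le> W_norm a b f"
  proof (rule ccontr)
    assume "\<not> ereal (norm (f t)) \<le> W_norm a b f"
    then obtain K where K: "W_norm a b f < ereal K" "ereal K < ereal (norm (f t))"
      using ereal_dense2[of "W_norm a b f" "ereal (norm (f t))"] by (auto simp: not_le)
    have "AE s in lebesgue_on {a..b}. norm (f s) \<le> K"
      using ae
    proof eventually_elim
      case (elim s)
      then have "ereal (norm (f s)) < ereal K" using K(1) by (rule le_less_trans)
      then show ?case by simp
    qed
    from le_if_AE_le[OF cont ab this t] K(2) show False by simp
  qed
  then have "ereal c * ereal (norm (f t)) \<le> ereal c * W_norm a b f"
    using c(1) by (intro ereal_mult_left_mono) auto
  also have "\<dots> \<le> ereal \<kappa>" by (rule c(2))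
  finally show ?thesis by simp
qed

subsection \<open>One subinterval of the scheme\<close>

locale glp_step =
  collocation "\<Omega>\<^sub>1 \<times> \<Omega>\<^sub>2" U V C J h \<tau> \<rho> + tensor_unitary_group \<Omega>\<^sub>1 \<Omega>\<^sub>2 U\<^sub>1 U\<^sub>2 U \<Delta>\<^sub>1 \<Delta>\<^sub>2
  for \<Omega>\<^sub>1 :: "'a::euclidean_space set" and \<Omega>\<^sub>2 :: "'b::euclidean_space set"
    and U\<^sub>1 U\<^sub>2 U \<Delta>\<^sub>1 \<Delta>\<^sub>2 V C J h \<tau> \<rho> +
  fixes rk :: nat
  assumes V_rank: "separable_repr \<Omega>\<^sub>1 \<Omega>\<^sub>2 V rk" and rk1: "1 \<le> rk" and \<rho>_pos: "0 < \<rho>"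
begin

lemma Vop_rank: "tensor_rank_le p f \<Longrightarrow> tensor_rank_le (rk * p) (Vop f)"
proof (induction p arbitrary: f)
  case 0
  have "Vop (0 + 0) = Vop 0 + Vop 0" by (rule Vop_add)
  with 0 show ?case by simp
next
  case (Suc p)
  then obtain y a b where y: "tensor_rank_le p y" and f: "f = y + a \<otimes> b" by auto
  have S: "proj_L2 \<Omega>\<^sub>1 a \<otimes> proj_L2 \<Omega>\<^sub>2 b \<in> L2_on (\<Omega>\<^sub>1 \<times> \<Omega>\<^sub>2)"
    by (intro tensor_in_L2_on proj_L2_in G1.\<Omega> G2.\<Omega>)
  have "Vop (a \<otimes> b) = mult_op V (proj_L2 \<Omega>\<^sub>1 a \<otimes> proj_L2 \<Omega>\<^sub>2 b)"
    by (simp only: Vop_def proj_L2_tensor[OF G1.\<Omega> G2.\<Omega>])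
  also have "tensor_rank_le rk \<dots>"
    by (intro mult_op_tensor_rank[OF G1.\<Omega> G2.\<Omega> V_rank] proj_L2_in G1.\<Omega> G2.\<Omega> Vop_multipliable S)
  finally have "tensor_rank_le (rk * p + rk) (Vop y + Vop (a \<otimes> b))"
    by (intro tensor_rank_le_add Suc.IH y)
  then show ?case by (simp only: f Vop_add mult_Suc_right add.commute)
qed

lemma picard_rank:
  assumes u0: "u0 \<in> L2_on (\<Omega>\<^sub>1 \<times> \<Omega>\<^sub>2)" "tensor_rank_le R u0"
    and w: "\<And>m. m \<in> {1..J} \<Longrightarrow> w m \<in> L2_on (\<Omega>\<^sub>1 \<times> \<Omega>\<^sub>2)" "\<And>m. m \<in> {1..J} \<Longrightarrow> tensor_rank_le p (w m)"
    and t: "0 \<le> t"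
  shows "tensor_rank_le (R + J * (rk * p)) (picard_map U V J \<tau> u0 w t)"
proof -
  have "tensor_rank_le (rk * p) (Lint m t *\<^sub>R G (\<tau> m) (W (- \<tau> m) (w m)))" if "m \<in> {1..J}" for m
  proof -
    have "tensor_rank_le (rk * p) ((- \<i>) *\<^sub>C W (- \<tau> m) (Vop (W (\<tau> m) (W (- \<tau> m) (w m)))))"
      by (intro tensor_rank_le_scaleC W_tensor_rank Vop_rank w(2) that)
    then have "tensor_rank_le (rk * p) (complex_of_real (Lint m t) *\<^sub>C G (\<tau> m) (W (- \<tau> m) (w m)))"
      by (intro tensor_rank_le_scaleC) (simp add: G_def scaleC_minus_left)
    then show ?thesis by (simp only: scaleR_L2_def)
  qed
  then have "tensor_rank_le (\<Sum>m=1..J. rk * p) (\<Sum>m=1..J. Lint m t *\<^sub>R G (\<tau> m) (W (- \<tau> m) (w m)))"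
    by (intro tensor_rank_le_sum) auto
  then have "tensor_rank_le (R + J * (rk * p)) (u0 + (\<Sum>m=1..J. Lint m t *\<^sub>R G (\<tau> m) (W (- \<tau> m) (w m))))"
    by (intro tensor_rank_le_add u0(2)) simp
  then have "tensor_rank_le (R + J * (rk * p)) (W t (u0 + (\<Sum>m=1..J. Lint m t *\<^sub>R G (\<tau> m) (W (- \<tau> m) (w m)))))"
    by (rule W_tensor_rank)
  also have "W t (u0 + (\<Sum>m=1..J. Lint m t *\<^sub>R G (\<tau> m) (W (- \<tau> m) (w m)))) = picard_map U V J \<tau> u0 w t"
    by (rule picard_twisted[symmetric]) (fact u0(1) w(1) t)+
  finally show ?thesis .
qed

end

text \<open>Here \<open>x\<close> is the exact solution in local time and \<open>u0\<close> the
  computed initial value. The quantity in \<open>resid\<close> is the defect of the exact solution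
  in the Picard map started from \<open>u0\<close>; its bound \<xi> combines the initial error with
  the interpolation error.\<close>

locale glp_interval = glp_step \<Omega>\<^sub>1 \<Omega>\<^sub>2 U\<^sub>1 U\<^sub>2 U \<Delta>\<^sub>1 \<Delta>\<^sub>2 V C J h \<tau> \<rho> rk
  for \<Omega>\<^sub>1 :: "'a::euclidean_space set" and \<Omega>\<^sub>2 :: "'b::euclidean_space set"
    and U\<^sub>1 U\<^sub>2 U \<Delta>\<^sub>1 \<Delta>\<^sub>2 V C J h \<tau> \<rho> rk +
  fixes u0 :: "('a \<times> 'b) L2" and x :: "real \<Rightarrow> ('a \<times> 'b) L2" and \<alpha> \<eta> \<xi> :: real
  assumes u0: "u0 \<in> L2_on (\<Omega>\<^sub>1 \<times> \<Omega>\<^sub>2)" and xS: "\<And>t. t \<in> {0..h} \<Longrightarrow> x t \<in> L2_on (\<Omega>\<^sub>1 \<times> \<Omega>\<^sub>2)"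
    and soft: "\<And>t. t \<in> {0..h} \<Longrightarrow> norm (x t - soft_threshold \<alpha> (x t)) \<le> \<eta>"
    and resid: "\<And>t. t \<in> {0..h} \<Longrightarrow> norm (picard_map U V J \<tau> u0 (\<lambda>m. x (\<tau> m)) t - x t) \<le> \<xi>"
    and \<eta>0: "0 < \<eta>" and \<eta>\<xi>: "\<eta> \<le> \<xi>" and \<alpha>0: "0 < \<alpha>"
begin

definition \<theta> :: real where "\<theta> = sqrt \<rho>"
definition iter :: "nat \<Rightarrow> nat \<Rightarrow> ('a \<times> 'b) L2" where "iter = picard_iterate U V J \<tau> \<theta> u0"
definition \<beta> :: "nat \<Rightarrow> real" where "\<beta> k = max 1 (\<theta> ^ k * sigma_max u0 / \<alpha>)"
definition tol :: real where "tol = 4 * \<xi> * ((1 + \<rho>) / (1 - \<rho>)\<^sup>2)"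
definition rtol :: real where "rtol = \<rho> * tol / (1 - \<rho>)"
definition stop :: nat where "stop = stopping_index U V J \<tau> \<theta> tol u0"
definition A :: "nat \<Rightarrow> real" where "A k = \<xi> / (1 - \<rho>) + \<eta> * \<beta> k / (1 - \<theta>)"
abbreviation \<Phi> :: "(nat \<Rightarrow> ('a \<times> 'b) L2) \<Rightarrow> real \<Rightarrow> ('a \<times> 'b) L2" where "\<Phi> \<equiv> picard_map U V J \<tau> u0"

lemma \<theta>: "0 < \<theta>" "\<theta> < 1" "\<theta> * \<theta> = \<rho>" "\<rho> \<le> \<theta>"
proof -
  show \<theta>01: "0 < \<theta>" "\<theta> < 1" using \<rho>_pos \<rho>1 by (auto simp: \<theta>_def real_sqrt_lt_1_iff)
  show sq: "\<theta> * \<theta> = \<rho>" using \<rho>_pos by (simp add: \<theta>_def)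
  show "\<rho> \<le> \<theta>" using mult_right_mono[of \<theta> 1 \<theta>] \<theta>01 sq by linarith
qed

lemma \<xi>0: "0 < \<xi>" using \<eta>0 \<eta>\<xi> by simp

lemma sigma0: "0 \<le> sigma_max u0" by (simp add: sigma_max_def)

lemma iter_Suc: "iter (Suc k) j = soft_threshold (\<theta> ^ k * sigma_max u0) (\<Phi> (iter k) (\<tau> j))"
  by (simp add: iter_def)

lemma iter_in: "j \<in> {1..J} \<Longrightarrow> iter k j \<in> L2_on (\<Omega>\<^sub>1 \<times> \<Omega>\<^sub>2)"
proof (induction k arbitrary: j)
  case 0
  then show ?case by (simp add: iter_def subspace_0[OF L2_on_subspace[OF \<Omega>]])
next
  case (Suc k)
  have "\<Phi> (iter k) (\<tau> j) \<in> L2_on (\<Omega>\<^sub>1 \<times> \<Omega>\<^sub>2)"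
    using node_in[OF Suc.prems] by (intro picard_in u0 Suc.IH) auto
  then show ?case
    unfolding iter_Suc using \<theta>(1) sigma0 by (intro threshold_in_L2_on(1) G1.\<Omega> G2.\<Omega>) auto
qed

lemma picard_iter_in: "t \<in> {0..h} \<Longrightarrow> \<Phi> (iter k) t \<in> L2_on (\<Omega>\<^sub>1 \<times> \<Omega>\<^sub>2)"
  by (intro picard_in u0 iter_in) auto

text \<open>The first threshold is at least \<open>\<sigma>\<^sub>m\<^sub>a\<^sub>x\<close> of the free evolution of \<open>u0\<close>, since the latter acts factorwise.\<close>

lemma iter_1: 
  assumes j: "j \<in> {1..J}"
  shows "iter (Suc 0) j = 0"
proof -
  have "W t (0 + 0) = W t 0 + W t 0" for t by (rule W_add)
  then have W0: "W t 0 = 0" for t by simp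
  have "\<Phi> (iter 0) (\<tau> j) = W (\<tau> j) (u0 + (\<Sum>m=1..J. Lint m (\<tau> j) *\<^sub>R G (\<tau> m) (W (- \<tau> m) (iter 0 m))))"
    using node_in[OF j] by (intro picard_twisted u0 iter_in) auto
  also have "\<dots> = W (\<tau> j) u0"
    by (simp add: iter_def W0 linear_0[OF bounded_linear.linear[OF G_bounded_linear]])
  finally show ?thesis
    using sigma_max_W[of "\<tau> j" u0] by (simp only: iter_Suc power_0 mult_1_left) (rule soft_threshold_eq_0)
qed

lemma soft_residual:
  assumes t: "t \<in> {0..h}" and g: "0 \<le> \<gamma>"
  shows "norm (x t - soft_threshold \<gamma> (x t)) \<le> \<eta> * max 1 (\<gamma> / \<alpha>)"
proof (cases "\<gamma> \<le> \<alpha>")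
  case True
  have "norm (x t - soft_threshold \<gamma> (x t)) \<le> \<eta>"
    by (rule order_trans[OF soft_residual_mono[OF g True] soft[OF t]])
  also have "\<dots> \<le> \<eta> * max 1 (\<gamma> / \<alpha>)" using \<eta>0 by simp
  finally show ?thesis .
next
  case False
  then have "norm (x t - soft_threshold \<gamma> (x t)) \<le> \<gamma> / \<alpha> * norm (x t - soft_threshold \<alpha> (x t))"
    by (intro soft_residual_scale \<alpha>0) simp
  also have "\<dots> \<le> \<gamma> / \<alpha> * \<eta>" using \<alpha>0 g by (intro mult_left_mono soft t) auto
  also have "\<dots> \<le> \<eta> * max 1 (\<gamma> / \<alpha>)"
    using mult_left_mono[OF max.cobounded2[of "\<gamma> / \<alpha>" 1], of \<eta>] \<eta>0 by (simp add: mult.commute)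
  finally show ?thesis .
qed

lemma picard_error:
  assumes D: "\<And>m. m \<in> {1..J} \<Longrightarrow> norm (w m - x (\<tau> m)) \<le> D" and w: "\<And>m. m \<in> {1..J} \<Longrightarrow> w m \<in> L2_on (\<Omega>\<^sub>1 \<times> \<Omega>\<^sub>2)"
    and t: "t \<in> {0..h}"
  shows "norm (\<Phi> w t - x t) \<le> \<rho> * D + \<xi>"
proof -
  have "norm (\<Phi> w t - \<Phi> (\<lambda>m. x (\<tau> m)) t) \<le> norm (u0 - u0) + \<rho> * D"
    by (rule picard_contraction[OF u0 u0 w xS[OF node_closed] D t])
  with norm_triangle_mono[OF this resid[OF t]] show ?thesis by simp
qed

lemma iter_error_step:
  assumes D: "\<And>m. m \<in> {1..J} \<Longrightarrow> norm (iter k m - x (\<tau> m)) \<le> D" and j: "j \<in> {1..J}"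
  shows "norm (iter (Suc k) j - x (\<tau> j)) \<le> \<xi> + \<eta> * \<beta> k + \<rho> * D"
proof -
  let ?g = "\<theta> ^ k * sigma_max u0"
  have g: "0 \<le> ?g" using \<theta>(1) sigma0 by simp
  have "norm (soft_threshold ?g (\<Phi> (iter k) (\<tau> j)) - soft_threshold ?g (x (\<tau> j))) \<le> norm (\<Phi> (iter k) (\<tau> j) - x (\<tau> j))"
    by (rule soft_threshold_nonexpansive[OF g])
  also have "\<dots> \<le> \<rho> * D + \<xi>" by (rule picard_error[OF D iter_in node_closed[OF j]])
  finally have 1: "norm (soft_threshold ?g (\<Phi> (iter k) (\<tau> j)) - soft_threshold ?g (x (\<tau> j))) \<le> \<rho> * D + \<xi>" .
  have 2: "norm (soft_threshold ?g (x (\<tau> j)) - x (\<tau> j)) \<le> \<eta> * \<beta> k"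
    using soft_residual[OF node_closed[OF j] g] by (simp add: \<beta>_def norm_minus_commute)
  from norm_triangle_mono[OF 1 2] show ?thesis by (simp add: iter_Suc)
qed

lemma \<beta>1: "1 \<le> \<beta> k" by (simp add: \<beta>_def)

text \<open>Iterates 0 and 1 both vanish at the nodes, so the step estimate for k = 0 bounds the
  error of iterate 1 by itself and can be absorbed; this keeps the norm of the solution out of the
  bound. The induction rests on \<rho> \<beta>(k) \<le> \<theta> \<beta>(k+1). Index k belongs to
  iterate k + 1 because the latter is formed with the k-th threshold.\<close>

lemma iter_error: "j \<in> {1..J} \<Longrightarrow> norm (iter (Suc k) j - x (\<tau> j)) \<le> A k"
proof (induction k arbitrary: j)
  case 0
  have eq: "iter 0 m = iter (Suc 0) m" if "m \<in> {1..J}" for m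
    using iter_1[OF that] by (simp add: iter_def)
  have "norm (iter (Suc 0) j - x (\<tau> j)) \<le> (\<xi> + \<eta> * \<beta> 0) / (1 - \<rho>)"
  proof (rule absorb_max[OF _ 0])
    fix D i assume D: "\<And>m. m \<in> {1..J} \<Longrightarrow> norm (iter (Suc 0) m - x (\<tau> m)) \<le> D" and i: "i \<in> {1..J}"
    show "norm (iter (Suc 0) i - x (\<tau> i)) \<le> \<xi> + \<eta> * \<beta> 0 + \<rho> * D"
      by (rule iter_error_step[OF _ i]) (simp only: eq D)
  qed
  also have "\<dots> \<le> A 0"
    unfolding A_def add_divide_distrib using \<theta> \<eta>0 \<beta>1[of 0] by (intro add_mono order_refl divide_left_mono) auto
  finally show ?case .
next
  case (Suc k)
  have "\<theta> * \<beta> k = max (\<theta> * 1) (\<theta> * (\<theta> ^ k * sigma_max u0 / \<alpha>))"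
    unfolding \<beta>_def using \<theta>(1) by (simp only: max_mult_distrib_left) simp
  also have "\<dots> \<le> \<beta> (Suc k)"
    unfolding \<beta>_def power_Suc using \<theta>(2) by (intro max.mono) (simp_all add: mult.assoc)
  finally have "\<theta> * \<beta> k \<le> \<beta> (Suc k)" .
  then have "\<theta> * (\<theta> * \<beta> k) \<le> \<theta> * \<beta> (Suc k)" using \<theta>(1) by (intro mult_left_mono) auto
  then have "\<rho> * \<beta> k \<le> \<theta> * \<beta> (Suc k)" by (simp only: mult.assoc[symmetric] \<theta>(3))
  then have "\<eta> * (\<rho> * \<beta> k) \<le> \<eta> * (\<theta> * \<beta> (Suc k))" using \<eta>0 by (intro mult_left_mono) auto
  then have "\<eta> * (\<rho> * \<beta> k) / (1 - \<theta>) + \<eta> * \<beta> (Suc k) \<le> \<eta> * (\<theta> * \<beta> (Suc k)) / (1 - \<theta>) + \<eta> * \<beta> (Suc k)"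
    using \<theta>(2) by (intro add_right_mono divide_right_mono) auto
  also have "\<dots> = \<eta> * \<beta> (Suc k) / (1 - \<theta>)" using \<theta>(2) by (simp add: field_simps)
  finally have 1: "\<rho> * (\<eta> * \<beta> k / (1 - \<theta>)) + \<eta> * \<beta> (Suc k) \<le> \<eta> * \<beta> (Suc k) / (1 - \<theta>)" by (simp add: mult_ac)
  have 2: "\<rho> * (\<xi> / (1 - \<rho>)) + \<xi> = \<xi> / (1 - \<rho>)" using \<rho>1 by (simp add: field_simps)
  have "norm (iter (Suc (Suc k)) j - x (\<tau> j)) \<le> \<xi> + \<eta> * \<beta> (Suc k) + \<rho> * A k"
    by (rule iter_error_step[OF Suc.IH Suc.prems])
  also have "\<dots> \<le> A (Suc k)" unfolding A_def distrib_left using 1 2 by linarith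
  finally show ?case .
qed

lemma picard_iter_error: "t \<in> {0..h} \<Longrightarrow> norm (\<Phi> (iter (Suc k)) t - x t) \<le> \<rho> * A k + \<xi>"
  by (rule picard_error[OF iter_error iter_in])

text \<open>The identity (1 + \<theta>) (1 - \<theta>) = 1 - \<rho> replaces 1 / (1 - \<theta>) by
  at most 2 / (1 - \<rho>).\<close>

lemma A_le: "A k \<le> (\<xi> + 2 * (\<eta> * \<beta> k)) / (1 - \<rho>)"
proof -
  have eq: "(1 + \<theta>) * (1 - \<theta>) = 1 - \<rho>" using \<theta>(3) by (simp add: algebra_simps)
  have "\<eta> * \<beta> k / (1 - \<theta>) = (1 + \<theta>) * (\<eta> * \<beta> k) / (1 - \<rho>)"
    unfolding eq[symmetric] using \<theta>(1,2) by simp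
  also have "\<dots> \<le> 2 * (\<eta> * \<beta> k) / (1 - \<rho>)"
    using \<theta>(2) \<eta>0 \<beta>1[of k] \<rho>1 by (intro divide_right_mono mult_right_mono mult_nonneg_nonneg) auto
  finally show ?thesis by (simp add: A_def add_divide_distrib)
qed

text \<open>Passing through the exact solution gives a residual of at most (1 + \<rho>)
  \<open>A k\<close> + \<xi>, with \<open>A k\<close> at most 3 \<xi> / (1 - \<rho>). The tolerance
  is shaped to dominate the resulting \<xi> (4 + 2 \<rho>) / (1 - \<rho>).\<close>

lemma residual_small:
  assumes "\<eta> * \<beta> k \<le> \<xi>" and j: "j \<in> {1..J}"
  shows "norm (\<Phi> (iter (Suc k)) (\<tau> j) - iter (Suc k) j) \<le> tol"
proof -
  have "norm (x (\<tau> j) - iter (Suc k) j) \<le> A k" using iter_error[OF j] by (simp add: norm_minus_commute)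
  from norm_triangle_mono[OF picard_iter_error[OF node_closed[OF j]] this]
  have "norm (\<Phi> (iter (Suc k)) (\<tau> j) - iter (Suc k) j) \<le> (1 + \<rho>) * A k + \<xi>" by (simp add: algebra_simps)
  also have "A k \<le> 3 * \<xi> / (1 - \<rho>)"
    using assms(1) \<rho>1 by (intro order_trans[OF A_le] divide_right_mono) auto
  then have "(1 + \<rho>) * A k + \<xi> \<le> (1 + \<rho>) * (3 * \<xi> / (1 - \<rho>)) + \<xi>"
    using \<rho>_pos by (intro add_right_mono mult_left_mono) auto
  also have "\<dots> = \<xi> * (4 + 2 * \<rho>) / (1 - \<rho>)"
    using \<rho>1 by (simp add: field_simps)
  also have "\<dots> = \<xi> * ((4 + 2 * \<rho>) * (1 - \<rho>)) / (1 - \<rho>)\<^sup>2"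
    using \<rho>1 by (simp add: power2_eq_square)
  also have "\<dots> \<le> \<xi> * (4 * (1 + \<rho>)) / (1 - \<rho>)\<^sup>2"
    using \<xi>0 \<rho>_pos by (intro divide_right_mono mult_left_mono) (auto simp: algebra_simps)
  also have "\<dots> = tol" by (simp add: tol_def)
  finally show ?thesis .
qed

lemma norm_J_le: "norm_J J w \<le> c \<longleftrightarrow> (\<forall>j\<in>{1..J}. norm (w j) \<le> c)"
  unfolding norm_J_def using J1 by (subst Max_le_iff) auto

text \<open>The thresholds tend to zero, so \<beta>(k) is eventually 1 and \<eta> \<le> \<xi>
  triggers the criterion; hence the least index exists. Its minimality gives the second claim as the
  contrapositive of \<open>residual_small\<close>.\<close>

lemma stop:
  shows "\<And>j. j \<in> {1..J} \<Longrightarrow> norm (\<Phi> (iter stop) (\<tau> j) - iter stop j) \<le> tol"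
    and "\<And>k. Suc k < stop \<Longrightarrow> \<xi> < \<eta> * \<beta> k"
proof -
  let ?P = "\<lambda>k. norm_J J (\<lambda>j. \<Phi> (iter k) (\<tau> j) - iter k j) \<le> tol"
  have stop: "stop = (LEAST k. ?P k)" by (simp add: stop_def stopping_index_def iter_def)
  have small: "?P (Suc k)" if "\<eta> * \<beta> k \<le> \<xi>" for k
    unfolding norm_J_le using residual_small[OF that] by blast
  have "(\<lambda>k. \<theta> ^ k * (sigma_max u0 / \<alpha>)) \<longlonglongrightarrow> 0 * (sigma_max u0 / \<alpha>)"
    using \<theta> by (intro tendsto_mult LIMSEQ_power_zero tendsto_const) auto
  then have "\<forall>\<^sub>F k in sequentially. \<theta> ^ k * (sigma_max u0 / \<alpha>) < 1"
    by (intro order_tendstoD(2)[where a = 1]) auto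
  then obtain k where "\<theta> ^ k * (sigma_max u0 / \<alpha>) < 1"
    using eventually_happens' sequentially_bot by blast
  then have "\<beta> k = 1" by (simp add: \<beta>_def)
  with \<eta>\<xi> have "?P (Suc k)" by (intro small) simp
  then have "?P stop" unfolding stop by (rule LeastI)
  then show "norm (\<Phi> (iter stop) (\<tau> j) - iter stop j) \<le> tol" if "j \<in> {1..J}" for j
    using that unfolding norm_J_le by blast
  show "\<xi> < \<eta> * \<beta> k" if "Suc k < stop" for k
    using small[of k] not_less_Least[of "Suc k" ?P] that unfolding stop by linarith
qed

text \<open>The rank of an iterate in units of \<eta>^2 / \<alpha>^2: the 1 stands for the truncated
  exact solution, the rest for the squared ratio of the error \<open>M\<close> to the threshold in
  \<open>iter_tensor_rank\<close>.\<close>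

definition gain :: real where "gain = 1 + 4 * ((1 + \<rho>) / (1 - \<rho>))\<^sup>2 / \<rho>"
definition iter_rank :: nat where "iter_rank = nat \<lfloor>gain * (\<eta>\<^sup>2 / \<alpha>\<^sup>2)\<rfloor>"

lemma x_hard:
  assumes t: "t \<in> {0..h}"
  obtains p where "tensor_rank_le p (hard_threshold \<alpha> (x t))" "real p \<le> \<eta>\<^sup>2 / \<alpha>\<^sup>2"
    "norm (x t - hard_threshold \<alpha> (x t)) \<le> \<eta>"
  using hard_threshold_rank[OF \<alpha>0] card_sing_val_gt(2)[OF \<alpha>0 soft[OF t]]
    order_trans[OF hard_residual_le_soft[OF less_imp_le[OF \<alpha>0]] soft[OF t]] by (rule that)

text \<open>Iterates 0 and 1 vanish. Iterate l + 2 is cut with the threshold of index l + 1, while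
  minimality of the stopping index controls only \<beta>(l); the missing factor \<theta> in the
  threshold is the 1 / \<rho> in \<open>gain\<close>.\<close>

lemma iter_tensor_rank:
  assumes k: "k \<le> stop" and j: "j \<in> {1..J}"
  shows "tensor_rank_le iter_rank (iter k j)"
proof -
  consider "k = 0" | "k = Suc 0" | l where "k = Suc (Suc l)" by (metis not0_implies_Suc)
  then show ?thesis
  proof cases
    case 1
    then show ?thesis by (simp add: iter_def)
  next
    case 2
    then show ?thesis using iter_1[OF j] by simp
  next
    case 3
    then have less: "\<xi> < \<eta> * \<beta> l" using k by (intro stop(2)) simp
    define y where "y = \<eta> * \<beta> l"
    have y: "\<xi> \<le> y" "\<eta> \<le> y" "0 < y" using less \<eta>\<xi> \<eta>0 by (auto simp: y_def \<beta>1 intro: mult_pos_pos less_le_trans[OF zero_less_one \<beta>1])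
    have "\<eta> * 1 < \<eta> * \<beta> l" using less \<eta>\<xi> by simp
    then have "1 < \<beta> l" using \<eta>0 by (simp only: mult_less_cancel_left_pos)
    then have "\<beta> l = \<theta> ^ l * sigma_max u0 / \<alpha>" by (auto simp: \<beta>_def max_def split: if_splits)
    then have g: "\<theta> ^ Suc l * sigma_max u0 = \<theta> * \<beta> l * \<alpha>" using \<alpha>0 by simp
    have gpos: "0 < \<theta> * \<beta> l * \<alpha>" using \<theta>(1) \<alpha>0 \<open>1 < \<beta> l\<close> by simp
    \<comment> \<open>Chosen to dominate \<rho> \<open>A l\<close> + \<xi> + \<eta>, which is at
      most y (2 + \<rho>) / (1 - \<rho>): the distance from the unthresholded Picard value to the
      truncated exact solution.\<close>
    define M where "M = 2 * y * ((1 + \<rho>) / (1 - \<rho>))"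
    obtain p where p: "tensor_rank_le p (hard_threshold \<alpha> (x (\<tau> j)))" "real p \<le> \<eta>\<^sup>2 / \<alpha>\<^sup>2"
      "norm (x (\<tau> j) - hard_threshold \<alpha> (x (\<tau> j))) \<le> \<eta>"
      by (rule x_hard[OF node_closed[OF j]])
    have "A l \<le> 3 * y / (1 - \<rho>)"
      using y \<rho>1 by (intro order_trans[OF A_le] divide_right_mono) (auto simp: y_def)
    then have "\<rho> * A l \<le> \<rho> * (3 * y / (1 - \<rho>))" using \<rho>_pos by (intro mult_left_mono) auto
    moreover have "\<rho> * (3 * y / (1 - \<rho>)) + y + y \<le> M"
    proof -
      have "\<rho> * (3 * y / (1 - \<rho>)) + y + y = y * (2 + \<rho>) / (1 - \<rho>)" using \<rho>1 by (simp add: field_simps)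
      also have "\<dots> \<le> y * (2 * (1 + \<rho>)) / (1 - \<rho>)"
        using y(3) \<rho>1 \<rho>_pos by (intro divide_right_mono mult_left_mono) auto
      finally show ?thesis by (simp add: M_def mult_ac)
    qed
    ultimately have "\<rho> * A l + \<xi> + \<eta> \<le> M" using y by linarith
    moreover from norm_triangle_mono[OF picard_iter_error[OF node_closed[OF j]] p(3)]
    have "norm (\<Phi> (iter (Suc l)) (\<tau> j) - hard_threshold \<alpha> (x (\<tau> j))) \<le> \<rho> * A l + \<xi> + \<eta>" by simp
    ultimately have "norm (\<Phi> (iter (Suc l)) (\<tau> j) - hard_threshold \<alpha> (x (\<tau> j))) \<le> M" by linarith
    from card_sing_val_gt_perturb[OF p(1) gpos this]
    have "real (card {k. sing_val (\<Phi> (iter (Suc l)) (\<tau> j)) k > \<theta> * \<beta> l * \<alpha>}) \<le> \<eta>\<^sup>2 / \<alpha>\<^sup>2 + M\<^sup>2 / (\<theta> * \<beta> l * \<alpha>)\<^sup>2"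
      using p(2) by linarith
    also have "(\<theta> * \<beta> l * \<alpha>)\<^sup>2 = \<rho> * (\<beta> l)\<^sup>2 * \<alpha>\<^sup>2"
      by (simp add: power_mult_distrib) (simp add: power2_eq_square \<theta>(3))
    also have "\<eta>\<^sup>2 / \<alpha>\<^sup>2 + M\<^sup>2 / (\<rho> * (\<beta> l)\<^sup>2 * \<alpha>\<^sup>2) = gain * (\<eta>\<^sup>2 / \<alpha>\<^sup>2)"
    proof -
      define Q where "Q = (1 + \<rho>) / (1 - \<rho>)"
      have "M\<^sup>2 = 4 * \<eta>\<^sup>2 * Q\<^sup>2 * (\<beta> l)\<^sup>2" unfolding M_def y_def Q_def[symmetric] by (simp add: power_mult_distrib)
      then show ?thesis
        using \<open>1 < \<beta> l\<close> \<alpha>0 \<rho>_pos by (simp add: gain_def Q_def[symmetric] field_simps)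
    qed
    finally have "card {k. sing_val (\<Phi> (iter (Suc l)) (\<tau> j)) k > \<theta> * \<beta> l * \<alpha>} \<le> iter_rank"
      unfolding iter_rank_def by (simp add: le_nat_floor)
    then have "tensor_rank_le iter_rank (soft_threshold (\<theta> * \<beta> l * \<alpha>) (\<Phi> (iter (Suc l)) (\<tau> j)))"
      by (rule tensor_rank_le_mono[OF soft_threshold_rank[OF gpos]])
    then show ?thesis unfolding 3 iter_Suc g .
  qed
qed

lemma picard_iter_rank:
  assumes "tensor_rank_le R u0" "k \<le> stop" "0 \<le> t"
  shows "tensor_rank_le (R + J * (rk * iter_rank)) (\<Phi> (iter k) t)"
  by (intro picard_rank u0 iter_in iter_tensor_rank assms)

lemma tol0: "0 < tol" using \<xi>0 \<rho>_pos \<rho>1 by (simp add: tol_def)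

lemma rtol0: "0 < rtol" using tol0 \<rho>_pos \<rho>1 by (simp add: rtol_def)

text \<open>The residual bound \<open>tol\<close> makes the last iterate an approximate fixed point,
  with nodal error \<open>tol / (1 - \<rho>)\<close> after absorption. Evaluating the Picard map at
  h contracts once more, which is why \<delta>_n carries the factor \<rho>.\<close>

lemma final_collocation_error:
  assumes c: "collocation_solution u0 c"
  shows "norm (\<Phi> (iter stop) h - c h) \<le> rtol"
proof -
  note cD = collocation_solutionD[OF c]
  have contr: "norm (\<Phi> (iter stop) t - c t) \<le> \<rho> * D"
    if D: "\<And>m. m \<in> {1..J} \<Longrightarrow> norm (iter stop m - c (\<tau> m)) \<le> D" and t: "t \<in> {0..h}" for D t
  proof -
    have "norm (\<Phi> (iter stop) t - \<Phi> (\<lambda>m. c (\<tau> m)) t) \<le> norm (u0 - u0) + \<rho> * D"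
      by (rule picard_contraction[OF u0 u0 iter_in cD(1)[OF node_closed] D t])
    then show ?thesis by (subst cD(2)[OF t]) simp
  qed
  have "norm (iter stop j - c (\<tau> j)) \<le> tol / (1 - \<rho>)" if j: "j \<in> {1..J}" for j
  proof (rule absorb_max[OF _ j])
    fix D i assume D: "\<And>m. m \<in> {1..J} \<Longrightarrow> norm (iter stop m - c (\<tau> m)) \<le> D" and i: "i \<in> {1..J}"
    have "norm (iter stop i - \<Phi> (iter stop) (\<tau> i)) \<le> tol" using stop(1)[OF i] by (simp add: norm_minus_commute)
    from norm_triangle_mono[OF this contr[OF D node_closed[OF i]]]
    show "norm (iter stop i - c (\<tau> i)) \<le> tol + \<rho> * D" by simp
  qed
  from contr[OF this, of h] show ?thesis using h0 by (simp add: rtol_def)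
qed

lemma collocation_error:
  assumes c: "collocation_solution u0 c"
  shows "norm (c h - x h) \<le> \<xi> / (1 - \<rho>)"
proof -
  note cD = collocation_solutionD[OF c]
  have err: "norm (c t - x t) \<le> \<rho> * D + \<xi>"
    if D: "\<And>m. m \<in> {1..J} \<Longrightarrow> norm (c (\<tau> m) - x (\<tau> m)) \<le> D" and t: "t \<in> {0..h}" for D t
    by (subst cD(2)[OF t]) (rule picard_error[OF D cD(1)[OF node_closed] t])
  have "norm (c (\<tau> j) - x (\<tau> j)) \<le> \<xi> / (1 - \<rho>)" if j: "j \<in> {1..J}" for j
  proof (rule absorb_max[OF _ j])
    fix D i assume D: "\<And>m. m \<in> {1..J} \<Longrightarrow> norm (c (\<tau> m) - x (\<tau> m)) \<le> D" and i: "i \<in> {1..J}"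
    show "norm (c (\<tau> i) - x (\<tau> i)) \<le> \<xi> + \<rho> * D" using err[OF D node_closed[OF i]] by simp
  qed
  from err[OF this, of h] have "norm (c h - x h) \<le> \<rho> * (\<xi> / (1 - \<rho>)) + \<xi>" using h0 by simp
  also have "\<dots> = \<xi> / (1 - \<rho>)" using \<rho>1 by (simp add: field_simps)
  finally show ?thesis .
qed

section \<open>The recompressed endpoint value and its rank\<close>

definition next_value :: "('a \<times> 'b) L2" where "next_value = recompress rtol (\<Phi> (iter stop) h)"

lemma next_value_in: "next_value \<in> L2_on (\<Omega>\<^sub>1 \<times> \<Omega>\<^sub>2)"
  unfolding next_value_def using h0 by (intro threshold_in_L2_on(3) G1.\<Omega> G2.\<Omega> picard_iter_in rtol0) simp

lemma next_value_error:
  assumes c: "collocation_solution u0 c"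
  shows "norm (next_value - c h) \<le> 2 * rtol"
proof -
  have "norm (next_value - \<Phi> (iter stop) h) \<le> rtol"
    using recompress_props[OF rtol0, of "\<Phi> (iter stop) h"] unfolding next_value_def norm_minus_commute[of "recompress _ _"] by metis
  from norm_triangle_mono[OF this final_collocation_error[OF c]] show ?thesis by simp
qed

lemma next_value_rank:
  assumes R: "tensor_rank_le R u0"
  obtains r p where "tensor_rank_le r next_value" "real p \<le> \<eta>\<^sup>2 / \<alpha>\<^sup>2"
    "real r \<le> max (real p) (real p + 1 + (1 - \<rho>\<^sup>2) * (real (R + J * (rk * iter_rank)) - real p))"
proof -
  obtain c where c: "collocation_solution u0 c" by (rule ex_collocation_solution[OF u0])
  have hh: "h \<in> {0..h}" using h0 by simp
  obtain p where p: "tensor_rank_le p (hard_threshold \<alpha> (x h))" "real p \<le> \<eta>\<^sup>2 / \<alpha>\<^sup>2"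
    "norm (x h - hard_threshold \<alpha> (x h)) \<le> \<eta>"
    by (rule x_hard[OF hh])
  have "norm ((\<Phi> (iter stop) h - c h) + ((c h - x h) + (x h - hard_threshold \<alpha> (x h)))) \<le> rtol + (\<xi> / (1 - \<rho>) + \<eta>)"
    by (intro norm_triangle_mono final_collocation_error[OF c] collocation_error[OF c] p(3))
  \<comment> \<open>\<open>rtol / \<rho>\<close> exceeds \<open>rtol\<close> by exactly
    \<open>tol\<close>, and \<open>tol\<close> is at least 2 \<xi> / (1 - \<rho>), which covers the
    two other errors because \<eta> \<le> \<xi>.\<close>
  also have "\<dots> \<le> rtol / \<rho>"
  proof -
    define a where "a = \<xi> / (1 - \<rho>)"
    have a: "0 < a" using \<xi>0 \<rho>1 by (simp add: a_def)
    have "\<eta> \<le> a * (1 - \<rho>)" using \<eta>\<xi> \<rho>1 by (simp add: a_def)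
    also have "\<dots> \<le> a" using a \<rho>_pos by (simp add: algebra_simps)
    finally have "\<xi> / (1 - \<rho>) + \<eta> \<le> 2 * a" by (simp add: a_def)
    moreover have "rtol / \<rho> - rtol = tol"
    proof -
      define y where "y = tol / (1 - \<rho>)"
      have "rtol = \<rho> * y" "tol = (1 - \<rho>) * y" using \<rho>1 by (simp_all add: rtol_def y_def)
      then show ?thesis using \<rho>_pos by (simp add: algebra_simps)
    qed
    moreover have "2 * a \<le> tol"
    proof -
      have "tol = a * (4 * (1 + \<rho>) / (1 - \<rho>))" by (simp add: tol_def a_def power2_eq_square)
      moreover have "2 \<le> 4 * (1 + \<rho>) / (1 - \<rho>)" using \<rho>1 \<rho>_pos by (simp add: field_simps)
      ultimately show ?thesis using a mult_left_mono[of 2 "4 * (1 + \<rho>) / (1 - \<rho>)" a] by simp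
    qed
    ultimately show ?thesis by linarith
  qed
  finally have M: "norm (\<Phi> (iter stop) h - hard_threshold \<alpha> (x h)) \<le> rtol / \<rho>" by simp
  have le: "rtol \<le> rtol / \<rho>" using rtol0 \<rho>_pos \<rho>1 by (simp add: field_simps)
  have q: "rtol\<^sup>2 / (rtol / \<rho>)\<^sup>2 = \<rho>\<^sup>2" using rtol0 by (simp add: power_divide)
  have "tensor_rank_le (R + J * (rk * iter_rank)) (\<Phi> (iter stop) h)"
    using h0 by (intro picard_iter_rank R) auto
  from recompress_rank[OF this p(1) M rtol0 le] obtain r where "tensor_rank_le r next_value"
    "real r \<le> max (real p) (real p + 1 + (1 - \<rho>\<^sup>2) * (real (R + J * (rk * iter_rank)) - real p))"
    unfolding q next_value_def by blast
  with p(2) show ?thesis by (intro that)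
qed

definition rank_bound :: "real \<Rightarrow> real" where
  "rank_bound m = 16 / \<rho> ^ 3 * ((1 + \<rho>) / (1 - \<rho>))\<^sup>2 * (1 + real J * real rk * m)"

text \<open>Let X = J rk m. One subinterval adds at most \<open>gain\<close> X to the rank, and
  recompression then gains \<rho>^2 times the excess, up to the rounding term 1. The bound is scaled
  so that \<rho>^2 times it equals q (1 + X), which exceeds 1 + \<open>gain\<close> X because
  \<open>q\<close> is at least 1 and at least \<open>gain\<close>.\<close>

lemma rank_bound_closes:
  assumes R: "real R \<le> rank_bound m" and m: "\<eta>\<^sup>2 / \<alpha>\<^sup>2 \<le> m"
  shows "real iter_rank \<le> rank_bound m" "real (R + J * (rk * iter_rank)) \<le> 2 * rank_bound m"
    "real p \<le> \<eta>\<^sup>2 / \<alpha>\<^sup>2 \<Longrightarrow>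
      max (real p) (real p + 1 + (1 - \<rho>\<^sup>2) * (real (R + J * (rk * iter_rank)) - real p)) \<le> rank_bound m"
proof -
  define q where "q = 16 * ((1 + \<rho>) / (1 - \<rho>))\<^sup>2 / \<rho>"
  define X where "X = real J * real rk * m"
  have B: "rank_bound m = q / \<rho>\<^sup>2 * (1 + X)"
    by (simp add: rank_bound_def q_def X_def power2_eq_square power3_eq_cube)
  have Jr: "1 \<le> real J * real rk" using J1 rk1 by (metis mult_le_one nat_mult_1 of_nat_1 of_nat_le_iff of_nat_mult mult_le_mono)
  have m0: "0 \<le> m" using m order_trans[OF _ m, of 0] by simp
  have mX: "m \<le> X" unfolding X_def using mult_right_mono[OF Jr m0] by simp
  have X0: "0 \<le> X" using mX m0 by simp
  have "1 \<le> (1 + \<rho>) / (1 - \<rho>)" using \<rho>_pos \<rho>1 by simp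
  then have "1 \<le> ((1 + \<rho>) / (1 - \<rho>))\<^sup>2" by (rule one_le_power)
  then have "\<rho> \<le> ((1 + \<rho>) / (1 - \<rho>))\<^sup>2" using \<rho>1 by simp
  then have "1 \<le> ((1 + \<rho>) / (1 - \<rho>))\<^sup>2 / \<rho>" using \<rho>_pos by simp
  then have q: "gain \<le> q" "1 \<le> q" "1 \<le> gain" by (simp_all add: gain_def q_def)
  have rho2: "0 < \<rho>\<^sup>2" "\<rho>\<^sup>2 \<le> 1" using \<rho>_pos \<rho>1 by (auto simp: power_le_one)
  have "q * 1 \<le> q * (1 / \<rho>\<^sup>2)" using q rho2 by (intro mult_left_mono) auto
  then have "q \<le> q / \<rho>\<^sup>2" by simp
  then have "q * (1 + X) \<le> q / \<rho>\<^sup>2 * (1 + X)" using X0 by (intro mult_right_mono) auto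
  then have qX: "q + q * X \<le> rank_bound m" unfolding B by (simp add: algebra_simps)
  have "0 \<le> gain * (\<eta>\<^sup>2 / \<alpha>\<^sup>2)" using q by simp
  then have "real iter_rank \<le> gain * (\<eta>\<^sup>2 / \<alpha>\<^sup>2)" unfolding iter_rank_def by linarith
  also have "\<dots> \<le> gain * m" using q m by (intro mult_left_mono) auto
  finally have ir: "real iter_rank \<le> gain * m" .
  have "gain * m \<le> q * X" using q mX m0 X0 by (intro mult_mono) auto
  with ir qX q show "real iter_rank \<le> rank_bound m" by linarith
  have "(real J * real rk) * real iter_rank \<le> (real J * real rk) * (gain * m)" by (intro mult_left_mono ir) simp
  then have P: "real (R + J * (rk * iter_rank)) \<le> rank_bound m + gain * X"
    using R by (simp add: X_def mult_ac)
  have gX: "gain * X \<le> q * X" using q X0 by (intro mult_right_mono)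
  with P qX q show "real (R + J * (rk * iter_rank)) \<le> 2 * rank_bound m" by linarith
  assume p: "real p \<le> \<eta>\<^sup>2 / \<alpha>\<^sup>2"
  then have pX: "real p \<le> X" using m mX by linarith
  have "X \<le> q * X" using mult_right_mono[OF q(2) X0] by simp
  then have 1: "real p \<le> rank_bound m" using pX qX q by linarith
  have "(1 - \<rho>\<^sup>2) * real (R + J * (rk * iter_rank)) \<le> (1 - \<rho>\<^sup>2) * (rank_bound m + gain * X)"
    using rho2 by (intro mult_left_mono P) simp
  moreover have "\<rho>\<^sup>2 * real p \<le> \<rho>\<^sup>2 * (gain * X)"
    using mult_right_mono[OF q(3) X0] pX rho2 by (intro mult_left_mono) auto
  moreover have "\<rho>\<^sup>2 * rank_bound m = q + q * X" unfolding B using rho2 by (simp add: field_simps)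
  ultimately have 2: "real p + 1 + (1 - \<rho>\<^sup>2) * (real (R + J * (rk * iter_rank)) - real p) \<le> rank_bound m"
    using gX q by (simp add: algebra_simps) 
  from 1 2 show "max (real p) (real p + 1 + (1 - \<rho>\<^sup>2) * (real (R + J * (rk * iter_rank)) - real p)) \<le> rank_bound m"
    by simp
qed

end

subsection \<open>The exact solution on a subinterval\<close>

lemma has_vector_derivative_shift_within:
  fixes f :: "real \<Rightarrow> 'a::real_normed_vector"
  assumes f: "(f has_vector_derivative f') (at (b + s) within I)" and sub: "(+) b ` I' \<subseteq> I"
  shows "((\<lambda>s. f (b + s)) has_vector_derivative f') (at s within I')"
proof -
  have "((+) b has_vector_derivative 1) (at s within I')"
    by (auto intro!: derivative_eq_intros)
  from vector_diff_chain_within[OF this has_vector_derivative_within_subset[OF f sub]]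
  show ?thesis by (simp add: o_def)
qed

lemma picard_map_cong:
  "(\<And>m. m \<in> {1..J} \<Longrightarrow> w m = w' m) \<Longrightarrow> picard_map U V J \<tau> u0 w t = picard_map U V J \<tau> u0 w' t"
  unfolding picard_map_def
  by (intro arg_cong2[where f = "(-)"] refl arg_cong[where f = "scaleC _"] arg_cong[where f = "integral _"]
      ext sum.cong) simp

lemma schroedinger_solutionD:
  assumes "schroedinger_solution S U V T u"
  shows "continuous_on {0..T} u" "t \<in> {0..T} \<Longrightarrow> u t \<in> S"
    "t \<in> {0..T} \<Longrightarrow> u t = U t (u 0) - \<i> *\<^sub>C integral {0..t} (\<lambda>s. U (t - s) (mult_op V (u s)))"
  using assms unfolding schroedinger_solution_def by blast+

text \<open>Pulled back by \<open>W (- s)\<close>, Duhamel's formula becomes an ordinary indefinite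
  integral of a continuous function, so the mild solution is classically differentiable after
  twisting.\<close>

lemma (in potential_group) solution_twisted_derivative:
  assumes u: "schroedinger_solution (L2_on \<Omega>) U V T u" and t: "t \<in> {0..T}"
  shows "((\<lambda>s. W (- s) (u s)) has_vector_derivative G t (W (- t) (u t))) (at t within {0..T})"
proof -
  note uc = schroedinger_solutionD(1)[OF u] and uS = schroedinger_solutionD(2)[OF u]
  define F where "F = (\<lambda>s. W (- s) (Vop (u s)))"
  have Vu: "continuous_on A (\<lambda>s. Vop (u s))" if "A \<subseteq> {0..T}" for A
    by (rule bounded_linear.continuous_on[OF Vop_bounded_linear continuous_on_subset[OF uc that]])
  have eq: "W (- s) (u s) = u 0 - \<i> *\<^sub>C integral {0..s} F" if s: "s \<in> {0..T}" for s
  proof -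
    have sub: "{0..s} \<subseteq> {0..T}" using s by auto
    have 0: "0 \<in> {0..T}" using s by auto
    have "integral {0..s} (\<lambda>r. U (s - r) (mult_op V (u r))) = integral {0..s} (\<lambda>r. W (s - r) (Vop (u r)))"
    proof (rule integral_cong)
      fix r assume "r \<in> {0..s}"
      then have "Vop (u r) = mult_op V (u r)" using sub by (intro Vop_eq uS) blast
      then show "U (s - r) (mult_op V (u r)) = W (s - r) (Vop (u r))" using W_eq_U[OF Vop_in, of "s - r" "u r"] by simp
    qed
    moreover have "u s = U s (u 0) - \<i> *\<^sub>C integral {0..s} (\<lambda>r. U (s - r) (mult_op V (u r)))"
      by (rule schroedinger_solutionD(3)[OF u s])
    ultimately have us: "u s = W s (u 0) - \<i> *\<^sub>C integral {0..s} (\<lambda>r. W (s - r) (Vop (u r)))"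
      by (simp only: W_eq_U[OF uS[OF 0]])
    have int: "(\<lambda>r. W (s - r) (Vop (u r))) integrable_on {0..s}"
      by (intro integrable_continuous_interval W_continuous_on continuous_intros Vu sub)
    have "W (- s) (u s) = u 0 - \<i> *\<^sub>C W (- s) (integral {0..s} (\<lambda>r. W (s - r) (Vop (u r))))"
      by (subst us) (simp only: W_diff W_scaleC W_W W_0 add.left_inverse proj_L2_on[OF \<Omega> uS[OF 0]])
    also have "W (- s) (integral {0..s} (\<lambda>r. W (s - r) (Vop (u r)))) = integral {0..s} F"
      using integral_linear[OF int W_bounded_linear[of "- s"]] by (simp add: o_def W_W F_def)
    finally show ?thesis .
  qed
  have "continuous_on {0..T} F" unfolding F_def by (intro W_continuous_on continuous_intros Vu) simp
  from integral_has_vector_derivative[OF this t]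
  have "((\<lambda>s. \<i> *\<^sub>C integral {0..s} F) has_vector_derivative \<i> *\<^sub>C F t) (at t within {0..T})"
    by (rule bounded_linear.has_vector_derivative[OF bounded_bilinear.bounded_linear_right[OF scaleC_bilinear]])
  from has_vector_derivative_diff[OF has_vector_derivative_const this]
  have "((\<lambda>s. u 0 - \<i> *\<^sub>C integral {0..s} F) has_vector_derivative 0 - \<i> *\<^sub>C F t) (at t within {0..T})" .
  then have "((\<lambda>s. W (- s) (u s)) has_vector_derivative 0 - \<i> *\<^sub>C F t) (at t within {0..T})"
    by (rule has_vector_derivative_transform[OF t, rotated]) (simp only: eq)
  moreover have "G t (W (- t) (u t)) = 0 - \<i> *\<^sub>C F t"
    by (simp add: G_def F_def W_W W_0 proj_L2_on[OF \<Omega> uS[OF t]])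
  ultimately show ?thesis by simp
qed

locale collocation_solved = collocation \<Omega> U V C J h \<tau> \<rho>
  for \<Omega> :: "'a::euclidean_space set" and U V C J h \<tau> \<rho> +
  fixes T :: real and u :: "real \<Rightarrow> 'a L2"
  assumes u: "schroedinger_solution (L2_on \<Omega>) U V T u"
begin

lemma u_in: "t \<in> {0..T} \<Longrightarrow> u t \<in> L2_on \<Omega>"
  by (rule schroedinger_solutionD(2)[OF u])

lemma u_continuous: "continuous_on {0..T} u"
  by (rule schroedinger_solutionD(1)[OF u])

lemma norm_u: "t \<in> {0..T} \<Longrightarrow> norm (u t) = norm (u 0)"
proof -
  assume t: "t \<in> {0..T}"
  note d = solution_twisted_derivative[OF u]
  have "inner (W (- t) (u t)) (W (- t) (u t)) = inner (W (- 0) (u 0)) (W (- 0) (u 0))"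
    by (rule flow_inner_const[OF d d t])
  then have "norm (W (- t) (u t)) = norm (W (- 0) (u 0))" by (simp only: norm_eq_sqrt_inner)
  then show ?thesis using t by (simp add: norm_W_on u_in)
qed

text \<open>The interaction picture restarted at the left endpoint b, so that its initial value is
  \<open>u b\<close> and local time enters the Picard map as in the scheme.\<close>

definition local_flow :: "real \<Rightarrow> real \<Rightarrow> 'a L2" where
  "local_flow b s = W (- s) (u (b + s))"

context
  fixes b assumes b: "0 \<le> b" "b + h \<le> T"
begin

lemma sub: "s \<in> {0..h} \<Longrightarrow> b + s \<in> {0..T}" "(+) b ` {0..h} \<subseteq> {0..T}"
  using b by auto

lemma W_local_flow: "s \<in> {0..h} \<Longrightarrow> W s (local_flow b s) = u (b + s)"
  by (simp only: local_flow_def W_W W_0 add.right_inverse proj_L2_on[OF \<Omega> u_in[OF sub(1)]])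

lemma local_flow_0: "local_flow b 0 = u b"
  using b h0 by (simp add: local_flow_def W_0 proj_L2_on[OF \<Omega> u_in])

lemma G_local_flow: "s \<in> {0..h} \<Longrightarrow> G s (local_flow b s) = W b (- (\<i> *\<^sub>C W (- (b + s)) (Vop (u (b + s)))))"
  by (simp add: G_def W_local_flow linear_neg[OF W_linear] W_scaleC W_W)

lemma local_flow_derivative:
  assumes s: "s \<in> {0..h}"
  shows "(local_flow b has_vector_derivative G s (local_flow b s)) (at s within {0..h})"
proof -
  have "((\<lambda>s. W (- (b + s)) (u (b + s))) has_vector_derivative G (b + s) (W (- (b + s)) (u (b + s)))) (at s within {0..h})"
    by (rule has_vector_derivative_shift_within[OF solution_twisted_derivative[OF u sub(1)[OF s]] sub(2)])
  from bounded_linear.has_vector_derivative[OF W_bounded_linear this, of b]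
  have "((\<lambda>s. W b (W (- (b + s)) (u (b + s)))) has_vector_derivative
    W b (G (b + s) (W (- (b + s)) (u (b + s))))) (at s within {0..h})" .
  moreover have "(\<lambda>s. W b (W (- (b + s)) (u (b + s)))) = local_flow b"
    by (simp add: local_flow_def fun_eq_iff W_W)
  moreover have "W b (G (b + s) (W (- (b + s)) (u (b + s)))) = G s (local_flow b s)"
    unfolding G_local_flow[OF s]
    by (simp only: G_def W_W W_0 add.right_inverse proj_L2_on[OF \<Omega> u_in[OF sub(1)[OF s]]])
  ultimately show ?thesis by simp
qed

text \<open>The given derivatives refer to the twist based at time 0. The local twist differs from
  it by the fixed operator \<open>W b\<close>, which commutes with time derivatives and does not
  increase norms, so the same \<kappa> serves every subinterval.\<close>

lemma solution_residual:
  assumes g0: "\<And>t. t \<in> {0..T} \<Longrightarrow> g 0 t = U (- t) (mult_op V (u t))" and g: "derivs_on {0..T} J g"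
    and \<kappa>: "ereal (fact J / (sqrt (2 * real J + 1) * fact (2 * J))) * W_norm 0 T (g J) \<le> ereal \<kappa>"
    and t: "t \<in> {0..h}"
  shows "norm (picard_map U V J \<tau> (u b) (\<lambda>m. u (b + \<tau> m)) t - u (b + t)) \<le> \<kappa> * h ^ (J + 1)"
proof -
  let ?c = "fact J / (sqrt (2 * real J + 1) * fact (2 * J)) :: real"
  have c: "0 < ?c" by simp
  define q where "q = (\<lambda>m s. - (\<i> *\<^sub>C W b (g m (b + s))))"
  have T: "0 < T" using b h0 by linarith
  have M: "norm (q J s) \<le> \<kappa> / ?c" if s: "s \<in> {0..h}" for s
  proof -
    have "continuous_on {0..T} (g J)" using g by (simp add: derivs_on_def)
    from W_norm_bound[OF this T sub(1)[OF s] less_imp_le[OF c] \<kappa>] have "norm (g J (b + s)) \<le> \<kappa> / ?c"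
      by (simp only: pos_le_divide_eq[OF c] mult.commute[of _ ?c])
    moreover have "norm (q J s) \<le> norm (g J (b + s))" by (simp add: q_def norm_scaleC norm_W_le)
    ultimately show ?thesis by linarith
  qed
  have "norm (picard_map U V J \<tau> (local_flow b 0) (\<lambda>m. W (\<tau> m) (local_flow b (\<tau> m))) t - W t (local_flow b t))
    \<le> ?c * (\<kappa> / ?c) * h ^ (J + 1)"
  proof (rule interpolation_residual[where q = q and v = "local_flow b", OF _ local_flow_derivative _ _ M t])
    show "local_flow b s \<in> L2_on \<Omega>" for s unfolding local_flow_def by (rule W_in)
    show "(q m has_vector_derivative q (Suc m) s) (at s within {0..h})" if "m < J" "s \<in> {0..h}" for m s
    proof -
      have "(g m has_vector_derivative g (Suc m) (b + s)) (at (b + s) within {0..T})"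
        using g that sub by (simp add: derivs_on_def)
      from has_vector_derivative_shift_within[OF this sub(2)]
      have "((\<lambda>s. - (\<i> *\<^sub>C W b (g m (b + s)))) has_vector_derivative - (\<i> *\<^sub>C W b (g (Suc m) (b + s)))) (at s within {0..h})"
        by (intro has_vector_derivative_minus bounded_linear.has_vector_derivative[OF W_bounded_linear]
            bounded_linear.has_vector_derivative[OF bounded_bilinear.bounded_linear_right[OF scaleC_bilinear]])
      then show ?thesis by (simp only: q_def)
    qed
    show "q 0 s = G s (local_flow b s)" if s: "s \<in> {0..h}" for s
    proof -
      have "g 0 (b + s) = W (- (b + s)) (Vop (u (b + s)))"
        using W_eq_U[OF Vop_in, of "- (b + s)" "u (b + s)"]
        by (simp only: g0[OF sub(1)[OF s]] Vop_eq[OF u_in[OF sub(1)[OF s]]])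
      then show ?thesis unfolding G_local_flow[OF s] q_def by (simp only: linear_neg[OF W_linear] W_scaleC)
    qed
  qed
  also have "?c * (\<kappa> / ?c) = \<kappa>" using c by simp
  also have "picard_map U V J \<tau> (local_flow b 0) (\<lambda>m. W (\<tau> m) (local_flow b (\<tau> m))) t
      = picard_map U V J \<tau> (u b) (\<lambda>m. u (b + \<tau> m)) t"
    unfolding local_flow_0 by (intro picard_map_cong W_local_flow node_closed)
  finally show ?thesis by (simp only: W_local_flow[OF t])
qed

text \<open>Twisting converts the operator that generates the \<open>w m\<close> into the time
  derivative minus \<open>G\<close>, the form required by \<open>superconvergence\<close>.
  Positivity of the error constant gives the last claim.\<close>

lemma collocation_superconvergence:
  assumes A: "is_exp_i (L2_on \<Omega>) A U" "A \<subseteq> L2_on \<Omega> \<times> L2_on \<Omega>"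
    and c: "\<And>t. t \<in> {0..h} \<Longrightarrow> c (b + t) = picard_map U V J \<tau> (u b) (\<lambda>m. c (b + \<tau> m)) t"
    and w0: "w 0 = c" and w: "schroedinger_derivs_on A V {b..b + h} (2 * J + 1) w"
    and \<kappa>: "ereal ((fact J) ^ 4 / (fact (2 * J + 1) * (fact (2 * J))\<^sup>2)) * W_norm b (b + h) (w (2 * J + 1)) \<le> ereal \<kappa>"
  shows "collocation_solution (u b) (\<lambda>t. c (b + t))"
    and "norm (c (b + h) - u (b + h)) \<le> \<kappa> * h ^ (2 * J + 1)"
    and "0 \<le> \<kappa>"
proof -
  let ?k = "(fact J) ^ 4 / (fact (2 * J + 1) * (fact (2 * J))\<^sup>2) :: real"
  have k: "0 < ?k" by simp
  have shift: "(+) b ` {0..h} \<subseteq> {b..b + h}" by auto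
  have wD: "w m (b + s) \<in> L2_on \<Omega> \<and> ((\<lambda>s. W (- s) (w m (b + s))) has_vector_derivative
      W (- s) (w (Suc m) (b + s)) + G s (W (- s) (w m (b + s)))) (at s within {0..h})"
    if m: "m < 2 * J + 1" and s: "s \<in> {0..h}" for m s
  proof -
    obtain w' a where w': "\<forall>t\<in>{b..b + h}. (w m has_vector_derivative w' t) (at t within {b..b + h})"
      and a: "\<forall>t\<in>{b..b + h}. (w m t, a t) \<in> A"
      and Suc: "\<forall>t\<in>{b..b + h}. w (Suc m) t = w' t - \<i> *\<^sub>C a t + \<i> *\<^sub>C mult_op V (w m t)"
      using w m unfolding schroedinger_derivs_on_def by blast
    have bs: "b + s \<in> {b..b + h}" using s by simp
    have S: "w m (b + s) \<in> L2_on \<Omega>" using a bs A(2) by blast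
    have "((\<lambda>s. w m (b + s)) has_vector_derivative w' (b + s)) (at s within {0..h})"
      by (rule has_vector_derivative_shift_within[OF bspec[OF w' bs] shift])
    from twisted_derivative[where w = "\<lambda>s. w m (b + s)", OF A(1) S bspec[OF a bs] this]
    have "((\<lambda>s. W (- s) (w m (b + s))) has_vector_derivative W (- s) (w' (b + s) - \<i> *\<^sub>C a (b + s))) (at s within {0..h})" .
    moreover have "w' (b + s) - \<i> *\<^sub>C a (b + s) = w (Suc m) (b + s) + - (\<i> *\<^sub>C Vop (w m (b + s)))"
      using bspec[OF Suc bs] by (simp add: Vop_eq[OF S])
    moreover have "G s (W (- s) (w m (b + s))) = W (- s) (- (\<i> *\<^sub>C Vop (w m (b + s))))"
      by (simp add: G_def W_W W_0 proj_L2_on[OF \<Omega> S] linear_neg[OF W_linear] W_scaleC)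
    ultimately show ?thesis using S by (simp only: W_add simp_thms)
  qed
  have cS: "c (b + s) \<in> L2_on \<Omega>" if "s \<in> {0..h}" for s using wD[of 0 s] that by (simp add: w0)
  show sol: "collocation_solution (u b) (\<lambda>t. c (b + t))"
    unfolding collocation_solution_def using cS c by blast
  have ubS: "u b \<in> L2_on \<Omega>" using u_in[OF sub(1)[of 0]] h0 by simp
  define z where "z = (\<lambda>m s. W (- s) (w m (b + s)))"
  have cont: "continuous_on {b..b + h} (w (2 * J + 1))" using w by (simp add: schroedinger_derivs_on_def)
  have wM: "?k * norm (w (2 * J + 1) (b + s)) \<le> \<kappa>" if "s \<in> {0..h}" for s
    using h0 that by (intro W_norm_bound[OF cont _ _ less_imp_le[OF k] \<kappa>]) auto
  have "0 \<le> ?k * norm (w (2 * J + 1) (b + 0))" by simp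
  moreover have "?k * norm (w (2 * J + 1) (b + 0)) \<le> \<kappa>" using h0 by (intro wM) simp
  ultimately show "0 \<le> \<kappa>" by (rule order_trans)
  have z0: "z 0 s = u b + (\<Sum>m=1..J. Lint m s *\<^sub>R G (\<tau> m) (z 0 (\<tau> m)))" if s: "s \<in> {0..h}" for s
  proof -
    let ?d = "u b + (\<Sum>m=1..J. Lint m s *\<^sub>R G (\<tau> m) (W (- \<tau> m) (c (b + \<tau> m))))"
    have "?d \<in> L2_on \<Omega>"
      by (intro subspace_add[OF L2_on_subspace[OF \<Omega>]] subspace_sum[OF L2_on_subspace[OF \<Omega>]]
          subspace_scale[OF L2_on_subspace[OF \<Omega>]] G_in ubS)
    then have "W (- s) (W s ?d) = ?d" by (simp only: W_W W_0 add.left_inverse proj_L2_on[OF \<Omega>])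
    then show ?thesis using collocation_twisted[OF ubS sol s] by (simp only: z_def w0)
  qed
  have "norm (z 0 h - local_flow b h) \<le> ?k * (\<kappa> / ?k) * h ^ (2 * J + 1)"
  proof (rule superconvergence)
    show "(z m has_vector_derivative z (Suc m) t + G t (z m t)) (at t within {0..h})"
      if "m < 2 * J + 1" "t \<in> {0..h}" for m t
      using wD[OF that] by (simp only: z_def)
    show "norm (z (2 * J + 1) t) \<le> \<kappa> / ?k" if t: "t \<in> {0..h}" for t
    proof -
      have "norm (w (2 * J + 1) (b + t)) \<le> \<kappa> / ?k"
        using wM[OF t] by (simp only: pos_le_divide_eq[OF k] mult.commute[of _ ?k])
      then show ?thesis unfolding z_def by (rule order_trans[OF norm_W_le])
    qed
    \<comment> \<open>At a node the Lagrange basis collapses, so the collocation equation says that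
      \<open>z 0\<close> satisfies the twisted differential equation there; uniqueness of
      derivatives leaves nothing for \<open>z 1\<close>.\<close>
    show "z 1 (\<tau> j) = 0" if j: "j \<in> {1..J}" for j
    proof -
      have tj: "\<tau> j \<in> {0..h}" by (rule node_closed[OF j])
      have "((\<lambda>s. Lint m s *\<^sub>R G (\<tau> m) (z 0 (\<tau> m))) has_vector_derivative
          lagrange_basis J \<tau> m (\<tau> j) *\<^sub>R G (\<tau> m) (z 0 (\<tau> m))) (at (\<tau> j) within {0..h})" for m
      proof -
        have "(Lint m has_vector_derivative lagrange_basis J \<tau> m (\<tau> j)) (at (\<tau> j) within {0..h})"
          unfolding Lint_def[abs_def] by (rule integral_has_vector_derivative[OF lagrange_basis_continuous tj])
        then show ?thesis
          by (rule bounded_linear.has_vector_derivative[OF bounded_linear_scaleR_left])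
      qed
      then have "((\<lambda>s. u b + (\<Sum>m=1..J. Lint m s *\<^sub>R G (\<tau> m) (z 0 (\<tau> m)))) has_vector_derivative
          0 + (\<Sum>m=1..J. lagrange_basis J \<tau> m (\<tau> j) *\<^sub>R G (\<tau> m) (z 0 (\<tau> m)))) (at (\<tau> j) within {0..h})"
        by (intro has_vector_derivative_add has_vector_derivative_const has_vector_derivative_sum)
      moreover have "(\<Sum>m=1..J. lagrange_basis J \<tau> m (\<tau> j) *\<^sub>R G (\<tau> m) (z 0 (\<tau> m))) = G (\<tau> j) (z 0 (\<tau> j))"
      proof -
        have "(\<Sum>m=1..J. lagrange_basis J \<tau> m (\<tau> j) *\<^sub>R G (\<tau> m) (z 0 (\<tau> m)))
          = (\<Sum>m=1..J. if m = j then G (\<tau> m) (z 0 (\<tau> m)) else 0)"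
          using j by (intro sum.cong refl) (simp only: lagrange_basis_node[OF _ j] split: if_split, simp)
        then show ?thesis using j by (simp only: sum.delta[OF finite_atLeastAtMost] if_True)
      qed
      ultimately have "((\<lambda>s. u b + (\<Sum>m=1..J. Lint m s *\<^sub>R G (\<tau> m) (z 0 (\<tau> m)))) has_vector_derivative
          G (\<tau> j) (z 0 (\<tau> j))) (at (\<tau> j) within {0..h})" by simp
      then have 1: "(z 0 has_vector_derivative G (\<tau> j) (z 0 (\<tau> j))) (at (\<tau> j) within {0..h})"
        by (rule has_vector_derivative_transform[OF tj, rotated]) (rule z0)
      have 2: "(z 0 has_vector_derivative z (Suc 0) (\<tau> j) + G (\<tau> j) (z 0 (\<tau> j))) (at (\<tau> j) within {0..h})"
        using wD[of 0, OF _ tj] by (simp add: z_def)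
      have "G (\<tau> j) (z 0 (\<tau> j)) = z (Suc 0) (\<tau> j) + G (\<tau> j) (z 0 (\<tau> j))"
        using tj h0 1 2 by (intro vector_derivative_unique_within_closed_interval[of 0 h "\<tau> j" "z 0"]) auto
      then show ?thesis by simp
    qed
    show "(local_flow b has_vector_derivative G t (local_flow b t)) (at t within {0..h})" if "t \<in> {0..h}" for t
      using that by (rule local_flow_derivative)
    show "local_flow b 0 = z 0 0"
      using z0[of 0] h0 by (simp add: local_flow_0 Lint_def)
  qed
  also have "?k * (\<kappa> / ?k) = \<kappa>" using k by simp
  also have "norm (z 0 h - local_flow b h) = norm (W (- h) (c (b + h) - u (b + h)))"
    by (simp only: z_def w0 local_flow_def W_diff)
  also have "\<dots> = norm (c (b + h) - u (b + h))"
  proof (rule norm_W_on)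
    have "h \<in> {0..h}" using h0 by simp
    then show "c (b + h) - u (b + h) \<in> L2_on \<Omega>"
      by (intro subspace_diff[OF L2_on_subspace[OF \<Omega>]] cS u_in sub(1))
  qed
  finally show "norm (c (b + h) - u (b + h)) \<le> \<kappa> * h ^ (2 * J + 1)" .
qed

end

end

subsection \<open>The global error and rank bounds\<close>

text \<open>A discrete Gronwall step, from 1 + x \<le> exp x. The added \<open>b\<close> may be
  multiplied by the full exponential because that is at least 1.\<close>

lemma error_recursion:
  fixes a b x :: real
  assumes a: "0 \<le> a" and b: "0 \<le> b" and x: "0 \<le> x"
  shows "(a + real n * b) * exp (real n * x) * (1 + x) + b \<le> (a + real (Suc n) * b) * exp (real (Suc n) * x)"
proof -
  have 1: "(a + real n * b) * exp (real n * x) * (1 + x) \<le> (a + real n * b) * exp (real n * x) * exp x"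
    using a b exp_ge_add_one_self[of x] by (intro mult_left_mono) auto
  have "1 \<le> exp (real (Suc n) * x)" using x by simp
  then have 2: "b * 1 \<le> b * exp (real (Suc n) * x)" using b by (rule mult_left_mono)
  have "(a + real n * b) * exp (real n * x) * exp x + b * exp (real (Suc n) * x)
      = (a + real (Suc n) * b) * exp (real (Suc n) * x)"
    by (simp add: algebra_simps exp_add)
  with 1 2 show ?thesis by simp
qed

lemma rank_L2_le_real: "tensor_rank_le p v \<Longrightarrow> real p \<le> x \<Longrightarrow> ereal_of_enat (rank_L2 v) \<le> ereal x"
proof -
  assume "tensor_rank_le p v" and x: "real p \<le> x"
  then have "rank_L2 v \<le> enat p" by (intro rank_L2_le_if)
  then have "ereal_of_enat (rank_L2 v) \<le> ereal_of_enat (enat p)" by (simp only: ereal_of_enat_le_iff)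
  also have "\<dots> \<le> ereal x" using x by simp
  finally show ?thesis .
qed

theorem theorem27:
  fixes \<Omega>\<^sub>1 :: "'a::euclidean_space set" and \<Omega>\<^sub>2 :: "'b::euclidean_space set"
    and \<Delta>\<^sub>1 :: "'a L2 rel" and \<Delta>\<^sub>2 :: "'b L2 rel" and \<Delta> :: "('a \<times> 'b) L2 rel"
    and U\<^sub>1 :: "real \<Rightarrow> 'a L2 \<Rightarrow> 'a L2" and U\<^sub>2 :: "real \<Rightarrow> 'b L2 \<Rightarrow> 'b L2"
    and U :: "real \<Rightarrow> ('a \<times> 'b) L2 \<Rightarrow> ('a \<times> 'b) L2"
    and V :: "'a \<times> 'b \<Rightarrow> real" and u :: "real \<Rightarrow> ('a \<times> 'b) L2"
    and T h :: real and N J :: nat and \<tau> :: "nat \<Rightarrow> real"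
    and C\<^sub>V \<Lambda> \<rho> \<theta> \<eta> \<kappa>\<^sub>J \<kappa>\<^sub>2\<^sub>J :: real
    and g :: "nat \<Rightarrow> real \<Rightarrow> ('a \<times> 'b) L2"
    and ucol :: "nat \<Rightarrow> real \<Rightarrow> ('a \<times> 'b) L2"
    and w :: "nat \<Rightarrow> nat \<Rightarrow> real \<Rightarrow> ('a \<times> 'b) L2"
    and \<alpha> r \<xi> \<epsilon> \<delta> B :: "nat \<Rightarrow> real"
    and ut :: "nat \<Rightarrow> ('a \<times> 'b) L2" and K :: "nat \<Rightarrow> nat"
    and it :: "nat \<Rightarrow> nat \<Rightarrow> nat \<Rightarrow> ('a \<times> 'b) L2"
  assumes \<Omega>: "\<Omega>\<^sub>1 \<in> sets lebesgue" "\<Omega>\<^sub>2 \<in> sets lebesgue"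
    and laplacians: "laplacian_realization \<Omega>\<^sub>1 \<Delta>\<^sub>1" "laplacian_realization \<Omega>\<^sub>2 \<Delta>\<^sub>2"
      "\<Delta> = tensor_sum \<Delta>\<^sub>1 \<Delta>\<^sub>2"
    and groups: "is_exp_i (L2_on \<Omega>\<^sub>1) \<Delta>\<^sub>1 U\<^sub>1" "is_exp_i (L2_on \<Omega>\<^sub>2) \<Delta>\<^sub>2 U\<^sub>2"
      "is_exp_i (L2_on (\<Omega>\<^sub>1 \<times> \<Omega>\<^sub>2)) \<Delta> U"
    and V_nonzero: "\<not> (AE z in lebesgue. z \<in> \<Omega>\<^sub>1 \<times> \<Omega>\<^sub>2 \<longrightarrow> V z = 0)"
    and V_bounded: "bounded_potential (\<Omega>\<^sub>1 \<times> \<Omega>\<^sub>2) V"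
    and V_finite_rank: "\<exists>R. separable_repr \<Omega>\<^sub>1 \<Omega>\<^sub>2 V R"
    and C\<^sub>V: "C\<^sub>V = op_norm_on (L2_on (\<Omega>\<^sub>1 \<times> \<Omega>\<^sub>2)) (mult_op V)"
    and grid: "0 < T" "0 < h" "real N = T / h"
    and u: "schroedinger_solution (L2_on (\<Omega>\<^sub>1 \<times> \<Omega>\<^sub>2)) U V T u"
    and nodes: "1 \<le> J" "gauss_legendre_nodes J h \<tau>"
    and \<Lambda>: "\<Lambda> = mean_lebesgue_const J h \<tau>"
    and \<rho>: "\<rho> = h * \<Lambda> * C\<^sub>V" "0 < \<rho>" "\<rho> < 1"
    and \<theta>: "\<theta> = sqrt \<rho>"
    and \<eta>: "0 < \<eta>" "\<eta> < norm (u 0)"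
    \<comment> \<open>\<open>g m\<close> is the \<open>m\<close>-th time derivative of \<open>exp (- \<i> t \<Delta>) V u(t)\<close>\<close>
    and g: "\<And>t. t \<in> {0..T} \<Longrightarrow> g 0 t = U (- t) (mult_op V (u t))" "derivs_on {0..T} J g"
    and \<kappa>\<^sub>J: "ereal (fact J / (sqrt (2 * real J + 1) * fact (2 * J))) * W_norm 0 T (g J)
          \<le> ereal \<kappa>\<^sub>J"
    \<comment> \<open>\<open>ucol n\<close> is the exact collocation solution on the \<open>n\<close>-th subinterval, in global time\<close>
    and ucol: "\<And>n t. \<lbrakk>n \<in> {1..N}; t \<in> {0..h}\<rbrakk> \<Longrightarrow>
          ucol n (real (n - 1) * h + t) =
            picard_map U V J \<tau> (u (real (n - 1) * h)) (\<lambda>m. ucol n (real (n - 1) * h + \<tau> m)) t"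
    and w: "\<And>n. n \<in> {1..N} \<Longrightarrow> w n 0 = ucol n"
      "\<And>n. n \<in> {1..N} \<Longrightarrow>
         schroedinger_derivs_on \<Delta> V {real (n - 1) * h..real n * h} (2 * J + 1) (w n)"
    and \<kappa>\<^sub>2\<^sub>J: "ereal ((fact J) ^ 4 / (fact (2 * J + 1) * (fact (2 * J))\<^sup>2)) *
            (MAX n\<in>{1..N}. W_norm (real (n - 1) * h) (real n * h) (w n (2 * J + 1)))
          \<le> ereal \<kappa>\<^sub>2\<^sub>J"
    and \<alpha>: "\<alpha> 0 = largest_threshold \<eta> u {0}"
      "\<And>n. n \<in> {1..N} \<Longrightarrow> \<alpha> n = largest_threshold \<eta> u {real (n - 1) * h..real n * h}"
    and r: "\<And>n. n \<in> {1..N} \<Longrightarrow> r n = \<eta>\<^sup>2 / (\<alpha> n)\<^sup>2"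
    and \<xi>: "\<And>n. n \<le> N \<Longrightarrow> \<xi> n = (\<eta> + \<kappa>\<^sub>J * h ^ (J + 1) + real n * \<kappa>\<^sub>2\<^sub>J * h ^ (2 * J + 1)) *
          exp (8 * \<rho> * real n * ((1 + \<rho>) / (1 - \<rho>) ^ 3))"
    and \<epsilon>: "\<And>n. n \<in> {1..N} \<Longrightarrow> \<epsilon> n = 4 * \<xi> (n - 1) * ((1 + \<rho>) / (1 - \<rho>)\<^sup>2)"
    and \<delta>: "\<And>n. n \<in> {1..N} \<Longrightarrow> \<delta> n = \<rho> * \<epsilon> n / (1 - \<rho>)"
    and scheme: "ut = glp_scheme U V J h \<tau> \<theta> \<epsilon> \<delta> (hard_threshold (\<alpha> 0) (u 0))"
    \<comment> \<open>the \<open>k\<close>-th iterate and the stopping index in the \<open>n\<close>-th subinterval\<close>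
    and it: "\<And>n. n \<in> {1..N} \<Longrightarrow> it n = picard_iterate U V J \<tau> \<theta> (ut (n - 1))"
    and K: "\<And>n. n \<in> {1..N} \<Longrightarrow> K n = stopping_index U V J \<tau> \<theta> (\<epsilon> n) (ut (n - 1))"
    and B: "\<And>n. n \<in> {1..N} \<Longrightarrow> B n = 16 / \<rho> ^ 3 * ((1 + \<rho>) / (1 - \<rho>))\<^sup>2 *
          (1 + real J * real (potential_rank \<Omega>\<^sub>1 \<Omega>\<^sub>2 V) * (MAX i\<in>{1..n}. r i))"
  shows "(SUP n\<in>{1..N}. norm (ut n - u (real n * h)))
           \<le> (\<eta> + \<kappa>\<^sub>J * h ^ (J + 1) + \<kappa>\<^sub>2\<^sub>J * h ^ (2 * J) * T) *
             exp (8 * \<Lambda> * C\<^sub>V * ((1 + \<rho>) / (1 - \<rho>) ^ 3) * T) \<and>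
         (\<rho> \<le> 1 / 2 \<longrightarrow>
           (\<forall>n\<in>{1..N}. ereal_of_enat (rank_L2 (ut n)) \<le> ereal (B n)) \<and>
           (\<forall>n\<in>{1..N}. \<forall>k\<in>{0..K n}. \<forall>j\<in>{1..J}.
              ereal_of_enat (rank_L2 (it n k j)) \<le> ereal (2 * B n) \<and>
              ereal_of_enat (rank_L2 (picard_map U V J \<tau> (ut (n - 1)) (it n k) (\<tau> j)))
                \<le> ereal (2 * B n)))"
proof -
  define rk where "rk = potential_rank \<Omega>\<^sub>1 \<Omega>\<^sub>2 V"
  have rk: "separable_repr \<Omega>\<^sub>1 \<Omega>\<^sub>2 V rk"
    unfolding rk_def potential_rank_def by (rule LeastI_ex[OF V_finite_rank])
  have rk1: "1 \<le> rk"
  proof (rule ccontr)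
    assume "\<not> 1 \<le> rk"
    then have "rk = 0" by simp
    with rk have "AE z in lebesgue. z \<in> \<Omega>\<^sub>1 \<times> \<Omega>\<^sub>2 \<longrightarrow> complex_of_real (V z) = rep_L2 0 z"
      by (simp add: separable_repr_def)
    with rep_L2_zero have "AE z in lebesgue. z \<in> \<Omega>\<^sub>1 \<times> \<Omega>\<^sub>2 \<longrightarrow> V z = 0"
      by eventually_elim simp
    with V_nonzero show False by contradiction
  qed
  have gn: "gauss_nodes J h \<tau>" by unfold_locales (fact nodes grid)+
  have "0 < h * \<Lambda>" using gauss_nodes.mean_lebesgue_const_ge_1[OF gn] grid(2) by (simp add: \<Lambda>)
  then have C0: "0 < C\<^sub>V" using \<rho>(1,2) zero_less_mult_pos by metis
  have groups': "unitary_group_on (L2_on \<Omega>\<^sub>1) U\<^sub>1" "unitary_group_on (L2_on \<Omega>\<^sub>2) U\<^sub>2"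
    "unitary_group_on (L2_on (\<Omega>\<^sub>1 \<times> \<Omega>\<^sub>2)) U"
    using groups by (simp_all add: is_exp_i_def)
  have sa: "self_adjoint_on (L2_on \<Omega>\<^sub>1) \<Delta>\<^sub>1" "self_adjoint_on (L2_on \<Omega>\<^sub>2) \<Delta>\<^sub>2"
    using laplacians by (simp_all add: laplacian_realization_def)
  have \<rho>': "\<rho> = h * mean_lebesgue_const J h \<tau> * C\<^sub>V" using \<rho>(1) \<Lambda> by simp
  interpret S: glp_step \<Omega>\<^sub>1 \<Omega>\<^sub>2 U\<^sub>1 U\<^sub>2 U \<Delta>\<^sub>1 \<Delta>\<^sub>2 V C\<^sub>V J h \<tau> \<rho> rk
    by unfold_locales
      (fact \<Omega> Times_lebesgue[OF \<Omega>] groups' V_bounded C\<^sub>V less_imp_le[OF C0] nodes grid(2) \<rho>' \<rho>(3) groups(1,2)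
        groups(3)[unfolded laplacians(3)] sa rk rk1 \<rho>(2))+
  interpret E: collocation_solved "\<Omega>\<^sub>1 \<times> \<Omega>\<^sub>2" U V C\<^sub>V J h \<tau> \<rho> T u
    by unfold_locales (fact u)
  have NT: "real N * h = T" using grid by (simp add: field_simps)
  have "0 < real N" using grid by simp
  then have N1: "1 \<le> N" by simp
  have bT: "0 \<le> real n * h" "real n * h + h \<le> T" "real n * h + h = real (Suc n) * h" if "n < N" for n
  proof -
    show "0 \<le> real n * h" using grid(2) by simp
    show "real n * h + h = real (Suc n) * h" by (simp add: algebra_simps)
    also have "\<dots> \<le> real N * h" using that grid(2) by (intro mult_right_mono) auto
    finally show "real n * h + h \<le> T" by (simp only: NT)
  qed
  define eJ where "eJ = \<kappa>\<^sub>J * h ^ (J + 1)"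
  define e2 where "e2 = \<kappa>\<^sub>2\<^sub>J * h ^ (2 * J + 1)"
  \<comment> \<open>The growth rate per subinterval: twice the recompression tolerance of step n + 1
    equals \<open>x\<close> times \<xi>(n).\<close>
  define x where "x = 8 * \<rho> * ((1 + \<rho>) / (1 - \<rho>) ^ 3)"
  have x0: "0 \<le> x" using \<rho> by (simp add: x_def)
  \<comment> \<open>As an upper bound for a norm, \<open>\<kappa>\<^sub>J\<close> is nonnegative,
    which is needed for \<eta> \<le> \<xi>(n).\<close>
  have "continuous_on {0..T} (g J)" using g(2) by (simp add: derivs_on_def)
  from W_norm_bound[OF this grid(1) _ _ \<kappa>\<^sub>J, of 0] grid(1)
  have "fact J / (sqrt (2 * real J + 1) * fact (2 * J)) * norm (g J 0) \<le> \<kappa>\<^sub>J" by simp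
  moreover have "0 \<le> fact J / (sqrt (2 * real J + 1) * fact (2 * J)) * norm (g J 0)" by simp
  ultimately have "0 \<le> \<kappa>\<^sub>J" by (rule order_trans[rotated])
  then have eJ0: "0 \<le> eJ" using grid(2) by (simp add: eJ_def)
  have conv: "S.collocation_solution (u (real n * h)) (\<lambda>t. ucol (Suc n) (real n * h + t))"
    "norm (ucol (Suc n) (real n * h + h) - u (real n * h + h)) \<le> e2" "0 \<le> \<kappa>\<^sub>2\<^sub>J" if n: "n < N" for n
  proof -
    let ?b = "real n * h"
    have mem: "Suc n \<in> {1..N}" using n by simp
    have c: "ucol (Suc n) (?b + t) = picard_map U V J \<tau> (u ?b) (\<lambda>m. ucol (Suc n) (?b + \<tau> m)) t"
      if "t \<in> {0..h}" for t
      using ucol[OF mem that] by (simp only: diff_Suc_1)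
    have w': "schroedinger_derivs_on (tensor_sum \<Delta>\<^sub>1 \<Delta>\<^sub>2) V {?b..?b + h} (2 * J + 1) (w (Suc n))"
      using w(2)[OF mem] by (simp only: diff_Suc_1 laplacians(3) bT(3)[OF n])
    have "W_norm ?b (?b + h) (w (Suc n) (2 * J + 1))
        \<le> (MAX n\<in>{1..N}. W_norm (real (n - 1) * h) (real n * h) (w n (2 * J + 1)))"
    proof (rule Max_ge)
      show "W_norm ?b (?b + h) (w (Suc n) (2 * J + 1)) \<in> (\<lambda>n. W_norm (real (n - 1) * h) (real n * h) (w n (2 * J + 1))) ` {1..N}"
        by (rule image_eqI[OF _ mem]) (simp only: diff_Suc_1 bT(3)[OF n])
    qed simp
    then have "ereal ((fact J) ^ 4 / (fact (2 * J + 1) * (fact (2 * J))\<^sup>2)) * W_norm ?b (?b + h) (w (Suc n) (2 * J + 1))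
      \<le> ereal ((fact J) ^ 4 / (fact (2 * J + 1) * (fact (2 * J))\<^sup>2)) *
          (MAX n\<in>{1..N}. W_norm (real (n - 1) * h) (real n * h) (w n (2 * J + 1)))"
      by (rule ereal_mult_left_mono) simp
    note \<kappa> = order_trans[OF this \<kappa>\<^sub>2\<^sub>J]
    note conv = E.collocation_superconvergence[OF bT(1,2)[OF n] S.exp S.tensor_sum_subset _ w(1)[OF mem] w' \<kappa>]
    show "S.collocation_solution (u ?b) (\<lambda>t. ucol (Suc n) (?b + t))" by (rule conv(1)) (rule c)
    show "norm (ucol (Suc n) (?b + h) - u (?b + h)) \<le> e2" unfolding e2_def by (rule conv(2)) (rule c)
    show "0 \<le> \<kappa>\<^sub>2\<^sub>J" by (rule conv(3)) (rule c)
  qed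
  have \<kappa>2: "0 \<le> \<kappa>\<^sub>2\<^sub>J" using conv(3)[of 0] N1 by simp
  then have e20: "0 \<le> e2" using grid(2) by (simp add: e2_def)
  have \<xi>_eq: "\<xi> n = ((\<eta> + eJ) + real n * e2) * exp (real n * x)" if "n \<le> N" for n
    using \<xi>[OF that] by (simp add: eJ_def e2_def x_def mult_ac)
  have \<eta>\<xi>: "\<eta> \<le> \<xi> n" if "n \<le> N" for n
  proof -
    have "\<eta> * 1 \<le> ((\<eta> + eJ) + real n * e2) * exp (real n * x)"
      using \<eta>(1) eJ0 e20 x0 by (intro mult_mono) auto
    then show ?thesis by (simp only: \<xi>_eq[OF that] mult_1_right)
  qed
  have big: "\<eta> < norm (u t)" if "t \<in> {0..T}" for t using E.norm_u[OF that] \<eta>(2) by simp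
  have \<alpha>_props: "0 < \<alpha> (Suc n)"
    "\<And>t. t \<in> {real n * h..real n * h + h} \<Longrightarrow> norm (u t - soft_threshold (\<alpha> (Suc n)) (u t)) \<le> \<eta>"
    if n: "n < N" for n
  proof -
    have sub: "{real n * h..real n * h + h} \<subseteq> {0..T}" using bT[OF n] by auto
    have \<alpha>_eq: "\<alpha> (Suc n) = largest_threshold \<eta> u {real n * h..real n * h + h}"
      using \<alpha>(2)[of "Suc n"] n bT(3)[OF n] by simp
    have ne: "{real n * h..real n * h + h} \<noteq> {}" using grid(2) by simp
    have big': "\<eta> < norm (u t)" if "t \<in> {real n * h..real n * h + h}" for t using big sub that by blast
    note props = largest_threshold_props(1,2)[OF \<eta>(1) compact_Icc ne continuous_on_subset[OF E.u_continuous sub] big']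
    show "0 < \<alpha> (Suc n)" unfolding \<alpha>_eq by (rule props(1))
    show "norm (u t - soft_threshold (\<alpha> (Suc n)) (u t)) \<le> \<eta>" if "t \<in> {real n * h..real n * h + h}" for t
      unfolding \<alpha>_eq by (rule props(2)[OF _ that])
  qed
  \<comment> \<open>The threshold of the first subinterval is admissible at its left endpoint, so it
    cannot exceed \<alpha>(0); this bounds the rank of the initial value by r(1).\<close>
  have \<alpha>0: "0 < \<alpha> 0" "norm (u 0 - soft_threshold (\<alpha> 0) (u 0)) \<le> \<eta>" "\<alpha> 1 \<le> \<alpha> 0"
  proof -
    note props = largest_threshold_props[OF \<eta>(1), of "{0}" u, folded \<alpha>(1)]
    show "0 < \<alpha> 0" "norm (u 0 - soft_threshold (\<alpha> 0) (u 0)) \<le> \<eta>" using props(1,2) \<eta>(2) by auto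
    show "\<alpha> 1 \<le> \<alpha> 0" using props(3)[of "\<alpha> 1"] \<eta>(2) \<alpha>_props[of 0] N1 grid(2) by auto
  qed
  define rb where "rb m = 16 / \<rho> ^ 3 * ((1 + \<rho>) / (1 - \<rho>))\<^sup>2 * (1 + real J * real rk * m)" for m
  \<comment> \<open>The summand \<open>eJ\<close> makes \<xi>(n) bound the initial error together
    with the interpolation defect, as \<open>resid\<close> demands. Index 0 is charged to r(1),
    whence \<open>max 1 n\<close>. Quantifying over all upper bounds m of the r(i), instead of
    taking their maximum, makes the rank bound pass directly to later n.\<close>
  define good where "good n \<longleftrightarrow> ut n \<in> L2_on (\<Omega>\<^sub>1 \<times> \<Omega>\<^sub>2) \<and> norm (ut n - u (real n * h)) + eJ \<le> \<xi> n \<and>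
    (\<exists>R. tensor_rank_le R (ut n) \<and> (\<forall>m. (\<forall>i\<in>{1..max 1 n}. r i \<le> m) \<longrightarrow> real R \<le> rb m))" for n
  define low where "low n \<longleftrightarrow> (\<forall>m k j. (\<forall>i\<in>{1..n}. r i \<le> m) \<longrightarrow> k \<le> K n \<longrightarrow> j \<in> {1..J} \<longrightarrow>
    (\<exists>p. tensor_rank_le p (it n k j) \<and> real p \<le> 2 * rb m) \<and>
    (\<exists>p. tensor_rank_le p (picard_map U V J \<tau> (ut (n - 1)) (it n k) (\<tau> j)) \<and> real p \<le> 2 * rb m))" for n
  have step: "good (Suc n) \<and> low (Suc n)" if n: "n < N" and good: "good n" for n
  proof -
    let ?b = "real n * h"
    have mem: "Suc n \<in> {1..N}" using n by simp
    from good have utS: "ut n \<in> L2_on (\<Omega>\<^sub>1 \<times> \<Omega>\<^sub>2)" and err: "norm (ut n - u ?b) + eJ \<le> \<xi> n"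
      by (auto simp: good_def)
    from good obtain R where R: "tensor_rank_le R (ut n)"
      "\<And>m. (\<forall>i\<in>{1..max 1 n}. r i \<le> m) \<Longrightarrow> real R \<le> rb m" by (auto simp: good_def)
    have shift: "?b + t \<in> {0..T}" if "t \<in> {0..h}" for t using that bT[OF n] by auto
    have ubS: "u ?b \<in> L2_on (\<Omega>\<^sub>1 \<times> \<Omega>\<^sub>2)" using E.u_in[OF shift[of 0]] grid(2) by simp
    interpret I: glp_interval \<Omega>\<^sub>1 \<Omega>\<^sub>2 U\<^sub>1 U\<^sub>2 U \<Delta>\<^sub>1 \<Delta>\<^sub>2 V C\<^sub>V J h \<tau> \<rho> rk "ut n" "\<lambda>s. u (?b + s)" "\<alpha> (Suc n)" \<eta> "\<xi> n"
    proof unfold_locales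
      have nodeS: "u (?b + \<tau> m) \<in> L2_on (\<Omega>\<^sub>1 \<times> \<Omega>\<^sub>2)" if "m \<in> {1..J}" for m
        by (rule E.u_in[OF shift[OF S.node_closed[OF that]]])
      show "norm (picard_map U V J \<tau> (ut n) (\<lambda>m. u (?b + \<tau> m)) t - u (?b + t)) \<le> \<xi> n" if t: "t \<in> {0..h}" for t
      proof -
        \<comment> \<open>Both Picard maps use the exact nodal values, so only the initial values
          differ and the contraction term is \<rho> times 0.\<close>
        have "norm (picard_map U V J \<tau> (ut n) (\<lambda>m. u (?b + \<tau> m)) t - picard_map U V J \<tau> (u ?b) (\<lambda>m. u (?b + \<tau> m)) t)
            \<le> norm (ut n - u ?b) + \<rho> * 0"
          by (rule S.picard_contraction[OF utS ubS _ _ _ t]) (fact nodeS, fact nodeS, simp)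
        from norm_triangle_mono[OF this E.solution_residual[OF bT(1,2)[OF n] g \<kappa>\<^sub>J t]] err
        show ?thesis by (simp add: eJ_def)
      qed
      show "u (?b + t) \<in> L2_on (\<Omega>\<^sub>1 \<times> \<Omega>\<^sub>2)" if "t \<in> {0..h}" for t by (rule E.u_in[OF shift[OF that]])
      show "norm (u (?b + t) - soft_threshold (\<alpha> (Suc n)) (u (?b + t))) \<le> \<eta>" if "t \<in> {0..h}" for t
        by (rule \<alpha>_props(2)[OF n]) (use that in simp)
    qed (use utS \<alpha>_props(1)[OF n] \<eta>(1) \<eta>\<xi>[of n] n in simp_all)
    have \<theta>_eq: "\<theta> = I.\<theta>" by (simp add: \<theta> I.\<theta>_def)
    have tol: "\<epsilon> (Suc n) = I.tol" using \<epsilon>[OF mem] by (simp add: I.tol_def)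
    have rtol: "\<delta> (Suc n) = I.rtol" using \<delta>[OF mem] by (simp add: I.rtol_def tol)
    have K_eq: "K (Suc n) = I.stop" using K[OF mem] by (simp add: I.stop_def tol \<theta>_eq)
    have it_eq: "it (Suc n) = I.iter" using it[OF mem] by (simp add: I.iter_def \<theta>_eq)
    have ut_Suc: "ut (Suc n) = recompress (\<delta> (Suc n)) (picard_map U V J \<tau> (ut n) (it (Suc n) (K (Suc n))) h)"
      using K[OF mem] it[OF mem] by (simp add: scheme Let_def)
    have ut_eq: "ut (Suc n) = I.next_value"
      unfolding ut_Suc rtol K_eq it_eq I.next_value_def by (rule refl)
    have r_eq: "\<eta>\<^sup>2 / (\<alpha> (Suc n))\<^sup>2 = r (Suc n)" using r[OF mem] by simp
    have rb_eq: "rb m = I.rank_bound m" for m by (simp add: rb_def I.rank_bound_def)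
    have closes: "real R \<le> I.rank_bound m" "\<eta>\<^sup>2 / (\<alpha> (Suc n))\<^sup>2 \<le> m" if m: "\<forall>i\<in>{1..Suc n}. r i \<le> m" for m
    proof -
      have "{1..max 1 n} \<subseteq> {1..Suc n}" by simp
      then show "real R \<le> I.rank_bound m" unfolding rb_eq[symmetric] using m by (intro R(2)) blast
      show "\<eta>\<^sup>2 / (\<alpha> (Suc n))\<^sup>2 \<le> m" unfolding r_eq using m by simp
    qed
    have "good (Suc n)"
      unfolding good_def
    proof (intro conjI)
      show "ut (Suc n) \<in> L2_on (\<Omega>\<^sub>1 \<times> \<Omega>\<^sub>2)" unfolding ut_eq by (rule I.next_value_in)
      obtain c where c: "S.collocation_solution (ut n) c" by (rule S.ex_collocation_solution[OF utS])
      \<comment> \<open>The collocation solution from the computed value is compared with the one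
        from the exact value. Conservation makes this middle difference equal to the old error, with
        no growth factor.\<close>
      have "norm ((I.next_value - c h) + ((c h - ucol (Suc n) (?b + h)) + (ucol (Suc n) (?b + h) - u (?b + h))))
          \<le> 2 * I.rtol + (norm (ut n - u ?b) + e2)"
        by (intro norm_triangle_mono I.next_value_error c conv(2) n
            eq_refl[OF S.collocation_conserved[OF utS ubS c conv(1)[OF n]]])
      then have "norm (I.next_value - u (?b + h)) \<le> 2 * I.rtol + (norm (ut n - u ?b) + e2)" by simp
      then have "norm (ut (Suc n) - u (real (Suc n) * h)) + eJ \<le> 2 * I.rtol + \<xi> n + e2"
        using err unfolding ut_eq bT(3)[OF n, symmetric] by linarith
      also have "2 * I.rtol = \<xi> n * x"
        using \<rho>(3) by (simp add: I.rtol_def I.tol_def x_def power2_eq_square power3_eq_cube)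
      also have "\<xi> n * x + \<xi> n + e2 = \<xi> n * (1 + x) + e2" by (simp add: algebra_simps)
      also have "\<dots> \<le> \<xi> (Suc n)"
        using error_recursion[of "\<eta> + eJ" e2 x n] \<eta>(1) eJ0 e20 x0 n by (simp only: \<xi>_eq less_imp_le Suc_le_eq)
      finally show "norm (ut (Suc n) - u (real (Suc n) * h)) + eJ \<le> \<xi> (Suc n)" .
      obtain R' p where R': "tensor_rank_le R' I.next_value" "real p \<le> \<eta>\<^sup>2 / (\<alpha> (Suc n))\<^sup>2"
        "real R' \<le> max (real p) (real p + 1 + (1 - \<rho>\<^sup>2) * (real (R + J * (rk * I.iter_rank)) - real p))"
        by (rule I.next_value_rank[OF R(1)])
      show "\<exists>R. tensor_rank_le R (ut (Suc n)) \<and> (\<forall>m. (\<forall>i\<in>{1..max 1 (Suc n)}. r i \<le> m) \<longrightarrow> real R \<le> rb m)"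
      proof (intro exI[of _ R'] conjI allI impI)
        show "tensor_rank_le R' (ut (Suc n))" unfolding ut_eq by (rule R'(1))
        fix m assume "\<forall>i\<in>{1..max 1 (Suc n)}. r i \<le> m"
        then have "\<forall>i\<in>{1..Suc n}. r i \<le> m" by simp
        from order_trans[OF R'(3) I.rank_bound_closes(3)[OF closes[OF this] R'(2)]]
        show "real R' \<le> rb m" by (simp only: rb_eq)
      qed
    qed
    moreover have "low (Suc n)"
      unfolding low_def
    proof (intro allI impI conjI)
      fix m k j assume m: "\<forall>i\<in>{1..Suc n}. r i \<le> m" and k: "k \<le> K (Suc n)" and j: "j \<in> {1..J}"
      note bounds = I.rank_bound_closes(1,2)[OF closes[OF m]]
      have "real I.iter_rank \<le> 2 * rb m" using bounds(1) by (simp add: rb_eq)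
      then show "\<exists>p. tensor_rank_le p (it (Suc n) k j) \<and> real p \<le> 2 * rb m"
        using I.iter_tensor_rank[of k j] k j by (auto simp: K_eq it_eq)
      show "\<exists>p. tensor_rank_le p (picard_map U V J \<tau> (ut (Suc n - 1)) (it (Suc n) k) (\<tau> j)) \<and> real p \<le> 2 * rb m"
      proof (intro exI conjI)
        show "tensor_rank_le (R + J * (rk * I.iter_rank)) (picard_map U V J \<tau> (ut (Suc n - 1)) (it (Suc n) k) (\<tau> j))"
          using I.picard_iter_rank[OF R(1), of k "\<tau> j"] k S.node_in[OF j] by (simp add: K_eq it_eq)
        show "real (R + J * (rk * I.iter_rank)) \<le> 2 * rb m" using bounds(2) by (simp only: rb_eq)
      qed
    qed
    ultimately show ?thesis ..
  qed
  have "good n" if "n \<le> N" for n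
    using that
  proof (induction n)
    case 0
    have ut0: "ut 0 = hard_threshold (\<alpha> 0) (u 0)" by (simp add: scheme)
    have u0S: "u 0 \<in> L2_on (\<Omega>\<^sub>1 \<times> \<Omega>\<^sub>2)" using grid(1) by (intro E.u_in) simp
    have "norm (ut 0 - u 0) \<le> \<eta>"
      using order_trans[OF hard_residual_le_soft[OF less_imp_le[OF \<alpha>0(1)]] \<alpha>0(2)] by (simp add: ut0 norm_minus_commute)
    then have "norm (ut 0 - u (real 0 * h)) + eJ \<le> \<xi> 0" by (simp add: \<xi>_eq)
    moreover have "real (card {k. sing_val (u 0) k > \<alpha> 0}) \<le> rb m" if "\<forall>i\<in>{1..max 1 0}. r i \<le> m" for m
    proof -
      have "real (card {k. sing_val (u 0) k > \<alpha> 0}) \<le> \<eta>\<^sup>2 / (\<alpha> 0)\<^sup>2" by (rule card_sing_val_gt(2)[OF \<alpha>0(1,2)])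
      also have "\<dots> \<le> \<eta>\<^sup>2 / (\<alpha> 1)\<^sup>2"
        using \<alpha>0(3) \<alpha>_props(1)[of 0] N1 by (intro divide_left_mono power_mono mult_pos_pos) auto
      also have "\<dots> = r 1" using r[of 1] N1 by simp
      also have "\<dots> \<le> m" using that by simp
      finally have pm: "real (card {k. sing_val (u 0) k > \<alpha> 0}) \<le> m" .
      then have m0: "0 \<le> m" by (rule order_trans[rotated]) simp
      have "1 \<le> real J * real rk"
        using mult_mono[of 1 "real J" 1 "real rk"] nodes(1) rk1 by simp
      from mult_right_mono[OF this m0] have "m \<le> 1 + real J * real rk * m" by simp
      moreover have "1 \<le> 16 / \<rho> ^ 3 * ((1 + \<rho>) / (1 - \<rho>))\<^sup>2"
      proof -
        have "1 \<le> ((1 + \<rho>) / (1 - \<rho>))\<^sup>2" using \<rho>(2,3) by (intro one_le_power) simp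
        moreover have "\<rho> ^ 3 \<le> 1" using \<rho>(2,3) by (intro power_le_one) auto
        then have "1 \<le> 16 / \<rho> ^ 3" using \<rho>(2) by (simp add: pos_le_divide_eq)
        ultimately show ?thesis using mult_mono[of 1 "16 / \<rho> ^ 3" 1 "((1 + \<rho>) / (1 - \<rho>))\<^sup>2"] \<rho>(2) by simp
      qed
      ultimately have "1 * m \<le> rb m" unfolding rb_def using m0 by (intro mult_mono) auto
      with pm show ?thesis by simp
    qed
    ultimately show ?case
      unfolding good_def using hard_threshold_rank[OF \<alpha>0(1), of "u 0"] threshold_in_L2_on(2)[OF \<Omega> u0S]
      by (intro conjI exI[of _ "card {k. sing_val (u 0) k > \<alpha> 0}"] allI impI) (simp_all only: ut0)
  next
    case (Suc n)
    then show ?case using step[of n] by simp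
  qed
  note good_all = this
  have final: "good n \<and> low n" if n: "n \<in> {1..N}" for n
  proof -
    obtain k where k: "n = Suc k" "k < N" using n by (cases n) auto
    show ?thesis unfolding k(1) by (rule step[OF k(2) good_all]) (use k(2) in simp)
  qed
  have "(SUP n\<in>{1..N}. norm (ut n - u (real n * h)))
      \<le> (\<eta> + eJ + real N * e2) * exp (real N * x)"
  proof (rule cSUP_least)
    show "{1..N} \<noteq> {}" using N1 by simp
    fix n assume n: "n \<in> {1..N}"
    have "norm (ut n - u (real n * h)) \<le> \<xi> n" using final[OF n] eJ0 by (simp add: good_def)
    also have "\<xi> n = (\<eta> + eJ + real n * e2) * exp (real n * x)" using n by (intro \<xi>_eq) simp
    also have "\<dots> \<le> (\<eta> + eJ + real N * e2) * exp (real N * x)"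
      using n \<eta>(1) eJ0 e20 x0 by (intro mult_mono add_mono mult_right_mono) (auto intro!: mult_right_mono)
    finally show "norm (ut n - u (real n * h)) \<le> (\<eta> + eJ + real N * e2) * exp (real N * x)" .
  qed
  also have "real N * e2 = \<kappa>\<^sub>2\<^sub>J * h ^ (2 * J) * T" by (simp add: e2_def NT[symmetric] mult_ac)
  also have "real N * x = 8 * \<Lambda> * C\<^sub>V * ((1 + \<rho>) / (1 - \<rho>) ^ 3) * T"
    unfolding x_def NT[symmetric] by (subst (1) \<rho>(1)) (simp only: mult_ac)
  finally have error: "(SUP n\<in>{1..N}. norm (ut n - u (real n * h)))
      \<le> (\<eta> + \<kappa>\<^sub>J * h ^ (J + 1) + \<kappa>\<^sub>2\<^sub>J * h ^ (2 * J) * T) * exp (8 * \<Lambda> * C\<^sub>V * ((1 + \<rho>) / (1 - \<rho>) ^ 3) * T)"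
    by (simp only: eJ_def)
  have B_eq: "B n = rb (MAX i\<in>{1..n}. r i)" if "n \<in> {1..N}" for n
    using B[OF that] by (simp add: rb_def rk_def)
  have max: "\<forall>i\<in>{1..n}. r i \<le> (MAX i\<in>{1..n}. r i)" for n by auto
  have "ereal_of_enat (rank_L2 (ut n)) \<le> ereal (B n)" if n: "n \<in> {1..N}" for n
  proof -
    have max_n: "max 1 n = n" using n by simp
    obtain R where R: "tensor_rank_le R (ut n)" "\<And>m. (\<forall>i\<in>{1..n}. r i \<le> m) \<Longrightarrow> real R \<le> rb m"
      using final[OF n] unfolding good_def max_n by blast
    from R(2)[OF max] show ?thesis by (intro rank_L2_le_real[OF R(1)]) (simp only: B_eq[OF n])
  qed
  moreover have "ereal_of_enat (rank_L2 (it n k j)) \<le> ereal (2 * B n) \<and>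
      ereal_of_enat (rank_L2 (picard_map U V J \<tau> (ut (n - 1)) (it n k) (\<tau> j))) \<le> ereal (2 * B n)"
    if n: "n \<in> {1..N}" and k: "k \<in> {0..K n}" and j: "j \<in> {1..J}" for n k j
  proof -
    have "k \<le> K n" using k by simp
    with final[OF n] max[of n] j obtain p q where
      "tensor_rank_le p (it n k j)" "real p \<le> 2 * rb (MAX i\<in>{1..n}. r i)"
      "tensor_rank_le q (picard_map U V J \<tau> (ut (n - 1)) (it n k) (\<tau> j))" "real q \<le> 2 * rb (MAX i\<in>{1..n}. r i)"
      unfolding low_def by blast
    then show ?thesis unfolding B_eq[OF n] by (intro conjI rank_L2_le_real)
  qed
  ultimately show ?thesis using error by blast
qed

end
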